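(* Let $v\in L^\infty((0,T);L^2(\mathbb{T}^3))$ be a weak solution of the inviscid Leray-$\alpha$ model, with $u=(I-\alpha^2\Delta)^{-1}v$, and assume in addition that $$\int_{\mathbb{T}^3}|\delta u(\xi;x,t)|\,|\delta v(\xi;x,t)|^2\,dx\le C(t)\,|\xi|\,\sigma_1(|\xi|)$$ (for $\xi\in\mathbb{R}^3$ and a.e. $t\in(0,T)$), where $C\in L^1(0,T)$ and $\sigma_1\in L^\infty_{\mathrm{loc}}(\mathbb{R})$ satisfies $\sigma_1(|\xi|)\to0$ as $|\xi|\to0$ (for example, this is the case when $v\in L^3((0,T);B^s_{3,\infty}(\mathbb{T}^3))$ with $s>1$). Then conservation of energy holds, i.e. $$\|v(t_1,\cdot)\|_{L^2}=\|v(t_2,\cdot)\|_{L^2}$$ for almost all $t_1,t_2\in(0,T)$.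
   Context: Fix $\alpha>0$, $T>0$; $\mathbb{T}^3$ is the flat three-dimensional torus; repeated indices are summed. $B^s_{3,\infty}$ denotes the usual Besov space. Increments (periodic extension): $\delta w(\xi;x,t)=w(x+\xi,t)-w(x,t)$. A pair $v,p\in L^\infty((0,T);L^2(\mathbb{T}^3))$ ($v$ vector-valued, $p$ scalar), with $u=(I-\alpha^2\Delta)^{-1}v$, i.e. $v=u-\alpha^2\Delta u$, is a weak solution of the inviscid Leray-$\alpha$ model ($\partial_t v+\nabla\cdot(u\otimes v)+\nabla p=0$, $\nabla\cdot u=\nabla\cdot v=0$) if for all $\psi\in\mathcal{D}(\mathbb{T}^3\times(0,T);\mathbb{R}^3)$ and $\chi\in\mathcal{D}(\mathbb{T}^3\times(0,T);\mathbb{R})$ $$\int_0^T\!\!\int_{\mathbb{T}^3} v_i\partial_t\psi_i\,dx\,dt+\int_0^T\!\!\int_{\mathbb{T}^3} v_ju_i\partial_i\psi_j\,dx\,dt+\int_0^T\!\!\int_{\mathbb{T}^3} p\,\partial_i\psi_i\,dx\,dt=0,\qquad \int_0^T\!\!\int_{\mathbb{T}^3}u_i\partial_i\chi\,dx\,dt=0,$$ with $\int_{\mathbb{T}^3}p(x,t)\,dx=0$. Here $\mathcal{D}$ denotes smooth compactly supported functions. *)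

theory Defs
  imports "HOL-Analysis.Analysis"
begin

text \<open>The torus is \<open>\<real>\<^sup>3 / \<int>\<^sup>3\<close>. A function on it is a \<open>\<int>\<^sup>3\<close>-periodic function on \<open>\<real>\<^sup>3\<close>,
  integrated over the half-open unit cell. Space-time functions are curried, time first; a class of
  functions equal almost everywhere is given by a Borel representative, and only the values at
  times in \<open>(0, T)\<close> matter.\<close>

definition torus :: "(real ^ 3) measure" where
  "torus = restrict_space lborel {x. \<forall>i. 0 \<le> x $ i \<and> x $ i < 1}"

definition time :: "real \<Rightarrow> real measure" where
  "time T = restrict_space lborel {0<..<T}"

definition periodic :: "(real ^ 3 \<Rightarrow> 'b) \<Rightarrow> bool" where
  "periodic f \<longleftrightarrow> (\<forall>x k. (\<forall>i. k $ i \<in> \<int>) \<longrightarrow> f (x + k) = f x)"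

definition torus_field :: "real \<Rightarrow> (real \<Rightarrow> real ^ 3 \<Rightarrow> 'b::euclidean_space) \<Rightarrow> bool" where
  "torus_field T w \<longleftrightarrow> (\<forall>t\<in>{0<..<T}. periodic (w t)) \<and>
     (\<lambda>(t, x). w t x) \<in> borel_measurable (time T \<Otimes>\<^sub>M torus)"

definition in_Lp :: "real \<Rightarrow> (real ^ 3 \<Rightarrow> 'b::euclidean_space) \<Rightarrow> bool" where
  "in_Lp q f \<longleftrightarrow> f \<in> borel_measurable torus \<and> integrable torus (\<lambda>x. norm (f x) powr q)"

definition Lp_norm :: "real \<Rightarrow> (real ^ 3 \<Rightarrow> 'b::euclidean_space) \<Rightarrow> real" where
  "Lp_norm q f = (LINT x|torus. norm (f x) powr q) powr (1 / q)"

definition Linf_L2 :: "real \<Rightarrow> (real \<Rightarrow> real ^ 3 \<Rightarrow> 'b::euclidean_space) \<Rightarrow> bool" where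
  "Linf_L2 T w \<longleftrightarrow> torus_field T w \<and>
     (\<exists>K. AE t in time T. in_Lp 2 (w t) \<and> Lp_norm 2 (w t) \<le> K)"

text \<open>\<open>n\<close> times continuously differentiable on the whole space.\<close>

primrec Cn :: "nat \<Rightarrow> ('a::euclidean_space \<Rightarrow> 'b::real_normed_vector) \<Rightarrow> bool" where
  "Cn 0 f \<longleftrightarrow> continuous_on UNIV f"
| "Cn (Suc n) f \<longleftrightarrow> f differentiable_on UNIV \<and>
     (\<forall>e\<in>Basis. Cn n (\<lambda>x. frechet_derivative f (at x) e))"

definition smooth :: "('a::euclidean_space \<Rightarrow> 'b::real_normed_vector) \<Rightarrow> bool" where
  "smooth f \<longleftrightarrow> (\<forall>n. Cn n f)"

definition partial :: "3 \<Rightarrow> (real ^ 3 \<Rightarrow> real) \<Rightarrow> real ^ 3 \<Rightarrow> real" where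
  "partial i f x = frechet_derivative f (at x) (axis i 1)"

definition laplacian :: "(real ^ 3 \<Rightarrow> real) \<Rightarrow> real ^ 3 \<Rightarrow> real" where
  "laplacian f x = (\<Sum>i\<in>UNIV. partial i (partial i f) x)"

text \<open>Elements of \<open>\<D>(\<T>\<^sup>3 \<times> (0, T))\<close>, extended by zero in time: as the torus is compact,
  compact support only restricts the time variable.\<close>

definition test_function :: "real \<Rightarrow> (real \<Rightarrow> real ^ 3 \<Rightarrow> 'b::euclidean_space) \<Rightarrow> bool" where
  "test_function T \<psi> \<longleftrightarrow> smooth (\<lambda>(t, x). \<psi> t x) \<and> (\<forall>t. periodic (\<psi> t)) \<and>
     (\<exists>a b. 0 < a \<and> b < T \<and> (\<forall>t x. t \<notin> {a..b} \<longrightarrow> \<psi> t x = 0))"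

text \<open>\<open>g = (I - \<alpha>\<^sup>2\<Delta>)\<^sup>-\<^sup>1 f\<close>: \<open>g\<close> solves \<open>f = g - \<alpha>\<^sup>2\<Delta>g\<close> on the torus in the sense of distributions,
  componentwise. Such a \<open>g\<close> is unique up to null sets.\<close>

definition inverse_helmholtz ::
    "real \<Rightarrow> (real ^ 3 \<Rightarrow> real ^ 3) \<Rightarrow> (real ^ 3 \<Rightarrow> real ^ 3) \<Rightarrow> bool" where
  "inverse_helmholtz \<alpha> f g \<longleftrightarrow> in_Lp 2 g \<and>
     (\<forall>\<phi> j. smooth \<phi> \<and> periodic \<phi> \<longrightarrow>
        (LINT x|torus. g x $ j * (\<phi> x - \<alpha>\<^sup>2 * laplacian \<phi> x)) = (LINT x|torus. f x $ j * \<phi> x))"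

definition leray_alpha_weak_solution ::
    "real \<Rightarrow> real \<Rightarrow> (real \<Rightarrow> real ^ 3 \<Rightarrow> real ^ 3) \<Rightarrow> (real \<Rightarrow> real ^ 3 \<Rightarrow> real ^ 3) \<Rightarrow>
     (real \<Rightarrow> real ^ 3 \<Rightarrow> real) \<Rightarrow> bool" where
  "leray_alpha_weak_solution \<alpha> T u v p \<longleftrightarrow>
     Linf_L2 T v \<and> Linf_L2 T p \<and>
     torus_field T u \<and> (AE t in time T. inverse_helmholtz \<alpha> (v t) (u t)) \<and>
     (\<forall>\<psi> :: real \<Rightarrow> real ^ 3 \<Rightarrow> real ^ 3. test_function T \<psi> \<longrightarrow>
        (LINT t|time T. LINT x|torus. (\<Sum>i\<in>UNIV. v t x $ i * deriv (\<lambda>s. \<psi> s x $ i) t))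
      + (LINT t|time T. LINT x|torus.
           (\<Sum>i\<in>UNIV. \<Sum>j\<in>UNIV. v t x $ j * u t x $ i * partial i (\<lambda>y. \<psi> t y $ j) x))
      + (LINT t|time T. LINT x|torus. p t x * (\<Sum>i\<in>UNIV. partial i (\<lambda>y. \<psi> t y $ i) x)) = 0) \<and>
     (\<forall>\<eta> :: real \<Rightarrow> real ^ 3 \<Rightarrow> real. test_function T \<eta> \<longrightarrow>
        (LINT t|time T. LINT x|torus. (\<Sum>i\<in>UNIV. u t x $ i * partial i (\<eta> t) x)) = 0) \<and>
     (AE t in time T. (LINT x|torus. p t x) = 0)"

definition increment :: "real ^ 3 \<Rightarrow> (real ^ 3 \<Rightarrow> 'b::euclidean_space) \<Rightarrow> real ^ 3 \<Rightarrow> 'b" where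
  "increment \<xi> w x = w (x + \<xi>) - w x"

text \<open>The integral of \<open>|\<delta>f| |\<delta>g|\<^sup>2\<close> is required to be finite, since the Bochner integral
  of a non-integrable function is \<open>0\<close>.\<close>

definition increment_bound ::
    "(real ^ 3 \<Rightarrow> real ^ 3) \<Rightarrow> (real ^ 3 \<Rightarrow> real ^ 3) \<Rightarrow> real \<Rightarrow> (real \<Rightarrow> real) \<Rightarrow> real ^ 3 \<Rightarrow> bool" where
  "increment_bound f g c \<sigma> \<xi> \<longleftrightarrow>
     integrable torus (\<lambda>x. norm (increment \<xi> f x) * (norm (increment \<xi> g x))\<^sup>2) \<and>
     (LINT x|torus. norm (increment \<xi> f x) * (norm (increment \<xi> g x))\<^sup>2) \<le> c * norm \<xi> * \<sigma> (norm \<xi>)"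

definition Linf_loc :: "(real \<Rightarrow> real) \<Rightarrow> bool" where
  "Linf_loc \<sigma> \<longleftrightarrow> \<sigma> \<in> borel_measurable lebesgue \<and>
     (\<forall>K. compact K \<longrightarrow> (\<exists>M. AE r in lebesgue. r \<in> K \<longrightarrow> \<bar>\<sigma> r\<bar> \<le> M))"

text \<open>The Besov space \<open>B\<^sup>s\<^sub>3\<^sub>,\<^sub>\<infinity>\<close> for arbitrary \<open>s > 0\<close>, with the standard norm in terms of
  the differences of order \<open>\<lfloor>s\<rfloor> + 1\<close>, an integer larger than \<open>s\<close>.\<close>

definition besov_quotient :: "real \<Rightarrow> (real ^ 3 \<Rightarrow> real ^ 3) \<Rightarrow> real ^ 3 \<Rightarrow> real" where
  "besov_quotient s f h = norm h powr (- s) * Lp_norm 3 ((increment h ^^ (nat \<lfloor>s\<rfloor> + 1)) f)"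

definition in_besov :: "real \<Rightarrow> (real ^ 3 \<Rightarrow> real ^ 3) \<Rightarrow> bool" where
  "in_besov s f \<longleftrightarrow> periodic f \<and> in_Lp 3 f \<and> bdd_above (besov_quotient s f ` (- {0}))"

definition besov_norm :: "real \<Rightarrow> (real ^ 3 \<Rightarrow> real ^ 3) \<Rightarrow> real" where
  "besov_norm s f = Lp_norm 3 f + (SUP h\<in>- {0}. besov_quotient s f h)"

definition L3_besov :: "real \<Rightarrow> real \<Rightarrow> (real \<Rightarrow> real ^ 3 \<Rightarrow> real ^ 3) \<Rightarrow> bool" where
  "L3_besov T s w \<longleftrightarrow> torus_field T w \<and> (AE t in time T. in_besov s (w t)) \<and>
     integrable (time T) (\<lambda>t. besov_norm s (w t) ^ 3)"

end

theory Submission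
  imports Defs "HOL-Computational_Algebra.Polynomial"
begin

text \<open>The proof follows the argument of Duchon and Robert, adapted to the Leray-\<open>\<alpha>\<close> model.

  Filter \<open>v\<close> in space with an even periodic mollifier \<open>\<phi>\<close> of scale \<open>\<delta>\<close>. Testing the momentum equation with
  \<open>\<theta>(t) \<phi>(y - x)\<close> at a fixed point \<open>y\<close> shows that the filtered velocity has a bounded weak derivative in time at
  \<open>y\<close>. Hence it agrees at almost every time with an absolutely continuous function, whose square obeys the chain rule
  (\<open>weak_deriv_square\<close>). Integration over \<open>y\<close> yields a filtered energy whose time derivative is \<open>-2\<close> times a flux. The
  pressure does not contribute to the flux, because \<open>v\<close> is divergence-free together with \<open>u\<close>: the operator
  \<open>I - \<alpha>\<^sup>2\<Delta>\<close> commutes with the divergence (\<open>divfree_helmholtz\<close>).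

  With the odd kernel \<open>K\<^sub>i(\<xi>) = \<integral> \<partial>\<^sub>i\<phi>(\<eta>) \<phi>(\<eta> - \<xi>) d\<eta>\<close> the flux equals
  one quarter of \<open>\<Sum>\<^sub>i \<integral>\<integral> K\<^sub>i(\<xi>) \<delta>u\<^sub>i(\<xi>; x) \<bar>\<delta>v(\<xi>; x)\<bar>\<^sup>2 dx d\<xi>\<close>,
  since all other terms in the expansion of the increments vanish or coincide (\<open>increment_identity\<close>). One of
  them is the increment of \<open>u\<^sub>i \<bar>v\<bar>\<^sup>2\<close>, a function that need not be integrable; its increment nevertheless has
  integral zero whenever it is integrable (\<open>integral_coboundary\<close>). The kernel has mass \<open>O(1 / \<delta>)\<close> and lives on
  \<open>\<bar>\<xi>\<bar> \<le> 2 \<delta>\<close>, and the hypothesis bounds the inner integral by \<open>C(t) \<bar>\<xi>\<bar> \<sigma>\<^sub>1(\<bar>\<xi>\<bar>)\<close>. So the flux tends to zero in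
  \<open>L\<^sup>1(0, T)\<close> as \<open>\<delta> \<rightarrow> 0\<close> (\<open>flux_time_bound\<close>), and since the filtered energies converge to the energy of \<open>v\<close>, the energy
  is constant up to a null set of times (\<open>energy_conservation\<close>). A weak solution is first modified on a null set of times,
  so that it is controlled at every time (\<open>regular_solution_of_weak_solution\<close>).

  For \<open>v\<close> in a Besov space with \<open>s > 1\<close>, the increments of \<open>v\<close> satisfy \<open>\<integral> \<bar>\<delta>v\<bar>\<^sup>3 dx \<le> c \<bar>\<xi>\<bar>\<^sup>2\<close>. The Besov norm controls
  differences of a higher order, and \<open>lower_difference_order\<close> descends from there to first differences through dyadic scales. The
  filter \<open>(I - \<alpha>\<^sup>2\<Delta>)\<^sup>-\<^sup>1\<close> contracts every convex functional, in particular the \<open>L\<^sup>3\<close> norm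
  (\<open>helmholtz_convex_contraction\<close>): multiply the mollified equation by a subgradient and
  sum by parts. So the increments of \<open>u\<close> obey the same bound, and the hypothesis holds with \<open>\<sigma>\<^sub>1(r) = r\<close>.\<close>

section \<open>Smooth functions\<close>

lemma Cn_SucI:
  assumes "\<And>x. (f has_derivative D x) (at x)" and "\<And>e. e \<in> Basis \<Longrightarrow> Cn n (\<lambda>x. D x e)"
  shows "Cn (Suc n) f"
proof -
  have "frechet_derivative f (at x) = D x" for x
    using assms(1) frechet_derivative_at by metis
  moreover have "f differentiable_on UNIV"
    using assms(1) by (auto simp: differentiable_on_def differentiable_def)
  ultimately show ?thesis using assms(2) by simp
qed

lemma Cn_Suc_has_derivative:
  assumes "Cn (Suc n) f"
  shows "(f has_derivative frechet_derivative f (at x)) (at x)"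
  using assms by (simp add: differentiable_on_def frechet_derivative_works[symmetric])

lemma Cn_Suc_imp_Cn: "Cn (Suc n) f \<Longrightarrow> Cn n f"
proof (induction n arbitrary: f)
  case 0
  then show ?case by (simp add: differentiable_imp_continuous_on)
next
  case (Suc n)
  have "Cn (Suc n) (\<lambda>x. frechet_derivative f (at x) e)" if "e \<in> Basis" for e
    using Suc.prems that by simp
  then have "Cn n (\<lambda>x. frechet_derivative f (at x) e)" if "e \<in> Basis" for e
    using Suc.IH that by blast
  with Suc.prems show ?case by simp
qed

lemma Cn_const: "Cn n (\<lambda>x. c)"
proof (induction n arbitrary: c)
  case (Suc n)
  show ?case by (rule Cn_SucI[where D="\<lambda>x h. 0"]) (use Suc in auto)
qed simp

lemma Cn_linear: "bounded_linear f \<Longrightarrow> Cn n f"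
proof (cases n)
  case 0 then show "bounded_linear f \<Longrightarrow> Cn n f" by (simp add: linear_continuous_on)
next
  case (Suc k) show "bounded_linear f \<Longrightarrow> Cn n f" unfolding Suc
    by (rule Cn_SucI[where D="\<lambda>x. f"]) (auto intro: bounded_linear_imp_has_derivative Cn_const)
qed

lemma Cn_linear_comp:
  assumes L: "bounded_linear L"
  shows "Cn n f \<Longrightarrow> Cn n (\<lambda>x. L (f x))"
proof (induction n arbitrary: f)
  case 0 then show ?case by (simp add: bounded_linear.continuous_on[OF L])
next
  case (Suc n)
  show ?case
    by (rule Cn_SucI[OF bounded_linear.has_derivative[OF L Cn_Suc_has_derivative[OF Suc.prems]]])
      (use Suc in auto)
qed

lemma Cn_add: "Cn n f \<Longrightarrow> Cn n g \<Longrightarrow> Cn n (\<lambda>x. f x + g x)"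
proof (induction n arbitrary: f g)
  case 0 then show ?case by (simp add: continuous_on_add)
next
  case (Suc n)
  show ?case
    by (rule Cn_SucI[OF has_derivative_add[OF Suc.prems[THEN Cn_Suc_has_derivative]]])
      (use Suc in auto)
qed

lemma Cn_sum: "(\<And>i. i \<in> I \<Longrightarrow> Cn n (f i)) \<Longrightarrow> Cn n (\<lambda>x. \<Sum>i\<in>I. f i x)"
  by (induction I rule: infinite_finite_induct) (auto simp: Cn_const intro: Cn_add)

lemma Cn_mult:
  fixes f g :: "'a::euclidean_space \<Rightarrow> real"
  shows "Cn n f \<Longrightarrow> Cn n g \<Longrightarrow> Cn n (\<lambda>x. f x * g x)"
proof (induction n arbitrary: f g)
  case 0 then show ?case by (simp add: continuous_on_mult)
next
  case (Suc n)
  show ?case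
  proof (rule Cn_SucI[OF has_derivative_mult[OF Suc.prems[THEN Cn_Suc_has_derivative]]])
    fix e :: 'a assume "e \<in> Basis"
    then show "Cn n (\<lambda>x. f x * frechet_derivative g (at x) e + frechet_derivative f (at x) e * g x)"
      using Suc.prems by (intro Cn_add Suc.IH Cn_Suc_imp_Cn[of n f] Cn_Suc_imp_Cn[of n g]) auto
  qed
qed

lemma Cn_comp_real:
  fixes f :: "'a::euclidean_space \<Rightarrow> real" and G :: "real \<Rightarrow> real"
  shows "Cn n G \<Longrightarrow> Cn n f \<Longrightarrow> Cn n (\<lambda>x. G (f x))"
proof (induction n arbitrary: f G)
  case 0 then show ?case using continuous_on_compose2[of UNIV G UNIV f] by simp
next
  case (Suc n)
  let ?G' = "\<lambda>y. frechet_derivative G (at y) 1"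
  have lin: "frechet_derivative G (at y) s = s * ?G' y" for y s
  proof -
    have "linear (frechet_derivative G (at y))"
      using Cn_Suc_has_derivative[OF Suc.prems(1)] has_derivative_linear by blast
    then show ?thesis using linear_cmul[of _ s 1] by fastforce
  qed
  show ?case
  proof (rule Cn_SucI)
    show "((\<lambda>x. G (f x)) has_derivative (\<lambda>h. frechet_derivative f (at x) h * ?G' (f x))) (at x)" for x
      using has_derivative_compose[OF Suc.prems(2)[THEN Cn_Suc_has_derivative]
          Suc.prems(1)[THEN Cn_Suc_has_derivative], of x] by (simp add: lin[symmetric])
    fix e :: 'a assume "e \<in> Basis"
    then show "Cn n (\<lambda>x. frechet_derivative f (at x) e * ?G' (f x))"
      using Suc.prems by (intro Cn_mult Suc.IH[of ?G'] Cn_Suc_imp_Cn[of n f]) auto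
  qed
qed

lemma Cn_comp_affine:
  fixes L :: "'a::euclidean_space \<Rightarrow> 'b::euclidean_space"
  assumes L: "bounded_linear L"
  shows "Cn n f \<Longrightarrow> Cn n (\<lambda>x. f (c + L x))"
proof (induction n arbitrary: f)
  case 0 then show ?case
    by (auto intro!: continuous_on_compose2[of UNIV f] continuous_intros bounded_linear.continuous_on[OF L])
next
  case (Suc n)
  let ?D = "\<lambda>y. frechet_derivative f (at y)"
  show ?case
  proof (rule Cn_SucI)
    show "((\<lambda>x. f (c + L x)) has_derivative (\<lambda>h. ?D (c + L x) (L h))) (at x)" for x
    proof -
      have "((\<lambda>x. c + L x) has_derivative L) (at x)"
        using bounded_linear_imp_has_derivative[OF L] by (auto intro!: derivative_eq_intros)
      from has_derivative_compose[OF this Cn_Suc_has_derivative[OF Suc.prems]] show ?thesis .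
    qed
    fix e :: 'a assume e: "e \<in> Basis"
    have "?D y (L e) = (\<Sum>b\<in>Basis. (L e \<bullet> b) *\<^sub>R ?D y b)" for y
    proof -
      have "linear (?D y)"
        using Cn_Suc_has_derivative[OF Suc.prems] has_derivative_linear by blast
      then have "?D y (\<Sum>b\<in>Basis. (L e \<bullet> b) *\<^sub>R b) = (\<Sum>b\<in>Basis. (L e \<bullet> b) *\<^sub>R ?D y b)"
        by (simp add: linear_sum linear_scale)
      then show ?thesis by (simp add: euclidean_representation)
    qed
    moreover have "Cn n (\<lambda>x. \<Sum>b\<in>Basis. (L e \<bullet> b) *\<^sub>R ?D (c + L x) b)"
      using Suc.prems by (intro Cn_sum Cn_linear_comp[OF bounded_linear_scaleR_right] Suc.IH[of "\<lambda>y. ?D y _"]) auto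
    ultimately show "Cn n (\<lambda>x. ?D (c + L x) (L e))" by simp
  qed
qed

lemma smooth_const: "smooth (\<lambda>x. c)" by (simp add: smooth_def Cn_const)
lemma smooth_linear: "bounded_linear f \<Longrightarrow> smooth f" by (simp add: smooth_def Cn_linear)
lemma smooth_linear_comp: "bounded_linear L \<Longrightarrow> smooth f \<Longrightarrow> smooth (\<lambda>x. L (f x))"
  by (simp add: smooth_def Cn_linear_comp)
lemma smooth_add: "smooth f \<Longrightarrow> smooth g \<Longrightarrow> smooth (\<lambda>x. f x + g x)"
  by (simp add: smooth_def Cn_add)
lemma smooth_sum: "(\<And>i. i \<in> I \<Longrightarrow> smooth (f i)) \<Longrightarrow> smooth (\<lambda>x. \<Sum>i\<in>I. f i x)"
  by (simp add: smooth_def Cn_sum)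
lemma smooth_mult:
  fixes f g :: "'a::euclidean_space \<Rightarrow> real"
  shows "smooth f \<Longrightarrow> smooth g \<Longrightarrow> smooth (\<lambda>x. f x * g x)"
  by (simp add: smooth_def Cn_mult)
lemma smooth_comp_real:
  fixes f :: "'a::euclidean_space \<Rightarrow> real" and G :: "real \<Rightarrow> real"
  shows "smooth G \<Longrightarrow> smooth f \<Longrightarrow> smooth (\<lambda>x. G (f x))"
  by (simp add: smooth_def Cn_comp_real)
lemma smooth_comp_affine:
  fixes L :: "'a::euclidean_space \<Rightarrow> 'b::euclidean_space"
  shows "bounded_linear L \<Longrightarrow> smooth f \<Longrightarrow> smooth (\<lambda>x. f (c + L x))"
  by (simp add: smooth_def Cn_comp_affine)

lemma smooth_diff:
  fixes f g :: "'a::euclidean_space \<Rightarrow> real"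
  assumes "smooth f" "smooth g" shows "smooth (\<lambda>x. f x - g x)"
  using smooth_add[OF assms(1) smooth_linear_comp[OF bounded_linear_minus[OF bounded_linear_ident] assms(2)]]
  by simp

lemma smooth_cmult:
  fixes f :: "'a::euclidean_space \<Rightarrow> real"
  shows "smooth f \<Longrightarrow> smooth (\<lambda>x. c * f x)"
  by (rule smooth_mult[OF smooth_const])

lemma smooth_shift: "smooth f \<Longrightarrow> smooth (\<lambda>x. f (c + x))"
  using smooth_comp_affine[OF bounded_linear_ident] .

lemma smooth_reflect: "smooth f \<Longrightarrow> smooth (\<lambda>x. f (c - x))"
  using smooth_comp_affine[OF bounded_linear_minus[OF bounded_linear_ident], of f c] by simp

lemma smooth_has_derivative:
  "smooth f \<Longrightarrow> (f has_derivative frechet_derivative f (at x)) (at x)"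
  unfolding smooth_def by (rule Cn_Suc_has_derivative) auto

lemma smooth_continuous: "smooth f \<Longrightarrow> continuous_on UNIV f"
  unfolding smooth_def by (metis Cn.simps(1))

lemma smooth_directional: "smooth f \<Longrightarrow> e \<in> Basis \<Longrightarrow> smooth (\<lambda>x. frechet_derivative f (at x) e)"
  unfolding smooth_def by (metis Cn.simps(2))

lemma smooth_partial: "smooth f \<Longrightarrow> smooth (partial i f)"
  unfolding partial_def[abs_def] by (rule smooth_directional) (auto simp: axis_in_Basis_iff)

lemma smooth_laplacian: "smooth f \<Longrightarrow> smooth (laplacian f)"
  unfolding laplacian_def[abs_def] by (intro smooth_sum smooth_partial)

text \<open>A class of functions that is closed under differentiation consists of smooth functions: membership
  in \<open>C\<^sup>n\<close> follows by induction on \<open>n\<close>, for all members of the class at once.\<close>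

lemma smoothI_real:
  fixes P :: "(real \<Rightarrow> real) \<Rightarrow> bool"
  assumes P: "P f" and step: "\<And>f. P f \<Longrightarrow> \<exists>g. P g \<and> (\<forall>x. (f has_real_derivative g x) (at x))"
  shows "smooth f"
proof -
  have "Cn n f" if "P f" for n f using that
  proof (induction n arbitrary: f)
    case 0
    then obtain g where "\<And>x. (f has_real_derivative g x) (at x)" using step by blast
    then show ?case by (auto intro!: continuous_at_imp_continuous_on DERIV_isCont)
  next
    case (Suc n)
    then obtain g where g: "P g" "\<And>x. (f has_real_derivative g x) (at x)" using step by blast
    show ?case
      by (rule Cn_SucI[OF g(2)[unfolded has_field_derivative_def]]) (use Suc.IH g in auto)
  qed
  then show ?thesis using P by (simp add: smooth_def)
qed

lemma smooth_real_has_derivative: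
  fixes f :: "real \<Rightarrow> real"
  assumes "smooth f"
  shows "(f has_real_derivative deriv f x) (at x)"
proof -
  have "f differentiable (at x)" using smooth_has_derivative[OF assms] differentiable_def by blast
  then show ?thesis by (simp add: DERIV_deriv_iff_real_differentiable)
qed

lemma smooth_deriv:
  fixes f :: "real \<Rightarrow> real"
  assumes "smooth f" shows "smooth (deriv f)"
proof -
  have "frechet_derivative f (at x) 1 = deriv f x" for x
    using frechet_derivative_at[OF smooth_real_has_derivative[OF assms, unfolded has_field_derivative_def], of x]
    by (metis mult.right_neutral)
  then show ?thesis using smooth_directional[OF assms, of 1] by simp
qed

lemma smooth_primitive:
  fixes f g :: "real \<Rightarrow> real"
  assumes "\<And>x. (f has_real_derivative g x) (at x)" and "smooth g"
  shows "smooth f"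
  unfolding smooth_def
proof
  fix n
  have "Cn (Suc n) f"
    by (rule Cn_SucI[OF assms(1)[unfolded has_field_derivative_def]]) (use assms(2) in \<open>auto simp: smooth_def\<close>)
  then show "Cn n f" by (rule Cn_Suc_imp_Cn)
qed

lemma smooth_sin: "smooth (\<lambda>x::real. sin (c * x))"
proof (rule smoothI_real[where P="\<lambda>f. \<exists>a b. f = (\<lambda>x. a * sin (c * x) + b * cos (c * x))"])
  show "\<exists>a b. (\<lambda>x. sin (c * x)) = (\<lambda>x. a * sin (c * x) + b * cos (c * x))"
    by (intro exI[of _ 1] exI[of _ 0]) simp
  fix f :: "real \<Rightarrow> real" assume "\<exists>a b. f = (\<lambda>x. a * sin (c * x) + b * cos (c * x))"
  then obtain a b where f: "f = (\<lambda>x. a * sin (c * x) + b * cos (c * x))" by blast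
  show "\<exists>g. (\<exists>a b. g = (\<lambda>x. a * sin (c * x) + b * cos (c * x))) \<and> (\<forall>x. (f has_real_derivative g x) (at x))"
    unfolding f
    by (intro exI[of _ "\<lambda>x. (- b * c) * sin (c * x) + (a * c) * cos (c * x)"] conjI)
      (blast, auto intro!: derivative_eq_intros simp: algebra_simps)
qed

definition bump :: "real \<Rightarrow> real" where "bump x = (if x > 0 then exp (- (1 / x)) else 0)"

lemma bump_nonneg: "0 \<le> bump x" by (simp add: bump_def)
lemma bump_le_1: "bump x \<le> 1" by (simp add: bump_def)
lemma bump_eq_0: "x \<le> 0 \<Longrightarrow> bump x = 0" by (simp add: bump_def)
lemma bump_pos: "x > 0 \<Longrightarrow> bump x > 0" by (simp add: bump_def)

lemma poly_exp_tendsto_0: "((\<lambda>y::real. poly P y * exp (- y)) \<longlongrightarrow> 0) at_top"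
proof -
  have "((\<lambda>y. \<Sum>i\<le>degree P. coeff P i * (y ^ i / exp y)) \<longlongrightarrow> (\<Sum>i\<le>degree P. coeff P i * 0)) at_top"
    by (intro tendsto_intros tendsto_power_div_exp_0)
  then show ?thesis
    by (simp add: poly_altdef exp_minus sum_distrib_right sum_divide_distrib field_simps)
qed

text \<open>The functions \<open>P (1 / x) exp (- 1 / x)\<close> on \<open>x > 0\<close>, extended by zero, are closed under
  differentiation because the exponential beats every polynomial at the origin.\<close>

lemma smooth_bump: "smooth bump"
proof -
  define B where "B P = (\<lambda>x::real. if x > 0 then poly P (1 / x) * exp (- (1 / x)) else 0)" for P
  have D: "(B P has_real_derivative B ((P - pderiv P) * [:0, 0, 1:]) x) (at x)" for P x
  proof -
    consider "x > 0" | "x < 0" | "x = 0" by linarith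
    then show ?thesis
    proof cases
      case 1
      have "((\<lambda>x. poly P (1 / x) * exp (- (1 / x))) has_real_derivative
          poly ((P - pderiv P) * [:0, 0, 1:]) (1 / x) * exp (- (1 / x))) (at x)"
        using 1 by (auto intro!: derivative_eq_intros DERIV_chain2[OF poly_DERIV]
            simp: algebra_simps power2_eq_square divide_simps)
      then have "(B P has_real_derivative poly ((P - pderiv P) * [:0, 0, 1:]) (1 / x) * exp (- (1 / x))) (at x)"
        by (rule DERIV_cong_ev[THEN iffD1, rotated -1])
          (use 1 in \<open>auto simp: B_def eventually_nhds intro!: exI[of _ "{0<..}"]\<close>)
      then show ?thesis using 1 by (simp add: B_def)
    next
      case 2
      have "((\<lambda>x. 0) has_real_derivative 0) (at x)" by simp
      then have "(B P has_real_derivative 0) (at x)"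
        by (rule DERIV_cong_ev[THEN iffD1, rotated -1])
          (use 2 in \<open>auto simp: B_def eventually_nhds intro!: exI[of _ "{..<0}"]\<close>)
      then show ?thesis using 2 by (simp add: B_def)
    next
      case 3
      have r: "((\<lambda>h. poly P (1 / h) * exp (- (1 / h)) / h) \<longlongrightarrow> 0) (at_right 0)"
      proof -
        have "((\<lambda>h. poly (P * [:0, 1:]) (inverse h) * exp (- inverse h)) \<longlongrightarrow> 0) (at_right (0::real))"
          using filterlim_compose[OF poly_exp_tendsto_0 filterlim_inverse_at_top_right] by blast
        then show ?thesis by (simp add: field_simps)
      qed
      have "((\<lambda>h. (B P h - B P 0) / (h - 0)) \<longlongrightarrow> 0) (at 0)"
        unfolding filterlim_at_split
      proof
        show "((\<lambda>h. (B P h - B P 0) / (h - 0)) \<longlongrightarrow> 0) (at_left 0)"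
          by (rule tendsto_eventually) (auto simp: B_def eventually_at_filter)
        show "((\<lambda>h. (B P h - B P 0) / (h - 0)) \<longlongrightarrow> 0) (at_right 0)"
          by (rule Lim_transform_eventually[OF r]) (auto simp: B_def eventually_at_filter)
      qed
      then show ?thesis unfolding 3 has_field_derivative_iff by (simp add: B_def)
    qed
  qed
  have "bump = B 1" by (auto simp: bump_def B_def fun_eq_iff)
  then show ?thesis
    by (intro smoothI_real[where P="\<lambda>f. \<exists>P. f = B P"]) (use D in blast)+
qed

section \<open>Integration over the torus\<close>

definition cell :: "(real ^ 3) set" where "cell = {x. \<forall>i. 0 \<le> x $ i \<and> x $ i < 1}"
definition lattice :: "(real ^ 3) set" where "lattice = {k. \<forall>i. k $ i \<in> \<int>}"
definition wrap :: "real ^ 3 \<Rightarrow> real ^ 3" where "wrap x = (\<chi> i. frac (x $ i))"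

lemma torus_eq: "torus = restrict_space lborel cell" by (simp add: torus_def cell_def)

lemma cell_borel [measurable]: "cell \<in> sets borel" unfolding cell_def by measurable

lemma countable_lattice: "countable lattice"
  unfolding lattice_def by (rule countable_vector) (auto simp: Ints_def)

lemma lattice_minus: "k \<in> lattice \<Longrightarrow> - k \<in> lattice" by (auto simp: lattice_def)

lemma lattice_diff: "k \<in> lattice \<Longrightarrow> l \<in> lattice \<Longrightarrow> k - l \<in> lattice" by (auto simp: lattice_def)

lemma wrap_cell: "wrap x \<in> cell" by (auto simp: wrap_def cell_def frac_lt_1)
lemma wrap_lattice: "wrap x - x \<in> lattice" by (auto simp: wrap_def lattice_def frac_def)
lemma wrap_id: "x \<in> cell \<Longrightarrow> wrap x = x" by (auto simp: wrap_def cell_def vec_eq_iff frac_eq)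

lemma cell_lattice_zero: assumes "x \<in> cell" "x + k \<in> cell" "k \<in> lattice" shows "k = 0"
proof -
  have "k $ i = 0" for i
  proof -
    have "-1 < k $ i" "k $ i < 1" "k $ i \<in> \<int>"
      using assms by (auto simp: cell_def lattice_def dest!: spec[where x=i])
    then show ?thesis by (auto elim!: Ints_cases)
  qed
  then show ?thesis by (simp add: vec_eq_iff)
qed

lemma borel_measurable_wrap [measurable]: "wrap \<in> borel_measurable borel"
proof -
  have "(\<lambda>x. wrap x \<bullet> b) \<in> borel_measurable borel" if b': "b \<in> Basis" for b
  proof -
    obtain i where b: "b = axis i 1" using b' by (auto simp: Basis_vec_def)
    have "(\<lambda>y::real. frac y) \<in> borel_measurable borel" unfolding frac_def by measurable
    moreover have "(\<lambda>x::real ^ 3. x $ i) \<in> borel_measurable borel"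
      by (intro borel_measurable_continuous_onI continuous_intros)
    ultimately have "(\<lambda>x::real ^ 3. frac (x $ i)) \<in> borel_measurable borel"
      by (rule measurable_compose[rotated])
    then show ?thesis by (simp add: b inner_axis wrap_def)
  qed
  then show ?thesis by (subst borel_measurable_euclidean_space) auto
qed

lemma wrap_add_lattice: "k \<in> lattice \<Longrightarrow> wrap (x + k) = wrap x"
proof -
  assume "k \<in> lattice"
  moreover have "frac (a + b) = frac a" if "b \<in> \<int>" for a b :: real
    using that by (auto simp: frac_def elim!: Ints_cases)
  ultimately show ?thesis by (auto simp: wrap_def vec_eq_iff lattice_def)
qed

lemma periodic_iff: "periodic f \<longleftrightarrow> (\<forall>x. \<forall>k\<in>lattice. f (x + k) = f x)"
  by (auto simp: periodic_def lattice_def)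

lemma periodic_wrap: "periodic f \<Longrightarrow> f (wrap x) = f x"
  using wrap_lattice[of x] unfolding periodic_iff by (metis add_diff_cancel_left' add_diff_eq)

lemma periodic_wrap_comp: "periodic (\<lambda>x. f (wrap x))"
  by (simp add: periodic_iff wrap_add_lattice)

lemma periodicD: "periodic f \<Longrightarrow> k \<in> lattice \<Longrightarrow> f (x + k) = f x" by (simp add: periodic_iff)

lemma periodic_comp: "periodic f \<Longrightarrow> periodic (\<lambda>x. G (f x))" by (simp add: periodic_def)
lemma periodic_comp2: "periodic f \<Longrightarrow> periodic g \<Longrightarrow> periodic (\<lambda>x. G (f x) (g x))" by (simp add: periodic_def)
lemma periodic_shift: "periodic f \<Longrightarrow> periodic (\<lambda>x. f (x + a))"
  unfolding periodic_def by (metis (no_types, lifting) add.assoc add.commute)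
lemma periodic_shift': "periodic f \<Longrightarrow> periodic (\<lambda>x. f (a + x))"
  using periodic_shift[of f a] by (simp add: add.commute[of a])
lemma periodic_reflect: assumes "periodic f" shows "periodic (\<lambda>x. f (a - x))"
  unfolding periodic_iff
proof safe
  fix x k assume "k \<in> lattice"
  then show "f (a - (x + k)) = f (a - x)"
    using periodicD[OF assms lattice_minus, of k "a - x"] by (simp add: algebra_simps)
qed

text \<open>A set that contains exactly one point of every coset of the lattice can replace the unit cell
  as domain of integration: decompose it along the translates of the other domain.\<close>

lemma nn_integral_fundamental_domain:
  fixes f :: "real ^ 3 \<Rightarrow> ennreal"
  assumes [measurable]: "f \<in> borel_measurable borel" "A \<in> sets borel" "B \<in> sets borel"
    and f: "periodic f"
    and A: "\<And>x. \<exists>!k. k \<in> lattice \<and> x + k \<in> A" and B: "\<And>x. \<exists>!k. k \<in> lattice \<and> x + k \<in> B"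
  shows "(\<integral>\<^sup>+x. f x * indicator A x \<partial>lborel) = (\<integral>\<^sup>+x. f x * indicator B x \<partial>lborel)"
proof -
  have one: "(\<integral>\<^sup>+k. indicator A (x + s *\<^sub>R k) \<partial>count_space lattice) = 1"
    if A: "\<And>x. \<exists>!k. k \<in> lattice \<and> x + k \<in> A" and s: "s = 1 \<or> s = -1" for x s and A :: "(real ^ 3) set"
  proof -
    obtain k0 where k0: "k0 \<in> lattice" "x + k0 \<in> A" "\<And>k. k \<in> lattice \<Longrightarrow> x + k \<in> A \<Longrightarrow> k = k0"
      using A[of x] by blast
    have "indicator A (x + s *\<^sub>R k) = (indicator {s *\<^sub>R k0} k :: ennreal)" if "k \<in> lattice" for k
    proof -
      have "x + s *\<^sub>R k \<in> A \<longleftrightarrow> k = s *\<^sub>R k0"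
      proof
        assume "x + s *\<^sub>R k \<in> A"
        then have "s *\<^sub>R k = k0" using s that lattice_minus[OF that] by (intro k0(3)) auto
        then show "k = s *\<^sub>R k0" using s by auto
      qed (use s k0(2) in auto)
      then show ?thesis by (simp add: indicator_def)
    qed
    then have "(\<integral>\<^sup>+k. indicator A (x + s *\<^sub>R k) \<partial>count_space lattice) =
        (\<integral>\<^sup>+k. indicator {s *\<^sub>R k0} k \<partial>count_space lattice)"
      by (intro nn_integral_cong) simp
    also have "\<dots> = 1"
      using k0(1) lattice_minus[OF k0(1)] s by (subst nn_integral_indicator) auto
    finally show ?thesis .
  qed
  have "(\<integral>\<^sup>+x. f x * indicator A x \<partial>lborel) =
      (\<integral>\<^sup>+x. (\<integral>\<^sup>+k. f x * indicator A x * indicator B (x + 1 *\<^sub>R k) \<partial>count_space lattice) \<partial>lborel)"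
    by (subst nn_integral_cmult) (simp_all only: one[OF B, of 1] simp_thms mult_1_right borel_measurable_count_space)
  also have "\<dots> = (\<integral>\<^sup>+k. (\<integral>\<^sup>+x. f x * indicator A x * indicator B (x + 1 *\<^sub>R k) \<partial>lborel) \<partial>count_space lattice)"
    by (rule nn_integral_count_space_nn_integral[OF countable_lattice]) measurable
  also have "\<dots> = (\<integral>\<^sup>+k. (\<integral>\<^sup>+x. f x * indicator B x * indicator A (x + (-1) *\<^sub>R k) \<partial>lborel) \<partial>count_space lattice)"
  proof (rule nn_integral_cong)
    fix k assume "k \<in> space (count_space lattice)"
    then have k: "k \<in> lattice" by simp
    have "(\<integral>\<^sup>+x. f x * indicator A x * indicator B (x + 1 *\<^sub>R k) \<partial>lborel) =
        (\<integral>\<^sup>+x. f x * indicator A x * indicator B (x + 1 *\<^sub>R k) \<partial>distr lborel borel ((+) (- k)))"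
      by (simp only: lborel_distr_plus)
    also have "\<dots> = (\<integral>\<^sup>+x. f (- k + x) * indicator A (- k + x) * indicator B (- k + x + 1 *\<^sub>R k) \<partial>lborel)"
      by (rule nn_integral_distr) measurable
    also have "\<dots> = (\<integral>\<^sup>+x. f x * indicator B x * indicator A (x + (-1) *\<^sub>R k) \<partial>lborel)"
      using periodicD[OF f lattice_minus[OF k]]
      by (intro nn_integral_cong) (simp add: add.commute mult_ac)
    finally show "(\<integral>\<^sup>+x. f x * indicator A x * indicator B (x + 1 *\<^sub>R k) \<partial>lborel) =
        (\<integral>\<^sup>+x. f x * indicator B x * indicator A (x + (-1) *\<^sub>R k) \<partial>lborel)" .
  qed
  also have "\<dots> = (\<integral>\<^sup>+x. (\<integral>\<^sup>+k. f x * indicator B x * indicator A (x + (-1) *\<^sub>R k) \<partial>count_space lattice) \<partial>lborel)"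
    by (rule nn_integral_count_space_nn_integral[OF countable_lattice, symmetric]) measurable
  also have "\<dots> = (\<integral>\<^sup>+x. f x * indicator B x \<partial>lborel)"
    by (subst nn_integral_cmult) (simp_all only: one[OF A, of "-1"] simp_thms mult_1_right borel_measurable_count_space)
  finally show ?thesis .
qed

lemma cell_fundamental: "\<exists>!k. k \<in> lattice \<and> x + k \<in> cell"
proof (rule ex1I)
  show w: "wrap x - x \<in> lattice \<and> x + (wrap x - x) \<in> cell" using wrap_cell wrap_lattice by simp
  fix k assume "k \<in> lattice \<and> x + k \<in> cell"
  then show "k = wrap x - x"
    using cell_lattice_zero[of "x + k" "wrap x - x - k"] w by (auto simp: lattice_diff)
qed

lemma nn_integral_torus:
  "f \<in> borel_measurable borel \<Longrightarrow> (\<integral>\<^sup>+x. f x \<partial>torus) = (\<integral>\<^sup>+x. f x * indicator cell x \<partial>lborel)"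
  unfolding torus_eq by (subst nn_integral_restrict_space) auto

lemma nn_integral_torus_affine:
  fixes f :: "real ^ 3 \<Rightarrow> ennreal"
  assumes [measurable]: "f \<in> borel_measurable borel" and f: "periodic f" and s: "s = 1 \<or> s = -1"
  shows "(\<integral>\<^sup>+x. f (a + s *\<^sub>R x) \<partial>torus) = (\<integral>\<^sup>+x. f x \<partial>torus)"
proof -
  define A where "A = {y. s *\<^sub>R (y - a) \<in> cell}"
  have [measurable]: "A \<in> sets borel" unfolding A_def by measurable
  have lb: "distr lborel borel (\<lambda>x::real ^ 3. a + s *\<^sub>R x) = lborel"
    using lborel_affine[of s a] s by (auto simp: density_1)
  have fund: "\<exists>!k. k \<in> lattice \<and> x + k \<in> A" for x
  proof -
    obtain k0 where k0: "k0 \<in> lattice" "s *\<^sub>R (x - a) + k0 \<in> cell"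
      and u: "\<And>k. k \<in> lattice \<Longrightarrow> s *\<^sub>R (x - a) + k \<in> cell \<Longrightarrow> k = k0"
      using cell_fundamental[of "s *\<^sub>R (x - a)"] by blast
    show ?thesis
    proof (rule ex1I[of _ "s *\<^sub>R k0"])
      show "s *\<^sub>R k0 \<in> lattice \<and> x + s *\<^sub>R k0 \<in> A"
        using k0 s lattice_minus[OF k0(1)] by (auto simp: A_def algebra_simps)
      fix k assume k: "k \<in> lattice \<and> x + k \<in> A"
      then have "s *\<^sub>R k \<in> lattice" "s *\<^sub>R (x - a) + s *\<^sub>R k \<in> cell"
        using s lattice_minus[of k] by (auto simp: A_def algebra_simps)
      then have "s *\<^sub>R k = k0" by (rule u)
      then show "k = s *\<^sub>R k0" using s by auto
    qed
  qed
  have "(\<integral>\<^sup>+x. f (a + s *\<^sub>R x) \<partial>torus) = (\<integral>\<^sup>+x. f (a + s *\<^sub>R x) * indicator A (a + s *\<^sub>R x) \<partial>lborel)"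
  proof (subst nn_integral_torus)
    show "(\<lambda>x. f (a + s *\<^sub>R x)) \<in> borel_measurable borel" by measurable
    show "(\<integral>\<^sup>+x. f (a + s *\<^sub>R x) * indicator cell x \<partial>lborel) =
        (\<integral>\<^sup>+x. f (a + s *\<^sub>R x) * indicator A (a + s *\<^sub>R x) \<partial>lborel)"
      using s by (intro nn_integral_cong) (auto simp: A_def indicator_def)
  qed
  also have "\<dots> = (\<integral>\<^sup>+y. f y * indicator A y \<partial>distr lborel borel (\<lambda>x. a + s *\<^sub>R x))"
    by (rule nn_integral_distr[symmetric]) measurable
  also have "\<dots> = (\<integral>\<^sup>+x. f x * indicator cell x \<partial>lborel)"
    unfolding lb by (rule nn_integral_fundamental_domain[OF _ _ _ f fund cell_fundamental]) measurable
  also have "\<dots> = (\<integral>\<^sup>+x. f x \<partial>torus)" by (rule nn_integral_torus[symmetric]) measurable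
  finally show ?thesis .
qed

lemma space_torus: "space torus = cell" by (simp add: torus_eq space_restrict_space)

lemma torus_to_borel: "(\<lambda>x. x) \<in> torus \<rightarrow>\<^sub>M borel"
  unfolding torus_eq by (rule measurable_restrict_space1) simp

lemma measurable_torus: "f \<in> borel \<rightarrow>\<^sub>M N \<Longrightarrow> f \<in> torus \<rightarrow>\<^sub>M N"
  using measurable_compose[OF torus_to_borel] .

lemma wrap_to_torus: "wrap \<in> borel \<rightarrow>\<^sub>M torus"
  unfolding torus_eq by (rule measurable_restrict_space2) (auto simp: wrap_cell)

lemma pair_to_borel:
  assumes "(\<lambda>x. x) \<in> M \<rightarrow>\<^sub>M borel" "(\<lambda>x. x) \<in> N \<rightarrow>\<^sub>M borel"
  shows "(\<lambda>x. x) \<in> M \<Otimes>\<^sub>M N \<rightarrow>\<^sub>M borel \<Otimes>\<^sub>M borel"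
proof -
  have "(\<lambda>z. (fst z, snd z)) \<in> M \<Otimes>\<^sub>M N \<rightarrow>\<^sub>M borel \<Otimes>\<^sub>M borel"
    by (intro measurable_Pair measurable_compose[OF measurable_fst assms(1)]
        measurable_compose[OF measurable_snd assms(2)])
  then show ?thesis by simp
qed

lemma measurable_torus2: "f \<in> borel \<Otimes>\<^sub>M borel \<rightarrow>\<^sub>M N \<Longrightarrow> f \<in> torus \<Otimes>\<^sub>M torus \<rightarrow>\<^sub>M N"
  using measurable_compose[OF pair_to_borel[OF torus_to_borel torus_to_borel]] .

lemma emeasure_torus: "emeasure torus (space torus) = 1"
proof -
  have "emeasure torus (space torus) = emeasure lborel cell"
    unfolding space_torus unfolding torus_eq by (subst emeasure_restrict_space) auto
  also have "\<dots> = 1"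
  proof (rule antisym)
    have one: "(\<Prod>b\<in>Basis. (1 - 0 :: real ^ 3) \<bullet> b) = 1"
      by (rule prod.neutral) (auto simp: Basis_vec_def inner_axis)
    have le: "\<forall>b\<in>Basis. (0::real ^ 3) \<bullet> b \<le> 1 \<bullet> b"
      by (auto simp: Basis_vec_def inner_axis)
    have "cell \<subseteq> cbox 0 1" by (auto simp: cell_def mem_box_cart less_imp_le)
    from emeasure_mono[OF this, of lborel] show "emeasure lborel cell \<le> 1"
      unfolding emeasure_lborel_cbox_eq one using le by simp
    have "box 0 1 \<subseteq> cell" by (auto simp: cell_def mem_box_cart less_imp_le)
    from emeasure_mono[OF this, of lborel] show "1 \<le> emeasure lborel cell"
      unfolding emeasure_lborel_box_eq one using le by simp
  qed
  finally show ?thesis .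
qed

interpretation torus: finite_measure torus
  by standard (simp add: emeasure_torus)

interpretation torus2: pair_sigma_finite torus torus ..

lemma measure_torus [simp]: "measure torus (space torus) = 1"
  by (simp add: measure_def emeasure_torus)

text \<open>Stated as an image measure, so that the invariance of integrals and of integrability transfers to
  functions with values in any Banach space.\<close>

lemma distr_torus_affine:
  assumes s: "s = 1 \<or> s = -1"
  shows "distr torus torus (\<lambda>x. wrap (a + s *\<^sub>R x)) = torus"
proof -
  have m: "(\<lambda>x. wrap (a + s *\<^sub>R x)) \<in> torus \<rightarrow>\<^sub>M torus"
    by (intro measurable_torus measurable_compose[OF _ wrap_to_torus]) measurable
  show ?thesis
  proof (rule measure_eqI)
    show "sets (distr torus torus (\<lambda>x. wrap (a + s *\<^sub>R x))) = sets torus" by simp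
    fix A assume "A \<in> sets (distr torus torus (\<lambda>x. wrap (a + s *\<^sub>R x)))"
    then have [measurable]: "A \<in> sets torus" by simp
    have A: "(\<lambda>x. indicator A (wrap x) :: ennreal) \<in> borel_measurable borel"
      by (rule measurable_compose[OF wrap_to_torus]) measurable
    have "emeasure (distr torus torus (\<lambda>x. wrap (a + s *\<^sub>R x))) A = (\<integral>\<^sup>+x. indicator A (wrap (a + s *\<^sub>R x)) \<partial>torus)"
    proof -
      have "emeasure (distr torus torus (\<lambda>x. wrap (a + s *\<^sub>R x))) A =
          (\<integral>\<^sup>+x. indicator A x \<partial>distr torus torus (\<lambda>x. wrap (a + s *\<^sub>R x)))"
        by simp
      also have "\<dots> = (\<integral>\<^sup>+x. indicator A (wrap (a + s *\<^sub>R x)) \<partial>torus)"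
        by (rule nn_integral_distr[OF m]) measurable
      finally show ?thesis .
    qed
    also have "\<dots> = (\<integral>\<^sup>+x. indicator A (wrap x) \<partial>torus)"
      by (rule nn_integral_torus_affine[OF A periodic_wrap_comp s])
    also have "\<dots> = (\<integral>\<^sup>+x. indicator A x \<partial>torus)"
      by (intro nn_integral_cong) (simp add: wrap_id space_torus)
    finally show "emeasure (distr torus torus (\<lambda>x. wrap (a + s *\<^sub>R x))) A = emeasure torus A" by simp
  qed
qed

lemma
  fixes f :: "real ^ 3 \<Rightarrow> 'b::{banach, second_countable_topology}"
  assumes f [measurable]: "f \<in> borel_measurable borel" and p: "periodic f"
  shows integral_torus_shift: "(LINT x|torus. f (a + x)) = (LINT x|torus. f x)"
    and integral_torus_reflect: "(LINT x|torus. f (a - x)) = (LINT x|torus. f x)"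
    and integrable_torus_shift: "integrable torus (\<lambda>x. f (a + x)) \<longleftrightarrow> integrable torus f"
proof -
  have m: "(\<lambda>x. wrap (a + s *\<^sub>R x)) \<in> torus \<rightarrow>\<^sub>M torus" for s
    by (intro measurable_torus measurable_compose[OF _ wrap_to_torus]) measurable
  have ft: "f \<in> borel_measurable torus" by (rule measurable_torus) fact
  have 1: "(LINT x|torus. f (a + s *\<^sub>R x)) = (LINT x|torus. f x)" if "s = 1 \<or> s = -1" for s
    using integral_distr[OF m ft, of s] distr_torus_affine[OF that, of a] by (simp add: periodic_wrap[OF p])
  have 2: "integrable torus (\<lambda>x. f (a + s *\<^sub>R x)) \<longleftrightarrow> integrable torus f" if "s = 1 \<or> s = -1" for s
    using integrable_distr_eq[OF m ft, of s] distr_torus_affine[OF that, of a] by (simp add: periodic_wrap[OF p])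
  show "(LINT x|torus. f (a + x)) = (LINT x|torus. f x)" using 1[of 1] by simp
  show "(LINT x|torus. f (a - x)) = (LINT x|torus. f x)" using 1[of "-1"] by simp
  show "integrable torus (\<lambda>x. f (a + x)) \<longleftrightarrow> integrable torus f" using 2[of 1] by simp
qed

lemma periodic_borel_iff:
  assumes "periodic f"
  shows "f \<in> borel_measurable torus \<longleftrightarrow> f \<in> borel_measurable borel"
proof
  assume "f \<in> borel_measurable torus"
  from measurable_compose[OF wrap_to_torus this] show "f \<in> borel_measurable borel"
    by (simp add: periodic_wrap[OF assms])
qed (rule measurable_torus)

text \<open>If \<open>h\<close> itself is not integrable, truncate it: \<open>\<bar>h \<circ> shift - h\<bar>\<close> dominates the increment of each
  truncation, whose integral vanishes.\<close>

lemma integral_coboundary: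
  fixes h :: "real ^ 3 \<Rightarrow> real"
  assumes h [measurable]: "h \<in> borel_measurable borel" and p: "periodic h"
    and int: "integrable torus (\<lambda>x. h (a + x) - h x)"
  shows "(LINT x|torus. h (a + x) - h x) = 0"
proof -
  define c where "c n y = max (- real n) (min (real n) y)" for n y
  have [measurable]: "c n \<in> borel_measurable borel" for n unfolding c_def by measurable
  have b: "integrable torus (\<lambda>x. c n (h (g x)))" if [measurable]: "g \<in> borel_measurable borel" for n and g
  proof (rule torus.integrable_const_bound[where B="real n"])
    show "(\<lambda>x. c n (h (g x))) \<in> borel_measurable torus" by (rule measurable_torus) measurable
  qed (auto simp: c_def)
  have z: "(LINT x|torus. c n (h (a + x)) - c n (h x)) = 0" for n
  proof -
    have "(LINT x|torus. c n (h (a + x))) = (LINT x|torus. c n (h x))"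
      by (rule integral_torus_shift[where f="\<lambda>x. c n (h x)"]) (measurable, rule periodic_comp[OF p])
    then show ?thesis using b[of "\<lambda>x. a + x" n] b[of "\<lambda>x. x" n] by simp
  qed
  have "(\<lambda>n. LINT x|torus. c n (h (a + x)) - c n (h x)) \<longlonglongrightarrow> (LINT x|torus. h (a + x) - h x)"
  proof (rule integral_dominated_convergence[where w="\<lambda>x. \<bar>h (a + x) - h x\<bar>"])
    show "AE x in torus. (\<lambda>n. c n (h (a + x)) - c n (h x)) \<longlonglongrightarrow> h (a + x) - h x"
    proof (intro always_eventually allI tendsto_diff)
      fix y
      have "(\<lambda>n. c n y) \<longlonglongrightarrow> y" for y
      proof (rule tendsto_eventually)
        obtain N where N: "\<bar>y\<bar> \<le> real N" using real_arch_simple by blast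
        show "\<forall>\<^sub>F n in sequentially. c n y = y"
          using eventually_ge_at_top[of N] by eventually_elim (use N in \<open>auto simp: c_def\<close>)
      qed
      then show "(\<lambda>n. c n (h (a + y))) \<longlonglongrightarrow> h (a + y)" "(\<lambda>n. c n (h y)) \<longlonglongrightarrow> h y" by auto
    qed
    show "AE x in torus. norm (c n (h (a + x)) - c n (h x)) \<le> \<bar>h (a + x) - h x\<bar>" for n
      by (intro always_eventually) (auto simp: c_def)
    show "(\<lambda>x. c n (h (a + x)) - c n (h x)) \<in> borel_measurable torus" for n
      by (rule measurable_torus) measurable
    show "(\<lambda>x. h (a + x) - h x) \<in> borel_measurable torus" by (rule measurable_torus) measurable
  qed (use int in simp)
  then show ?thesis unfolding z using LIMSEQ_unique tendsto_const by metis
qed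

section \<open>Convolutions and correlations\<close>

lemma (in pair_sigma_finite) integrable_mult_bounded:
  fixes f :: "'a \<Rightarrow> real" and g :: "'a \<times> 'b \<Rightarrow> real"
  assumes f: "integrable M1 f" and "finite_measure M2"
    and g: "g \<in> borel_measurable (M1 \<Otimes>\<^sub>M M2)" and B: "\<And>z. \<bar>g z\<bar> \<le> B"
  shows "integrable (M1 \<Otimes>\<^sub>M M2) (\<lambda>(x, y). f x * g (x, y))"
proof -
  interpret F: finite_measure M2 by fact
  have [measurable]: "f \<in> borel_measurable M1" using f by auto
  have "integrable (M1 \<Otimes>\<^sub>M M2) (\<lambda>z. f (fst z) * B)"
  proof (rule Fubini_integrable)
    have "integrable M1 (\<lambda>x. measure M2 (space M2) * \<bar>f x * B\<bar>)" using f by (intro integrable_mult_right integrable_abs integrable_mult_left)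
    then show "integrable M1 (\<lambda>x. LINT y|M2. norm (f (fst (x, y)) * B))" by simp
  qed auto
  then show ?thesis
  proof (rule Bochner_Integration.integrable_bound)
    show "(\<lambda>(x, y). f x * g (x, y)) \<in> borel_measurable (M1 \<Otimes>\<^sub>M M2)" using g by measurable
    show "AE z in M1 \<Otimes>\<^sub>M M2. norm (case z of (x, y) \<Rightarrow> f x * g (x, y)) \<le> norm (f (fst z) * B)"
      by (intro always_eventually) (auto simp: abs_mult intro!: mult_left_mono order_trans[OF B])
  qed
qed

lemma integrable_torus_bounded:
  fixes f :: "real ^ 3 \<Rightarrow> real"
  assumes "f \<in> borel_measurable borel" and "\<And>x. \<bar>f x\<bar> \<le> B"
  shows "integrable torus f"
  using assms by (intro torus.integrable_const_bound[where B=B]) (auto intro: measurable_torus)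

lemma integrable_mult_bounded_torus:
  fixes f g :: "real ^ 3 \<Rightarrow> real"
  assumes "integrable torus f" and "g \<in> borel_measurable borel" and "\<And>x. \<bar>g x\<bar> \<le> B"
  shows "integrable torus (\<lambda>x. f x * g x)"
proof (rule Bochner_Integration.integrable_bound)
  show "integrable torus (\<lambda>x. f x * B)" using assms by simp
  show "(\<lambda>x. f x * g x) \<in> borel_measurable torus"
    using assms(1) measurable_torus[OF assms(2)] by measurable
  have "\<bar>g x\<bar> \<le> \<bar>B\<bar>" for x using assms(3)[of x] by linarith
  then show "AE x in torus. norm (f x * g x) \<le> norm (f x * B)"
    by (intro always_eventually) (auto simp: abs_mult intro!: mult_left_mono)
qed

lemma add_diff_swap: "(x + k) - z = (x - z) + k" for x k z :: "real ^ 3" by simp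

lemma integrable_correlation:
  fixes f g K :: "real ^ 3 \<Rightarrow> real"
  assumes [measurable]: "f \<in> borel_measurable borel" "g \<in> borel_measurable borel" "K \<in> borel_measurable borel"
    and f: "integrable torus f" and g: "integrable torus g" "periodic g" and K: "\<And>x. \<bar>K x\<bar> \<le> B"
  shows "integrable (torus \<Otimes>\<^sub>M torus) (\<lambda>(x, \<xi>). K \<xi> * (f x * g (x + \<xi>)))"
proof (rule torus2.Fubini_integrable)
  have gs: "integrable torus (\<lambda>\<xi>. g (x + \<xi>))" for x
    using integrable_torus_shift[of g x] g by simp
  have i: "integrable torus (\<lambda>\<xi>. K \<xi> * (f x * g (x + \<xi>)))" for x
    using integrable_mult_bounded_torus[OF integrable_mult_right[OF gs] \<open>K \<in> _\<close> K, of "f x" x]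
    by (simp add: mult_ac)
  then show "AE x in torus. integrable torus (\<lambda>\<xi>. (case (x, \<xi>) of (x, \<xi>) \<Rightarrow> K \<xi> * (f x * g (x + \<xi>))))" by simp
  show m: "(\<lambda>(x, \<xi>). K \<xi> * (f x * g (x + \<xi>))) \<in> borel_measurable (torus \<Otimes>\<^sub>M torus)"
    by (rule measurable_torus2) measurable
  show "integrable torus (\<lambda>x. LINT \<xi>|torus. norm (case (x, \<xi>) of (x, \<xi>) \<Rightarrow> K \<xi> * (f x * g (x + \<xi>))))"
  proof (rule Bochner_Integration.integrable_bound)
    show "integrable torus (\<lambda>x. f x * (B * (LINT \<xi>|torus. \<bar>g \<xi>\<bar>)))" using f by simp
    show "(\<lambda>x. LINT \<xi>|torus. norm (case (x, \<xi>) of (x, \<xi>) \<Rightarrow> K \<xi> * (f x * g (x + \<xi>)))) \<in> borel_measurable torus"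
      using m by measurable
    have "(LINT \<xi>|torus. \<bar>K \<xi> * (f x * g (x + \<xi>))\<bar>) \<le> \<bar>f x\<bar> * (B * (LINT \<xi>|torus. \<bar>g \<xi>\<bar>))" for x
    proof -
      have "(LINT \<xi>|torus. \<bar>K \<xi> * (f x * g (x + \<xi>))\<bar>) \<le> (LINT \<xi>|torus. B * \<bar>f x\<bar> * \<bar>g (x + \<xi>)\<bar>)"
        using integrable_abs[OF i[of x]] gs[of x] K
        by (intro integral_mono) (auto simp: abs_mult mult.assoc intro!: mult_right_mono)
      also have "\<dots> = B * \<bar>f x\<bar> * (LINT \<xi>|torus. \<bar>g \<xi>\<bar>)"
        using integral_torus_shift[of "\<lambda>\<xi>. \<bar>g \<xi>\<bar>" x] periodic_comp[OF g(2), of abs] by simp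
      finally show ?thesis by (simp add: mult_ac)
    qed
    moreover have "0 \<le> B" using K[of 0] by linarith
    ultimately show "AE x in torus. norm (LINT \<xi>|torus. norm (case (x, \<xi>) of (x, \<xi>) \<Rightarrow> K \<xi> * (f x * g (x + \<xi>))))
        \<le> norm (f x * (B * (LINT \<xi>|torus. \<bar>g \<xi>\<bar>)))"
      by (intro always_eventually) (auto simp: abs_mult)
  qed
qed

definition conv :: "(real ^ 3 \<Rightarrow> real) \<Rightarrow> (real ^ 3 \<Rightarrow> real) \<Rightarrow> real ^ 3 \<Rightarrow> real" where
  "conv f \<Phi> y = (LINT x|torus. f x * \<Phi> (y - x))"

lemma integrable_conv:
  fixes f \<Phi> :: "real ^ 3 \<Rightarrow> real"
  assumes "integrable torus f" and [measurable]: "\<Phi> \<in> borel_measurable borel" and B: "\<And>x. \<bar>\<Phi> x\<bar> \<le> B"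
  shows "integrable torus (\<lambda>x. f x * \<Phi> (y - x))"
  by (rule integrable_mult_bounded_torus[where B=B]) (use assms in auto)

lemma conv_bound:
  assumes "integrable torus f" and [measurable]: "\<Phi> \<in> borel_measurable borel" and B: "\<And>x. \<bar>\<Phi> x\<bar> \<le> B"
  shows "\<bar>conv f \<Phi> y\<bar> \<le> B * (LINT x|torus. \<bar>f x\<bar>)"
proof -
  have "\<bar>conv f \<Phi> y\<bar> \<le> (LINT x|torus. \<bar>f x * \<Phi> (y - x)\<bar>)"
    unfolding conv_def by (rule integral_abs_bound)
  also have "\<dots> \<le> (LINT x|torus. B * \<bar>f x\<bar>)"
  proof (rule integral_mono)
    show "integrable torus (\<lambda>x. \<bar>f x * \<Phi> (y - x)\<bar>)"
      by (rule integrable_abs[OF integrable_conv[OF assms]])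
    show "\<bar>f x * \<Phi> (y - x)\<bar> \<le> B * \<bar>f x\<bar>" for x
      using mult_right_mono[OF B[of "y - x"], of "\<bar>f x\<bar>"] by (simp add: abs_mult mult.commute)
  qed (use assms(1) in simp)
  finally show ?thesis by simp
qed

lemma conv_periodic: "periodic \<Phi> \<Longrightarrow> periodic (conv f \<Phi>)"
  by (auto simp: periodic_iff conv_def add_diff_swap)

lemma conv_borel [measurable (raw)]:
  assumes [measurable]: "f \<in> borel_measurable borel" "\<Phi> \<in> borel_measurable borel"
  shows "conv f \<Phi> \<in> borel_measurable borel"
proof -
  have "(\<lambda>(y, x). f x * \<Phi> (y - x)) \<in> borel_measurable (borel \<Otimes>\<^sub>M torus)"
    by (rule measurable_compose[OF pair_to_borel[OF _ torus_to_borel]]) measurable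
  then show ?thesis unfolding conv_def by (rule torus.borel_measurable_lebesgue_integral)
qed

lemma conv_continuous:
  assumes f: "integrable torus f" and \<Phi>: "continuous_on UNIV \<Phi>" and B: "\<And>x. \<bar>\<Phi> x\<bar> \<le> B"
  shows "continuous_on UNIV (conv f \<Phi>)"
  unfolding continuous_on_sequentially
proof (intro allI impI ballI)
  fix y :: "nat \<Rightarrow> real ^ 3" and a assume y: "(\<forall>n. y n \<in> UNIV) \<and> y \<longlonglongrightarrow> a"
  have [measurable]: "\<Phi> \<in> borel_measurable borel" by (rule borel_measurable_continuous_onI[OF \<Phi>])
  have [measurable]: "f \<in> borel_measurable torus" using f by auto
  have m: "(\<lambda>x. f x * \<Phi> (y - x)) \<in> borel_measurable torus" for y
    using integrable_conv[OF f _ B] by (auto intro: borel_measurable_integrable)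
  have "(\<lambda>n. LINT x|torus. f x * \<Phi> (y n - x)) \<longlonglongrightarrow> (LINT x|torus. f x * \<Phi> (a - x))"
  proof (rule integral_dominated_convergence[where w="\<lambda>x. B * \<bar>f x\<bar>"])
    show "AE x in torus. (\<lambda>n. f x * \<Phi> (y n - x)) \<longlonglongrightarrow> f x * \<Phi> (a - x)"
      using y \<Phi> by (intro always_eventually allI tendsto_mult tendsto_const
          isCont_tendsto_compose[of _ \<Phi>] tendsto_diff) (auto simp: continuous_on_eq_continuous_at)
    show "AE x in torus. norm (f x * \<Phi> (y n - x)) \<le> B * \<bar>f x\<bar>" for n
    proof (intro always_eventually allI)
      show "norm (f x * \<Phi> (y n - x)) \<le> B * \<bar>f x\<bar>" for x
        using mult_right_mono[OF B[of "y n - x"], of "\<bar>f x\<bar>"] by (simp add: abs_mult mult.commute)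
    qed
  qed (use f m in auto)
  then show "(conv f \<Phi> \<circ> y) \<longlonglongrightarrow> conv f \<Phi> a" by (simp add: conv_def o_def)
qed

text \<open>The kernel that remains of two convolutions once the point of evaluation has been integrated out,
  see \<open>integral_conv_mult_conv\<close>.\<close>

definition kern :: "(real ^ 3 \<Rightarrow> real) \<Rightarrow> (real ^ 3 \<Rightarrow> real) \<Rightarrow> real ^ 3 \<Rightarrow> real" where
  "kern a b \<xi> = (LINT \<eta>|torus. a \<eta> * b (\<eta> - \<xi>))"

lemma kern_borel [measurable (raw)]:
  assumes [measurable]: "a \<in> borel_measurable borel" "b \<in> borel_measurable borel"
  shows "kern a b \<in> borel_measurable borel"
proof -
  have "(\<lambda>(\<xi>, \<eta>). a \<eta> * b (\<eta> - \<xi>)) \<in> borel_measurable (borel \<Otimes>\<^sub>M torus)"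
    by (rule measurable_compose[OF pair_to_borel[OF _ torus_to_borel]]) measurable
  then show ?thesis unfolding kern_def by (rule torus.borel_measurable_lebesgue_integral)
qed

lemma kern_bound:
  assumes [measurable]: "a \<in> borel_measurable borel" "b \<in> borel_measurable borel"
    and a: "\<And>x. \<bar>a x\<bar> \<le> A" and b: "\<And>x. \<bar>b x\<bar> \<le> B"
  shows "\<bar>kern a b \<xi>\<bar> \<le> A * B"
proof -
  have A0: "0 \<le> A" using a[of 0] by linarith
  have bd: "\<bar>a \<eta> * b (\<eta> - \<xi>)\<bar> \<le> A * B" for \<eta>
    using a b A0 by (auto simp: abs_mult intro!: mult_mono)
  have "\<bar>kern a b \<xi>\<bar> \<le> (LINT \<eta>|torus. \<bar>a \<eta> * b (\<eta> - \<xi>)\<bar>)"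
    unfolding kern_def by (rule integral_abs_bound)
  also have "\<dots> \<le> (LINT \<eta>|torus. A * B)"
    by (intro integral_mono integrable_abs integrable_torus_bounded[OF _ bd] bd) auto
  finally show ?thesis by simp
qed

lemma kern_periodic: "periodic b \<Longrightarrow> periodic (kern a b)"
  unfolding kern_def using periodic_reflect[of b] by (auto simp: periodic_iff)

text \<open>Writing \<open>y = x + \<eta>\<close> and \<open>z = x + \<xi>\<close> in the double integral over \<open>y\<close> and \<open>z\<close>.\<close>

lemma integral_kern_shift:
  assumes [measurable]: "g \<in> borel_measurable borel" "a \<in> borel_measurable borel" "b \<in> borel_measurable borel"
    and g: "integrable torus g" "periodic g"
    and a: "\<And>x. \<bar>a x\<bar> \<le> A" "periodic a" and b: "\<And>x. \<bar>b x\<bar> \<le> B" "periodic b"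
  shows "(LINT \<xi>|torus. kern a b \<xi> * g (x + \<xi>)) = (LINT y|torus. a (y - x) * conv g b y)"
proof -
  have A0: "0 \<le> A" using a(1)[of 0] by linarith
  have "(LINT y|torus. a (y - x) * conv g b y) = (LINT y|torus. (LINT z|torus. g z * (a (y - x) * b (y - z))))"
    unfolding conv_def by (simp flip: integral_mult_right_zero add: mult_ac)
  also have "\<dots> = (LINT z|torus. (LINT y|torus. g z * (a (y - x) * b (y - z))))"
  proof (rule torus2.Fubini_integral)
    show "integrable (torus \<Otimes>\<^sub>M torus) (\<lambda>(z, y). g z * (a (y - x) * b (y - z)))"
    proof (rule torus2.integrable_mult_bounded[where g="\<lambda>(z, y). a (y - x) * b (y - z)" and B="A * B", simplified])
      show "(\<lambda>(z, y). a (y - x) * b (y - z)) \<in> borel_measurable (torus \<Otimes>\<^sub>M torus)"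
        by (rule measurable_torus2) measurable
    qed (use a b A0 g torus.finite_measure_axioms in \<open>auto simp: abs_mult intro!: mult_mono\<close>)
  qed
  also have "\<dots> = (LINT z|torus. kern a b (z - x) * g z)"
  proof (intro Bochner_Integration.integral_cong refl)
    fix z
    have "(LINT y|torus. a (y - x) * b (y - z)) = (LINT y|torus. a ((x + y) - x) * b ((x + y) - z))"
    proof (rule integral_torus_shift[symmetric])
      show "periodic (\<lambda>y. a (y - x) * b (y - z))"
        using a(2) b(2) by (auto simp: periodic_iff add_diff_swap)
    qed measurable
    also have "\<dots> = kern a b (z - x)" unfolding kern_def by (simp add: algebra_simps)
    finally show "(LINT y|torus. g z * (a (y - x) * b (y - z))) = kern a b (z - x) * g z" by simp
  qed
  also have "\<dots> = (LINT \<xi>|torus. kern a b ((x + \<xi>) - x) * g (x + \<xi>))"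
  proof (rule integral_torus_shift[symmetric])
    have [measurable]: "kern a b \<in> borel_measurable borel" by (rule kern_borel) measurable
    show "(\<lambda>z. kern a b (z - x) * g z) \<in> borel_measurable borel" by measurable
    show "periodic (\<lambda>z. kern a b (z - x) * g z)"
      using g(2) kern_periodic[OF b(2), of a] by (auto simp: periodic_iff add_diff_swap)
  qed
  finally show ?thesis by simp
qed

lemma integral_conv_mult_conv:
  assumes [measurable]: "f \<in> borel_measurable borel" "g \<in> borel_measurable borel"
      "a \<in> borel_measurable borel" "b \<in> borel_measurable borel"
    and f: "integrable torus f" and g: "integrable torus g" "periodic g"
    and a: "\<And>x. \<bar>a x\<bar> \<le> A" "periodic a" and b: "\<And>x. \<bar>b x\<bar> \<le> B" "periodic b"
  shows "(LINT y|torus. conv f a y * conv g b y) = (LINT x|torus. f x * (LINT \<xi>|torus. kern a b \<xi> * g (x + \<xi>)))"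
proof -
  define W where "W = conv g b"
  have W [measurable]: "W \<in> borel_measurable borel" unfolding W_def by measurable
  have "\<bar>W y\<bar> \<le> B * (LINT x|torus. \<bar>g x\<bar>)" for y
    unfolding W_def by (rule conv_bound[OF g(1) _ b(1)]) measurable
  then obtain C where C: "\<And>y. \<bar>W y\<bar> \<le> C" by blast
  have A0: "0 \<le> A" using a(1)[of 0] by linarith
  have "(LINT y|torus. conv f a y * conv g b y) = (LINT y|torus. (LINT x|torus. f x * (a (y - x) * W y)))"
    unfolding W_def[symmetric] unfolding conv_def by (simp flip: integral_mult_left_zero add: mult.assoc)
  also have "\<dots> = (LINT x|torus. (LINT y|torus. f x * (a (y - x) * W y)))"
  proof (rule torus2.Fubini_integral)
    show "integrable (torus \<Otimes>\<^sub>M torus) (\<lambda>(x, y). f x * (a (y - x) * W y))"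
    proof (rule torus2.integrable_mult_bounded[where g="\<lambda>(x, y). a (y - x) * W y" and B="A * C", simplified])
      show "(\<lambda>(x, y). a (y - x) * W y) \<in> borel_measurable (torus \<Otimes>\<^sub>M torus)"
        by (rule measurable_torus2) measurable
    qed (use a C A0 f torus.finite_measure_axioms in \<open>auto simp: abs_mult intro!: mult_mono\<close>)
  qed
  also have "\<dots> = (LINT x|torus. f x * (LINT \<xi>|torus. kern a b \<xi> * g (x + \<xi>)))"
    unfolding W_def by (simp add: integral_kern_shift[OF _ _ _ g a b])
  finally show ?thesis .
qed

section \<open>Continuity of translations in the mean\<close>

lemma measure_torus_eq: "A \<in> sets borel \<Longrightarrow> A \<subseteq> cell \<Longrightarrow> measure torus A = measure lborel A"
  unfolding torus_eq by (subst measure_restrict_space) auto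

lemma emeasure_torus_eq: "A \<in> sets borel \<Longrightarrow> A \<subseteq> cell \<Longrightarrow> emeasure torus A = emeasure lborel A"
  unfolding torus_eq by (subst emeasure_restrict_space) auto

lemma sets_torus_borel: "A \<in> sets torus \<Longrightarrow> A \<in> sets borel \<and> A \<subseteq> cell"
  unfolding torus_eq by (auto simp: sets_restrict_space)

lemma
  fixes f :: "real ^ 3 \<Rightarrow> real"
  assumes "integrable torus f"
  shows integrable_wrap_shift: "integrable torus (\<lambda>x. f (wrap (\<xi> + x)))"
    and integral_wrap_shift: "(LINT x|torus. f (wrap (\<xi> + x))) = (LINT x|torus. f x)"
proof -
  have f: "f \<in> borel_measurable torus" using assms by auto
  have m: "(\<lambda>x. f (wrap x)) \<in> borel_measurable borel"
    by (rule measurable_compose[OF wrap_to_torus f])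
  have e: "(\<lambda>x. f (wrap x)) \<in> borel_measurable borel" "periodic (\<lambda>x. f (wrap x))"
    using m periodic_wrap_comp by auto
  have "integrable torus (\<lambda>x. f (wrap x)) \<longleftrightarrow> integrable torus f"
    by (rule Bochner_Integration.integrable_cong) (auto simp: wrap_id space_torus)
  then show "integrable torus (\<lambda>x. f (wrap (\<xi> + x)))"
    using integrable_torus_shift[OF e, of \<xi>] assms by simp
  have "(LINT x|torus. f (wrap x)) = (LINT x|torus. f x)"
    by (rule Bochner_Integration.integral_cong) (auto simp: wrap_id space_torus)
  then show "(LINT x|torus. f (wrap (\<xi> + x))) = (LINT x|torus. f x)"
    using integral_torus_shift[OF e, of \<xi>] by simp
qed

text \<open>By regularity the set lies, up to a small measure, between a compact and an open subset of the open
  cell, where small shifts do not wrap around.\<close>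

lemma indicator_translation:
  assumes A: "A \<in> sets torus" and e: "e > 0"
  shows "\<exists>d>0. \<forall>\<xi>. norm \<xi> < d \<longrightarrow>
    (LINT x|torus. \<bar>indicator A (wrap (\<xi> + x)) - indicator A x :: real\<bar>) < e"
proof -
  have [measurable]: "A \<in> sets borel" and Ac: "A \<subseteq> cell" using sets_torus_borel[OF A] by auto
  define O' where "O' = (box 0 1 :: (real ^ 3) set)"
  have O': "open O'" "O' \<subseteq> cell" by (auto simp: O'_def cell_def mem_box_cart less_imp_le)
  have [measurable]: "O' \<in> sets borel" using O' by auto
  define A' where "A' = A \<inter> O'"
  have [measurable]: "A' \<in> sets borel" by (simp add: A'_def)
  have A'l: "A' \<in> sets lebesgue" by simp
  have e8: "e/8 > 0" using e by simp
  obtain K where K: "closed K" "K \<subseteq> A'" "A' - K \<in> lmeasurable" "emeasure lebesgue (A' - K) < ennreal (e/8)"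
    by (rule sets_lebesgue_inner_closed[OF A'l e8])
  obtain U where U: "open U" "A' \<subseteq> U" "U - A' \<in> lmeasurable" "emeasure lebesgue (U - A') < ennreal (e/8)"
    by (rule sets_lebesgue_outer_open[OF A'l e8])
  have [measurable]: "K \<in> sets borel" "U \<in> sets borel" using K U by auto
  have "compact K"
    using K O'_def A'_def bounded_subset[OF bounded_box, of K] by (auto simp: compact_eq_bounded_closed)
  then obtain d where d: "d > 0" "(\<Union>x\<in>K. ball x d) \<subseteq> U \<inter> O'"
    using compact_subset_open_imp_ball_epsilon_subset[of K "U \<inter> O'"] K U O' unfolding A'_def by blast
  have null: "measure lborel (cell - O') = 0"
  proof -
    have "cell - O' \<subseteq> cbox 0 1 - box 0 1"
      by (auto simp: cell_def O'_def mem_box_cart less_imp_le)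
    moreover have "emeasure lborel (cbox 0 1 - box 0 1 :: (real ^ 3) set) = 0"
    proof (subst emeasure_Diff)
      show "box 0 1 \<subseteq> (cbox 0 1 :: (real ^ 3) set)" by (rule box_subset_cbox)
    qed (auto simp: emeasure_lborel_box_eq emeasure_lborel_cbox_eq)
    ultimately have "emeasure lborel (cell - O') = 0"
      using emeasure_mono[of "cell - O'" "cbox 0 1 - box 0 1" lborel] by simp
    then show ?thesis by (simp add: measure_def)
  qed
  have mu: "measure torus B < e/8"
    if "B \<subseteq> cell" "B \<inter> O' \<subseteq> C" "emeasure lebesgue C < ennreal (e/8)" and [measurable]: "B \<in> sets borel" "C \<in> sets borel" for B C
  proof -
    have "emeasure lborel B \<le> emeasure lborel (C \<union> (cell - O'))"
      using that by (intro emeasure_mono) auto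
    also have "\<dots> \<le> emeasure lborel C + emeasure lborel (cell - O')"
      by (rule emeasure_subadditive) auto
    also have "emeasure lborel (cell - O') = 0"
    proof -
      have "emeasure lborel (cell - O') \<le> emeasure lborel cell" by (intro emeasure_mono) auto
      also have "\<dots> < \<infinity>" using emeasure_torus emeasure_torus_eq[of cell] by (simp add: space_torus)
      finally show ?thesis using null by (auto simp: measure_def enn2real_eq_0_iff)
    qed
    finally have "emeasure lborel B < ennreal (e/8)" using that by simp
    moreover from this have "emeasure lborel B = ennreal (measure lborel B)"
      by (intro emeasure_eq_ennreal_measure) auto
    ultimately have "measure lborel B < e/8" using e by (simp add: ennreal_less_iff)
    then show ?thesis using that by (simp add: measure_torus_eq)
  qed
  have m1: "measure torus (A - K) < e/8"
    by (rule mu[where C="A' - K"]) (use Ac K in \<open>auto simp: A'_def\<close>)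
  have m2: "measure torus ((U \<inter> O') - A) < e/8"
    by (rule mu[where C="U - A'"]) (use O' U in \<open>auto simp: A'_def\<close>)
  show ?thesis
  proof (intro exI[of _ d] conjI d(1) allI impI)
    fix \<xi> :: "real ^ 3" assume \<xi>: "norm \<xi> < d"
    have st: "B \<in> sets torus" if "B \<in> sets borel" "B \<subseteq> cell" for B
      unfolding torus_eq using that by (auto simp: sets_restrict_space)
    have ii: "integrable torus (indicator B :: _ \<Rightarrow> real)" if "B \<in> sets borel" "B \<subseteq> cell" for B
      using st[OF that] by (simp add: torus.emeasure_finite less_top[symmetric])
    have iA: "integrable torus (indicator A :: _ \<Rightarrow> real)"
      and iAK: "integrable torus (indicator (A - K) :: _ \<Rightarrow> real)"
      and iU: "integrable torus (indicator ((U \<inter> O') - A) :: _ \<Rightarrow> real)"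
      using Ac O' by (auto intro!: ii)
    (* The absolute value is twice the positive part minus the difference, and the difference has
       integral zero. *)
    have le: "\<bar>indicator A (wrap (\<xi> + x)) - indicator A x :: real\<bar>
        \<le> 2 * (indicator (A - K) (wrap (\<xi> + x)) + indicator ((U \<inter> O') - A) x)
          - (indicator A (wrap (\<xi> + x)) - indicator A x)" if x: "x \<in> cell" for x
    proof -
      have "x \<in> U \<inter> O'" if k: "wrap (\<xi> + x) \<in> K"
      proof -
        let ?y = "wrap (\<xi> + x) - \<xi>"
        have y: "?y \<in> U \<inter> O'" 
        proof -
          have "?y \<in> ball (wrap (\<xi> + x)) d" using \<xi> by (simp add: dist_norm)
          then show ?thesis using d(2) k by blast
        qed
        have "?y - x \<in> lattice" using wrap_lattice[of "\<xi> + x"] by (simp add: algebra_simps)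
        then have "?y - x = 0" using cell_lattice_zero[OF x, of "?y - x"] y O'(2) by auto
        then show ?thesis using y by simp
      qed
      then show ?thesis by (auto simp: indicator_def)
    qed
    have int: "(A - K) \<inter> space torus = A - K" "(U \<inter> O' - A) \<inter> space torus = U \<inter> O' - A"
      using Ac O' by (auto simp: space_torus)
    have "(LINT x|torus. \<bar>indicator A (wrap (\<xi> + x)) - indicator A x :: real\<bar>)
        \<le> (LINT x|torus. 2 * (indicator (A - K) (wrap (\<xi> + x)) + indicator ((U \<inter> O') - A) x)
          - (indicator A (wrap (\<xi> + x)) - indicator A x))"
      using iA iAK iU integrable_wrap_shift[OF iA, of \<xi>] integrable_wrap_shift[OF iAK, of \<xi>]
      by (intro integral_mono le) (auto simp: space_torus)
    also have "\<dots> = 2 * (measure torus (A - K) + measure torus ((U \<inter> O') - A))"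
      using iA iAK iU integrable_wrap_shift[OF iA, of \<xi>] integrable_wrap_shift[OF iAK, of \<xi>]
        integral_wrap_shift[OF iA, of \<xi>] integral_wrap_shift[OF iAK, of \<xi>] int
        st[of "A - K"] st[of "(U \<inter> O') - A"] Ac O' by auto
    also have "\<dots> < e" using m1 m2 e by simp
    finally show "(LINT x|torus. \<bar>indicator A (wrap (\<xi> + x)) - indicator A x :: real\<bar>) < e" .
  qed
qed

lemma L1_translation_wrap:
  fixes f :: "real ^ 3 \<Rightarrow> real"
  assumes "integrable torus f"
  shows "\<forall>e>0. \<exists>d>0. \<forall>\<xi>. norm \<xi> < d \<longrightarrow> (LINT x|torus. \<bar>f (wrap (\<xi> + x)) - f x\<bar>) < e"
  using assms
proof (induction rule: integrable_induct)
  case (base A c)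
  show ?case
  proof (intro allI impI)
    fix e :: real assume e: "e > 0"
    then have "e / (\<bar>c\<bar> + 1) > 0" by simp
    from indicator_translation[OF base(1) this] obtain d where d: "d > 0"
      "\<And>\<xi>. norm \<xi> < d \<Longrightarrow> (LINT x|torus. \<bar>indicator A (wrap (\<xi> + x)) - indicator A x :: real\<bar>) < e / (\<bar>c\<bar> + 1)"
      by blast
    have "(LINT x|torus. \<bar>indicator A (wrap (\<xi> + x)) *\<^sub>R c - indicator A x *\<^sub>R c\<bar>) < e" if "norm \<xi> < d" for \<xi>
    proof -
      let ?I = "LINT x|torus. \<bar>indicator A (wrap (\<xi> + x)) - indicator A x :: real\<bar>"
      have "(LINT x|torus. \<bar>indicator A (wrap (\<xi> + x)) *\<^sub>R c - indicator A x *\<^sub>R c\<bar>) = ?I * \<bar>c\<bar>"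
      proof (subst integral_mult_left_zero[symmetric], rule Bochner_Integration.integral_cong)
        show "\<bar>indicator A (wrap (\<xi> + x)) *\<^sub>R c - indicator A x *\<^sub>R c\<bar> =
            \<bar>indicator A (wrap (\<xi> + x)) - indicator A x :: real\<bar> * \<bar>c\<bar>" for x
          unfolding abs_mult[symmetric] by (simp add: left_diff_distrib)
      qed simp
      also have "\<dots> \<le> ?I * (\<bar>c\<bar> + 1)" by (intro mult_left_mono) auto
      also have "\<dots> < e" using d(2)[OF that] by (simp add: field_simps)
      finally show ?thesis .
    qed
    then show "\<exists>d>0. \<forall>\<xi>. norm \<xi> < d \<longrightarrow> (LINT x|torus. \<bar>indicator A (wrap (\<xi> + x)) *\<^sub>R c - indicator A x *\<^sub>R c\<bar>) < e"
      using d(1) by blast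
  qed
next
  case (add f g)
  show ?case
  proof (intro allI impI)
    fix e :: real assume e: "e > 0"
    then have e2: "e/2 > 0" by simp
    obtain d1 where d1: "d1 > 0" "\<And>\<xi>. norm \<xi> < d1 \<Longrightarrow> (LINT x|torus. \<bar>f (wrap (\<xi> + x)) - f x\<bar>) < e/2"
      using add.IH(1)[rule_format, OF e2] by blast
    obtain d2 where d2: "d2 > 0" "\<And>\<xi>. norm \<xi> < d2 \<Longrightarrow> (LINT x|torus. \<bar>g (wrap (\<xi> + x)) - g x\<bar>) < e/2"
      using add.IH(2)[rule_format, OF e2] by blast
    have "(LINT x|torus. \<bar>f (wrap (\<xi> + x)) + g (wrap (\<xi> + x)) - (f x + g x)\<bar>) < e" if "norm \<xi> < min d1 d2" for \<xi>
    proof -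
      have "(LINT x|torus. \<bar>f (wrap (\<xi> + x)) + g (wrap (\<xi> + x)) - (f x + g x)\<bar>)
          \<le> (LINT x|torus. \<bar>f (wrap (\<xi> + x)) - f x\<bar> + \<bar>g (wrap (\<xi> + x)) - g x\<bar>)"
        using add.hyps integrable_wrap_shift[OF add.hyps(1), of \<xi>] integrable_wrap_shift[OF add.hyps(2), of \<xi>]
        by (intro integral_mono) auto
      also have "\<dots> = (LINT x|torus. \<bar>f (wrap (\<xi> + x)) - f x\<bar>) + (LINT x|torus. \<bar>g (wrap (\<xi> + x)) - g x\<bar>)"
        using add.hyps integrable_wrap_shift[OF add.hyps(1), of \<xi>] integrable_wrap_shift[OF add.hyps(2), of \<xi>] by simp
      also have "\<dots> < e" using d1(2)[of \<xi>] d2(2)[of \<xi>] that by simp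
      finally show ?thesis .
    qed
    then show "\<exists>d>0. \<forall>\<xi>. norm \<xi> < d \<longrightarrow> (LINT x|torus. \<bar>f (wrap (\<xi> + x)) + g (wrap (\<xi> + x)) - (f x + g x)\<bar>) < e"
      using d1(1) d2(1) by (intro exI[of _ "min d1 d2"]) auto
  qed
next
  case (lim f s)
  show ?case
  proof (intro allI impI)
    fix e :: real assume e: "e > 0"
    have "(\<lambda>i. LINT x|torus. \<bar>f x - s i x\<bar>) \<longlonglongrightarrow> (LINT x|torus. 0)"
    proof (rule integral_dominated_convergence[where w="\<lambda>x. 3 * \<bar>f x\<bar>"])
      show "AE x in torus. (\<lambda>i. \<bar>f x - s i x\<bar>) \<longlonglongrightarrow> 0"
      proof (rule AE_I2)
        fix x assume "x \<in> space torus"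
        from tendsto_diff[OF tendsto_const lim.hyps(2)[OF this], of "f x"]
        show "(\<lambda>i. \<bar>f x - s i x\<bar>) \<longlonglongrightarrow> 0" by (simp add: tendsto_rabs_zero_iff)
      qed
      show "AE x in torus. norm \<bar>f x - s i x\<bar> \<le> 3 * \<bar>f x\<bar>" for i
        using lim.hyps(3)[of _ i] by (intro AE_I2) (fastforce intro: order_trans[OF abs_triangle_ineq4])
    qed (use lim.hyps(1,4) in auto)
    then obtain i where i: "(LINT x|torus. \<bar>f x - s i x\<bar>) < e/4"
      using order_tendstoD(2)[of _ 0 sequentially "e/4"] e by (auto simp: eventually_sequentially)
    obtain d where d: "d > 0" "\<And>\<xi>. norm \<xi> < d \<Longrightarrow> (LINT x|torus. \<bar>s i (wrap (\<xi> + x)) - s i x\<bar>) < e/4"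
      using lim.IH[of i, rule_format, of "e/4"] e by auto
    have "(LINT x|torus. \<bar>f (wrap (\<xi> + x)) - f x\<bar>) < e" if "norm \<xi> < d" for \<xi>
    proof -
      have id: "integrable torus (\<lambda>x. \<bar>f x - s i x\<bar>)" using lim.hyps(1,4) by auto
      note I = integrable_wrap_shift[OF id, of \<xi>] integrable_wrap_shift[OF lim.hyps(1), of i \<xi>]
          integrable_wrap_shift[OF lim.hyps(4), of \<xi>] id lim.hyps(1)[of i] lim.hyps(4)
      have "(LINT x|torus. \<bar>f (wrap (\<xi> + x)) - f x\<bar>)
          \<le> (LINT x|torus. \<bar>f (wrap (\<xi> + x)) - s i (wrap (\<xi> + x))\<bar> + \<bar>s i (wrap (\<xi> + x)) - s i x\<bar> + \<bar>f x - s i x\<bar>)"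
        using I by (intro integral_mono) auto
      also have "\<dots> = (LINT x|torus. \<bar>f (wrap (\<xi> + x)) - s i (wrap (\<xi> + x))\<bar>)
          + (LINT x|torus. \<bar>s i (wrap (\<xi> + x)) - s i x\<bar>) + (LINT x|torus. \<bar>f x - s i x\<bar>)"
        using I by simp
      also have "\<dots> < e" using d(2)[OF that] i integral_wrap_shift[OF id, of \<xi>] e by simp
      finally show ?thesis .
    qed
    then show "\<exists>d>0. \<forall>\<xi>. norm \<xi> < d \<longrightarrow> (LINT x|torus. \<bar>f (wrap (\<xi> + x)) - f x\<bar>) < e"
      using d(1) by blast
  qed
qed

lemma L1_translation:
  fixes f :: "real ^ 3 \<Rightarrow> real"
  assumes "integrable torus f" "periodic f" "e > 0"
  obtains d where "d > 0" "\<And>\<xi>. norm \<xi> < d \<Longrightarrow> (LINT x|torus. \<bar>f (\<xi> + x) - f x\<bar>) < e"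
  using L1_translation_wrap[OF assms(1)] assms(3) by (auto simp: periodic_wrap[OF assms(2)])

text \<open>From \<open>(a - b)\<^sup>2 \<le> 2 \<bar>a \<bar>a\<bar> - b \<bar>b\<bar>\<bar>\<close>: the translates of \<open>f\<close> are close in \<open>L\<^sup>2\<close> as soon as those of
  \<open>f \<bar>f\<bar>\<close> are close in \<open>L\<^sup>1\<close>.\<close>

lemma L2_translation:
  fixes f :: "real ^ 3 \<Rightarrow> real"
  assumes [measurable]: "f \<in> borel_measurable borel" and f: "integrable torus (\<lambda>x. (f x)\<^sup>2)" "periodic f" and e: "e > 0"
  obtains d where "d > 0" "\<And>\<xi>. norm \<xi> < d \<Longrightarrow> (LINT x|torus. (f (\<xi> + x) - f x)\<^sup>2) < e"
proof -
  define F where "F x = f x * \<bar>f x\<bar>" for x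
  have [measurable]: "F \<in> borel_measurable borel" unfolding F_def by measurable
  have pF: "periodic F" unfolding F_def using f(2) by (simp add: periodic_def)
  have iF: "integrable torus F"
    by (rule Bochner_Integration.integrable_bound[OF f(1)])
      (auto intro: measurable_torus simp: F_def abs_mult power2_eq_square)
  have key: "(a - b)\<^sup>2 \<le> 2 * abs (a * abs a - b * abs b)" for a b :: real
  proof (cases "0 \<le> a * b")
    case True
    have "\<bar>a - b\<bar> \<le> \<bar>a + b\<bar>" using True by (auto simp: zero_le_mult_iff)
    then have "\<bar>a - b\<bar> * \<bar>a - b\<bar> \<le> \<bar>a - b\<bar> * \<bar>a + b\<bar>" by (intro mult_left_mono) auto
    also have "\<dots> = abs (a * abs a - b * abs b)"
      using True by (auto simp: zero_le_mult_iff abs_mult[symmetric] algebra_simps)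
    finally have "(a - b)\<^sup>2 \<le> abs (a * abs a - b * abs b)" by (simp add: power2_eq_square)
    moreover have "y \<le> 2 * y" if "0 \<le> y" for y :: real using that by simp
    ultimately show ?thesis by (meson abs_ge_zero order_trans)
  next
    case False
    then have "a * abs a - b * abs b = a\<^sup>2 + b\<^sup>2 \<or> a * abs a - b * abs b = - (a\<^sup>2 + b\<^sup>2)"
      by (auto simp: zero_le_mult_iff power2_eq_square not_le)
    then have "abs (a * abs a - b * abs b) = a\<^sup>2 + b\<^sup>2"
      using abs_of_nonneg[of "a\<^sup>2 + b\<^sup>2"] by (metis abs_minus_cancel add_nonneg_nonneg zero_le_power2)
    moreover have "(a - b)\<^sup>2 \<le> 2 * (a\<^sup>2 + b\<^sup>2)"
      using zero_le_power2[of "a + b"] by (simp add: power2_eq_square algebra_simps)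
    ultimately show ?thesis by simp
  qed
  obtain d where d: "d > 0" "\<And>\<xi>. norm \<xi> < d \<Longrightarrow> (LINT x|torus. \<bar>F (\<xi> + x) - F x\<bar>) < e/2"
    using L1_translation[OF iF pF, of "e/2"] e by auto
  have "(LINT x|torus. (f (\<xi> + x) - f x)\<^sup>2) < e" if "norm \<xi> < d" for \<xi>
  proof -
    have iFs: "integrable torus (\<lambda>x. F (\<xi> + x))" using integrable_torus_shift[OF _ pF] iF by auto
    have "(LINT x|torus. (f (\<xi> + x) - f x)\<^sup>2) \<le> (LINT x|torus. 2 * \<bar>F (\<xi> + x) - F x\<bar>)"
    proof (rule integral_mono)
      show i: "integrable torus (\<lambda>x. 2 * \<bar>F (\<xi> + x) - F x\<bar>)" using iF iFs by auto
      show le: "(f (\<xi> + x) - f x)\<^sup>2 \<le> 2 * \<bar>F (\<xi> + x) - F x\<bar>" for x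
        using key[of "f (\<xi> + x)" "f x"] by (simp add: F_def)
      show "integrable torus (\<lambda>x. (f (\<xi> + x) - f x)\<^sup>2)"
        by (rule Bochner_Integration.integrable_bound[OF i]) (auto intro: measurable_torus simp: le)
    qed
    also have "\<dots> < e" using d(2)[OF that] by simp
    finally show ?thesis .
  qed
  then show ?thesis using that d(1) by blast
qed

section \<open>Periodic mollifiers\<close>

lemma partial_eqI: "(f has_derivative D) (at x) \<Longrightarrow> partial i f x = D (axis i 1)"
  unfolding partial_def using frechet_derivative_at by metis

lemma partial_periodic: assumes "smooth (f :: real ^ 3 \<Rightarrow> real)" "periodic f" shows "periodic (partial i f)"
  unfolding periodic_iff
proof safe
  fix x k :: "real ^ 3" assume k: "k \<in> lattice"
  have "((\<lambda>y. y + k) has_derivative (\<lambda>h. h)) (at x)" by (auto intro!: derivative_eq_intros)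
  from has_derivative_compose[OF this smooth_has_derivative[OF assms(1)]]
  have "((\<lambda>y. f (y + k)) has_derivative frechet_derivative f (at (x + k))) (at x)" .
  then have "(f has_derivative frechet_derivative f (at (x + k))) (at x)"
    using assms(2) k by (simp add: periodic_iff)
  then show "partial i f (x + k) = partial i f x" by (metis partial_eqI partial_def)
qed

lemma partial_reflect:
  assumes "smooth (f :: real ^ 3 \<Rightarrow> real)"
  shows "partial i (\<lambda>x. f (c - x)) x = - partial i f (c - x)"
proof -
  have "((\<lambda>y. c - y) has_derivative (\<lambda>h. - h)) (at x)" by (auto intro!: derivative_eq_intros)
  from has_derivative_compose[OF this smooth_has_derivative[OF assms(1)]]
  have "((\<lambda>y. f (c - y)) has_derivative (\<lambda>h. frechet_derivative f (at (c - x)) (- h))) (at x)" .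
  from partial_eqI[OF this, of i] show ?thesis
    using linear_neg[OF has_derivative_linear[OF smooth_has_derivative[OF assms, of "c - x"]]]
    by (simp add: partial_def)
qed

lemma partial_cmult:
  assumes "smooth (f :: real ^ 3 \<Rightarrow> real)"
  shows "partial i (\<lambda>x. c * f x) x = c * partial i f x"
  using partial_eqI[OF has_derivative_mult_right[OF smooth_has_derivative[OF assms]], of i]
  by (simp add: partial_def)

lemma partial_uminus:
  assumes "smooth (f :: real ^ 3 \<Rightarrow> real)"
  shows "partial i (\<lambda>x. - f x) x = - partial i f x"
  using partial_cmult[OF assms, of i "-1"] by simp

lemma periodic_continuous_bounded:
  fixes f :: "real ^ 3 \<Rightarrow> real"
  assumes "continuous_on UNIV f" "periodic f"
  obtains B where "\<And>x. \<bar>f x\<bar> \<le> B"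
proof -
  have "compact (f ` cbox 0 1)"
    using assms(1) by (intro compact_continuous_image) (auto intro: continuous_on_subset)
  then obtain B where B: "\<And>x. x \<in> cbox 0 1 \<Longrightarrow> \<bar>f x\<bar> \<le> B"
    using compact_imp_bounded bounded_iff by (metis image_eqI real_norm_def)
  have "\<bar>f x\<bar> \<le> B" for x
  proof -
    have "wrap x \<in> cbox 0 1" using wrap_cell[of x] by (auto simp: cell_def mem_box_cart less_imp_le)
    from B[OF this] show ?thesis by (simp add: periodic_wrap[OF assms(2)])
  qed
  then show ?thesis by (rule that)
qed

lemma smooth_borel: "smooth (f :: real ^ 3 \<Rightarrow> real) \<Longrightarrow> f \<in> borel_measurable borel"
  by (rule borel_measurable_continuous_onI[OF smooth_continuous])

text \<open>A representative of the coset of \<open>x\<close> that is nearest to the origin; its norm is the distance of \<open>x\<close>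
  to the lattice.\<close>

definition cent :: "real ^ 3 \<Rightarrow> real ^ 3" where "cent x = (\<chi> i. x $ i - of_int (round (x $ i)))"

lemma cent_lattice: "x - cent x \<in> lattice" by (auto simp: cent_def lattice_def)

lemma norm_cent_le: "k \<in> lattice \<Longrightarrow> norm (cent x) \<le> norm (x - k)"
proof (rule norm_le_componentwise_cart)
  fix i assume "k \<in> lattice"
  then obtain m where "k $ i = of_int m" by (auto simp: lattice_def Ints_def)
  then show "norm (cent x $ i) \<le> norm ((x - k) $ i)"
    using round_diff_minimal[of "x $ i" m] by (simp add: cent_def)
qed

lemma norm_cent_diff: "norm (cent (x - y)) \<le> norm (cent x) + norm (cent y)"
proof -
  have "norm (cent (x - y)) \<le> norm (x - y - ((x - cent x) - (y - cent y)))"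
    by (intro norm_cent_le lattice_diff cent_lattice)
  also have "\<dots> = norm (cent x - cent y)" by simp
  also have "\<dots> \<le> norm (cent x) + norm (cent y)" by (rule norm_triangle_ineq4)
  finally show ?thesis .
qed

lemma periodic_cent: "periodic f \<Longrightarrow> f (cent x) = f x"
  using periodicD[of f "x - cent x" "cent x"] cent_lattice by simp

lemma abs_cent_le: "\<bar>cent x $ i\<bar> \<le> 1/2"
  using of_int_round_abs_le[of "x $ i"] by (simp add: cent_def abs_minus_commute)

definition periodic_cube :: "real \<Rightarrow> (real ^ 3) set" where "periodic_cube r = {x. \<forall>i. \<bar>cent x $ i\<bar> \<le> r}"

lemma periodic_cube_borel [measurable]: "periodic_cube r \<in> sets borel"
proof -
  have m: "(\<lambda>x::real ^ 3. x $ i) \<in> borel_measurable borel" for i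
    by (intro borel_measurable_continuous_onI continuous_intros)
  have "(\<lambda>y::real. y - of_int (round y)) \<in> borel_measurable borel" unfolding round_def by measurable
  from measurable_compose[OF m this]
  have [measurable]: "(\<lambda>x. cent x $ i) \<in> borel_measurable borel" for i by (simp add: cent_def)
  show ?thesis unfolding periodic_cube_def by measurable
qed

lemma cent_periodic: "k \<in> lattice \<Longrightarrow> cent (x + k) = cent x"
proof -
  assume k: "k \<in> lattice"
  have "a + b - of_int (round (a + b)) = a - of_int (round a)" if "b \<in> \<int>" for a b :: real
  proof -
    obtain m where m: "b = of_int m" using \<open>b \<in> \<int>\<close> by (rule Ints_cases)
    have "round (a + of_int m) = round a + m" 
      using floor_add_int[of "a + 1/2" m] unfolding round_def by (simp add: add_ac)
    then show ?thesis by (simp add: m)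
  qed
  then show ?thesis using k by (auto simp: cent_def vec_eq_iff lattice_def)
qed

lemma measure_periodic_cube:
  assumes r: "0 \<le> r" "r < 1/2"
  shows "(LINT x|torus. indicator (periodic_cube r) x) = (2 * r) ^ 3"
proof -
  (* The shift moves the cube around the origin to the middle of the unit cell. *)
  define a :: "real ^ 3" where "a = (\<chi> i. - 1/2)"
  define lo hi :: "real ^ 3" where "lo = (\<chi> i. 1/2 - r)" and "hi = (\<chi> i. 1/2 + r)"
  have p: "periodic (indicator (periodic_cube r) :: real ^ 3 \<Rightarrow> real)"
    by (auto simp: periodic_iff periodic_cube_def indicator_def cent_periodic)
  have sub: "cbox lo hi \<subseteq> cell"
  proof
    fix x assume x: "x \<in> cbox lo hi"
    show "x \<in> cell" unfolding cell_def
    proof (safe)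
      fix i show "0 \<le> x $ i" "x $ i < 1"
        using x r by (auto simp: mem_box_cart lo_def hi_def dest!: spec[where x=i])
    qed
  qed
  have eq: "indicator (periodic_cube r) (a + x) = (indicator (cbox lo hi) x :: real)" if x: "x \<in> space torus" for x
  proof -
    have c: "cent (a + x) $ i = x $ i - 1/2" for i
    proof -
      have "0 \<le> x $ i" "x $ i < 1" using x by (auto simp: space_torus cell_def)
      then have "round (x $ i - 1/2) = 0" unfolding round_def by (simp add: floor_eq_iff)
      then show ?thesis by (simp add: cent_def a_def)
    qed
    then have "a + x \<in> periodic_cube r \<longleftrightarrow> x \<in> cbox lo hi"
      unfolding periodic_cube_def mem_Collect_eq c mem_box_cart lo_def hi_def by (auto simp: abs_le_iff algebra_simps)
    then show ?thesis by (simp add: indicator_def)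
  qed
  have "(LINT x|torus. indicator (periodic_cube r) x) = (LINT x|torus. indicator (periodic_cube r) (a + x) :: real)"
    by (rule integral_torus_shift[symmetric, OF _ p]) measurable
  also have "\<dots> = (LINT x|torus. indicator (cbox lo hi) x)"
    by (rule Bochner_Integration.integral_cong[OF refl eq])
  also have "\<dots> = measure torus (cbox lo hi)"
    using sub by (simp add: space_torus Int_absorb2)
  also have "\<dots> = measure lborel (cbox lo hi)" using sub by (simp add: measure_torus_eq)
  also have "\<dots> = (2 * r) ^ 3"
  proof -
    have "cbox lo hi \<noteq> {}" using r by (auto simp: interval_ne_empty_cart lo_def hi_def)
    then show ?thesis by (simp add: content_cbox_cart lo_def hi_def)
  qed
  finally show ?thesis .
qed

lemma abs_sin_pi_ge: assumes "\<bar>c\<bar> \<le> 1/2" shows "\<bar>c\<bar> \<le> \<bar>sin (pi * c)\<bar>"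
proof -
  have *: "c \<le> sin (pi * c)" if "0 \<le> c" "c \<le> 1/2" for c
  proof (cases "c \<le> 1/6")
    case True
    have "sin 0 - 0 / 2 \<le> sin (pi * c) - (pi * c) / 2"
    proof (rule DERIV_nonneg_imp_nondecreasing[where f="\<lambda>y. sin y - y / 2"])
      fix y assume y: "0 \<le> y" "y \<le> pi * c"
      have "pi * c \<le> pi * (1 / 3)" using True by (intro mult_left_mono) auto
      then have "y \<le> pi / 3" using y by linarith
      then have "cos (pi / 3) \<le> cos y" using y by (intro cos_monotone_0_pi_le) auto
      then have "0 \<le> cos y - 1 / 2" by (simp add: cos_60)
      moreover have "((\<lambda>y. sin y - y / 2) has_real_derivative cos y - 1 / 2) (at y)"
        by (auto intro!: derivative_eq_intros)
      ultimately show "\<exists>d. ((\<lambda>y. sin y - y / 2) has_real_derivative d) (at y) \<and> 0 \<le> d" by blast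
    qed (use that in simp)
    moreover have "c \<le> pi * c / 2" using mult_right_mono[OF less_imp_le[OF pi_gt3] \<open>0 \<le> c\<close>] that by simp
    ultimately show ?thesis by simp
  next
    case False
    have "sin (pi / 6) \<le> sin (pi * c)" 
      using False that by (intro sin_monotone_2pi_le) auto
    then show ?thesis using that by (simp add: sin_30)
  qed
  show ?thesis
    using *[of "\<bar>c\<bar>"] assms by (cases "0 \<le> c") (auto simp: abs_if)
qed

text \<open>A smooth periodic substitute for the squared distance to the lattice, comparable to it from both sides.\<close>

definition torus_dist2 :: "real ^ 3 \<Rightarrow> real" where "torus_dist2 x = (\<Sum>i\<in>UNIV. (sin (pi * x $ i))\<^sup>2)"

lemma smooth_torus_dist2: "smooth torus_dist2"
  unfolding torus_dist2_def[abs_def] power2_eq_square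
  by (intro smooth_sum smooth_mult smooth_comp_real[OF smooth_sin] smooth_linear bounded_linear_vec_nth)

lemma torus_dist2_periodic: "periodic torus_dist2"
  unfolding periodic_iff
proof safe
  fix x k assume k: "k \<in> lattice"
  have "(sin (pi * (a + b)))\<^sup>2 = (sin (pi * a))\<^sup>2" if "b \<in> \<int>" for a b :: real
  proof -
    have "sin (pi * b) = 0" using that by (auto elim!: Ints_cases)
    moreover from this have "(cos (pi * b))\<^sup>2 = 1" using sin_cos_squared_add[of "pi * b"] by simp
    ultimately show ?thesis by (simp add: distrib_left sin_add power_mult_distrib)
  qed
  then show "torus_dist2 (x + k) = torus_dist2 x"
    using k by (simp add: torus_dist2_def lattice_def)
qed

lemma norm_cent_torus_dist2: "(norm (cent x))\<^sup>2 \<le> torus_dist2 x"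
proof -
  have "(norm (cent x))\<^sup>2 = (\<Sum>i\<in>UNIV. (cent x $ i)\<^sup>2)" by (simp add: norm_vec_def L2_set_def sum_nonneg)
  also have "\<dots> \<le> (\<Sum>i\<in>UNIV. (sin (pi * cent x $ i))\<^sup>2)"
    using abs_sin_pi_ge[OF abs_cent_le] by (intro sum_mono) (simp add: abs_le_square_iff[symmetric])
  also have "\<dots> = torus_dist2 (cent x)" by (simp add: torus_dist2_def)
  finally show ?thesis by (simp add: periodic_cent[OF torus_dist2_periodic])
qed

lemma torus_dist2_le_periodic_cube:
  assumes "x \<in> periodic_cube r" shows "torus_dist2 x \<le> 32 * r\<^sup>2"
proof -
  have "torus_dist2 x = torus_dist2 (cent x)" by (simp add: periodic_cent[OF torus_dist2_periodic])
  also have "\<dots> \<le> (\<Sum>i\<in>(UNIV :: 3 set). (3.2 * r)\<^sup>2)" unfolding torus_dist2_def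
  proof (rule sum_mono)
    fix i :: 3
    have "\<bar>sin (pi * cent x $ i)\<bar> \<le> \<bar>pi * cent x $ i\<bar>" by (rule abs_sin_x_le_abs_x)
    also have "\<dots> = pi * \<bar>cent x $ i\<bar>" by (simp add: abs_mult)
    also have "\<dots> \<le> 3.2 * r"
      using assms pi_approx by (intro mult_mono) (auto simp: periodic_cube_def)
    finally have "\<bar>sin (pi * cent x $ i)\<bar> \<le> \<bar>3.2 * r\<bar>" by linarith
    then show "(sin (pi * cent x $ i))\<^sup>2 \<le> (3.2 * r)\<^sup>2" by (simp only: abs_le_square_iff)
  qed
  also have "\<dots> \<le> 32 * r\<^sup>2"
    using zero_le_square[of r] by (simp add: power2_eq_square)
  finally show ?thesis .
qed

text \<open>The kernel has the scale \<open>\<delta>\<close>. The last clause bounds the mass of its gradient by \<open>\<kappa> / \<delta>\<close>; what matters is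
  that one \<open>\<kappa>\<close> serves all scales.\<close>

definition mollifier :: "real \<Rightarrow> real \<Rightarrow> (real ^ 3 \<Rightarrow> real) \<Rightarrow> bool" where
  "mollifier \<kappa> \<delta> \<phi> \<longleftrightarrow> smooth \<phi> \<and> periodic \<phi> \<and> (\<forall>x. \<phi> (- x) = \<phi> x) \<and> (\<forall>x. 0 \<le> \<phi> x) \<and>
     (LINT x|torus. \<phi> x) = 1 \<and> (\<forall>x. \<phi> x \<noteq> 0 \<longrightarrow> norm (cent x) \<le> \<delta>) \<and>
     (\<forall>i. \<delta> * (LINT x|torus. \<bar>partial i \<phi> x\<bar>) \<le> \<kappa>)"

lemma partial_eq_0_if_min:
  assumes "smooth (\<phi> :: real ^ 3 \<Rightarrow> real)" "\<And>x. 0 \<le> \<phi> x" "\<phi> x = 0"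
  shows "partial i \<phi> x = 0"
  using has_derivative_local_min[OF smooth_has_derivative[OF assms(1)]] assms(2,3)
  by (auto simp: partial_def fun_eq_iff)

text \<open>The kernel is a normalised \<open>bump (1 - torus_dist2 / \<delta>\<^sup>2)\<close>. Its gradient has size \<open>1 / \<delta>\<close> on a cube of
  volume of order \<open>\<delta>\<^sup>3\<close>, and its mass is at least of order \<open>\<delta>\<^sup>3\<close>, so that the scale cancels up to one factor.\<close>

lemma mollifier_exists:
  obtains \<kappa> where "\<And>\<delta>. 0 < \<delta> \<Longrightarrow> \<delta> < 1/2 \<Longrightarrow> \<exists>\<phi>. mollifier \<kappa> \<delta> \<phi>"
proof -
  have "continuous_on {0..1} (deriv bump)"
    using smooth_continuous[OF smooth_deriv[OF smooth_bump]] by (rule continuous_on_subset) auto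
  then have "compact (deriv bump ` {0..1})" by (intro compact_continuous_image) auto
  then obtain M where M: "\<And>y. y \<in> {0..1} \<Longrightarrow> \<bar>deriv bump y\<bar> \<le> M"
    using compact_imp_bounded bounded_iff by (metis image_eqI real_norm_def)
  have M0: "0 \<le> M" using M[of 0] by simp
  (* A gradient of size 2 * pi * M / \<delta> on a set of measure (2 * \<delta>) ^ 3, over a mass of at
     least bump (1/2) * (\<delta>/4) ^ 3. *)
  define \<kappa> where "\<kappa> = 1024 * pi * M / bump (1/2)"
  have b2: "bump (1/2) > 0" by (simp add: bump_pos)
  have "\<exists>\<phi>. mollifier \<kappa> \<delta> \<phi>" if \<delta>: "0 < \<delta>" "\<delta> < 1/2" for \<delta>
  proof -
    define \<psi> where "\<psi> x = bump (1 - (1 / \<delta>\<^sup>2) * torus_dist2 x)" for x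
    have s: "smooth \<psi>"
      unfolding \<psi>_def[abs_def]
      by (rule smooth_comp_real[OF smooth_bump smooth_diff[OF smooth_const smooth_cmult[OF smooth_torus_dist2]]])
    have [measurable]: "\<psi> \<in> borel_measurable borel" by (rule smooth_borel[OF s])
    have per: "periodic \<psi>" unfolding \<psi>_def by (rule periodic_comp[OF torus_dist2_periodic])
    have even: "\<psi> (- x) = \<psi> x" for x by (simp add: \<psi>_def torus_dist2_def)
    have nn: "0 \<le> \<psi> x" "\<psi> x \<le> 1" for x by (auto simp: \<psi>_def bump_nonneg bump_le_1)
    have supp: "torus_dist2 x < \<delta>\<^sup>2" if "\<psi> x \<noteq> 0" for x
    proof (rule ccontr)
      assume "\<not> torus_dist2 x < \<delta>\<^sup>2"
      then have "1 - (1 / \<delta>\<^sup>2) * torus_dist2 x \<le> 0" using \<delta> by (simp add: field_simps)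
      from bump_eq_0[OF this] that show False by (simp add: \<psi>_def)
    qed
    have supp': "norm (cent x) \<le> \<delta>" if "\<psi> x \<noteq> 0" for x
      using order_trans[OF norm_cent_torus_dist2 less_imp_le[OF supp[OF that]]] \<delta>
      by (intro power2_le_imp_le[of "norm (cent x)" \<delta>]) auto
    have grad: "\<bar>partial i \<psi> x\<bar> \<le> (2 * pi * M / \<delta>) * indicator (periodic_cube \<delta>) x" for i x
    proof (cases "\<psi> x = 0")
      case True
      then show ?thesis using partial_eq_0_if_min[OF s nn(1)] M0 \<delta> by simp
    next
      case False
      let ?y = "1 - (1 / \<delta>\<^sup>2) * torus_dist2 x"
      have d2: "torus_dist2 x < \<delta>\<^sup>2" by (rule supp[OF False])
      have "x \<in> periodic_cube \<delta>" unfolding periodic_cube_def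
        using supp'[OF False] by (auto intro: order_trans[OF component_le_norm_cart])
      have y: "?y \<in> {0..1}" using d2 \<delta> by (auto simp: torus_dist2_def field_simps sum_nonneg)
      have si: "\<bar>sin (pi * x $ i)\<bar> \<le> \<delta>"
      proof (rule power2_le_imp_le)
        have "(sin (pi * x $ i))\<^sup>2 \<le> torus_dist2 x" unfolding torus_dist2_def
          by (rule member_le_sum) auto
        then show "\<bar>sin (pi * x $ i)\<bar>\<^sup>2 \<le> \<delta>\<^sup>2" using d2 by simp
      qed (use \<delta> in simp)
      have "((\<lambda>x. \<Sum>j\<in>UNIV. (sin (pi * x $ j))\<^sup>2) has_derivative
          (\<lambda>h. \<Sum>j\<in>UNIV. 2 * sin (pi * x $ j) * cos (pi * x $ j) * pi * h $ j)) (at x)"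
        by (rule has_derivative_sum)
          (auto intro!: derivative_eq_intros bounded_linear_imp_has_derivative[OF bounded_linear_vec_nth] simp: mult_ac)
      then have dS: "(torus_dist2 has_derivative
          (\<lambda>h. \<Sum>j\<in>UNIV. 2 * sin (pi * x $ j) * cos (pi * x $ j) * pi * h $ j)) (at x)"
        unfolding torus_dist2_def[abs_def] .
      have dT: "((\<lambda>x. 1 - (1 / \<delta>\<^sup>2) * torus_dist2 x) has_derivative
          (\<lambda>h. 0 - (1 / \<delta>\<^sup>2) * (\<Sum>j\<in>UNIV. 2 * sin (pi * x $ j) * cos (pi * x $ j) * pi * h $ j))) (at x)"
        by (intro has_derivative_diff has_derivative_const has_derivative_mult_right dS)
      have "(\<psi> has_derivative (\<lambda>h. deriv bump ?y * (0 - (1 / \<delta>\<^sup>2) *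
          (\<Sum>j\<in>UNIV. 2 * sin (pi * x $ j) * cos (pi * x $ j) * pi * h $ j)))) (at x)"
        unfolding \<psi>_def[abs_def]
        by (rule has_derivative_compose[OF dT smooth_real_has_derivative[OF smooth_bump, unfolded has_field_derivative_def]])
      from partial_eqI[OF this, of i]
      have "partial i \<psi> x = - (deriv bump ?y * ((1 / \<delta>\<^sup>2) * (2 * sin (pi * x $ i) * cos (pi * x $ i) * pi)))"
        by (simp add: axis_def if_distrib cong: if_cong)
      also have "\<bar>\<dots>\<bar> = \<bar>deriv bump ?y\<bar> * ((1 / \<delta>\<^sup>2) * (2 * \<bar>sin (pi * x $ i)\<bar> * \<bar>cos (pi * x $ i)\<bar> * pi))"
        by (simp add: abs_mult)
      also have "\<dots> \<le> M * ((1 / \<delta>\<^sup>2) * (2 * \<delta> * 1 * pi))"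
        using M[OF y] si M0 \<delta> by (intro mult_mono) auto
      also have "\<dots> = 2 * pi * M / \<delta>" using \<delta> by (simp add: power2_eq_square field_simps)
      finally show ?thesis using \<open>x \<in> periodic_cube \<delta>\<close> by simp
    qed
    define m where "m = (LINT x|torus. \<psi> x)"
    have i\<psi>: "integrable torus \<psi>" using nn by (intro integrable_torus_bounded[where B=1]) auto
    have ic: "integrable torus (indicator (periodic_cube r) :: _ \<Rightarrow> real)" for r
      by (intro integrable_torus_bounded[where B=1]) (auto simp: indicator_def)
    (* torus_dist2 is at most 32 * (\<delta>/8)^2 = \<delta>^2 / 2 on the cubes of side \<delta>/4 around the
       lattice points. *)
    have m: "bump (1/2) * (\<delta>/4) ^ 3 \<le> m"
    proof -
      have "bump (1/2) * indicator (periodic_cube (\<delta>/8)) x \<le> \<psi> x" for x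
      proof (cases "x \<in> periodic_cube (\<delta>/8)")
        case True
        define t where "t = (1 / \<delta>\<^sup>2) * torus_dist2 x"
        have t: "t \<le> 1/2" unfolding t_def
          using torus_dist2_le_periodic_cube[OF True] \<delta> by (simp add: field_simps power2_eq_square)
        then have "1 / (1 - t) \<le> 1 / (1/2)" by (intro divide_left_mono) auto
        then have "bump (1/2) \<le> bump (1 - t)" using t by (simp add: bump_def)
        then have "bump (1/2) \<le> \<psi> x" by (simp add: t_def \<psi>_def)
        then show ?thesis using True by simp
      qed (simp add: nn)
      then have "(LINT x|torus. bump (1/2) * indicator (periodic_cube (\<delta>/8)) x) \<le> m"
        unfolding m_def using ic i\<psi> by (intro integral_mono) auto
      then show ?thesis using measure_periodic_cube[of "\<delta>/8"] \<delta> by simp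
    qed
    have m0: "m > 0" using m b2 \<delta> by (smt (verit) mult_pos_pos zero_less_power divide_pos_pos)
    define \<phi> where "\<phi> x = (1/m) * \<psi> x" for x
    have "mollifier \<kappa> \<delta> \<phi>" unfolding mollifier_def
    proof (intro conjI allI impI)
      show "smooth \<phi>" unfolding \<phi>_def[abs_def] by (rule smooth_cmult[OF s])
      show "periodic \<phi>" unfolding \<phi>_def by (rule periodic_comp[OF per])
      show "\<phi> (- x) = \<phi> x" "0 \<le> \<phi> x" for x using nn m0 even by (auto simp: \<phi>_def)
      show "(LINT x|torus. \<phi> x) = 1" using m0 by (simp add: \<phi>_def m_def)
      show "norm (cent x) \<le> \<delta>" if "\<phi> x \<noteq> 0" for x using supp'[of x] that by (simp add: \<phi>_def)
      fix i
      have p\<phi>: "partial i \<phi> x = (1/m) * partial i \<psi> x" for x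
        unfolding \<phi>_def[abs_def] by (rule partial_cmult[OF s])
      have "(LINT x|torus. \<bar>partial i \<psi> x\<bar>) \<le> (LINT x|torus. (2 * pi * M / \<delta>) * indicator (periodic_cube \<delta>) x)"
      proof (rule integral_mono)
        have "continuous_on UNIV (partial i \<psi>)" by (rule smooth_continuous[OF smooth_partial[OF s]])
        then obtain B where "\<And>x. \<bar>partial i \<psi> x\<bar> \<le> B"
          using periodic_continuous_bounded partial_periodic[OF s per] by blast
        then show "integrable torus (\<lambda>x. \<bar>partial i \<psi> x\<bar>)"
          by (intro integrable_abs integrable_torus_bounded smooth_borel[OF smooth_partial[OF s]])
      qed (use ic grad in auto)
      also have "\<dots> = (2 * pi * M / \<delta>) * (2 * \<delta>) ^ 3" using measure_periodic_cube[of \<delta>] \<delta> by simp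
      finally have "(LINT x|torus. \<bar>partial i \<psi> x\<bar>) \<le> (2 * pi * M / \<delta>) * (2 * \<delta>) ^ 3" .
      then have "\<delta> * ((1/m) * (LINT x|torus. \<bar>partial i \<psi> x\<bar>)) \<le> \<delta> * ((1/m) * ((2 * pi * M / \<delta>) * (2 * \<delta>) ^ 3))"
        using \<delta> m0 by (intro mult_left_mono) auto
      also have "\<dots> = (16 * pi * M * \<delta> ^ 3) * (1 / m)" using \<delta> by (simp add: field_simps power3_eq_cube)
      also have "\<dots> \<le> (16 * pi * M * \<delta> ^ 3) * (1 / (bump (1/2) * (\<delta>/4) ^ 3))"
        using m m0 M0 \<delta> b2 by (intro mult_left_mono divide_left_mono mult_pos_pos) auto
      also have "\<dots> = \<kappa>" using \<delta> b2 by (simp add: \<kappa>_def field_simps power3_eq_cube)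
      finally show "\<delta> * (LINT x|torus. \<bar>partial i \<phi> x\<bar>) \<le> \<kappa>"
        using m0 by (simp add: p\<phi> abs_mult)
    qed
    then show ?thesis by blast
  qed
  then show ?thesis by (rule that)
qed

section \<open>Mollified functions\<close>

lemma mollifierD:
  assumes "mollifier \<kappa> \<delta> \<phi>"
  shows "smooth \<phi>" "periodic \<phi>" "\<phi> (- x) = \<phi> x" "0 \<le> \<phi> x" "(LINT x|torus. \<phi> x) = 1"
    "\<phi> x \<noteq> 0 \<Longrightarrow> norm (cent x) \<le> \<delta>" "\<delta> * (LINT x|torus. \<bar>partial i \<phi> x\<bar>) \<le> \<kappa>"
    "\<phi> \<in> borel_measurable borel" "continuous_on UNIV \<phi>"
  using assms smooth_borel smooth_continuous by (auto simp: mollifier_def)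

lemma mollifier_bounded:
  assumes "mollifier \<kappa> \<delta> \<phi>" obtains B where "\<And>x. \<bar>\<phi> x\<bar> \<le> B"
  using periodic_continuous_bounded mollifierD(2,9)[OF assms] by blast

lemma mollify_bounded:
  assumes "integrable torus f" "mollifier \<kappa> \<delta> \<phi>" obtains C where "\<And>y. \<bar>conv f \<phi> y\<bar> \<le> C"
proof -
  obtain B where B: "\<And>x. \<bar>\<phi> x\<bar> \<le> B" using mollifier_bounded[OF assms(2)] by blast
  show ?thesis by (rule that, rule conv_bound[OF assms(1) mollifierD(8)[OF assms(2)] B])
qed

lemma smooth_periodic_bounded:
  assumes "smooth (\<phi> :: real ^ 3 \<Rightarrow> real)" "periodic \<phi>" obtains B where "\<And>x. \<bar>\<phi> x\<bar> \<le> B"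
  using periodic_continuous_bounded smooth_continuous assms by blast

lemma conv_eq_shift:
  assumes [measurable]: "f \<in> borel_measurable borel" and f: "periodic f" and \<phi>: "mollifier \<kappa> \<delta> \<phi>"
  shows "conv f \<phi> y = (LINT \<xi>|torus. \<phi> \<xi> * f (y + \<xi>))"
proof -
  have [measurable]: "\<phi> \<in> borel_measurable borel" by (rule mollifierD[OF \<phi>])
  have "conv f \<phi> y = (LINT \<xi>|torus. f (y + \<xi>) * \<phi> (y - (y + \<xi>)))"
    unfolding conv_def
  proof (rule integral_torus_shift[symmetric])
    show "periodic (\<lambda>x. f x * \<phi> (y - x))"
      using f periodic_reflect[OF mollifierD(2)[OF \<phi>]] by (rule periodic_comp2)
  qed measurable
  then show ?thesis using mollifierD(3)[OF \<phi>] by (simp add: mult.commute)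
qed

lemma integrable_mollified_pair:
  assumes [measurable]: "f \<in> borel_measurable borel" and f: "periodic f" "integrable torus f"
    and \<phi>: "mollifier \<kappa> \<delta> \<phi>"
  shows "integrable (torus \<Otimes>\<^sub>M torus) (\<lambda>(y, \<xi>). \<phi> \<xi> * f (y + \<xi>))"
    and "integrable (torus \<Otimes>\<^sub>M torus) (\<lambda>(y, \<xi>). \<phi> \<xi> * f y)"
proof -
  have [measurable]: "\<phi> \<in> borel_measurable borel" by (rule mollifierD[OF \<phi>])
  obtain B where B: "\<And>x. \<bar>\<phi> x\<bar> \<le> B" using mollifier_bounded[OF \<phi>] by blast
  have c: "integrable torus (\<lambda>x::real ^ 3. 1 :: real)" "periodic (\<lambda>x. 1 :: real)" by (auto simp: periodic_def)
  show "integrable (torus \<Otimes>\<^sub>M torus) (\<lambda>(y, \<xi>). \<phi> \<xi> * f (y + \<xi>))"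
  proof -
    have "integrable (torus \<Otimes>\<^sub>M torus) (\<lambda>(y, \<xi>). \<phi> \<xi> * (1 * f (y + \<xi>)))"
      by (rule integrable_correlation[OF _ _ _ c(1) f(2) f(1) B]) measurable
    then show ?thesis by simp
  qed
  show "integrable (torus \<Otimes>\<^sub>M torus) (\<lambda>(y, \<xi>). \<phi> \<xi> * f y)"
  proof -
    have "integrable (torus \<Otimes>\<^sub>M torus) (\<lambda>(y, \<xi>). \<phi> \<xi> * (f y * 1))"
      by (rule integrable_correlation[OF _ _ _ f(2) c B]) measurable
    then show ?thesis by simp
  qed
qed

lemma integral_conv_mollifier:
  assumes [measurable]: "f \<in> borel_measurable borel" and f: "periodic f" "integrable torus f"
    and \<phi>: "mollifier \<kappa> \<delta> \<phi>"
  shows "(LINT y|torus. conv f \<phi> y) = (LINT y|torus. f y)"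
proof -
  have "(LINT y|torus. conv f \<phi> y) = (LINT y|torus. (LINT \<xi>|torus. \<phi> \<xi> * f (y + \<xi>)))"
    using conv_eq_shift[OF _ f(1) \<phi>] by simp
  also have "\<dots> = (LINT \<xi>|torus. (LINT y|torus. \<phi> \<xi> * f (y + \<xi>)))"
    by (rule torus2.Fubini_integral[symmetric]) (rule integrable_mollified_pair(1)[OF _ f \<phi>], simp)
  also have "\<dots> = (LINT \<xi>|torus. \<phi> \<xi> * (LINT y|torus. f y))"
  proof (intro Bochner_Integration.integral_cong refl)
    fix \<xi>
    have "(LINT y|torus. f (\<xi> + y)) = (LINT y|torus. f y)"
      by (rule integral_torus_shift[OF _ f(1)]) simp
    then show "(LINT y|torus. \<phi> \<xi> * f (y + \<xi>)) = \<phi> \<xi> * (LINT y|torus. f y)"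
      by (simp add: add.commute[of _ \<xi>])
  qed
  finally show ?thesis using mollifierD(5)[OF \<phi>] by simp
qed

lemma mollifier_modulus:
  assumes \<phi>: "mollifier \<kappa> \<delta> \<phi>" and f: "periodic f" and G: "\<And>y. norm y \<le> \<delta> \<Longrightarrow> (LINT x|torus. H (f (y + x)) (f x)) \<le> (e::real)"
  shows "\<phi> \<xi> * (LINT x|torus. H (f (x + \<xi>)) (f x)) \<le> \<phi> \<xi> * e"
proof (cases "\<phi> \<xi> = 0")
  case False
  have "f (x + \<xi>) = f (cent \<xi> + x)" for x
    using periodicD[OF f cent_lattice[of \<xi>], of "cent \<xi> + x"] by (simp add: algebra_simps)
  then have "(LINT x|torus. H (f (x + \<xi>)) (f x)) \<le> e"
    using G[of "cent \<xi>"] mollifierD(6)[OF \<phi> False] by simp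
  then show ?thesis using mollifierD(4)[OF \<phi>] by (rule mult_left_mono)
qed simp

lemma L1_mollify:
  assumes [measurable]: "f \<in> borel_measurable borel" and f: "periodic f" "integrable torus f"
    and \<phi>: "mollifier \<kappa> \<delta> \<phi>" and e: "\<And>y. norm y \<le> \<delta> \<Longrightarrow> (LINT x|torus. \<bar>f (y + x) - f x\<bar>) \<le> e"
  shows "(LINT y|torus. \<bar>conv f \<phi> y - f y\<bar>) \<le> e"
proof -
  have [measurable]: "\<phi> \<in> borel_measurable borel" by (rule mollifierD[OF \<phi>])
  obtain B where B: "\<And>x. \<bar>\<phi> x\<bar> \<le> B" using mollifier_bounded[OF \<phi>] by blast
  have i\<phi>: "integrable torus \<phi>" by (rule integrable_torus_bounded[OF _ B]) simp
  have P: "integrable (torus \<Otimes>\<^sub>M torus) (\<lambda>(y, \<xi>). \<phi> \<xi> * \<bar>f (y + \<xi>) - f y\<bar>)"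
    using integrable_abs[OF Bochner_Integration.integrable_diff[OF integrable_mollified_pair[OF _ f \<phi>]]]
    by (rule Bochner_Integration.integrable_cong[THEN iffD1, rotated -1])
      (auto simp: mollifierD(4)[OF \<phi>] abs_mult right_diff_distrib[symmetric])
  have fs: "integrable torus (\<lambda>\<xi>. \<phi> \<xi> * f (y + \<xi>))" for y
    using integrable_mult_bounded_torus[of "\<lambda>\<xi>. f (y + \<xi>)" \<phi> B] integrable_torus_shift[OF _ f(1)] f(2) B
    by (simp add: mult.commute)
  have "(LINT y|torus. \<bar>conv f \<phi> y - f y\<bar>) \<le> (LINT y|torus. (LINT \<xi>|torus. \<phi> \<xi> * \<bar>f (y + \<xi>) - f y\<bar>))"
  proof (rule integral_mono)
    have "integrable torus (conv f \<phi>)"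
      by (rule integrable_torus_bounded[OF _ conv_bound[OF f(2) _ B]]) measurable
    then show "integrable torus (\<lambda>y. \<bar>conv f \<phi> y - f y\<bar>)" using f by auto
    show "integrable torus (\<lambda>y. LINT \<xi>|torus. \<phi> \<xi> * \<bar>f (y + \<xi>) - f y\<bar>)"
      by (rule torus2.integrable_fst[OF P])
    fix y
    have "conv f \<phi> y - f y = (LINT \<xi>|torus. \<phi> \<xi> * f (y + \<xi>)) - (LINT \<xi>|torus. \<phi> \<xi> * f y)"
      using conv_eq_shift[OF _ f(1) \<phi>] mollifierD(5)[OF \<phi>] by simp
    also have "\<dots> = (LINT \<xi>|torus. \<phi> \<xi> * f (y + \<xi>) - \<phi> \<xi> * f y)"
      using fs i\<phi> by (intro Bochner_Integration.integral_diff[symmetric]) auto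
    also have "\<bar>\<dots>\<bar> \<le> (LINT \<xi>|torus. \<bar>\<phi> \<xi> * f (y + \<xi>) - \<phi> \<xi> * f y\<bar>)" by (rule integral_abs_bound)
    finally show "\<bar>conv f \<phi> y - f y\<bar> \<le> (LINT \<xi>|torus. \<phi> \<xi> * \<bar>f (y + \<xi>) - f y\<bar>)"
      by (simp add: mollifierD(4)[OF \<phi>] abs_mult right_diff_distrib[symmetric])
  qed
  also have "\<dots> = (LINT \<xi>|torus. (LINT y|torus. \<phi> \<xi> * \<bar>f (y + \<xi>) - f y\<bar>))"
    by (rule torus2.Fubini_integral[OF P, symmetric])
  also have "\<dots> \<le> (LINT \<xi>|torus. \<phi> \<xi> * e)"
    using mollifier_modulus[OF \<phi> f(1), where H="\<lambda>a b. \<bar>a - b\<bar>", OF e] i\<phi> torus2.integrable_snd[OF P]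
    by (intro integral_mono) auto
  finally show ?thesis using mollifierD(5)[OF \<phi>] by simp
qed

text \<open>Jensen's inequality, where \<open>G\<close> provides a supporting line of \<open>\<Psi>\<close> at the mean.\<close>

lemma convex_conv:
  assumes [measurable]: "f \<in> borel_measurable borel" and f: "periodic f" "integrable torus f"
    and \<phi>: "mollifier \<kappa> \<delta> \<phi>"
    and sub: "\<And>a b. \<Psi> a + G a * (b - a) \<le> (\<Psi> b :: real)" and i\<Psi>: "integrable torus (\<lambda>x. \<Psi> (f x))"
  shows "\<Psi> (conv f \<phi> y) \<le> conv (\<lambda>x. \<Psi> (f x)) \<phi> y"
proof -
  have [measurable]: "\<phi> \<in> borel_measurable borel" by (rule mollifierD[OF \<phi>])
  obtain B where B: "\<And>x. \<bar>\<phi> x\<bar> \<le> B" using mollifier_bounded[OF \<phi>] by blast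
  have one: "(LINT x|torus. \<phi> (y - x)) = 1"
    using integral_torus_reflect[OF _ mollifierD(2)[OF \<phi>]] mollifierD(5)[OF \<phi>] by simp
  have I: "integrable torus (\<lambda>x. \<phi> (y - x))" "integrable torus (\<lambda>x. f x * \<phi> (y - x))"
      "integrable torus (\<lambda>x. \<Psi> (f x) * \<phi> (y - x))"
    using integrable_conv[where f="\<lambda>x. 1" and \<Phi>=\<phi> and B=B and y=y]
      integrable_conv[where f=f and \<Phi>=\<phi> and B=B and y=y]
      integrable_conv[where f="\<lambda>x. \<Psi> (f x)" and \<Phi>=\<phi> and B=B and y=y] f(2) i\<Psi> B by auto
  let ?V = "conv f \<phi> y"
  have "(LINT x|torus. \<Psi> ?V * \<phi> (y - x) + G ?V * (f x * \<phi> (y - x) - ?V * \<phi> (y - x))) \<le> conv (\<lambda>x. \<Psi> (f x)) \<phi> y"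
    unfolding conv_def[of "\<lambda>x. \<Psi> (f x)"]
  proof (rule integral_mono)
    fix x
    show "\<Psi> ?V * \<phi> (y - x) + G ?V * (f x * \<phi> (y - x) - ?V * \<phi> (y - x)) \<le> \<Psi> (f x) * \<phi> (y - x)"
      using mult_right_mono[OF sub[of ?V "f x"] mollifierD(4)[OF \<phi>, of "y - x"]] by (simp add: algebra_simps)
  qed (use I in auto)
  moreover have "(LINT x|torus. \<Psi> ?V * \<phi> (y - x) + G ?V * (f x * \<phi> (y - x) - ?V * \<phi> (y - x))) = \<Psi> ?V"
    using I one by (simp add: conv_def)
  ultimately show ?thesis by simp
qed

text \<open>Under the probability density \<open>\<phi>\<close> the mean square of \<open>f (y + \<xi>) - f y\<close> is at least the square of its mean
  \<open>conv f \<phi> y - f y\<close>; integrate over \<open>y\<close> first.\<close>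

lemma L2_mollify:
  assumes [measurable]: "f \<in> borel_measurable borel" and f: "periodic f" "integrable torus (\<lambda>x. (f x)\<^sup>2)"
    and \<phi>: "mollifier \<kappa> \<delta> \<phi>" and e: "\<And>y. norm y \<le> \<delta> \<Longrightarrow> (LINT x|torus. (f (y + x) - f x)\<^sup>2) \<le> e"
  shows "(LINT y|torus. (conv f \<phi> y - f y)\<^sup>2) \<le> e"
proof -
  have [measurable]: "\<phi> \<in> borel_measurable borel" by (rule mollifierD[OF \<phi>])
  obtain B where B: "\<And>x. \<bar>\<phi> x\<bar> \<le> B" using mollifier_bounded[OF \<phi>] by blast
  have i\<phi>: "integrable torus \<phi>" by (rule integrable_torus_bounded[OF _ B]) simp
  have f1: "integrable torus f"
    by (rule torus.square_integrable_imp_integrable[OF _ f(2)]) (auto intro: measurable_torus)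
  have P: "integrable (torus \<Otimes>\<^sub>M torus) (\<lambda>(y, \<xi>). \<phi> \<xi> * (f (y + \<xi>) - f y)\<^sup>2)"
  proof -
    have f2: "periodic (\<lambda>x. (f x)\<^sup>2)" by (rule periodic_comp[OF f(1)])
    have "integrable (torus \<Otimes>\<^sub>M torus) (\<lambda>z. (case z of (y, \<xi>) \<Rightarrow> \<phi> \<xi> * (f (y + \<xi>))\<^sup>2) + (case z of (y, \<xi>) \<Rightarrow> \<phi> \<xi> * (f y)\<^sup>2)
        - 2 * (case z of (y, \<xi>) \<Rightarrow> \<phi> \<xi> * (f y * f (y + \<xi>))))"
      by (intro Bochner_Integration.integrable_diff Bochner_Integration.integrable_add integrable_mult_right
        integrable_mollified_pair[OF _ f2 f(2) \<phi>] integrable_correlation[OF _ _ _ f1 f1 f(1) B]) measurable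
    then show ?thesis
      by (rule Bochner_Integration.integrable_cong[THEN iffD1, rotated -1])
        (auto simp: power2_eq_square algebra_simps)
  qed
  have fs: "integrable torus (\<lambda>\<xi>. \<phi> \<xi> * f (y + \<xi>))" for y
    using integrable_mult_bounded_torus[of "\<lambda>\<xi>. f (y + \<xi>)" \<phi> B] integrable_torus_shift[OF _ f(1)] f1 B
    by (simp add: mult.commute)
  have fs2: "integrable torus (\<lambda>\<xi>. \<phi> \<xi> * (f (y + \<xi>))\<^sup>2)" for y
    using integrable_mult_bounded_torus[of "\<lambda>\<xi>. (f (y + \<xi>))\<^sup>2" \<phi> B]
      integrable_torus_shift[of "\<lambda>x. (f x)\<^sup>2", OF _ periodic_comp[OF f(1)]] f(2) B
    by (simp add: mult.commute)
  have "(LINT y|torus. (conv f \<phi> y - f y)\<^sup>2) \<le> (LINT y|torus. (LINT \<xi>|torus. \<phi> \<xi> * (f (y + \<xi>) - f y)\<^sup>2))"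
  proof (rule integral_mono)
    obtain C where C: "\<And>y. \<bar>conv f \<phi> y\<bar> \<le> C" using mollify_bounded[OF f1 \<phi>] by blast
    have ic: "integrable torus (\<lambda>y. (conv f \<phi> y)\<^sup>2)"
      by (rule integrable_torus_bounded[where B="C\<^sup>2"]) (simp, use power_mono[OF C abs_ge_zero, of _ 2] in simp)
    have ic2: "integrable torus (\<lambda>y. f y * conv f \<phi> y)"
      by (rule integrable_mult_bounded_torus[OF f1 _ C]) measurable
    have "integrable torus (\<lambda>y. (conv f \<phi> y)\<^sup>2 + (f y)\<^sup>2 - 2 * (f y * conv f \<phi> y))"
      using ic ic2 f(2) by auto
    then show "integrable torus (\<lambda>y. (conv f \<phi> y - f y)\<^sup>2)"
      by (rule Bochner_Integration.integrable_cong[THEN iffD1, rotated -1])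
        (auto simp: power2_eq_square algebra_simps)
    show "integrable torus (\<lambda>y. LINT \<xi>|torus. \<phi> \<xi> * (f (y + \<xi>) - f y)\<^sup>2)"
      by (rule torus2.integrable_fst[OF P])
    fix y
    let ?m = "conv f \<phi> y"
    have m: "(LINT \<xi>|torus. \<phi> \<xi> * f (y + \<xi>)) = ?m" using conv_eq_shift[OF _ f(1) \<phi>] by simp
    have "0 \<le> (LINT \<xi>|torus. \<phi> \<xi> * (f (y + \<xi>) - ?m)\<^sup>2)"
      using mollifierD(4)[OF \<phi>] by (intro integral_nonneg_AE) auto
    also have "\<dots> = (LINT \<xi>|torus. \<phi> \<xi> * (f (y + \<xi>))\<^sup>2 - 2 * ?m * (\<phi> \<xi> * f (y + \<xi>)) + ?m\<^sup>2 * \<phi> \<xi>)"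
      by (rule Bochner_Integration.integral_cong) (auto simp: power2_eq_square algebra_simps)
    also have "\<dots> = (LINT \<xi>|torus. \<phi> \<xi> * (f (y + \<xi>))\<^sup>2) - ?m\<^sup>2"
      using fs[of y] fs2[of y] i\<phi> m mollifierD(5)[OF \<phi>] by (simp add: power2_eq_square)
    finally have 1: "?m\<^sup>2 \<le> (LINT \<xi>|torus. \<phi> \<xi> * (f (y + \<xi>))\<^sup>2)" by simp
    have "(LINT \<xi>|torus. \<phi> \<xi> * (f (y + \<xi>) - f y)\<^sup>2)
        = (LINT \<xi>|torus. \<phi> \<xi> * (f (y + \<xi>))\<^sup>2 - 2 * f y * (\<phi> \<xi> * f (y + \<xi>)) + (f y)\<^sup>2 * \<phi> \<xi>)"
      by (rule Bochner_Integration.integral_cong) (auto simp: power2_eq_square algebra_simps)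
    also have "\<dots> = (LINT \<xi>|torus. \<phi> \<xi> * (f (y + \<xi>))\<^sup>2) - 2 * f y * ?m + (f y)\<^sup>2"
      using fs[of y] fs2[of y] i\<phi> m mollifierD(5)[OF \<phi>] by (simp add: power2_eq_square)
    finally show "(?m - f y)\<^sup>2 \<le> (LINT \<xi>|torus. \<phi> \<xi> * (f (y + \<xi>) - f y)\<^sup>2)"
      using 1 by (simp add: power2_eq_square algebra_simps)
  qed
  also have "\<dots> = (LINT \<xi>|torus. (LINT y|torus. \<phi> \<xi> * (f (y + \<xi>) - f y)\<^sup>2))"
    by (rule torus2.Fubini_integral[OF P, symmetric])
  also have "\<dots> \<le> (LINT \<xi>|torus. \<phi> \<xi> * e)"
    using mollifier_modulus[OF \<phi> f(1), where H="\<lambda>a b. (a - b)\<^sup>2", OF e] i\<phi> torus2.integrable_snd[OF P]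
    by (intro integral_mono) auto
  finally show ?thesis using mollifierD(5)[OF \<phi>] by simp
qed

text \<open>Young's inequality with a weight: \<open>\<bar>a\<^sup>2 - b\<^sup>2\<bar> \<le> (1 + 1 / k) (a - b)\<^sup>2 + k b\<^sup>2\<close>, with \<open>k\<close> chosen first.\<close>

lemma tendsto_norm_of_tendsto_0:
  fixes a :: "nat \<Rightarrow> real ^ 3 \<Rightarrow> real" and b :: "real ^ 3 \<Rightarrow> real"
  assumes ia: "\<And>n. integrable torus (\<lambda>x. (a n x)\<^sup>2)" and ib: "integrable torus (\<lambda>x. (b x)\<^sup>2)"
    and id: "\<And>n. integrable torus (\<lambda>x. (a n x - b x)\<^sup>2)"
    and lim: "(\<lambda>n. LINT x|torus. (a n x - b x)\<^sup>2) \<longlonglongrightarrow> 0"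
  shows "(\<lambda>n. LINT x|torus. (a n x)\<^sup>2) \<longlonglongrightarrow> (LINT x|torus. (b x)\<^sup>2)"
proof (rule LIMSEQ_I)
  fix r :: real assume r: "r > 0"
  define N where "N = (LINT x|torus. (b x)\<^sup>2)"
  have N: "N \<ge> 0" unfolding N_def by (intro integral_nonneg_AE) auto
  define k where "k = r / (2 * (N + 1))"
  have k: "k > 0" "k * N < r / 2" using r N by (auto simp: k_def field_simps)
  have "0 < r / 2 / (1 + 1 / k)" using k r by (auto intro!: divide_pos_pos add_pos_pos)
  from order_tendstoD(2)[OF lim this] obtain n0
    where n0: "\<And>n. n \<ge> n0 \<Longrightarrow> (LINT x|torus. (a n x - b x)\<^sup>2) < r / 2 / (1 + 1 / k)"
    by (auto simp: eventually_sequentially)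
  have "norm ((LINT x|torus. (a n x)\<^sup>2) - N) < r" if "n \<ge> n0" for n
  proof -
    have "\<bar>(LINT x|torus. (a n x)\<^sup>2) - N\<bar> = \<bar>LINT x|torus. (a n x)\<^sup>2 - (b x)\<^sup>2\<bar>"
      using ia ib by (simp add: N_def)
    also have "\<dots> \<le> (LINT x|torus. \<bar>(a n x)\<^sup>2 - (b x)\<^sup>2\<bar>)" by (rule integral_abs_bound)
    also have "\<dots> \<le> (LINT x|torus. (1 + 1 / k) * (a n x - b x)\<^sup>2 + k * (b x)\<^sup>2)"
    proof (rule integral_mono)
      fix x
      define d where "d = a n x - b x"
      have 2: "\<bar>2 * (b x * d)\<bar> \<le> k * (b x)\<^sup>2 + d\<^sup>2 / k"
      proof -
        have "0 \<le> (k * \<bar>b x\<bar> - \<bar>d\<bar>)\<^sup>2 / k" using k by simp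
        also have "\<dots> = k * (b x)\<^sup>2 + d\<^sup>2 / k - 2 * (\<bar>b x\<bar> * \<bar>d\<bar>)"
          using k by (simp add: power2_eq_square field_simps)
        finally show ?thesis by (simp add: abs_mult)
      qed
      have "(a n x)\<^sup>2 - (b x)\<^sup>2 = d\<^sup>2 + 2 * (b x * d)" by (simp add: d_def power2_eq_square algebra_simps)
      also have "\<bar>\<dots>\<bar> \<le> d\<^sup>2 + (k * (b x)\<^sup>2 + d\<^sup>2 / k)" using 2 by (smt (verit) zero_le_power2)
      finally show "\<bar>(a n x)\<^sup>2 - (b x)\<^sup>2\<bar> \<le> (1 + 1 / k) * (a n x - b x)\<^sup>2 + k * (b x)\<^sup>2"
        by (simp add: d_def algebra_simps)
    qed (use ia ib id in auto)
    also have "\<dots> = (1 + 1 / k) * (LINT x|torus. (a n x - b x)\<^sup>2) + k * N"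
      using ib id by (simp add: N_def)
    also have "(1 + 1 / k) * (LINT x|torus. (a n x - b x)\<^sup>2) < r / 2"
    proof -
      have "0 < 1 + 1 / k" using k by (intro add_pos_pos) auto
      from n0[OF that, unfolded pos_less_divide_eq[OF this]] show ?thesis by (simp only: mult.commute)
    qed
    finally show ?thesis using k by simp
  qed
  then show "\<exists>no. \<forall>n\<ge>no. norm ((LINT x|torus. (a n x)\<^sup>2) - (LINT x|torus. (b x)\<^sup>2)) < r"
    unfolding N_def by blast
qed

lemma energy_mollify_tendsto:
  assumes [measurable]: "f \<in> borel_measurable borel" and f: "periodic f" "integrable torus (\<lambda>x. (f x)\<^sup>2)"
    and \<phi>: "\<And>n. mollifier \<kappa> (\<delta> n) (\<phi> n)" and \<delta>: "\<delta> \<longlonglongrightarrow> 0"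
  shows "(\<lambda>n. LINT y|torus. (conv f (\<phi> n) y)\<^sup>2) \<longlonglongrightarrow> (LINT y|torus. (f y)\<^sup>2)"
proof (rule tendsto_norm_of_tendsto_0)
  have f1: "integrable torus f"
    by (rule torus.square_integrable_imp_integrable[OF _ f(2)]) (auto intro: measurable_torus)
  have [measurable]: "\<phi> n \<in> borel_measurable borel" for n by (rule mollifierD[OF \<phi>])
  have *: "integrable torus (\<lambda>y. (conv f (\<phi> n) y)\<^sup>2) \<and> integrable torus (\<lambda>y. (conv f (\<phi> n) y - f y)\<^sup>2)" for n
  proof -
    obtain B where B: "\<And>x. \<bar>\<phi> n x\<bar> \<le> B" using mollifier_bounded[OF \<phi>[of n]] by blast
    obtain C where C: "\<And>y. \<bar>conv f (\<phi> n) y\<bar> \<le> C" using mollify_bounded[OF f1 \<phi>[of n]] by blast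
    have ic: "integrable torus (\<lambda>y. (conv f (\<phi> n) y)\<^sup>2)"
      by (rule integrable_torus_bounded[where B="C\<^sup>2"]) (simp, use power_mono[OF C abs_ge_zero, of _ 2] in simp)
    have ic2: "integrable torus (\<lambda>y. f y * conv f (\<phi> n) y)"
      by (rule integrable_mult_bounded_torus[OF f1 _ C]) measurable
    have "integrable torus (\<lambda>y. (conv f (\<phi> n) y)\<^sup>2 + (f y)\<^sup>2 - 2 * (f y * conv f (\<phi> n) y))"
      using ic ic2 f(2) by auto
    then have "integrable torus (\<lambda>y. (conv f (\<phi> n) y - f y)\<^sup>2)"
      by (rule Bochner_Integration.integrable_cong[THEN iffD1, rotated -1])
        (auto simp: power2_eq_square algebra_simps)
    then show ?thesis using ic by blast
  qed
  show "integrable torus (\<lambda>y. (conv f (\<phi> n) y)\<^sup>2)" "integrable torus (\<lambda>y. (conv f (\<phi> n) y - f y)\<^sup>2)" for n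
    using * by auto
  show "(\<lambda>n. LINT y|torus. (conv f (\<phi> n) y - f y)\<^sup>2) \<longlonglongrightarrow> 0"
  proof (rule LIMSEQ_I)
    fix r :: real assume r: "r > 0"
    then have "r / 2 > 0" by simp
    from L2_translation[OF _ f(2,1) this] obtain d where d: "d > 0"
      "\<And>\<xi>. norm \<xi> < d \<Longrightarrow> (LINT x|torus. (f (\<xi> + x) - f x)\<^sup>2) < r / 2" by auto
    obtain n0 where n0: "\<And>n. n \<ge> n0 \<Longrightarrow> \<delta> n < d"
      using order_tendstoD(2)[OF \<delta> d(1)] by (auto simp: eventually_sequentially)
    have "norm ((LINT y|torus. (conv f (\<phi> n) y - f y)\<^sup>2) - 0) < r" if "n \<ge> n0" for n
    proof -
      have "(LINT y|torus. (conv f (\<phi> n) y - f y)\<^sup>2) \<le> r / 2"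
        by (rule L2_mollify[OF _ f \<phi>[of n]]) (use d(2) n0[OF that] in \<open>auto intro!: less_imp_le\<close>)
      moreover have "0 \<le> (LINT y|torus. (conv f (\<phi> n) y - f y)\<^sup>2)" by (intro integral_nonneg_AE) auto
      ultimately show ?thesis using r by simp
    qed
    then show "\<exists>no. \<forall>n\<ge>no. norm ((LINT y|torus. (conv f (\<phi> n) y - f y)\<^sup>2) - 0) < r" by blast
  qed
qed (rule f(2))

section \<open>The Helmholtz operator\<close>

definition diff2 :: "real \<Rightarrow> 3 \<Rightarrow> (real ^ 3 \<Rightarrow> real) \<Rightarrow> real ^ 3 \<Rightarrow> real" where
  "diff2 h i f x = (f (h *\<^sub>R axis i 1 + x) + f (- (h *\<^sub>R axis i 1) + x) - 2 * f x) / h\<^sup>2"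

lemma smooth_partial_pow: "smooth f \<Longrightarrow> smooth ((partial i ^^ m) f)"
  by (induction m) (auto intro: smooth_partial)

lemma smooth_line:
  assumes "smooth (f :: real ^ 3 \<Rightarrow> real)"
  shows "((\<lambda>s. f (s *\<^sub>R axis i 1 + x)) has_real_derivative partial i f (s *\<^sub>R axis i 1 + x)) (at s)"
proof -
  let ?D = "frechet_derivative f (at (s *\<^sub>R axis i 1 + x))"
  have "((\<lambda>s. s *\<^sub>R axis i 1 + x) has_derivative (\<lambda>r. r *\<^sub>R axis i 1)) (at s)"
    by (auto intro!: derivative_eq_intros)
  from has_derivative_compose[OF this smooth_has_derivative[OF assms]]
  have D: "((\<lambda>s. f (s *\<^sub>R axis i 1 + x)) has_derivative (\<lambda>r. ?D (r *\<^sub>R axis i 1))) (at s)" .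
  have "linear ?D" using smooth_has_derivative[OF assms] has_derivative_linear by blast
  then have "(\<lambda>r. ?D (r *\<^sub>R axis i 1)) = (\<lambda>r. partial i f (s *\<^sub>R axis i 1 + x) * r)"
    by (auto simp: linear_scale partial_def)
  with D show ?thesis unfolding has_field_derivative_def by simp
qed

text \<open>Taylor's formula of second order at \<open>h\<close> and at \<open>- h\<close>; the linear terms cancel.\<close>

lemma diff2_mean_value:
  assumes f: "smooth (f :: real ^ 3 \<Rightarrow> real)" and h: "h \<noteq> 0"
  obtains s t where "\<bar>s\<bar> \<le> \<bar>h\<bar>" "\<bar>t\<bar> \<le> \<bar>h\<bar>"
    "diff2 h i f x = (partial i (partial i f) (s *\<^sub>R axis i 1 + x) + partial i (partial i f) (t *\<^sub>R axis i 1 + x)) / 2"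
proof -
  define d where "d m s = (partial i ^^ m) f (s *\<^sub>R axis i 1 + x)" for m s
  have D: "\<forall>m s. DERIV (d m) s :> d (Suc m) s"
    unfolding d_def[abs_def] using smooth_line[OF smooth_partial_pow[OF f]] by auto
  obtain s where s: "\<bar>s\<bar> \<le> \<bar>h\<bar>" "d 0 h = (\<Sum>m<2. (d m 0 / fact m) * h ^ m) + (d 2 s / fact 2) * h ^ 2"
    using Maclaurin_all_le[OF refl D, of h 2] by blast
  obtain t where t: "\<bar>t\<bar> \<le> \<bar>-h\<bar>" "d 0 (-h) = (\<Sum>m<2. (d m 0 / fact m) * (-h) ^ m) + (d 2 t / fact 2) * (-h) ^ 2"
    using Maclaurin_all_le[OF refl D, of "-h" 2] by blast
  have "d 0 h + d 0 (-h) - 2 * d 0 0 = (d 2 s + d 2 t) / 2 * h\<^sup>2"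
    unfolding s(2) t(2) by (simp add: lessThan_nat_numeral lessThan_Suc numeral_2_eq_2 field_simps)
  then have "diff2 h i f x = (d 2 s + d 2 t) / 2"
    using h by (simp add: diff2_def d_def)
  then show ?thesis using that[of s t] s(1) t(1) by (simp add: d_def numeral_2_eq_2)
qed

lemma diff2_bound:
  assumes f: "smooth (f :: real ^ 3 \<Rightarrow> real)" and h: "h \<noteq> 0" and B: "\<And>x. \<bar>partial i (partial i f) x\<bar> \<le> B"
  shows "\<bar>diff2 h i f x\<bar> \<le> B"
proof -
  obtain a b where "diff2 h i f x = (a + b) / 2" "\<bar>a\<bar> \<le> B" "\<bar>b\<bar> \<le> B"
    using diff2_mean_value[OF f h] B by metis
  then show ?thesis using abs_triangle_ineq[of a b] by simp
qed

lemma diff2_tendsto: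
  assumes f: "smooth (f :: real ^ 3 \<Rightarrow> real)"
  shows "(\<lambda>n. diff2 (1 / real (Suc n)) i f x) \<longlonglongrightarrow> partial i (partial i f) x"
proof -
  let ?h = "\<lambda>n. 1 / real (Suc n)" and ?P = "partial i (partial i f)"
  have "\<exists>s t. \<bar>s\<bar> \<le> ?h n \<and> \<bar>t\<bar> \<le> ?h n \<and> diff2 (?h n) i f x = (?P (s *\<^sub>R axis i 1 + x) + ?P (t *\<^sub>R axis i 1 + x)) / 2" for n
    by (rule diff2_mean_value[OF f, of "?h n" i x]) auto
  then obtain s t where st: "\<And>n. \<bar>s n\<bar> \<le> ?h n" "\<And>n. \<bar>t n\<bar> \<le> ?h n"
    "\<And>n. diff2 (?h n) i f x = (?P (s n *\<^sub>R axis i 1 + x) + ?P (t n *\<^sub>R axis i 1 + x)) / 2"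
    by metis
  have h0: "?h \<longlonglongrightarrow> 0" by (rule LIMSEQ_inverse_real_of_nat[unfolded inverse_eq_divide])
  have s0: "s \<longlonglongrightarrow> 0" by (rule Lim_null_comparison[OF _ h0]) (use st in auto)
  have t0: "t \<longlonglongrightarrow> 0" by (rule Lim_null_comparison[OF _ h0]) (use st in auto)
  have c: "isCont ?P y" for y
    using smooth_continuous[OF smooth_partial[OF smooth_partial[OF f]]] by (simp add: continuous_on_eq_continuous_at)
  have "(\<lambda>n. ?P (r n *\<^sub>R axis i 1 + x)) \<longlonglongrightarrow> ?P x" if "r \<longlonglongrightarrow> 0" for r
  proof -
    have "(\<lambda>n. r n *\<^sub>R axis i 1 + x) \<longlonglongrightarrow> 0 *\<^sub>R axis i 1 + x" by (intro tendsto_intros that)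
    then show ?thesis using isCont_tendsto_compose[OF c] by fastforce
  qed
  from tendsto_divide[OF tendsto_add[OF this[OF s0] this[OF t0]] tendsto_const, of 2]
  show ?thesis unfolding st(3) by simp
qed

lemma conv_diff2:
  assumes g: "integrable torus g" and [measurable]: "\<phi> \<in> borel_measurable borel" and B: "\<And>x. \<bar>\<phi> x\<bar> \<le> B"
  shows "diff2 h i (conv g \<phi>) y = conv g (diff2 h i \<phi>) y"
proof -
  have I: "integrable torus (\<lambda>x. g x * \<phi> (z - x))" for z by (rule integrable_conv[OF g _ B]) simp
  have "conv g (diff2 h i \<phi>) y = (LINT x|torus. (g x * \<phi> (h *\<^sub>R axis i 1 + y - x) + g x * \<phi> (- (h *\<^sub>R axis i 1) + y - x)
      - 2 * (g x * \<phi> (y - x))) / h\<^sup>2)"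
    unfolding conv_def diff2_def by (rule Bochner_Integration.integral_cong) (auto simp: field_simps)
  also have "\<dots> = diff2 h i (conv g \<phi>) y"
    unfolding diff2_def conv_def using I by simp
  finally show ?thesis ..
qed

lemma conv_diff2_tendsto:
  assumes g: "integrable torus g" and \<phi>: "smooth \<phi>" "periodic \<phi>"
  shows "(\<lambda>n. conv g (diff2 (1 / real (Suc n)) i \<phi>) y) \<longlonglongrightarrow> conv g (partial i (partial i \<phi>)) y"
    and "\<exists>C. \<forall>n y. \<bar>conv g (diff2 (1 / real (Suc n)) i \<phi>) y\<bar> \<le> C"
proof -
  have s2: "smooth (partial i (partial i \<phi>))" by (intro smooth_partial \<phi>)
  obtain B where B: "\<And>x. \<bar>partial i (partial i \<phi>) x\<bar> \<le> B"
    using smooth_periodic_bounded[OF s2] partial_periodic smooth_partial \<phi> by metis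
  have [measurable]: "\<phi> \<in> borel_measurable borel" "partial i (partial i \<phi>) \<in> borel_measurable borel"
    by (auto intro!: smooth_borel \<phi> s2)
  have [measurable]: "diff2 h i \<phi> \<in> borel_measurable borel" for h
    unfolding diff2_def[abs_def] by measurable
  have b: "\<bar>diff2 (1 / real (Suc n)) i \<phi> x\<bar> \<le> B" for n x by (rule diff2_bound[OF \<phi>(1) _ B]) simp
  have [measurable]: "g \<in> borel_measurable torus" using g by auto
  show "\<exists>C. \<forall>n y. \<bar>conv g (diff2 (1 / real (Suc n)) i \<phi>) y\<bar> \<le> C"
    by (intro exI[of _ "B * (LINT x|torus. \<bar>g x\<bar>)"] allI conv_bound[OF g _ b]) measurable
  show "(\<lambda>n. conv g (diff2 (1 / real (Suc n)) i \<phi>) y) \<longlonglongrightarrow> conv g (partial i (partial i \<phi>)) y"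
    unfolding conv_def
  proof (rule integral_dominated_convergence[where w="\<lambda>x. B * \<bar>g x\<bar>"])
    show "(\<lambda>x. g x * partial i (partial i \<phi>) (y - x)) \<in> borel_measurable torus"
      by (rule borel_measurable_integrable, rule integrable_conv[OF g _ B]) measurable
    show "(\<lambda>x. g x * diff2 (1 / real (Suc n)) i \<phi> (y - x)) \<in> borel_measurable torus" for n
      by (rule borel_measurable_integrable, rule integrable_conv[OF g _ b]) measurable
    show "AE x in torus. (\<lambda>n. g x * diff2 (1 / real (Suc n)) i \<phi> (y - x)) \<longlonglongrightarrow> g x * partial i (partial i \<phi>) (y - x)"
      by (intro always_eventually allI tendsto_mult tendsto_const diff2_tendsto[OF \<phi>(1)])
    show "AE x in torus. norm (g x * diff2 (1 / real (Suc n)) i \<phi> (y - x)) \<le> B * \<bar>g x\<bar>" for n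
      unfolding real_norm_def abs_mult mult.commute[of B] by (intro always_eventually allI mult_left_mono b) auto
  qed (use g in auto)
qed

text \<open>Summation by parts: after a translation the integral is minus that of
  \<open>(G (U (y + a)) - G (U y)) (U (y + a) - U y)\<close>.\<close>

lemma integral_mono_diff2_nonpos:
  fixes U :: "real ^ 3 \<Rightarrow> real" and G :: "real \<Rightarrow> real"
  assumes [measurable]: "U \<in> borel_measurable borel" and U: "periodic U" "\<And>x. \<bar>U x\<bar> \<le> C" and G: "mono G"
  shows "(LINT y|torus. G (U y) * diff2 h i U y) \<le> 0"
proof -
  have [measurable]: "G \<in> borel_measurable borel" by (rule borel_measurable_mono[OF G])
  have "\<bar>G (U y)\<bar> \<le> \<bar>G C\<bar> + \<bar>G (- C)\<bar>" for y
    using monoD[OF G, of "U y" C] monoD[OF G, of "- C" "U y"] U(2)[of y] by linarith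
  then obtain K where K: "\<And>y. \<bar>G (U y)\<bar> \<le> K" by blast
  have K0: "0 \<le> K" using K[of 0] by linarith
  define a where "a = h *\<^sub>R axis i (1::real)"
  have I: "integrable torus (\<lambda>y. G (U (b + y)) * U (c + y))" for b c
    by (rule integrable_torus_bounded[where B="K * C"])
      (measurable, auto simp: abs_mult intro!: mult_mono K U(2) K0)
  have I0: "integrable torus (\<lambda>y. G (U (b + y)) * U y)" "integrable torus (\<lambda>y. G (U y) * U (b + y))"
    "integrable torus (\<lambda>y. G (U y) * U y)" for b
    using I[of b 0] I[of 0 b] I[of 0 0] by simp_all
  have s1: "(LINT y|torus. G (U (a + y)) * U (- a + (a + y))) = (LINT y|torus. G (U y) * U (- a + y))"
    by (rule integral_torus_shift[where f="\<lambda>y. G (U y) * U (- a + y)"])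
      (measurable, intro periodic_comp2[where G="\<lambda>u w. G u * w"] U(1) periodic_shift' )
  have s2: "(LINT y|torus. G (U (a + y)) * U (a + y)) = (LINT y|torus. G (U y) * U y)"
    by (rule integral_torus_shift[where f="\<lambda>y. G (U y) * U y"])
      (measurable, intro periodic_comp2[where G="\<lambda>u w. G u * w"] U(1))
  have "(LINT y|torus. G (U y) * diff2 h i U y) =
      (LINT y|torus. (G (U y) * U (a + y) + G (U y) * U (- a + y) - 2 * (G (U y) * U y)) / h\<^sup>2)"
    unfolding diff2_def a_def by (rule Bochner_Integration.integral_cong) (auto simp: algebra_simps)
  also have "\<dots> = ((LINT y|torus. G (U y) * U (a + y)) + (LINT y|torus. G (U (a + y)) * U y)
      - (LINT y|torus. G (U y) * U y) - (LINT y|torus. G (U (a + y)) * U (a + y))) / h\<^sup>2"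
    using I0 I0(2)[of "- a"] s1 s2 by simp
  also have "\<dots> = (LINT y|torus. G (U y) * U (a + y) + G (U (a + y)) * U y - G (U y) * U y - G (U (a + y)) * U (a + y)) / h\<^sup>2"
    using I0 I by simp
  also have "\<dots> \<le> 0"
  proof -
    have "G (U y) * U (a + y) + G (U (a + y)) * U y - G (U y) * U y - G (U (a + y)) * U (a + y) \<le> 0" for y
    proof -
      have "0 \<le> (G (U (a + y)) - G (U y)) * (U (a + y) - U y)"
        using monoD[OF G, of "U y" "U (a + y)"] monoD[OF G, of "U (a + y)" "U y"]
        by (cases "U y \<le> U (a + y)") (auto simp: zero_le_mult_iff)
      then show ?thesis by (simp add: algebra_simps)
    qed
    then have "0 \<le> (LINT y|torus. - (G (U y) * U (a + y) + G (U (a + y)) * U y - G (U y) * U y - G (U (a + y)) * U (a + y)))"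
      by (intro integral_nonneg_AE always_eventually allI) (simp only: neg_0_le_iff_le)
    then have "(LINT y|torus. G (U y) * U (a + y) + G (U (a + y)) * U y - G (U y) * U y - G (U (a + y)) * U (a + y)) \<le> 0"
      unfolding integral_minus by simp
    then show ?thesis by (simp add: divide_nonpos_nonneg)
  qed
  finally show ?thesis .
qed

definition helmholtz :: "real \<Rightarrow> (real ^ 3 \<Rightarrow> real) \<Rightarrow> (real ^ 3 \<Rightarrow> real) \<Rightarrow> bool" where
  "helmholtz \<alpha> f g \<longleftrightarrow> (\<forall>\<phi>. smooth \<phi> \<and> periodic \<phi> \<longrightarrow>
     (LINT x|torus. g x * (\<phi> x - \<alpha>\<^sup>2 * laplacian \<phi> x)) = (LINT x|torus. f x * \<phi> x))"

lemma laplacian_reflect: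
  assumes "smooth \<phi>" shows "laplacian (\<lambda>x. \<phi> (c - x)) x = laplacian \<phi> (c - x)"
proof -
  have "partial i (partial i (\<lambda>x. \<phi> (c - x))) x = partial i (partial i \<phi>) (c - x)" for i
  proof -
    have "partial i (\<lambda>x. \<phi> (c - x)) = (\<lambda>x. - partial i \<phi> (c - x))"
      using partial_reflect[OF assms] by blast
    then show ?thesis
      using partial_uminus[OF smooth_reflect[OF smooth_partial[OF assms]], of i i c x]
        partial_reflect[OF smooth_partial[OF assms], of i i c x] by simp
  qed
  then show ?thesis by (simp add: laplacian_def)
qed

lemma laplacian_periodic: "smooth \<phi> \<Longrightarrow> periodic \<phi> \<Longrightarrow> periodic (laplacian \<phi>)"
  unfolding laplacian_def periodic_iff
  using partial_periodic[unfolded periodic_iff] smooth_partial by (simp add: periodic_iff)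

lemma conv_laplacian:
  assumes g: "integrable torus g" and \<phi>: "smooth \<phi>" "periodic \<phi>"
  shows "conv g (laplacian \<phi>) y = (\<Sum>i\<in>UNIV. conv g (partial i (partial i \<phi>)) y)"
proof -
  have "integrable torus (\<lambda>x. g x * partial i (partial i \<phi>) (y - x))" for i
  proof -
    obtain B where B: "\<And>x. \<bar>partial i (partial i \<phi>) x\<bar> \<le> B"
      using smooth_periodic_bounded partial_periodic smooth_partial \<phi> by metis
    show ?thesis by (rule integrable_conv[OF g smooth_borel B]) (intro smooth_partial \<phi>)
  qed
  then show ?thesis unfolding conv_def laplacian_def by (simp add: sum_distrib_left)
qed

lemma helmholtz_conv:
  assumes H: "helmholtz \<alpha> f g" and g: "integrable torus g" and \<phi>: "smooth \<phi>" "periodic \<phi>"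
  shows "conv g \<phi> y - \<alpha>\<^sup>2 * conv g (laplacian \<phi>) y = conv f \<phi> y"
proof -
  have "(LINT x|torus. g x * (\<phi> (y - x) - \<alpha>\<^sup>2 * laplacian \<phi> (y - x))) = conv f \<phi> y"
    using H smooth_reflect[OF \<phi>(1), of y] periodic_reflect[OF \<phi>(2), of y]
    unfolding helmholtz_def conv_def laplacian_reflect[OF \<phi>(1), symmetric] by blast
  moreover have "(LINT x|torus. g x * (\<phi> (y - x) - \<alpha>\<^sup>2 * laplacian \<phi> (y - x))) =
      (LINT x|torus. g x * \<phi> (y - x) - \<alpha>\<^sup>2 * (g x * laplacian \<phi> (y - x)))"
    by (rule Bochner_Integration.integral_cong) (auto simp: algebra_simps)
  moreover have "\<dots> = conv g \<phi> y - \<alpha>\<^sup>2 * conv g (laplacian \<phi>) y"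
  proof -
    obtain B where B: "\<And>x. \<bar>\<phi> x\<bar> \<le> B" using smooth_periodic_bounded[OF \<phi>] by blast
    obtain B' where B': "\<And>x. \<bar>laplacian \<phi> x\<bar> \<le> B'"
      using smooth_periodic_bounded[OF smooth_laplacian[OF \<phi>(1)] laplacian_periodic[OF \<phi>]] by blast
    have "integrable torus (\<lambda>x. g x * \<phi> (y - x))" by (rule integrable_conv[OF g smooth_borel B]) (rule \<phi>)
    moreover have "integrable torus (\<lambda>x. g x * laplacian \<phi> (y - x))"
      by (rule integrable_conv[OF g smooth_borel B']) (rule smooth_laplacian[OF \<phi>(1)])
    ultimately show ?thesis by (simp add: conv_def)
  qed
  ultimately show ?thesis by simp
qed

text \<open>The limit of \<open>integral_mono_diff2_nonpos\<close>: the second differences of a convolution converge boundedly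
  to its second derivatives.\<close>

lemma integral_mono_laplacian_nonpos:
  fixes G :: "real \<Rightarrow> real"
  assumes [measurable]: "g \<in> borel_measurable borel" and g: "integrable torus g" and \<phi>: "smooth \<phi>" "periodic \<phi>" and G: "mono G"
  shows "(LINT y|torus. G (conv g \<phi> y) * conv g (laplacian \<phi>) y) \<le> 0"
proof -
  define U where "U = conv g \<phi>"
  obtain B where B: "\<And>x. \<bar>\<phi> x\<bar> \<le> B" using smooth_periodic_bounded[OF \<phi>] by blast
  have \<phi>m [measurable]: "\<phi> \<in> borel_measurable borel" "partial i (partial i \<phi>) \<in> borel_measurable borel" for i
    by (auto intro!: smooth_borel \<phi> smooth_partial)
  obtain C where C: "\<And>x. \<bar>U x\<bar> \<le> C" using conv_bound[OF g \<phi>m(1) B] unfolding U_def by blast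
  have U [measurable]: "U \<in> borel_measurable borel" unfolding U_def by measurable
  have pU: "periodic U" unfolding U_def by (rule conv_periodic[OF \<phi>(2)])
  have Gm [measurable]: "G \<in> borel_measurable borel" by (rule borel_measurable_mono[OF G])
  have "\<bar>G (U y)\<bar> \<le> \<bar>G C\<bar> + \<bar>G (- C)\<bar>" for y
    using monoD[OF G, of "U y" C] monoD[OF G, of "- C" "U y"] C[of y] by linarith
  then obtain K where K: "\<And>y. \<bar>G (U y)\<bar> \<le> K" by blast
  have [measurable]: "diff2 h i \<phi> \<in> borel_measurable borel" for h i unfolding diff2_def[abs_def] by measurable
  have lim: "(\<lambda>n. LINT y|torus. G (U y) * conv g (diff2 (1 / real (Suc n)) i \<phi>) y) \<longlonglongrightarrow>
      (LINT y|torus. G (U y) * conv g (partial i (partial i \<phi>)) y)" for i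
  proof -
    obtain D where D: "\<And>n y. \<bar>conv g (diff2 (1 / real (Suc n)) i \<phi>) y\<bar> \<le> D"
      using conv_diff2_tendsto(2)[OF g \<phi>, of i] by blast
    show ?thesis
    proof (rule integral_dominated_convergence[where w="\<lambda>x. K * D"])
      show "(\<lambda>y. G (U y) * conv g (partial i (partial i \<phi>)) y) \<in> borel_measurable torus"
        by (rule measurable_torus) measurable
      show "(\<lambda>y. G (U y) * conv g (diff2 (1 / real (Suc n)) i \<phi>) y) \<in> borel_measurable torus" for n
        by (rule measurable_torus) measurable
      show "AE y in torus. (\<lambda>n. G (U y) * conv g (diff2 (1 / real (Suc n)) i \<phi>) y) \<longlonglongrightarrow> G (U y) * conv g (partial i (partial i \<phi>)) y"
        by (intro always_eventually allI tendsto_mult tendsto_const conv_diff2_tendsto(1)[OF g \<phi>])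
      have "0 \<le> K" using K[of 0] by linarith
      then show "AE y in torus. norm (G (U y) * conv g (diff2 (1 / real (Suc n)) i \<phi>) y) \<le> K * D" for n
        unfolding real_norm_def abs_mult by (intro always_eventually allI mult_mono K D) auto
    qed simp
  qed
  have le: "(LINT y|torus. G (U y) * conv g (partial i (partial i \<phi>)) y) \<le> 0" for i
  proof (rule LIMSEQ_le_const2[OF lim], intro exI allI impI)
    fix n
    have "conv g (diff2 (1 / real (Suc n)) i \<phi>) y = diff2 (1 / real (Suc n)) i U y" for y
      unfolding U_def by (rule conv_diff2[OF g \<phi>m(1) B, symmetric])
    then show "(LINT y|torus. G (U y) * conv g (diff2 (1 / real (Suc n)) i \<phi>) y) \<le> 0"
      using integral_mono_diff2_nonpos[OF U pU C G] by simp
  qed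
  have "integrable torus (\<lambda>y. G (U y) * conv g (partial i (partial i \<phi>)) y)" for i
  proof -
    obtain B' where B': "\<And>x. \<bar>partial i (partial i \<phi>) x\<bar> \<le> B'"
      using smooth_periodic_bounded partial_periodic smooth_partial \<phi> by metis
    have "integrable torus (\<lambda>y. G (U y))" by (rule integrable_torus_bounded[OF _ K]) measurable
    then show ?thesis
      by (rule integrable_mult_bounded_torus[OF _ _ conv_bound[OF g \<phi>m(2) B']]) measurable
  qed
  then have "(LINT y|torus. G (U y) * conv g (laplacian \<phi>) y) = (\<Sum>i\<in>UNIV. LINT y|torus. G (U y) * conv g (partial i (partial i \<phi>)) y)"
    unfolding conv_laplacian[OF g \<phi>] by (simp add: sum_distrib_left)
  also have "\<dots> \<le> 0" by (intro sum_nonpos le)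
  finally show ?thesis by (simp add: U_def)
qed

section \<open>Contraction estimates for the Helmholtz filter\<close>

text \<open>Starts at \<open>1 / 3\<close>, because \<open>mollifier_exists\<close> provides kernels for scales below \<open>1 / 2\<close>.\<close>

definition scale_seq :: "nat \<Rightarrow> real" where "scale_seq n = 1 / real (n + 3)"

lemma mollifier_sequence:
  obtains \<kappa> \<phi> where "\<And>n. mollifier \<kappa> (scale_seq n) (\<phi> n)"
proof -
  obtain \<kappa> where "\<And>\<delta>. 0 < \<delta> \<Longrightarrow> \<delta> < 1/2 \<Longrightarrow> \<exists>\<phi>. mollifier \<kappa> \<delta> \<phi>" by (rule mollifier_exists) blast
  then have "\<exists>\<phi>. mollifier \<kappa> (scale_seq n) \<phi>" for n by (auto simp: scale_seq_def)
  then show ?thesis using that by metis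
qed

lemma scale_seq_tendsto: "scale_seq \<longlonglongrightarrow> 0"
  unfolding scale_seq_def[abs_def]
  by (rule LIMSEQ_ignore_initial_segment[OF lim_1_over_n])

text \<open>\<open>(I - \<alpha>\<^sup>2\<Delta>)\<^sup>-\<^sup>1\<close> contracts every convex functional: multiply the mollified equation by the
  subgradient of \<open>\<Psi>\<close> at the mollified solution and sum by parts.\<close>

lemma helmholtz_convex_contraction:
  fixes \<Psi> G :: "real \<Rightarrow> real"
  assumes fm [measurable]: "f \<in> borel_measurable borel" and gm [measurable]: "g \<in> borel_measurable borel"
    and f: "periodic f" "integrable torus f" and g: "periodic g" "integrable torus g"
    and H: "helmholtz \<alpha> f g"
    and sub: "\<And>a b. \<Psi> a + G a * (b - a) \<le> \<Psi> b" and G: "mono G" and \<Psi>0: "\<And>a. 0 \<le> \<Psi> a"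
    and \<Psi>c: "continuous_on UNIV \<Psi>" and i\<Psi>: "integrable torus (\<lambda>x. \<Psi> (f x))"
  shows "integrable torus (\<lambda>x. \<Psi> (g x))" "(LINT x|torus. \<Psi> (g x)) \<le> (LINT x|torus. \<Psi> (f x))"
proof -
  obtain \<kappa> \<phi> where \<phi>: "\<And>n. mollifier \<kappa> (scale_seq n) (\<phi> n)" using mollifier_sequence by blast
  have \<phi>m [measurable]: "\<phi> n \<in> borel_measurable borel" for n by (rule mollifierD[OF \<phi>])
  have \<Psi>m [measurable]: "\<Psi> \<in> borel_measurable borel" by (rule borel_measurable_continuous_onI[OF \<Psi>c])
  have Gm [measurable]: "G \<in> borel_measurable borel" by (rule borel_measurable_mono[OF G])
  define U where "U n = conv g (\<phi> n)" for n
  define I where "I = (LINT x|torus. \<Psi> (f x))"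
  have Um [measurable]: "U n \<in> borel_measurable borel" for n unfolding U_def by measurable
  have step: "integrable torus (\<lambda>y. \<Psi> (U n y)) \<and> (LINT y|torus. \<Psi> (U n y)) \<le> I" for n
  proof -
    define V where "V = conv f (\<phi> n)"
    define L where "L = conv g (laplacian (\<phi> n))"
    have s: "smooth (\<phi> n)" "periodic (\<phi> n)" using mollifierD[OF \<phi>] by auto
    have UV: "U n y - \<alpha>\<^sup>2 * L y = V y" for y
      unfolding U_def L_def V_def by (rule helmholtz_conv[OF H g(2) s])
    obtain C1 where C1: "\<And>y. \<bar>U n y\<bar> \<le> C1" using mollify_bounded[OF g(2) \<phi>[of n]] unfolding U_def by blast
    obtain C2 where C2: "\<And>y. \<bar>V y\<bar> \<le> C2" using mollify_bounded[OF f(2) \<phi>[of n]] unfolding V_def by blast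
    have Vm [measurable]: "V \<in> borel_measurable borel" unfolding V_def by measurable
    have lm [measurable]: "laplacian (\<phi> n) \<in> borel_measurable borel" by (rule smooth_borel[OF smooth_laplacian[OF s(1)]])
    have Lm [measurable]: "L \<in> borel_measurable borel" unfolding L_def by measurable
    have cb: "\<exists>K. \<forall>y. \<bar>\<Psi> (W y)\<bar> \<le> K" if W: "\<And>y. \<bar>W y\<bar> \<le> C" for W :: "real ^ 3 \<Rightarrow> real" and C
    proof -
      have "compact (\<Psi> ` {-C..C})"
        using \<Psi>c by (intro compact_continuous_image) (auto intro: continuous_on_subset)
      then obtain K where "\<And>a. a \<in> {-C..C} \<Longrightarrow> \<bar>\<Psi> a\<bar> \<le> K"
        using compact_imp_bounded bounded_iff by (metis image_eqI real_norm_def)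
      then show ?thesis using W by (auto simp: abs_le_iff intro!: exI[of _ K]) (metis abs_le_iff atLeastAtMost_iff minus_le_iff)+
    qed
    have iU: "integrable torus (\<lambda>y. \<Psi> (U n y))"
    proof -
      obtain K where K: "\<And>y. \<bar>\<Psi> (U n y)\<bar> \<le> K" using cb[where W="U n" and C=C1] C1 by blast
      show ?thesis by (rule integrable_torus_bounded[OF _ K]) measurable
    qed
    have iV: "integrable torus (\<lambda>y. \<Psi> (V y))"
    proof -
      obtain K where K: "\<And>y. \<bar>\<Psi> (V y)\<bar> \<le> K" using cb[where W=V and C=C2] C2 by blast
      show ?thesis by (rule integrable_torus_bounded[OF _ K]) measurable
    qed
    have "\<bar>G (U n y)\<bar> \<le> \<bar>G C1\<bar> + \<bar>G (- C1)\<bar>" for y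
      using monoD[OF G, of "U n y" C1] monoD[OF G, of "- C1" "U n y"] C1[of y] by linarith
    then obtain K where K: "\<And>y. \<bar>G (U n y)\<bar> \<le> K" by blast
    have iGL: "integrable torus (\<lambda>y. G (U n y) * L y)"
    proof -
      obtain B' where B': "\<And>x. \<bar>laplacian (\<phi> n) x\<bar> \<le> B'"
        using smooth_periodic_bounded[OF smooth_laplacian[OF s(1)] laplacian_periodic[OF s]] by blast
      have "integrable torus (\<lambda>y. G (U n y))" by (rule integrable_torus_bounded[OF _ K]) measurable
      then show ?thesis unfolding L_def
        by (rule integrable_mult_bounded_torus[OF _ _ conv_bound[OF g(2) lm B']]) measurable
    qed
    have "(LINT y|torus. \<Psi> (U n y)) \<le> (LINT y|torus. \<Psi> (V y))"
    proof -
      have "(LINT y|torus. \<Psi> (U n y) - \<alpha>\<^sup>2 * (G (U n y) * L y)) \<le> (LINT y|torus. \<Psi> (V y))"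
      proof (rule integral_mono)
        fix y
        have VU: "V y - U n y = - (\<alpha>\<^sup>2 * L y)" using UV[of y] by linarith
        show "\<Psi> (U n y) - \<alpha>\<^sup>2 * (G (U n y) * L y) \<le> \<Psi> (V y)"
          using sub[of "U n y" "V y"] unfolding VU by (simp add: mult_ac)
      qed (use iU iV iGL in auto)
      moreover have "(LINT y|torus. \<Psi> (U n y) - \<alpha>\<^sup>2 * (G (U n y) * L y)) =
          (LINT y|torus. \<Psi> (U n y)) - \<alpha>\<^sup>2 * (LINT y|torus. G (U n y) * L y)"
        using iU iGL by simp
      moreover have "(LINT y|torus. G (U n y) * L y) \<le> 0"
        unfolding U_def L_def by (rule integral_mono_laplacian_nonpos[OF gm g(2) s G])
      then have "\<alpha>\<^sup>2 * (LINT y|torus. G (U n y) * L y) \<le> 0" by (simp add: mult_nonneg_nonpos)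
      ultimately show ?thesis by linarith
    qed
    also have "(LINT y|torus. \<Psi> (V y)) \<le> (LINT y|torus. conv (\<lambda>x. \<Psi> (f x)) (\<phi> n) y)"
    proof (rule integral_mono[OF iV])
      obtain C where C: "\<And>y. \<bar>conv (\<lambda>x. \<Psi> (f x)) (\<phi> n) y\<bar> \<le> C" using mollify_bounded[OF i\<Psi> \<phi>[of n]] by blast
      show "integrable torus (conv (\<lambda>x. \<Psi> (f x)) (\<phi> n))" by (rule integrable_torus_bounded[OF _ C]) measurable
      show "\<Psi> (V y) \<le> conv (\<lambda>x. \<Psi> (f x)) (\<phi> n) y" for y
        unfolding V_def by (rule convex_conv[OF fm f \<phi>[of n] sub i\<Psi>])
    qed
    also have "\<dots> = I" unfolding I_def
      by (rule integral_conv_mollifier[OF _ periodic_comp[OF f(1)] i\<Psi> \<phi>[of n]]) measurable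
    finally show ?thesis using iU by blast
  qed
  have L1: "(\<lambda>n. LINT y|torus. norm (U n y - g y)) \<longlonglongrightarrow> 0"
  proof (rule LIMSEQ_I)
    fix r :: real assume r: "r > 0"
    then have "r / 2 > 0" by simp
    from L1_translation[OF g(2,1) this] obtain d where d: "d > 0"
      "\<And>\<xi>. norm \<xi> < d \<Longrightarrow> (LINT x|torus. \<bar>g (\<xi> + x) - g x\<bar>) < r / 2" by blast
    obtain n0 where n0: "\<And>n. n \<ge> n0 \<Longrightarrow> scale_seq n < d"
      using order_tendstoD(2)[OF scale_seq_tendsto d(1)] by (auto simp: eventually_sequentially)
    have "norm ((LINT y|torus. norm (U n y - g y)) - 0) < r" if "n \<ge> n0" for n
    proof -
      have "(LINT y|torus. \<bar>conv g (\<phi> n) y - g y\<bar>) \<le> r / 2"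
        by (rule L1_mollify[OF gm g \<phi>[of n]]) (use d(2) n0[OF that] in \<open>auto intro!: less_imp_le\<close>)
      moreover have "0 \<le> (LINT y|torus. \<bar>conv g (\<phi> n) y - g y\<bar>)" by (intro integral_nonneg_AE) auto
      ultimately show ?thesis using r by (simp add: U_def)
    qed
    then show "\<exists>no. \<forall>n\<ge>no. norm ((LINT y|torus. norm (U n y - g y)) - 0) < r" by blast
  qed
  have iU: "integrable torus (\<lambda>y. U n y - g y)" for n
  proof -
    obtain C where C: "\<And>y. \<bar>U n y\<bar> \<le> C" using mollify_bounded[OF g(2) \<phi>[of n]] unfolding U_def by blast
    have "integrable torus (U n)" by (rule integrable_torus_bounded[OF Um C])
    then show ?thesis using g by auto
  qed
  obtain r where r: "strict_mono r" "AE x in torus. (\<lambda>n. U (r n) x - g x) \<longlonglongrightarrow> 0"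
    using tendsto_L1_AE_subseq[OF iU L1] by blast
  have "AE x in torus. liminf (\<lambda>n. ennreal (\<Psi> (U (r n) x))) = ennreal (\<Psi> (g x))"
    using r(2)
  proof eventually_elim
    case (elim x)
    have "(\<lambda>n. U (r n) x) \<longlonglongrightarrow> g x" using elim by (simp add: LIM_zero_iff)
    then have "(\<lambda>n. \<Psi> (U (r n) x)) \<longlonglongrightarrow> \<Psi> (g x)"
      using \<Psi>c by (intro isCont_tendsto_compose[of _ \<Psi>]) (auto simp: continuous_on_eq_continuous_at)
    then show ?case by (intro lim_imp_Liminf tendsto_ennrealI) auto
  qed
  then have "(\<integral>\<^sup>+x. ennreal (\<Psi> (g x)) \<partial>torus) = (\<integral>\<^sup>+x. liminf (\<lambda>n. ennreal (\<Psi> (U (r n) x))) \<partial>torus)"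
    by (intro nn_integral_cong_AE) auto
  also have "\<dots> \<le> liminf (\<lambda>n. \<integral>\<^sup>+x. ennreal (\<Psi> (U (r n) x)) \<partial>torus)"
    by (rule nn_integral_liminf) (rule measurable_torus, measurable)
  also have "\<dots> \<le> ennreal I"
  proof -
    have "(\<integral>\<^sup>+x. ennreal (\<Psi> (U (r n) x)) \<partial>torus) \<le> ennreal I" for n
      using step[of "r n"] \<Psi>0 by (subst nn_integral_eq_integral) (auto intro: ennreal_leI)
    then have "liminf (\<lambda>n. \<integral>\<^sup>+x. ennreal (\<Psi> (U (r n) x)) \<partial>torus) \<le> liminf (\<lambda>n::nat. ennreal I)"
      by (intro Liminf_mono always_eventually) auto
    then show ?thesis by (simp add: Liminf_const)
  qed
  finally have le: "(\<integral>\<^sup>+x. ennreal (\<Psi> (g x)) \<partial>torus) \<le> ennreal I" .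
  have gt: "(\<lambda>x. \<Psi> (g x)) \<in> borel_measurable torus" by (rule measurable_torus) measurable
  show "integrable torus (\<lambda>x. \<Psi> (g x))"
    using le \<Psi>0 by (intro integrableI_nonneg gt) (auto simp: le_less_trans[OF le])
  then have "ennreal (LINT x|torus. \<Psi> (g x)) \<le> ennreal I"
    using le \<Psi>0 by (subst nn_integral_eq_integral[symmetric]) auto
  moreover have "0 \<le> I" unfolding I_def using \<Psi>0 by (intro integral_nonneg_AE) auto
  ultimately show "(LINT x|torus. \<Psi> (g x)) \<le> (LINT x|torus. \<Psi> (f x))" by (simp add: I_def)
qed

lemma helmholtz_L2:
  assumes "f \<in> borel_measurable borel" "g \<in> borel_measurable borel"
    and "periodic f" "integrable torus f" "periodic g" "integrable torus g" "helmholtz \<alpha> f g"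
    and "integrable torus (\<lambda>x. (f x)\<^sup>2)"
  shows "integrable torus (\<lambda>x. (g x)\<^sup>2)" "(LINT x|torus. (g x)\<^sup>2) \<le> (LINT x|torus. (f x)\<^sup>2)"
proof -
  have sub: "a\<^sup>2 + (2 * a) * (b - a) \<le> b\<^sup>2" for a b :: real
    using zero_le_power2[of "a - b"] by (simp add: power2_eq_square algebra_simps)
  have m: "mono (\<lambda>a::real. 2 * a)" by (auto simp: mono_def)
  show "integrable torus (\<lambda>x. (g x)\<^sup>2)" "(LINT x|torus. (g x)\<^sup>2) \<le> (LINT x|torus. (f x)\<^sup>2)"
    using helmholtz_convex_contraction[where \<Psi>="\<lambda>a. a\<^sup>2" and G="\<lambda>a. 2 * a", OF assms(1-7) sub m _ _ assms(8)]
      continuous_on_power[OF continuous_on_id, of "UNIV :: real set" 2] by auto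
qed

lemma abs_cube_subgradient: "\<bar>a\<bar> ^ 3 + (3 * (a * \<bar>a\<bar>)) * (b - a) \<le> \<bar>b :: real\<bar> ^ 3"
proof -
  define x y where "x = \<bar>a\<bar>" and "y = \<bar>b\<bar>"
  have xy: "0 \<le> x" "0 \<le> y" by (auto simp: x_def y_def)
  have "a * b \<le> x * y" unfolding x_def y_def by (simp flip: abs_mult)
  then have "x * (a * b) \<le> x * (x * y)" using xy by (intro mult_left_mono)
  moreover have "a * \<bar>a\<bar> * (b - a) = x * (a * b) - x ^ 3"
    unfolding x_def by (simp add: power3_eq_cube algebra_simps)
  moreover have "0 \<le> (x - y)\<^sup>2 * (2 * x + y)" using xy by simp
  then have "3 * (x * (x * y)) \<le> y ^ 3 + 2 * x ^ 3" by (simp add: power2_eq_square power3_eq_cube algebra_simps)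
  ultimately have "x ^ 3 + 3 * (a * \<bar>a\<bar> * (b - a)) \<le> y ^ 3" by linarith
  then show ?thesis by (simp add: x_def y_def mult.assoc)
qed

lemma helmholtz_L3:
  assumes "f \<in> borel_measurable borel" "g \<in> borel_measurable borel"
    and "periodic f" "integrable torus f" "periodic g" "integrable torus g" "helmholtz \<alpha> f g"
    and "integrable torus (\<lambda>x. \<bar>f x\<bar> ^ 3)"
  shows "integrable torus (\<lambda>x. \<bar>g x\<bar> ^ 3)" "(LINT x|torus. \<bar>g x\<bar> ^ 3) \<le> (LINT x|torus. \<bar>f x\<bar> ^ 3)"
proof -
  have m: "mono (\<lambda>a::real. 3 * (a * \<bar>a\<bar>))"
  proof (rule monoI)
    fix a b :: real assume ab: "a \<le> b"
    consider "0 \<le> a" | "a < 0" "0 \<le> b" | "b < 0" using ab by linarith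
    then have "a * \<bar>a\<bar> \<le> b * \<bar>b\<bar>"
    proof cases
      case 1 then show ?thesis using ab by (auto intro: mult_mono)
    next
      case 2 then have "a * \<bar>a\<bar> \<le> 0" "0 \<le> b * \<bar>b\<bar>" by (auto simp: mult_nonpos_nonneg)
      then show ?thesis by linarith
    next
      case 3 then show ?thesis using ab mult_mono[of "- b" "- a" "- b" "- a"] by simp
    qed
    then show "3 * (a * \<bar>a\<bar>) \<le> 3 * (b * \<bar>b\<bar>)" by simp
  qed
  show "integrable torus (\<lambda>x. \<bar>g x\<bar> ^ 3)" "(LINT x|torus. \<bar>g x\<bar> ^ 3) \<le> (LINT x|torus. \<bar>f x\<bar> ^ 3)"
    using helmholtz_convex_contraction[where \<Psi>="\<lambda>a. \<bar>a\<bar> ^ 3" and G="\<lambda>a. 3 * (a * \<bar>a\<bar>)", OF assms(1-7) abs_cube_subgradient m _ _ assms(8)]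
      continuous_on_power[OF continuous_on_rabs[OF continuous_on_id], of "UNIV :: real set" 3] by auto
qed

section \<open>Divergence-free fields and gradient kernels\<close>

text \<open>The distributional divergence, tested against all translates of one fixed kernel.\<close>

definition divfree :: "(real ^ 3 \<Rightarrow> real) \<Rightarrow> (3 \<Rightarrow> real ^ 3 \<Rightarrow> real) \<Rightarrow> bool" where
  "divfree \<phi> w \<longleftrightarrow> (\<forall>y. (\<Sum>i\<in>UNIV. conv (w i) (partial i \<phi>) y) = 0)"

text \<open>The operator \<open>I - \<alpha>\<^sup>2\<Delta>\<close> commutes with the divergence; second differences replace the Laplacian,
  since they only involve translates of the kernel.\<close>

lemma divfree_helmholtz:
  assumes H: "\<And>i. helmholtz \<alpha> (v i) (u i)" and u: "\<And>i. integrable torus (u i)"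
    and \<phi>: "smooth \<phi>" "periodic \<phi>" and d: "divfree \<phi> u"
  shows "divfree \<phi> v"
  unfolding divfree_def
proof
  fix y
  have s: "smooth (partial i \<phi>)" "periodic (partial i \<phi>)" for i
    using smooth_partial partial_periodic \<phi> by auto
  have pm: "partial i \<phi> \<in> borel_measurable borel" for i by (rule smooth_borel[OF s(1)])
  have z: "(\<Sum>i\<in>UNIV. conv (u i) (partial k (partial k (partial i \<phi>))) y) = 0" for k
  proof -
    have "(\<lambda>n. \<Sum>i\<in>UNIV. conv (u i) (diff2 (1 / real (Suc n)) k (partial i \<phi>)) y)
        \<longlonglongrightarrow> (\<Sum>i\<in>UNIV. conv (u i) (partial k (partial k (partial i \<phi>))) y)"
      by (intro tendsto_sum conv_diff2_tendsto(1)[OF u s])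
    moreover have "(\<Sum>i\<in>UNIV. conv (u i) (diff2 h k (partial i \<phi>)) y) = 0" for h
    proof -
      have c: "conv (u i) (diff2 h k (partial i \<phi>)) y = diff2 h k (conv (u i) (partial i \<phi>)) y" for i
      proof -
        obtain B where B: "\<And>x. \<bar>partial i \<phi> x\<bar> \<le> B" using smooth_periodic_bounded[OF s] by blast
        show ?thesis by (rule conv_diff2[OF u pm B, symmetric])
      qed
      have "(\<Sum>i\<in>UNIV. diff2 h k (conv (u i) (partial i \<phi>)) y) = diff2 h k (\<lambda>y. \<Sum>i\<in>UNIV. conv (u i) (partial i \<phi>) y) y"
        unfolding diff2_def by (simp add: sum.distrib sum_subtractf sum_distrib_left flip: sum_divide_distrib)
      then show ?thesis unfolding c using d by (simp add: divfree_def diff2_def)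
    qed
    ultimately show ?thesis by (simp add: LIMSEQ_const_iff)
  qed
  have "(\<Sum>i\<in>UNIV. conv (u i) (laplacian (partial i \<phi>)) y)
      = (\<Sum>k\<in>UNIV. \<Sum>i\<in>UNIV. conv (u i) (partial k (partial k (partial i \<phi>))) y)"
    unfolding conv_laplacian[OF u s] by (rule sum.swap)
  also have "\<dots> = 0" unfolding z by simp
  finally have "(\<Sum>i\<in>UNIV. conv (u i) (laplacian (partial i \<phi>)) y) = 0" .
  then show "(\<Sum>i\<in>UNIV. conv (v i) (partial i \<phi>) y) = 0"
    using d unfolding helmholtz_conv[OF H u s, symmetric]
    by (simp add: divfree_def sum_subtractf sum_distrib_left[symmetric])
qed

text \<open>In the energy flux a convolution with \<open>\<partial>\<^sub>i \<phi>\<close> meets a convolution with \<open>\<phi>\<close>.\<close>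

definition grad_kern :: "(real ^ 3 \<Rightarrow> real) \<Rightarrow> 3 \<Rightarrow> real ^ 3 \<Rightarrow> real" where
  "grad_kern \<phi> i = kern (partial i \<phi>) \<phi>"

lemma partial_odd:
  assumes "mollifier \<kappa> \<delta> \<phi>" shows "partial i \<phi> (- x) = - partial i \<phi> x"
  using partial_reflect[OF mollifierD(1)[OF assms], of i 0 "- x"] mollifierD(3)[OF assms] by simp

lemma partial_mollifier:
  assumes "mollifier \<kappa> \<delta> \<phi>"
  shows "smooth (partial i \<phi>)" "periodic (partial i \<phi>)" "partial i \<phi> \<in> borel_measurable borel"
    "\<exists>B. \<forall>x. \<bar>partial i \<phi> x\<bar> \<le> B"
proof -
  show s: "smooth (partial i \<phi>)" "periodic (partial i \<phi>)"
    using smooth_partial partial_periodic mollifierD[OF assms] by auto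
  show "partial i \<phi> \<in> borel_measurable borel" by (rule smooth_borel[OF s(1)])
  show "\<exists>B. \<forall>x. \<bar>partial i \<phi> x\<bar> \<le> B" using smooth_periodic_bounded[OF s] by metis
qed

lemma kern_swap:
  assumes [measurable]: "a \<in> borel_measurable borel" "b \<in> borel_measurable borel" and p: "periodic a" "periodic b"
  shows "kern a b \<xi> = kern b a (- \<xi>)"
proof -
  have "(LINT \<eta>|torus. a (\<xi> + \<eta>) * b ((\<xi> + \<eta>) - \<xi>)) = kern a b \<xi>"
    unfolding kern_def
  proof (rule integral_torus_shift)
    show "periodic (\<lambda>\<eta>. a \<eta> * b (\<eta> - \<xi>))" using p by (auto simp: periodic_iff add_diff_swap)
  qed measurable
  then show ?thesis by (simp add: kern_def mult.commute add.commute)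
qed

lemma grad_kern_odd:
  assumes \<phi>: "mollifier \<kappa> \<delta> \<phi>"
  shows "grad_kern \<phi> i (- \<xi>) = - grad_kern \<phi> i \<xi>"
proof -
  have [measurable]: "\<phi> \<in> borel_measurable borel" "partial i \<phi> \<in> borel_measurable borel"
    using mollifierD[OF \<phi>] partial_mollifier[OF \<phi>] by auto
  have "(LINT \<eta>|torus. partial i \<phi> (0 - \<eta>) * \<phi> ((0 - \<eta>) - \<xi>)) = grad_kern \<phi> i \<xi>"
    unfolding grad_kern_def kern_def
  proof (rule integral_torus_reflect)
    show "periodic (\<lambda>\<eta>. partial i \<phi> \<eta> * \<phi> (\<eta> - \<xi>))"
      using mollifierD(2)[OF \<phi>] partial_mollifier(2)[OF \<phi>, of i] by (auto simp: periodic_iff add_diff_swap)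
  qed measurable
  moreover have "\<phi> (- \<eta> - \<xi>) = \<phi> (\<eta> + \<xi>)" for \<eta>
    using mollifierD(3)[OF \<phi>, of "\<eta> + \<xi>"] by simp
  ultimately show ?thesis by (simp add: grad_kern_def kern_def partial_odd[OF \<phi>])
qed

lemma grad_kern_props:
  assumes \<phi>: "mollifier \<kappa> \<delta> \<phi>"
  shows "grad_kern \<phi> i \<in> borel_measurable borel" "periodic (grad_kern \<phi> i)" "\<exists>B. \<forall>\<xi>. \<bar>grad_kern \<phi> i \<xi>\<bar> \<le> B"
proof -
  note m = mollifierD(8)[OF \<phi>] partial_mollifier(3)[OF \<phi>]
  show "grad_kern \<phi> i \<in> borel_measurable borel" unfolding grad_kern_def by (rule kern_borel) (use m in auto)
  show "periodic (grad_kern \<phi> i)" unfolding grad_kern_def by (rule kern_periodic[OF mollifierD(2)[OF \<phi>]])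
  obtain B where B: "\<And>x. \<bar>\<phi> x\<bar> \<le> B" using mollifier_bounded[OF \<phi>] by blast
  obtain A where A: "\<And>x. \<bar>partial i \<phi> x\<bar> \<le> A" using partial_mollifier(4)[OF \<phi>] by blast
  show "\<exists>B. \<forall>\<xi>. \<bar>grad_kern \<phi> i \<xi>\<bar> \<le> B"
    unfolding grad_kern_def using kern_bound[OF m(2,1) A B] by blast
qed

text \<open>The kernel is odd, so the derivative can be moved to its other factor, at the price of a sign. There
  it falls on the convolution of \<open>w\<close>, where it produces the divergence.\<close>

lemma grad_kern_divfree:
  assumes \<phi>: "mollifier \<kappa> \<delta> \<phi>" and wm: "\<And>i. w i \<in> borel_measurable borel"
    and w: "\<And>i. integrable torus (w i)" "\<And>i. periodic (w i)" and d: "divfree \<phi> w"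
  shows "(\<Sum>i\<in>UNIV. LINT \<xi>|torus. grad_kern \<phi> i \<xi> * w i (x + \<xi>)) = 0"
proof -
  note m = mollifierD(8)[OF \<phi>] partial_mollifier(3)[OF \<phi>]
  obtain B where B: "\<And>x. \<bar>\<phi> x\<bar> \<le> B" using mollifier_bounded[OF \<phi>] by blast
  have *: "(LINT \<xi>|torus. grad_kern \<phi> i \<xi> * w i (x + \<xi>)) = - (LINT y|torus. \<phi> (y - x) * conv (w i) (partial i \<phi>) y)"
    and I: "integrable torus (\<lambda>y. \<phi> (y - x) * conv (w i) (partial i \<phi>) y)" for i
  proof -
    obtain A where A: "\<And>x. \<bar>partial i \<phi> x\<bar> \<le> A" using partial_mollifier(4)[OF \<phi>] by blast
    have "grad_kern \<phi> i \<xi> = - kern \<phi> (partial i \<phi>) \<xi>" for \<xi>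
      using grad_kern_odd[OF \<phi>, of i "- \<xi>"] kern_swap[OF m(1) m(2)[of i] mollifierD(2)[OF \<phi>] partial_mollifier(2)[OF \<phi>, of i], of \<xi>]
      by (simp add: grad_kern_def)
    then show "(LINT \<xi>|torus. grad_kern \<phi> i \<xi> * w i (x + \<xi>)) = - (LINT y|torus. \<phi> (y - x) * conv (w i) (partial i \<phi>) y)"
      using integral_kern_shift[OF wm m(1,2) w(1) w(2) B mollifierD(2)[OF \<phi>] A partial_mollifier(2)[OF \<phi>]] by simp
    have ic: "integrable torus (conv (w i) (partial i \<phi>))"
      by (rule integrable_torus_bounded[OF conv_borel[OF wm m(2)] conv_bound[OF w(1) m(2) A]])
    have [measurable]: "\<phi> \<in> borel_measurable borel" by (rule m)
    have "integrable torus (\<lambda>y. conv (w i) (partial i \<phi>) y * \<phi> (y - x))"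
      by (rule integrable_mult_bounded_torus[where B=B, OF ic _ B]) measurable
    then show "integrable torus (\<lambda>y. \<phi> (y - x) * conv (w i) (partial i \<phi>) y)" by (simp add: mult.commute)
  qed
  have "(\<Sum>i\<in>UNIV. LINT \<xi>|torus. grad_kern \<phi> i \<xi> * w i (x + \<xi>))
      = - (LINT y|torus. \<phi> (y - x) * (\<Sum>i\<in>UNIV. conv (w i) (partial i \<phi>) y))"
    unfolding * using I by (simp add: sum_distrib_left sum_negf)
  also have "\<dots> = 0" using d by (simp add: divfree_def)
  finally show ?thesis .
qed

lemma integrable_mult_of_squares:
  fixes f g :: "'a \<Rightarrow> real"
  assumes [measurable]: "f \<in> borel_measurable M" "g \<in> borel_measurable M"
    and "integrable M (\<lambda>x. (f x)\<^sup>2)" "integrable M (\<lambda>x. (g x)\<^sup>2)"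
  shows "integrable M (\<lambda>x. f x * g x)"
proof (rule Bochner_Integration.integrable_bound)
  show "integrable M (\<lambda>x. (f x)\<^sup>2 + (g x)\<^sup>2)" using assms by auto
  have "\<bar>a * b\<bar> \<le> a\<^sup>2 + b\<^sup>2" for a b :: real
  proof -
    have "\<bar>a * b\<bar> \<le> 2 * (\<bar>a\<bar> * \<bar>b\<bar>)" by (simp add: abs_mult)
    also have "\<dots> \<le> a\<^sup>2 + b\<^sup>2"
      using zero_le_power2[of "\<bar>a\<bar> - \<bar>b\<bar>"] by (simp add: power2_eq_square algebra_simps)
    finally show ?thesis .
  qed
  then show "AE x in M. norm (f x * g x) \<le> norm ((f x)\<^sup>2 + (g x)\<^sup>2)"
    by (intro always_eventually) (simp add: abs_of_nonneg)
qed measurable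

definition corr :: "(real ^ 3 \<Rightarrow> real) \<Rightarrow> (real ^ 3 \<Rightarrow> real) \<Rightarrow> (real ^ 3 \<Rightarrow> real) \<Rightarrow> real" where
  "corr K f g = (LINT z|(torus \<Otimes>\<^sub>M torus). K (snd z) * (f (fst z) * g (fst z + snd z)))"

lemma corr_integrable:
  fixes f g K :: "real ^ 3 \<Rightarrow> real"
  assumes "f \<in> borel_measurable borel" "g \<in> borel_measurable borel" "K \<in> borel_measurable borel"
    and "integrable torus f" "integrable torus g" "periodic g" "\<exists>B. \<forall>x. \<bar>K x\<bar> \<le> B"
  shows "integrable (torus \<Otimes>\<^sub>M torus) (\<lambda>z. K (snd z) * (f (fst z) * g (fst z + snd z)))"
proof -
  obtain B where "\<And>x. \<bar>K x\<bar> \<le> B" using assms(7) by blast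
  from integrable_correlation[OF assms(1-6) this] show ?thesis by (simp add: split_def)
qed

lemma corr_fst:
  fixes f g K :: "real ^ 3 \<Rightarrow> real"
  assumes "f \<in> borel_measurable borel" "g \<in> borel_measurable borel" "K \<in> borel_measurable borel"
    and "integrable torus f" "integrable torus g" "periodic g" "\<exists>B. \<forall>x. \<bar>K x\<bar> \<le> B"
  shows "corr K f g = (LINT x|torus. f x * (LINT \<xi>|torus. K \<xi> * g (x + \<xi>)))"
    and "integrable torus (\<lambda>x. f x * (LINT \<xi>|torus. K \<xi> * g (x + \<xi>)))"
proof -
  have eq: "(LINT \<xi>|torus. K \<xi> * (f x * g (x + \<xi>))) = f x * (LINT \<xi>|torus. K \<xi> * g (x + \<xi>))" for x
    by (simp flip: integral_mult_right_zero add: mult_ac)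
  show "corr K f g = (LINT x|torus. f x * (LINT \<xi>|torus. K \<xi> * g (x + \<xi>)))"
    unfolding corr_def using torus2.integral_fst'[OF corr_integrable[OF assms]] by (simp add: eq)
  show "integrable torus (\<lambda>x. f x * (LINT \<xi>|torus. K \<xi> * g (x + \<xi>)))"
    using torus2.integrable_fst'[OF corr_integrable[OF assms]] by (simp add: eq)
qed

lemma corr_snd:
  fixes f g K :: "real ^ 3 \<Rightarrow> real"
  assumes "f \<in> borel_measurable borel" "g \<in> borel_measurable borel" "K \<in> borel_measurable borel"
    and "integrable torus f" "integrable torus g" "periodic g" "\<exists>B. \<forall>x. \<bar>K x\<bar> \<le> B"
  shows "corr K f g = (LINT \<xi>|torus. (LINT x|torus. K \<xi> * (f x * g (x + \<xi>))))"
proof -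
  have "integrable (torus \<Otimes>\<^sub>M torus) (case_prod (\<lambda>x \<xi>. K \<xi> * (f x * g (x + \<xi>))))"
    using corr_integrable[OF assms] by (simp add: split_def)
  from torus2.integral_snd[OF this] show ?thesis unfolding corr_def by (simp only: split_def)
qed

text \<open>Translate by \<open>\<xi>\<close>, which exchanges the two functions, and reflect \<open>\<xi>\<close>, which gives the sign.\<close>

lemma corr_swap:
  fixes f g K :: "real ^ 3 \<Rightarrow> real"
  assumes m [measurable]: "f \<in> borel_measurable borel" "g \<in> borel_measurable borel" "K \<in> borel_measurable borel"
    and f: "integrable torus f" "periodic f" and g: "integrable torus g" "periodic g"
    and K: "\<exists>B. \<forall>x. \<bar>K x\<bar> \<le> B" "periodic K" and odd: "\<And>\<xi>. K (- \<xi>) = - K \<xi>"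
  shows "corr K f g = - corr K g f"
proof -
  have "corr K f g = (LINT \<xi>|torus. (LINT x|torus. K \<xi> * (f x * g (x + \<xi>))))"
    by (rule corr_snd[OF m f(1) g K(1)])
  also have "\<dots> = (LINT \<xi>|torus. (LINT x|torus. K \<xi> * (g x * f (x - \<xi>))))"
  proof (rule Bochner_Integration.integral_cong[OF refl])
    fix \<xi>
    have "(LINT x|torus. K \<xi> * (g (\<xi> + x) * f ((\<xi> + x) - \<xi>))) = (LINT x|torus. K \<xi> * (g x * f (x - \<xi>)))"
    proof (rule integral_torus_shift)
      show "periodic (\<lambda>x. K \<xi> * (g x * f (x - \<xi>)))" using f g by (auto simp: periodic_iff add_diff_swap)
    qed measurable
    then show "(LINT x|torus. K \<xi> * (f x * g (x + \<xi>))) = (LINT x|torus. K \<xi> * (g x * f (x - \<xi>)))"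
      by (simp add: add.commute mult_ac)
  qed
  also have "\<dots> = (LINT \<xi>|torus. (LINT x|torus. K (0 - \<xi>) * (g x * f (x - (0 - \<xi>)))))"
  proof (rule integral_torus_reflect[symmetric])
    have "(\<lambda>(\<xi>, x). K \<xi> * (g x * f (x - \<xi>))) \<in> borel_measurable (borel \<Otimes>\<^sub>M torus)"
      by (rule measurable_compose[OF pair_to_borel[OF _ torus_to_borel]]) measurable
    then show "(\<lambda>\<xi>. LINT x|torus. K \<xi> * (g x * f (x - \<xi>))) \<in> borel_measurable borel"
      by (rule torus.borel_measurable_lebesgue_integral)
    show "periodic (\<lambda>\<xi>. LINT x|torus. K \<xi> * (g x * f (x - \<xi>)))"
      using K(2) periodic_reflect[OF f(2)] by (auto simp: periodic_iff)
  qed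
  also have "\<dots> = - (LINT \<xi>|torus. (LINT x|torus. K \<xi> * (g x * f (x + \<xi>))))"
    by (simp add: odd)
  also have "(LINT \<xi>|torus. (LINT x|torus. K \<xi> * (g x * f (x + \<xi>)))) = corr K g f"
    by (rule corr_snd[OF m(2,1,3) g(1) f K(1), symmetric])
  finally show ?thesis .
qed

section \<open>The flux as an integral of increments\<close>

definition L2_field :: "(real ^ 3 \<Rightarrow> real ^ 3) \<Rightarrow> bool" where
  "L2_field w \<longleftrightarrow> periodic w \<and> w \<in> borel_measurable borel \<and> integrable torus (\<lambda>x. (norm (w x))\<^sup>2)"

lemma norm_vec_sq: "(norm (w :: real ^ 3))\<^sup>2 = (\<Sum>j\<in>UNIV. (w $ j)\<^sup>2)"
  by (simp add: norm_vec_def L2_set_def sum_nonneg)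

lemma borel_measurable_nth' [measurable (raw)]:
  fixes f :: "'a \<Rightarrow> real ^ 3"
  assumes "f \<in> borel_measurable M" shows "(\<lambda>x. f x $ i) \<in> borel_measurable M"
  using measurable_compose[OF assms, of "\<lambda>x. x $ i"]
    borel_measurable_continuous_onI[of "\<lambda>x::real ^ 3. x $ i"] by (simp add: continuous_intros)

lemma L2_fieldD:
  assumes "L2_field w"
  shows "periodic w" "w \<in> borel_measurable borel" "periodic (\<lambda>x. w x $ i)" "(\<lambda>x. w x $ i) \<in> borel_measurable borel"
    "integrable torus (\<lambda>x. (w x $ i)\<^sup>2)" "integrable torus (\<lambda>x. w x $ i)"
    "integrable torus (\<lambda>x. (norm (w x))\<^sup>2)"
proof -
  show p: "periodic w" and [measurable]: "w \<in> borel_measurable borel" and n: "integrable torus (\<lambda>x. (norm (w x))\<^sup>2)"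
    using assms by (auto simp: L2_field_def)
  show "periodic (\<lambda>x. w x $ i)" by (rule periodic_comp[OF p])
  show m: "(\<lambda>x. w x $ i) \<in> borel_measurable borel" by measurable
  show i: "integrable torus (\<lambda>x. (w x $ i)\<^sup>2)"
  proof (rule Bochner_Integration.integrable_bound[OF n])
    show "(\<lambda>x. (w x $ i)\<^sup>2) \<in> borel_measurable torus" by (rule measurable_torus) measurable
    show "AE x in torus. norm ((w x $ i)\<^sup>2) \<le> norm ((norm (w x))\<^sup>2)"
      using component_le_norm_cart by (intro always_eventually allI) (simp add: abs_le_square_iff[symmetric])
  qed
  show "integrable torus (\<lambda>x. w x $ i)"
    by (rule torus.square_integrable_imp_integrable[OF measurable_torus[OF m] i])
qed

lemma L2_field_mult:
  assumes "L2_field u" "L2_field v"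
  shows "integrable torus (\<lambda>x. u x $ i * v x $ j)" "(\<lambda>x. u x $ i * v x $ j) \<in> borel_measurable borel"
    "periodic (\<lambda>x. u x $ i * v x $ j)"
proof -
  note [measurable] = L2_fieldD(4)[OF assms(1)] L2_fieldD(4)[OF assms(2)]
  show "integrable torus (\<lambda>x. u x $ i * v x $ j)"
    by (rule integrable_mult_of_squares) (intro measurable_torus L2_fieldD assms)+
  show "(\<lambda>x. u x $ i * v x $ j) \<in> borel_measurable borel" by measurable
  show "periodic (\<lambda>x. u x $ i * v x $ j)"
    using L2_fieldD(1)[OF assms(1)] L2_fieldD(1)[OF assms(2)] by (simp add: periodic_def)
qed

text \<open>The divergence of the mollified tensor \<open>u \<otimes> v + p I\<close>, component \<open>j\<close>, with the derivative on the kernel.\<close>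

definition flux :: "(real ^ 3 \<Rightarrow> real) \<Rightarrow> (real ^ 3 \<Rightarrow> real ^ 3) \<Rightarrow> (real ^ 3 \<Rightarrow> real ^ 3) \<Rightarrow> (real ^ 3 \<Rightarrow> real) \<Rightarrow> 3 \<Rightarrow> real ^ 3 \<Rightarrow> real" where
  "flux \<phi> u v p j y = (\<Sum>i\<in>UNIV. conv (\<lambda>x. u x $ i * v x $ j) (partial i \<phi>) y) + conv p (partial j \<phi>) y"

text \<open>Expand \<open>\<delta>u\<^sub>i \<bar>\<delta>v\<bar>\<^sup>2\<close>. The two terms where \<open>u\<close> and \<open>\<bar>v\<bar>\<^sup>2\<close> sit at different points vanish since \<open>u\<close> is
  divergence-free. Those where they sit at the same point form an increment of \<open>u\<^sub>i \<bar>v\<bar>\<^sup>2\<close>, which has integral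
  zero by \<open>integral_coboundary\<close>, although \<open>u\<^sub>i \<bar>v\<bar>\<^sup>2\<close> itself may fail to be integrable. The mixed terms with
  \<open>v(x) \<cdot> v(x + \<xi>)\<close> occur twice, with a factor \<open>2\<close> each, and agree since the kernel is odd.\<close>

lemma increment_identity:
  assumes \<phi>: "mollifier \<kappa> \<delta> \<phi>" and u: "L2_field u" and v: "L2_field v" and d: "divfree \<phi> (\<lambda>i x. u x $ i)"
    and fin: "\<And>i. integrable (torus \<Otimes>\<^sub>M torus)
      (\<lambda>z. grad_kern \<phi> i (snd z) * (increment (snd z) u (fst z) $ i * (norm (increment (snd z) v (fst z)))\<^sup>2))"
  shows "(\<Sum>i\<in>UNIV. LINT z|(torus \<Otimes>\<^sub>M torus).
        grad_kern \<phi> i (snd z) * (increment (snd z) u (fst z) $ i * (norm (increment (snd z) v (fst z)))\<^sup>2))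
      = 4 * (\<Sum>i\<in>UNIV. \<Sum>j\<in>UNIV. corr (grad_kern \<phi> i) (\<lambda>x. u x $ i * v x $ j) (\<lambda>x. v x $ j))"
proof -
  define V where "V x = (norm (v x))\<^sup>2" for x
  note um [measurable] = L2_fieldD(4)[OF u] and vm [measurable] = L2_fieldD(4)[OF v]
  have [measurable]: "v \<in> borel_measurable borel" by (rule L2_fieldD[OF v])
  have Vm [measurable]: "V \<in> borel_measurable borel" unfolding V_def by measurable
  have V: "integrable torus V" "periodic V"
    unfolding V_def[abs_def] using L2_fieldD(7)[OF v] periodic_comp[OF L2_fieldD(1)[OF v], of "\<lambda>w. (norm w)\<^sup>2"] by auto
  note ui = L2_fieldD(6)[OF u] and up = L2_fieldD(3)[OF u] and vi = L2_fieldD(6)[OF v] and vp = L2_fieldD(3)[OF v]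
  note uv = L2_field_mult[OF u v]
  note K = grad_kern_props[OF \<phi>]
  define T1 where "T1 i z = grad_kern \<phi> i (snd z) *
    (u (fst z + snd z) $ i * V (fst z + snd z) - u (fst z) $ i * V (fst z))" for i z
  define c where "c K f g z = K (snd z) * (f (fst z) * g (fst z + snd z))" for K f g :: "real ^ 3 \<Rightarrow> real" and z
  let ?K = "grad_kern \<phi>" and ?u = "\<lambda>i x. u x $ i" and ?v = "\<lambda>j x. v x $ j" and ?uv = "\<lambda>i j x. u x $ i * v x $ j"
  let ?A = "\<lambda>i z. grad_kern \<phi> i (snd z) * (increment (snd z) u (fst z) $ i * (norm (increment (snd z) v (fst z)))\<^sup>2)"
  have exp: "?A i z = T1 i z + (c (?K i) V (?u i) z - c (?K i) (?u i) V z
      - 2 * (\<Sum>j\<in>UNIV. c (?K i) (?v j) (?uv i j) z) + 2 * (\<Sum>j\<in>UNIV. c (?K i) (?uv i j) (?v j) z))" for i z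
  proof -
    let ?y = "fst z + snd z" and ?x = "fst z"
    have sq: "(norm (increment (snd z) v ?x))\<^sup>2 = V ?y + V ?x - 2 * (\<Sum>j\<in>UNIV. v ?x $ j * v ?y $ j)"
      unfolding V_def norm_vec_sq increment_def sum_distrib_left sum.distrib[symmetric] sum_subtractf[symmetric]
      by (rule sum.cong) (auto simp: power2_eq_square algebra_simps)
    have "(\<Sum>j\<in>UNIV. c (?K i) (?v j) (?uv i j) z) = ?K i (snd z) * (u ?y $ i * (\<Sum>j\<in>UNIV. v ?x $ j * v ?y $ j))"
      "(\<Sum>j\<in>UNIV. c (?K i) (?uv i j) (?v j) z) = ?K i (snd z) * (u ?x $ i * (\<Sum>j\<in>UNIV. v ?x $ j * v ?y $ j))"
      unfolding c_def sum_distrib_left by (auto intro!: sum.cong simp: algebra_simps)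
    then show ?thesis unfolding sq unfolding T1_def c_def increment_def by (simp add: algebra_simps)
  qed
  have Ic: "integrable (torus \<Otimes>\<^sub>M torus) (c (?K i) V (?u i))" "integrable (torus \<Otimes>\<^sub>M torus) (c (?K i) (?u i) V)"
    "integrable (torus \<Otimes>\<^sub>M torus) (c (?K i) (?v j) (?uv i j))" "integrable (torus \<Otimes>\<^sub>M torus) (c (?K i) (?uv i j) (?v j))" for i j
    unfolding c_def
    by (rule corr_integrable[OF Vm um K(1) V(1) ui up K(3)] corr_integrable[OF um Vm K(1) ui V K(3)]
        corr_integrable[OF vm uv(2) K(1) vi uv(1,3) K(3)] corr_integrable[OF uv(2) vm K(1) uv(1) vi vp K(3)])+
  have IT: "integrable (torus \<Otimes>\<^sub>M torus) (T1 i)" for i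
  proof -
    have "T1 i = (\<lambda>z. ?A i z - (c (?K i) V (?u i) z - c (?K i) (?u i) V z
      - 2 * (\<Sum>j\<in>UNIV. c (?K i) (?v j) (?uv i j) z) + 2 * (\<Sum>j\<in>UNIV. c (?K i) (?uv i j) (?v j) z)))"
      using exp[of i] by (auto simp: fun_eq_iff)
    then show ?thesis
      by (auto intro!: Bochner_Integration.integrable_diff Bochner_Integration.integrable_add integrable_mult_right
          Bochner_Integration.integrable_sum Ic fin)
  qed
  have z1: "(LINT z|(torus \<Otimes>\<^sub>M torus). T1 i z) = 0" for i
  proof -
    define h where "h x = u x $ i * V x" for x
    have [measurable]: "h \<in> borel_measurable borel" unfolding h_def by measurable
    have hp: "periodic h" unfolding h_def using up V(2) by (rule periodic_comp2)
    have I: "integrable (torus \<Otimes>\<^sub>M torus) (case_prod (\<lambda>x \<xi>. ?K i \<xi> * (h (x + \<xi>) - h x)))"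
      using IT[of i] by (simp add: T1_def[abs_def] h_def split_def)
    have "(LINT z|(torus \<Otimes>\<^sub>M torus). T1 i z) = (LINT \<xi>|torus. (LINT x|torus. ?K i \<xi> * (h (x + \<xi>) - h x)))"
      unfolding torus2.integral_snd[OF I] by (simp add: T1_def h_def split_def)
    also have "\<dots> = (LINT \<xi>|torus. 0)"
    proof (rule integral_cong_AE)
      show "(\<lambda>\<xi>. LINT x|torus. ?K i \<xi> * (h (x + \<xi>) - h x)) \<in> borel_measurable torus"
        using torus2.integrable_snd[OF I] by auto
      show "AE \<xi> in torus. (LINT x|torus. ?K i \<xi> * (h (x + \<xi>) - h x)) = 0"
        using torus2.AE_integrable_snd[OF I]
      proof eventually_elim
        case (elim \<xi>)
        show ?case
        proof (cases "?K i \<xi> = 0")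
          case False
          then have "integrable torus (\<lambda>x. h (\<xi> + x) - h x)"
            using elim by (simp add: add.commute[of \<xi>])
          from integral_coboundary[OF _ hp this] show ?thesis by (simp add: add.commute[of \<xi>])
        qed simp
      qed
    qed simp
    finally show ?thesis by simp
  qed
  have z2: "(\<Sum>i\<in>UNIV. LINT z|(torus \<Otimes>\<^sub>M torus). c (?K i) V (?u i) z) = 0"
  proof -
    have "(\<Sum>i\<in>UNIV. corr (?K i) V (?u i)) = (LINT x|torus. (\<Sum>i\<in>UNIV. V x * (LINT \<xi>|torus. ?K i \<xi> * u (x + \<xi>) $ i)))"
      using corr_fst[OF Vm um K(1) V(1) ui up K(3)] by simp
    also have "\<dots> = (LINT x|torus. V x * (\<Sum>i\<in>UNIV. LINT \<xi>|torus. ?K i \<xi> * u (x + \<xi>) $ i))"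
      by (simp only: sum_distrib_left)
    also have "\<dots> = 0" using grad_kern_divfree[OF \<phi> um ui up d] by simp
    finally show ?thesis unfolding corr_def c_def .
  qed
  have z3: "(LINT z|(torus \<Otimes>\<^sub>M torus). c (?K i) (?u i) V z) = - (LINT z|(torus \<Otimes>\<^sub>M torus). c (?K i) V (?u i) z)" for i
    using corr_swap[OF um Vm K(1) ui up V K(3,2) grad_kern_odd[OF \<phi>]] by (simp add: corr_def c_def)
  have z4: "(LINT z|(torus \<Otimes>\<^sub>M torus). c (?K i) (?v j) (?uv i j) z) = - corr (?K i) (?uv i j) (?v j)" for i j
    using corr_swap[OF vm uv(2) K(1) vi vp uv(1,3) K(3,2) grad_kern_odd[OF \<phi>]] by (simp add: corr_def c_def)
  have "(LINT z|(torus \<Otimes>\<^sub>M torus). ?A i z) = 2 * (LINT z|(torus \<Otimes>\<^sub>M torus). c (?K i) V (?u i) z)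
      + 4 * (\<Sum>j\<in>UNIV. corr (?K i) (?uv i j) (?v j))" for i
  proof -
    have "(LINT z|(torus \<Otimes>\<^sub>M torus). ?A i z) = (LINT z|(torus \<Otimes>\<^sub>M torus). T1 i z)
      + ((LINT z|(torus \<Otimes>\<^sub>M torus). c (?K i) V (?u i) z) - (LINT z|(torus \<Otimes>\<^sub>M torus). c (?K i) (?u i) V z)
      - 2 * (\<Sum>j\<in>UNIV. LINT z|(torus \<Otimes>\<^sub>M torus). c (?K i) (?v j) (?uv i j) z)
      + 2 * (\<Sum>j\<in>UNIV. LINT z|(torus \<Otimes>\<^sub>M torus). c (?K i) (?uv i j) (?v j) z))"
      unfolding exp using IT Ic by simp
    also have "(\<Sum>j\<in>UNIV. LINT z|(torus \<Otimes>\<^sub>M torus). c (?K i) (?uv i j) (?v j) z) = (\<Sum>j\<in>UNIV. corr (?K i) (?uv i j) (?v j))"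
      by (simp add: corr_def c_def)
    finally show ?thesis unfolding z1 z3 z4 by (simp add: sum_negf)
  qed
  then have "(\<Sum>i\<in>UNIV. LINT z|(torus \<Otimes>\<^sub>M torus). ?A i z) =
      2 * (\<Sum>i\<in>UNIV. LINT z|(torus \<Otimes>\<^sub>M torus). c (?K i) V (?u i) z) + 4 * (\<Sum>i\<in>UNIV. \<Sum>j\<in>UNIV. corr (?K i) (?uv i j) (?v j))"
    by (simp add: sum.distrib sum_distrib_left)
  then show ?thesis unfolding z2 by simp
qed

text \<open>The pressure meets the divergence of the mollified \<open>v\<close>, which is zero.\<close>

lemma flux_integral_eq_corr:
  assumes \<phi>: "mollifier \<kappa> \<delta> \<phi>" and u: "L2_field u" and v: "L2_field v" and dv: "divfree \<phi> (\<lambda>i x. v x $ i)"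
    and p: "p \<in> borel_measurable borel" "integrable torus p"
  shows "(\<Sum>j\<in>UNIV. LINT y|torus. conv (\<lambda>x. v x $ j) \<phi> y * flux \<phi> u v p j y)
     = (\<Sum>i\<in>UNIV. \<Sum>j\<in>UNIV. corr (grad_kern \<phi> i) (\<lambda>x. u x $ i * v x $ j) (\<lambda>x. v x $ j))"
proof -
  note vm = L2_fieldD(4)[OF v] and vi = L2_fieldD(6)[OF v] and vp = L2_fieldD(3)[OF v]
  note uv = L2_field_mult[OF u v]
  note \<phi>m = mollifierD(8)[OF \<phi>] and pm = partial_mollifier(3)[OF \<phi>]
  note K = grad_kern_props[OF \<phi>]
  obtain B where B: "\<And>x. \<bar>\<phi> x\<bar> \<le> B" using mollifier_bounded[OF \<phi>] by blast
  have "\<exists>D. \<forall>i x. \<bar>partial i \<phi> x\<bar> \<le> D i" using partial_mollifier(4)[OF \<phi>] by metis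
  then obtain D where D: "\<And>i x. \<bar>partial i \<phi> x\<bar> \<le> D i" by blast
  have I: "integrable torus (\<lambda>y. conv (\<lambda>x. v x $ j) \<phi> y * conv f (partial i \<phi>) y)"
    if f: "f \<in> borel_measurable borel" "integrable torus f" for f i j
  proof -
    have "integrable torus (conv (\<lambda>x. v x $ j) \<phi>)"
      by (rule integrable_torus_bounded[OF conv_borel[OF vm \<phi>m] conv_bound[OF vi \<phi>m B]])
    then show ?thesis
      by (rule integrable_mult_bounded_torus[OF _ conv_borel[OF f(1) pm] conv_bound[OF f(2) pm D]])
  qed
  have M: "(LINT y|torus. conv (\<lambda>x. v x $ j) \<phi> y * conv f (partial i \<phi>) y) =
      (LINT x|torus. f x * (LINT \<xi>|torus. grad_kern \<phi> i \<xi> * v (x + \<xi>) $ j))"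
    if f: "f \<in> borel_measurable borel" "integrable torus f" for f i j
    unfolding grad_kern_def
    using integral_conv_mult_conv[OF f(1) vm pm \<phi>m f(2) vi vp D partial_mollifier(2)[OF \<phi>] B mollifierD(2)[OF \<phi>]]
    by (simp add: mult.commute)
  have z: "(\<Sum>j\<in>UNIV. LINT y|torus. conv (\<lambda>x. v x $ j) \<phi> y * conv p (partial j \<phi>) y) = 0"
  proof -
    have "(\<Sum>j\<in>UNIV. LINT y|torus. conv (\<lambda>x. v x $ j) \<phi> y * conv p (partial j \<phi>) y) =
        (LINT x|torus. (\<Sum>j\<in>UNIV. p x * (LINT \<xi>|torus. grad_kern \<phi> j \<xi> * v (x + \<xi>) $ j)))"
      unfolding M[OF p] using corr_fst(2)[OF p(1) vm K(1) p(2) vi vp K(3)] by simp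
    also have "\<dots> = (LINT x|torus. p x * (\<Sum>j\<in>UNIV. LINT \<xi>|torus. grad_kern \<phi> j \<xi> * v (x + \<xi>) $ j))"
      by (simp only: sum_distrib_left)
    also have "\<dots> = 0" using grad_kern_divfree[OF \<phi> vm vi vp dv] by simp
    finally show ?thesis .
  qed
  have "(\<Sum>j\<in>UNIV. LINT y|torus. conv (\<lambda>x. v x $ j) \<phi> y * flux \<phi> u v p j y) =
      (\<Sum>j\<in>UNIV. (\<Sum>i\<in>UNIV. LINT y|torus. conv (\<lambda>x. v x $ j) \<phi> y * conv (\<lambda>x. u x $ i * v x $ j) (partial i \<phi>) y)
        + (LINT y|torus. conv (\<lambda>x. v x $ j) \<phi> y * conv p (partial j \<phi>) y))"
    unfolding flux_def using I[OF uv(2,1)] I[OF p] by (simp add: distrib_left sum_distrib_left)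
  also have "\<dots> = (\<Sum>j\<in>UNIV. \<Sum>i\<in>UNIV. LINT y|torus. conv (\<lambda>x. v x $ j) \<phi> y * conv (\<lambda>x. u x $ i * v x $ j) (partial i \<phi>) y)"
    using z by (simp add: sum.distrib)
  also have "\<dots> = (\<Sum>j\<in>UNIV. \<Sum>i\<in>UNIV. corr (grad_kern \<phi> i) (\<lambda>x. u x $ i * v x $ j) (\<lambda>x. v x $ j))"
    unfolding M[OF uv(2,1)] using corr_fst(1)[OF uv(2) vm K(1) uv(1) vi vp K(3)] by simp
  also have "\<dots> = (\<Sum>i\<in>UNIV. \<Sum>j\<in>UNIV. corr (grad_kern \<phi> i) (\<lambda>x. u x $ i * v x $ j) (\<lambda>x. v x $ j))"
    by (rule sum.swap)
  finally show ?thesis .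
qed

text \<open>Where the right-hand side is infinite there is nothing to prove; where it is finite, it provides the
  integrability on which \<open>increment_identity\<close> rests.\<close>

lemma flux_integral_bound:
  assumes \<phi>: "mollifier \<kappa> \<delta> \<phi>" and u: "L2_field u" and v: "L2_field v"
    and du: "divfree \<phi> (\<lambda>i x. u x $ i)" and dv: "divfree \<phi> (\<lambda>i x. v x $ i)"
    and p: "p \<in> borel_measurable borel" "integrable torus p"
  shows "ennreal \<bar>\<Sum>j\<in>UNIV. LINT y|torus. conv (\<lambda>x. v x $ j) \<phi> y * flux \<phi> u v p j y\<bar>
     \<le> (\<Sum>i\<in>UNIV. \<integral>\<^sup>+\<xi>. ennreal \<bar>grad_kern \<phi> i \<xi>\<bar> *
          (\<integral>\<^sup>+x. ennreal (norm (increment \<xi> u x) * (norm (increment \<xi> v x))\<^sup>2) \<partial>torus) \<partial>torus)"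
    (is "_ \<le> ?N")
proof (cases "?N = top")
  case False
  let ?A = "\<lambda>i z. grad_kern \<phi> i (snd z) * (increment (snd z) u (fst z) $ i * (norm (increment (snd z) v (fst z)))\<^sup>2)"
  let ?n = "\<lambda>i. \<integral>\<^sup>+\<xi>. ennreal \<bar>grad_kern \<phi> i \<xi>\<bar> * (\<integral>\<^sup>+x. ennreal (norm (increment \<xi> u x) * (norm (increment \<xi> v x))\<^sup>2) \<partial>torus) \<partial>torus"
  have [measurable]: "u \<in> borel_measurable borel" "v \<in> borel_measurable borel" by (auto intro: L2_fieldD u v)
  note K [measurable] = grad_kern_props(1)[OF \<phi>]
  have m: "?A i \<in> borel_measurable (torus \<Otimes>\<^sub>M torus)" for i
    unfolding increment_def by (rule measurable_torus2) measurable
  have n: "(\<integral>\<^sup>+z. norm (?A i z) \<partial>(torus \<Otimes>\<^sub>M torus)) \<le> ?n i" for i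
  proof -
    have "(\<integral>\<^sup>+z. norm (?A i z) \<partial>(torus \<Otimes>\<^sub>M torus)) = (\<integral>\<^sup>+\<xi>. \<integral>\<^sup>+x. norm (?A i (x, \<xi>)) \<partial>torus \<partial>torus)"
      using m[of i] by (subst torus2.nn_integral_snd[symmetric]) auto
    also have "\<dots> \<le> (\<integral>\<^sup>+\<xi>. \<integral>\<^sup>+x. ennreal \<bar>grad_kern \<phi> i \<xi>\<bar> * ennreal (norm (increment \<xi> u x) * (norm (increment \<xi> v x))\<^sup>2) \<partial>torus \<partial>torus)"
    proof (intro nn_integral_mono)
      fix x \<xi> :: "real ^ 3"
      have "norm (?A i (x, \<xi>)) \<le> \<bar>grad_kern \<phi> i \<xi>\<bar> * (norm (increment \<xi> u x) * (norm (increment \<xi> v x))\<^sup>2)"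
        using component_le_norm_cart[of "increment \<xi> u x" i]
        by (auto simp: abs_mult intro!: mult_left_mono mult_right_mono)
      then show "ennreal (norm (?A i (x, \<xi>))) \<le> ennreal \<bar>grad_kern \<phi> i \<xi>\<bar> * ennreal (norm (increment \<xi> u x) * (norm (increment \<xi> v x))\<^sup>2)"
        by (simp add: ennreal_mult'[symmetric] ennreal_leI)
    qed
    also have "\<dots> = ?n i"
    proof (intro nn_integral_cong nn_integral_cmult)
      fix \<xi> show "(\<lambda>x. ennreal (norm (increment \<xi> u x) * (norm (increment \<xi> v x))\<^sup>2)) \<in> borel_measurable torus"
        unfolding increment_def by (rule measurable_torus) measurable
    qed
    finally show ?thesis .
  qed
  have fin: "?n i < top" for i
  proof -
    have "?n i \<le> ?N" by (rule member_le_sum) auto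
    then show ?thesis using False by (simp add: less_top[symmetric])
  qed
  have I: "integrable (torus \<Otimes>\<^sub>M torus) (?A i)" for i
    using le_less_trans[OF n fin] by (intro integrableI_bounded m) auto
  have "(\<Sum>i\<in>UNIV. LINT z|(torus \<Otimes>\<^sub>M torus). ?A i z) =
      4 * (\<Sum>j\<in>UNIV. LINT y|torus. conv (\<lambda>x. v x $ j) \<phi> y * flux \<phi> u v p j y)" (is "?L = 4 * ?F")
    unfolding flux_integral_eq_corr[OF \<phi> u v dv p] by (rule increment_identity[OF \<phi> u v du I])
  then have "\<bar>?F\<bar> \<le> \<bar>?L\<bar>" by simp
  also have "\<dots> \<le> (\<Sum>i\<in>UNIV. LINT z|(torus \<Otimes>\<^sub>M torus). norm (?A i z))"
    by (rule order_trans[OF sum_abs]) (intro sum_mono, unfold real_norm_def, rule integral_abs_bound)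
  finally have "ennreal \<bar>?F\<bar> \<le> ennreal (\<Sum>i\<in>UNIV. LINT z|(torus \<Otimes>\<^sub>M torus). norm (?A i z))" by (rule ennreal_leI)
  also have "\<dots> = (\<Sum>i\<in>UNIV. ennreal (LINT z|(torus \<Otimes>\<^sub>M torus). norm (?A i z)))"
    by (rule sum_ennreal[symmetric]) auto
  also have "\<dots> = (\<Sum>i\<in>UNIV. \<integral>\<^sup>+z. norm (?A i z) \<partial>(torus \<Otimes>\<^sub>M torus))"
    using I by (intro sum.cong refl nn_integral_eq_integral[symmetric]) auto
  also have "\<dots> \<le> ?N" by (intro sum_mono n)
  finally show ?thesis .
next
  case True
  show ?thesis unfolding True by simp
qed

section \<open>Weak derivatives in time\<close>

lemma space_time: "space (time T) = {0<..<T}" by (simp add: time_def space_restrict_space)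

lemma time_to_borel: "(\<lambda>x. x) \<in> time T \<rightarrow>\<^sub>M borel"
  unfolding time_def by (rule measurable_restrict_space1) simp

lemma measurable_time: "f \<in> borel \<rightarrow>\<^sub>M N \<Longrightarrow> f \<in> time T \<rightarrow>\<^sub>M N"
  using measurable_compose[OF time_to_borel] .

lemma finite_measure_time: "finite_measure (time T)"
proof
  have "emeasure (time T) (space (time T)) = emeasure lborel {0<..<T}"
    unfolding time_def by (subst emeasure_restrict_space) (auto simp: space_restrict_space)
  then show "emeasure (time T) (space (time T)) \<noteq> \<infinity>" by (cases "0 \<le> T") auto
qed

interpretation time: finite_measure "time T" for T by (rule finite_measure_time)
interpretation time2: pair_sigma_finite "time T" "time T" for T ..

lemma measurable_time2: "f \<in> borel \<Otimes>\<^sub>M borel \<rightarrow>\<^sub>M N \<Longrightarrow> f \<in> time T \<Otimes>\<^sub>M time T \<rightarrow>\<^sub>M N"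
  using measurable_compose[OF pair_to_borel[OF time_to_borel time_to_borel]] .

lemma integral_time: "f \<in> borel_measurable borel \<Longrightarrow> (LINT t|time T. f t) = (LINT t|lborel. indicator {0<..<T} t * f t :: real)"
  unfolding time_def by (subst integral_restrict_space) (auto simp: set_lebesgue_integral_def)

lemma AE_time_neq: "AE t in time T. t \<noteq> c"
  unfolding time_def by (subst AE_restrict_space_iff) (auto intro: AE_mp[OF AE_lborel_singleton])

definition time_test :: "real \<Rightarrow> (real \<Rightarrow> real) \<Rightarrow> bool" where
  "time_test T \<theta> \<longleftrightarrow> smooth \<theta> \<and> (\<exists>a b. 0 < a \<and> b < T \<and> (\<forall>t. t \<notin> {a..b} \<longrightarrow> \<theta> t = 0))"

definition weak_deriv :: "real \<Rightarrow> (real \<Rightarrow> real) \<Rightarrow> (real \<Rightarrow> real) \<Rightarrow> bool" where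
  "weak_deriv T f g \<longleftrightarrow> (\<forall>\<theta>. time_test T \<theta> \<longrightarrow> (LINT t|time T. deriv \<theta> t * f t) + (LINT t|time T. \<theta> t * g t) = 0)"

text \<open>Absolutely continuous functions on \<open>(0, T)\<close> with integrable derivative are those of the form
  \<open>c + primitive T g\<close>.\<close>

definition primitive :: "real \<Rightarrow> (real \<Rightarrow> real) \<Rightarrow> real \<Rightarrow> real" where
  "primitive T g t = (LINT s|time T. indicator {..<t} s * g s)"

lemma smooth_real_borel: "smooth (f :: real \<Rightarrow> real) \<Longrightarrow> f \<in> borel_measurable borel"
  by (rule borel_measurable_continuous_onI[OF smooth_continuous])

lemma compact_support_bounded:
  assumes "smooth (f :: real \<Rightarrow> real)" "\<And>t. t \<notin> {a..b} \<Longrightarrow> f t = 0"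
  obtains B where "\<And>t. \<bar>f t\<bar> \<le> B"
proof -
  have "compact (f ` {a..b})"
    using smooth_continuous[OF assms(1)] by (intro compact_continuous_image) (auto intro: continuous_on_subset)
  then obtain B where B: "\<And>t. t \<in> {a..b} \<Longrightarrow> \<bar>f t\<bar> \<le> B"
    using compact_imp_bounded bounded_iff by (metis image_eqI real_norm_def)
  have "\<bar>f t\<bar> \<le> max B 0" for t
    using B[of t] assms(2)[of t] by (cases "t \<in> {a..b}") auto
  then show ?thesis by (rule that)
qed

lemma time_test_props:
  assumes "time_test T \<theta>"
  shows "smooth \<theta>" "\<theta> \<in> borel_measurable borel" "deriv \<theta> \<in> borel_measurable borel"
    "\<exists>B. \<forall>t. \<bar>\<theta> t\<bar> \<le> B" "\<exists>B. \<forall>t. \<bar>deriv \<theta> t\<bar> \<le> B" "t \<le> 0 \<or> T \<le> t \<Longrightarrow> \<theta> t = 0"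
proof -
  obtain a b where s: "smooth \<theta>" and ab: "0 < a" "b < T" "\<And>t. t \<notin> {a..b} \<Longrightarrow> \<theta> t = 0"
    using assms by (auto simp: time_test_def)
  show "smooth \<theta>" by fact
  show "\<theta> \<in> borel_measurable borel" "deriv \<theta> \<in> borel_measurable borel"
    by (auto intro: smooth_real_borel s smooth_deriv)
  show "\<exists>B. \<forall>t. \<bar>\<theta> t\<bar> \<le> B" using compact_support_bounded[OF s ab(3)] by metis
  have "deriv \<theta> t = 0" if "t \<notin> {a..b}" for t
  proof -
    have "(\<theta> has_real_derivative 0) (at t)"
    proof (rule has_field_derivative_transform_within_open[where f="\<lambda>_. 0" and S="- {a..b}"])
      show "open (- {a..b})" by (simp add: open_Compl)
    qed (use that ab(3) in auto)
    then show ?thesis by (rule DERIV_imp_deriv)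
  qed
  then show "\<exists>B. \<forall>t. \<bar>deriv \<theta> t\<bar> \<le> B" using compact_support_bounded[OF smooth_deriv[OF s]] by metis
  show "t \<le> 0 \<or> T \<le> t \<Longrightarrow> \<theta> t = 0" using ab by auto
qed

lemma integrable_time_mult:
  fixes f :: "real \<Rightarrow> real"
  assumes f: "integrable (time T) f" and [measurable]: "\<theta> \<in> borel_measurable borel" and B: "\<exists>B. \<forall>t. \<bar>\<theta> t\<bar> \<le> B"
  shows "integrable (time T) (\<lambda>t. \<theta> t * f t)"
proof -
  obtain B where B: "\<And>t. \<bar>\<theta> t\<bar> \<le> B" using B by blast
  show ?thesis
  proof (rule Bochner_Integration.integrable_bound)
    show "integrable (time T) (\<lambda>t. B * f t)" using f by simp
    have "\<theta> \<in> borel_measurable (time T)" by (rule measurable_time) simp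
    then show "(\<lambda>t. \<theta> t * f t) \<in> borel_measurable (time T)" using f by measurable
    have "\<bar>\<theta> t\<bar> \<le> \<bar>B\<bar>" for t using B[of t] by linarith
    then show "AE t in time T. norm (\<theta> t * f t) \<le> norm (B * f t)"
      by (intro always_eventually) (auto simp: abs_mult intro!: mult_right_mono)
  qed
qed

lemma integral_deriv_after:
  assumes \<theta>: "smooth \<theta>" "\<theta> T = 0" and s: "0 \<le> s" "s \<le> T"
  shows "(LINT t|time T. indicator {s<..} t * deriv \<theta> t) = - \<theta> s"
proof -
  have [measurable]: "deriv \<theta> \<in> borel_measurable borel" by (rule smooth_real_borel[OF smooth_deriv[OF \<theta>(1)]])
  have "(LINT t|time T. indicator {s<..} t * deriv \<theta> t) = (LINT t|lborel. indicator {0<..<T} t * (indicator {s<..} t * deriv \<theta> t))"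
    by (rule integral_time) measurable
  also have "\<dots> = (LINT t|lborel. deriv \<theta> t * indicator {s..T} t)"
  proof (rule integral_cong_AE)
    have "AE t in lborel. t \<noteq> s" "AE t in lborel. t \<noteq> T" by (rule AE_lborel_singleton)+
    then show "AE t in lborel. indicator {0<..<T} t * (indicator {s<..} t * deriv \<theta> t) = deriv \<theta> t * indicator {s..T} t"
      by eventually_elim (use s in \<open>auto simp: indicator_def\<close>)
  qed auto
  also have "\<dots> = \<theta> T - \<theta> s"
  proof (rule integral_FTC_Icc_real[OF s(2)])
    show "(\<theta> has_real_derivative deriv \<theta> t) (at t)" for t by (rule smooth_real_has_derivative[OF \<theta>(1)])
    show "isCont (deriv \<theta>) t" for t
      using smooth_continuous[OF smooth_deriv[OF \<theta>(1)]] by (simp add: continuous_on_eq_continuous_at)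
  qed
  finally show ?thesis using \<theta> by simp
qed

lemma primitive_bound:
  assumes "integrable (time T) g" shows "\<bar>primitive T g t\<bar> \<le> (LINT s|time T. \<bar>g s\<bar>)"
proof -
  have "\<bar>primitive T g t\<bar> \<le> (LINT s|time T. \<bar>indicator {..<t} s * g s\<bar>)"
    unfolding primitive_def by (rule integral_abs_bound)
  also have "\<dots> \<le> (LINT s|time T. \<bar>g s\<bar>)"
  proof (rule integral_mono)
    show "integrable (time T) (\<lambda>s. \<bar>indicator {..<t} s * g s\<bar>)"
      by (intro integrable_abs integrable_time_mult assms) (auto intro!: exI[of _ 1] simp: indicator_def)
  qed (use assms in \<open>auto simp: indicator_def\<close>)
  finally show ?thesis .
qed

lemma primitive_borel:
  assumes "integrable (time T) g" shows "primitive T g \<in> borel_measurable borel"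
proof -
  have g: "g \<in> borel_measurable (time T)" using assms by auto
  have "(\<lambda>z. indicator {z. snd z < fst z} z * g (snd z) :: real) \<in> borel_measurable (borel \<Otimes>\<^sub>M time T)"
  proof (rule borel_measurable_times)
    have "(\<lambda>z. indicator {z. snd z < fst z} z :: real) \<in> borel_measurable (borel \<Otimes>\<^sub>M borel :: (real \<times> real) measure)"
      by measurable
    then show "(\<lambda>z. indicator {z. snd z < fst z} z :: real) \<in> borel_measurable (borel \<Otimes>\<^sub>M time T)"
      by (rule measurable_compose[OF pair_to_borel[OF _ time_to_borel], rotated]) simp
    show "(\<lambda>z. g (snd z)) \<in> borel_measurable (borel \<Otimes>\<^sub>M time T)" using g by measurable
  qed
  then have "(\<lambda>(t, s). indicator {..<t} s * g s) \<in> borel_measurable (borel \<Otimes>\<^sub>M time T)"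
    by (rule measurable_cong[THEN iffD1, rotated]) (auto simp: indicator_def)
  then show ?thesis unfolding primitive_def[abs_def] by (rule time.borel_measurable_lebesgue_integral)
qed

lemma primitive_integrable: "integrable (time T) g \<Longrightarrow> integrable (time T) (primitive T g)"
  by (rule time.integrable_const_bound[where B="LINT s|time T. \<bar>g s\<bar>"])
    (auto intro: measurable_time primitive_borel primitive_bound)

lemma weak_deriv_primitive:
  assumes T: "T > 0" and g: "integrable (time T) g"
  shows "weak_deriv T (\<lambda>t. c + primitive T g t) g"
  unfolding weak_deriv_def
proof (intro allI impI)
  fix \<theta> assume \<theta>: "time_test T \<theta>"
  note p [measurable] = time_test_props(2,3)[OF \<theta>]
  obtain B where B: "\<And>t. \<bar>deriv \<theta> t\<bar> \<le> B" using time_test_props(5)[OF \<theta>] by blast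
  have "(LINT t|time T. deriv \<theta> t) = (LINT t|time T. indicator {0<..} t * deriv \<theta> t)"
    by (rule Bochner_Integration.integral_cong) (auto simp: space_time)
  also have "\<dots> = 0" using integral_deriv_after[of \<theta> T 0] time_test_props[OF \<theta>] T by simp
  finally have z: "(LINT t|time T. deriv \<theta> t) = 0" .
  have id: "integrable (time T) (\<lambda>t. deriv \<theta> t)"
    by (rule time.integrable_const_bound[where B=B]) (auto intro: measurable_time B)
  have ip: "integrable (time T) (\<lambda>t. deriv \<theta> t * primitive T g t)"
    by (rule integrable_time_mult[OF primitive_integrable[OF g]]) (use B in auto)
  have B0: "0 \<le> B" using B[of 0] by linarith
  have I: "integrable (time T \<Otimes>\<^sub>M time T) (\<lambda>(s, t). g s * (indicator {s<..} t * deriv \<theta> t))"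
  proof (rule time2.integrable_mult_bounded[OF g finite_measure_time, where g="\<lambda>(s, t). indicator {s<..} t * deriv \<theta> t" and B=B, simplified])
    have "(\<lambda>z. indicator {z. fst z < snd z} z * deriv \<theta> (snd z) :: real) \<in> borel_measurable (borel \<Otimes>\<^sub>M borel :: (real \<times> real) measure)"
      by measurable
    then have "(\<lambda>(s, t). indicator {s<..} t * deriv \<theta> t) \<in> borel_measurable (borel \<Otimes>\<^sub>M borel)"
      by (rule measurable_cong[THEN iffD1, rotated]) (auto simp: indicator_def)
    then show "(\<lambda>(s, t). indicator {s<..} t * deriv \<theta> t) \<in> borel_measurable (time T \<Otimes>\<^sub>M time T)" by (rule measurable_time2)
  qed (use B B0 in \<open>auto simp: indicator_def\<close>)
  have "(LINT t|time T. deriv \<theta> t * primitive T g t) = (LINT t|time T. (LINT s|time T. g s * (indicator {s<..} t * deriv \<theta> t)))"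
  proof (rule Bochner_Integration.integral_cong[OF refl])
    fix t
    have "deriv \<theta> t * primitive T g t = (LINT s|time T. deriv \<theta> t * (indicator {..<t} s * g s))"
      unfolding primitive_def by simp
    also have "\<dots> = (LINT s|time T. g s * (indicator {s<..} t * deriv \<theta> t))"
      by (rule Bochner_Integration.integral_cong) (auto simp: indicator_def)
    finally show "deriv \<theta> t * primitive T g t = (LINT s|time T. g s * (indicator {s<..} t * deriv \<theta> t))" .
  qed
  also have "\<dots> = (LINT s|time T. (LINT t|time T. g s * (indicator {s<..} t * deriv \<theta> t)))"
    by (rule time2.Fubini_integral[OF I])
  also have "\<dots> = (LINT s|time T. - (\<theta> s * g s))"
  proof (rule Bochner_Integration.integral_cong[OF refl])
    fix s assume "s \<in> space (time T)"
    then show "(LINT t|time T. g s * (indicator {s<..} t * deriv \<theta> t)) = - (\<theta> s * g s)"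
      using integral_deriv_after[of \<theta> T s] time_test_props[OF \<theta>] T by (simp add: space_time)
  qed
  finally have "(LINT t|time T. deriv \<theta> t * primitive T g t) = - (LINT s|time T. \<theta> s * g s)" by simp
  then show "(LINT t|time T. deriv \<theta> t * (c + primitive T g t)) + (LINT t|time T. \<theta> t * g t) = 0"
    using z id ip by (simp add: distrib_left)
qed

text \<open>Open intervals form an intersection-stable generator of the Borel sets, so that the integrals over
  all Borel sets vanish.\<close>

lemma AE_zero_if_interval_integrals_zero:
  fixes m :: "real \<Rightarrow> real"
  assumes m: "integrable (time T) m" and z: "\<And>a b. (LINT t|time T. indicator {a<..<b} t * m t) = 0"
  shows "AE t in time T. m t = 0"
proof (rule time.density_zero[OF m])
  have I: "integrable (time T) (\<lambda>t. indicator A t * m t)" if "A \<in> sets borel" for A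
    by (rule integrable_time_mult[OF m]) (use that in \<open>auto intro!: exI[of _ 1] simp: indicator_def\<close>)
  have tot: "(LINT t|time T. m t) = 0"
  proof -
    have "(LINT t|time T. m t) = (LINT t|time T. indicator {0<..<T} t * m t)"
      by (rule Bochner_Integration.integral_cong) (auto simp: space_time)
    then show ?thesis using z by simp
  qed
  let ?G = "range (\<lambda>(a, b). box a b :: real set)"
  have bs: "sets (borel :: real measure) = sigma_sets UNIV ?G" by (subst borel_eq_box) simp
  have *: "(LINT t|time T. indicator A t * m t) = 0" if "A \<in> sets borel" for A
  proof -
    have "Int_stable ?G"
    proof (rule Int_stableI)
      fix A B :: "real set" assume "A \<in> ?G" "B \<in> ?G"
      then obtain a b c d where "A = {a<..<b}" "B = {c<..<d}" by auto
      then have "A \<inter> B = box (max a c) (min b d)" by auto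
      then show "A \<inter> B \<in> ?G" by blast
    qed
    moreover have "?G \<subseteq> Pow UNIV" by simp
    moreover have "A \<in> sigma_sets UNIV ?G" using that bs by simp
    ultimately show ?thesis
    proof (induction rule: sigma_sets_induct_disjoint)
      case (basic A) then show ?case using z by auto
    next
      case empty show ?case by simp
    next
      case (compl A)
      have "(LINT t|time T. indicator (UNIV - A) t * m t) = (LINT t|time T. m t - indicator A t * m t)"
        by (rule Bochner_Integration.integral_cong) (auto simp: indicator_def)
      also have "\<dots> = 0" using I[of A] compl tot m by (simp add: bs)
      finally show ?case .
    next
      case (union A)
      have Am: "A i \<in> sets borel" for i using union bs by auto
      have U: "\<Union>(range A) \<in> sets borel" using Am by auto
      have At: "A i \<inter> space (time T) \<in> sets (time T)" for i
        unfolding time_def using Am by (auto simp: sets_restrict_space space_restrict_space)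
      have ss: "set_lebesgue_integral (time T) (B \<inter> space (time T)) m = (LINT t|time T. indicator B t * m t)" for B
        unfolding set_lebesgue_integral_def by (rule Bochner_Integration.integral_cong) (auto simp: indicator_def)
      have "set_lebesgue_integral (time T) (\<Union>i. A i \<inter> space (time T)) m = (\<Sum>i. set_lebesgue_integral (time T) (A i \<inter> space (time T)) m)"
      proof (rule lebesgue_integral_countable_add[OF At])
        show "i \<noteq> j \<Longrightarrow> (A i \<inter> space (time T)) \<inter> (A j \<inter> space (time T)) = {}" for i j
          using union(1) by (auto simp: disjoint_family_on_def)
        show "set_integrable (time T) (\<Union>i. A i \<inter> space (time T)) m"
          unfolding set_integrable_def
          by (rule Bochner_Integration.integrable_cong[THEN iffD1, OF refl _ I[OF U]]) (auto simp: indicator_def)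
      qed
      also have "\<dots> = 0" unfolding ss using union by simp
      also have "(\<Union>i. A i \<inter> space (time T)) = \<Union>(range A) \<inter> space (time T)" by auto
      finally show ?case unfolding ss .
    qed
  qed
  fix A assume "A \<in> sets (time T)"
  then have "A \<in> sets borel" unfolding time_def by (auto simp: sets_restrict_space)
  then show "set_lebesgue_integral (time T) A m = 0" using * by (simp add: set_lebesgue_integral_def)
qed

lemma time_test_bump_product:
  assumes ab: "0 < a" "b < T" and "r > 0"
  shows "time_test T (\<lambda>t. bump (r * (t - a)) * bump (r * (b - t)))"
proof -
  have "smooth (\<lambda>t. bump (r * t - r * a))" "smooth (\<lambda>t. bump (r * b - r * t))"
    using smooth_comp_real[OF smooth_bump smooth_diff[OF smooth_cmult[OF smooth_linear[OF bounded_linear_ident]] smooth_const]]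
      smooth_comp_real[OF smooth_bump smooth_diff[OF smooth_const smooth_cmult[OF smooth_linear[OF bounded_linear_ident]]]]
    by auto
  from smooth_mult[OF this] have "smooth (\<lambda>t. bump (r * (t - a)) * bump (r * (b - t)))"
    by (simp add: right_diff_distrib)
  moreover have "bump (r * (t - a)) * bump (r * (b - t)) = 0" if "t \<notin> {a..b}" for t
    using that \<open>r > 0\<close> bump_eq_0[of "r * (t - a)"] bump_eq_0[of "r * (b - t)"]
    by (auto simp: mult_le_0_iff not_le)
  ultimately show ?thesis unfolding time_test_def using ab by blast
qed

lemma bump_tendsto: assumes "x > 0" shows "(\<lambda>n. bump (real n * x - 1)) \<longlonglongrightarrow> 1"
proof -
  have "filterlim (\<lambda>n. x * real n) at_top sequentially"
    by (rule filterlim_tendsto_pos_mult_at_top[OF tendsto_const assms filterlim_real_sequentially])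
  from filterlim_tendsto_add_at_top[OF tendsto_const this, of "-1"]
  have f: "filterlim (\<lambda>n. real n * x - 1) at_top sequentially" by (simp add: mult.commute)
  have "((\<lambda>y::real. exp (- inverse y)) \<longlongrightarrow> exp (- 0)) at_top"
    by (intro tendsto_intros tendsto_inverse_0_at_top filterlim_ident)
  then have "((\<lambda>y::real. exp (- (1 / y))) \<longlongrightarrow> 1) at_top" by (simp add: inverse_eq_divide)
  moreover have "eventually (\<lambda>y. exp (- (1 / y)) = bump y) at_top"
    using eventually_gt_at_top[of 0] by eventually_elim (simp add: bump_def)
  ultimately have "(bump \<longlongrightarrow> 1) at_top" by (rule Lim_transform_eventually)
  from filterlim_compose[OF this f] show ?thesis by simp
qed

text \<open>Products of two bumps, scaled to their steep limit, converge boundedly to the indicator of the interval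
  clipped to \<open>(0, T)\<close>.\<close>

lemma integral_zero_of_time_test:
  assumes m: "integrable (time T) m" and z: "\<And>\<theta>. time_test T \<theta> \<Longrightarrow> (LINT t|time T. \<theta> t * m t) = 0"
  shows "(LINT t|time T. indicator {a<..<b} t * m t) = 0"
proof -
  define a' b' where "a' = max a 0" and "b' = min b T"
  define \<psi> where "\<psi> n t = bump (real n * (t - (a' + 1 / real n))) * bump (real n * ((b' - 1 / real n) - t))" for n t
  have \<psi>: "time_test T (\<psi> n)" if "n > 0" for n
  proof -
    have n: "1 / real n > 0" "0 \<le> a'" "b' \<le> T" using that by (auto simp: a'_def b'_def)
    show ?thesis unfolding \<psi>_def by (rule time_test_bump_product) (use n that in linarith)+
  qed
  have \<psi>b: "\<bar>\<psi> n t\<bar> \<le> 1" for n t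
    unfolding \<psi>_def using bump_nonneg bump_le_1 by (simp add: abs_mult mult_le_one)
  have [measurable]: "\<psi> n \<in> borel_measurable borel" for n
    using smooth_real_borel[OF smooth_bump] unfolding \<psi>_def by measurable
  have lim: "(\<lambda>n. \<psi> n t) \<longlonglongrightarrow> indicator {a'<..<b'} t" for t
  proof (cases "t \<in> {a'<..<b'}")
    case True
    have "(\<lambda>n. bump (real n * (t - a') - 1) * bump (real n * (b' - t) - 1)) \<longlonglongrightarrow> 1 * 1"
      using True by (intro tendsto_mult bump_tendsto) auto
    then have "(\<lambda>n. bump (real n * (t - a') - 1) * bump (real n * (b' - t) - 1)) \<longlonglongrightarrow> indicator {a'<..<b'} t"
      using True by simp
    then show ?thesis
    proof (rule Lim_transform_eventually)
      show "\<forall>\<^sub>F n in sequentially. bump (real n * (t - a') - 1) * bump (real n * (b' - t) - 1) = \<psi> n t"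
        using eventually_gt_at_top[of 0] by eventually_elim (simp add: \<psi>_def algebra_simps)
    qed
  next
    case False
    have "\<psi> n t = 0" if "n > 0" for n
    proof -
      have "real n * (t - (a' + 1 / real n)) \<le> 0 \<or> real n * ((b' - 1 / real n) - t) \<le> 0"
      proof -
        have n: "1 / real n > 0" using that by simp
        have "t \<le> a' \<or> b' \<le> t" using False by auto
        then have "t - (a' + 1 / real n) \<le> 0 \<or> (b' - 1 / real n) - t \<le> 0" using n by linarith
        then show ?thesis by (auto intro!: mult_nonneg_nonpos)
      qed
      then show ?thesis unfolding \<psi>_def using bump_eq_0 by auto
    qed
    then show ?thesis using False
      by (intro tendsto_eventually) (auto intro: eventually_mono[OF eventually_gt_at_top[of 0]])
  qed
  have "(\<lambda>n. LINT t|time T. \<psi> n t * m t) \<longlonglongrightarrow> (LINT t|time T. indicator {a'<..<b'} t * m t)"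
  proof (rule integral_dominated_convergence[where w="\<lambda>t. \<bar>m t\<bar>"])
    show "AE t in time T. (\<lambda>n. \<psi> n t * m t) \<longlonglongrightarrow> indicator {a'<..<b'} t * m t"
      by (intro always_eventually allI tendsto_mult lim tendsto_const)
    show "AE t in time T. norm (\<psi> n t * m t) \<le> \<bar>m t\<bar>" for n
      using mult_right_mono[OF \<psi>b, of "\<bar>m _\<bar>" n] by (intro always_eventually allI) (simp add: abs_mult)
    show "(\<lambda>t. \<psi> n t * m t) \<in> borel_measurable (time T)" for n
      using integrable_time_mult[OF m, of "\<psi> n"] \<psi>b by (auto intro: borel_measurable_integrable)
    show "(\<lambda>t. indicator {a'<..<b'} t * m t) \<in> borel_measurable (time T)"
      using integrable_time_mult[OF m, of "indicator {a'<..<b'}"]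
      by (rule borel_measurable_integrable) (auto intro!: exI[of _ 1] simp: indicator_def)
  qed (use m in simp)
  moreover have "(\<lambda>n. LINT t|time T. \<psi> n t * m t) \<longlonglongrightarrow> 0"
    by (rule tendsto_eventually) (use z \<psi> in \<open>auto intro: eventually_mono[OF eventually_gt_at_top[of 0]]\<close>)
  ultimately have "(LINT t|time T. indicator {a'<..<b'} t * m t) = 0" by (rule LIMSEQ_unique)
  moreover have "(LINT t|time T. indicator {a'<..<b'} t * m t) = (LINT t|time T. indicator {a<..<b} t * m t)"
    by (rule Bochner_Integration.integral_cong) (auto simp: indicator_def a'_def b'_def space_time)
  ultimately show ?thesis by simp
qed

text \<open>The integral zero makes the primitive vanish again behind the support.\<close>

lemma time_test_primitive:
  assumes T: "T > 0" and \<eta>: "time_test T \<eta>" and z: "(LINT t|time T. \<eta> t) = 0"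
  obtains \<theta> where "time_test T \<theta>" "deriv \<theta> = \<eta>"
proof -
  note s = time_test_props(1)[OF \<eta>] and [measurable] = time_test_props(2)[OF \<eta>]
  obtain a b where ab: "0 < a" "b < T" "\<And>t. t \<notin> {a..b} \<Longrightarrow> \<eta> t = 0" using \<eta> by (auto simp: time_test_def)
  have c: "isCont \<eta> x" for x using smooth_continuous[OF s] by (simp add: continuous_on_eq_continuous_at)
  obtain F where F: "\<And>x. (F has_real_derivative \<eta> x) (at x)"
    using einterval_antiderivative[of "-\<infinity>" \<infinity> \<eta>] c by (auto simp: has_real_derivative_iff_has_vector_derivative)
  define \<theta> where "\<theta> t = F t - F 0" for t
  have D: "(\<theta> has_real_derivative \<eta> x) (at x)" for x
    unfolding \<theta>_def using F[of x] by (auto intro!: derivative_eq_intros)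
  have d: "deriv \<theta> = \<eta>" using DERIV_imp_deriv[OF D] by blast
  have const: "F x = F y" if "x < y" "\<And>t. x < t \<Longrightarrow> t < y \<Longrightarrow> \<eta> t = 0" for x y
    using MVT2[OF that(1), of F \<eta>] F that(2) by auto
  have FT: "F T = F 0"
  proof -
    have "0 = (LINT t|lborel. indicator {0<..<T} t * \<eta> t)" using z by (simp add: integral_time)
    also have "\<dots> = (LINT t|lborel. \<eta> t * indicator {0..T} t)"
    proof (rule Bochner_Integration.integral_cong[OF refl])
      fix t
      have "\<eta> t = 0 \<or> 0 < t \<and> t < T" using ab(1,2) ab(3)[of t] by (cases "t \<in> {a..b}") auto
      then show "indicator {0<..<T} t * \<eta> t = \<eta> t * indicator {0..T} t" by (auto simp: indicator_def)
    qed
    also have "\<dots> = F T - F 0" by (rule integral_FTC_Icc_real) (use T F c in auto)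
    finally show ?thesis by simp
  qed
  have "\<theta> t = 0" if "t \<notin> {a..b}" for t
  proof -
    have "F t = F 0" if "t < a"
    proof (cases t "0 :: real" rule: linorder_cases)
      case less show ?thesis by (rule const[OF less]) (use ab in auto)
    next
      case greater show ?thesis by (rule const[OF greater, symmetric]) (use ab that in auto)
    qed simp
    moreover have "F t = F T" if "t > b"
    proof (cases t T rule: linorder_cases)
      case less show ?thesis by (rule const[OF less]) (use ab that in auto)
    next
      case greater show ?thesis by (rule const[OF greater, symmetric]) (use ab that in auto)
    qed simp
    ultimately show ?thesis using that FT by (auto simp: \<theta>_def not_le)
  qed
  then have "time_test T \<theta>" unfolding time_test_def using smooth_primitive[OF D s] ab by blast
  then show ?thesis using d that by blast
qed

text \<open>The lemma of du Bois-Reymond. The difference \<open>k\<close> of \<open>f\<close> and the primitive is orthogonal to all derivatives of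
  test functions. An arbitrary test function becomes a derivative once a multiple of one fixed bump
  \<open>\<theta>\<^sub>1\<close> is subtracted that makes its integral zero; hence \<open>k\<close> is constant.\<close>

lemma weak_deriv_imp_primitive:
  assumes T: "T > 0" and f: "integrable (time T) f" and g: "integrable (time T) g" and w: "weak_deriv T f g"
  obtains c where "AE t in time T. f t = c + primitive T g t"
proof -
  define k where "k t = f t - primitive T g t" for t
  have k: "integrable (time T) k" unfolding k_def using f primitive_integrable[OF g] by auto
  have kz: "(LINT t|time T. deriv \<theta> t * k t) = 0" if \<theta>: "time_test T \<theta>" for \<theta>
  proof -
    have I: "integrable (time T) (\<lambda>t. deriv \<theta> t * f t)" "integrable (time T) (\<lambda>t. deriv \<theta> t * primitive T g t)"
      by (intro integrable_time_mult f primitive_integrable[OF g] time_test_props[OF \<theta>])+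
    show ?thesis
      using w[unfolded weak_deriv_def, rule_format, OF \<theta>]
        weak_deriv_primitive[OF T g, of 0, unfolded weak_deriv_def, rule_format, OF \<theta>] I
      by (simp add: k_def right_diff_distrib)
  qed
  define \<theta>\<^sub>1 where "\<theta>\<^sub>1 t = bump (1 * (t - T/3)) * bump (1 * (2*T/3 - t))" for t
  have \<theta>1: "time_test T \<theta>\<^sub>1" unfolding \<theta>\<^sub>1_def by (rule time_test_bump_product) (use T in auto)
  note [measurable] = time_test_props(2)[OF \<theta>1]
  have i1: "integrable (time T) \<theta>" if "time_test T \<theta>" for \<theta>
    using integrable_time_mult[of T "\<lambda>_. 1" \<theta>] time_test_props[OF that] by simp
  define M where "M = (LINT t|time T. \<theta>\<^sub>1 t)"
  have M: "M \<noteq> 0"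
  proof
    assume "M = 0"
    moreover have nn: "AE t in time T. 0 \<le> \<theta>\<^sub>1 t" by (auto simp: \<theta>\<^sub>1_def bump_nonneg)
    ultimately have "AE t in time T. \<theta>\<^sub>1 t = 0"
      using integral_nonneg_eq_0_iff_AE[OF i1[OF \<theta>1]] by (simp add: M_def)
    then have "AE t in lborel. t \<in> {0<..<T} \<longrightarrow> \<theta>\<^sub>1 t = 0" unfolding time_def by (simp add: AE_restrict_space_iff)
    then have "AE t in lborel. t \<notin> {T/3<..<2*T/3}"
    proof eventually_elim
      case (elim t)
      have "\<theta>\<^sub>1 t > 0" if "t \<in> {T/3<..<2*T/3}"
        unfolding \<theta>\<^sub>1_def using that by (intro mult_pos_pos bump_pos) auto
      then show ?case using elim T by fastforce
    qed
    then have "emeasure lborel {t \<in> space lborel. \<not> (t \<notin> {T/3<..<2*T/3})} = 0"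
      by (rule AE_E2) measurable
    moreover have "{t \<in> space lborel. \<not> (t \<notin> X)} = X" for X :: "real set" by auto
    ultimately have "emeasure lborel {T/3<..<2*T/3} = 0" by metis
    then show False using T by simp
  qed
  define \<theta>\<^sub>0 where "\<theta>\<^sub>0 t = (1 / M) * \<theta>\<^sub>1 t" for t
  define c where "c = (LINT t|time T. \<theta>\<^sub>0 t * k t)"
  have z: "(LINT t|time T. \<psi> t * (k t - c)) = 0" if \<psi>: "time_test T \<psi>" for \<psi>
  proof -
    define I where "I = (LINT t|time T. \<psi> t)"
    define \<eta> where "\<eta> t = \<psi> t - (I / M) * \<theta>\<^sub>1 t" for t
    have "time_test T \<eta>"
    proof -
      obtain a b a' b' where ab: "0 < a" "b < T" "\<And>t. t \<notin> {a..b} \<Longrightarrow> \<psi> t = 0"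
        "0 < a'" "b' < T" "\<And>t. t \<notin> {a'..b'} \<Longrightarrow> \<theta>\<^sub>1 t = 0" using \<psi> \<theta>1 by (auto simp: time_test_def)
      have "smooth \<eta>" unfolding \<eta>_def
        by (intro smooth_diff smooth_cmult time_test_props(1)[OF \<psi>] time_test_props(1)[OF \<theta>1])
      moreover have "\<eta> t = 0" if "t \<notin> {min a a'..max b b'}" for t
      proof -
        have "t \<notin> {a..b}" "t \<notin> {a'..b'}" using that by auto
        from ab(3)[OF this(1)] ab(6)[OF this(2)] show ?thesis by (simp add: \<eta>_def)
      qed
      ultimately show ?thesis unfolding time_test_def using ab
        by (intro conjI exI[of _ "min a a'"] exI[of _ "max b b'"]) auto
    qed
    moreover have "(LINT t|time T. \<eta> t) = 0"
      using i1[OF \<psi>] i1[OF \<theta>1] M unfolding \<eta>_def by (simp add: I_def M_def)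
    ultimately obtain \<theta> where \<theta>: "time_test T \<theta>" "deriv \<theta> = \<eta>" using time_test_primitive[OF T] by blast
    have Ik: "integrable (time T) (\<lambda>t. \<psi> t * k t)" "integrable (time T) (\<lambda>t. \<theta>\<^sub>1 t * k t)"
      by (intro integrable_time_mult k time_test_props[OF \<psi>] time_test_props[OF \<theta>1])+
    have "0 = (LINT t|time T. \<psi> t * k t - (I / M) * (\<theta>\<^sub>1 t * k t))"
      using kz[OF \<theta>(1)] unfolding \<theta>(2) \<eta>_def by (simp add: algebra_simps)
    also have "\<dots> = (LINT t|time T. \<psi> t * k t) - I * c"
      using Ik by (simp add: c_def \<theta>\<^sub>0_def)
    finally show ?thesis using Ik i1[OF \<psi>] by (simp add: right_diff_distrib I_def)
  qed
  have kc: "integrable (time T) (\<lambda>t. k t - c)" using k by auto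
  have "AE t in time T. k t - c = 0"
    by (rule AE_zero_if_interval_integrals_zero[OF kc]) (rule integral_zero_of_time_test[OF kc z])
  then have "AE t in time T. f t = c + primitive T g t" by eventually_elim (simp add: k_def)
  then show ?thesis by (rule that)
qed

text \<open>The square \<open>{s, r < t}\<close> splits into two triangles with equal integrals and a null diagonal.\<close>

lemma primitive_square:
  assumes g: "integrable (time T) g"
  shows "(primitive T g t)\<^sup>2 = primitive T (\<lambda>s. 2 * (primitive T g s * g s)) t"
proof -
  let ?i = "\<lambda>r s. indicator {..<t} r * (indicator {..<r} s * (g r * g s)) :: real"
  have gm [measurable]: "g \<in> borel_measurable (time T)" using g by auto
  have gg: "integrable (time T \<Otimes>\<^sub>M time T) (\<lambda>z. g (fst z) * g (snd z))"
  proof (rule time2.Fubini_integrable)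
    show "integrable (time T) (\<lambda>x. LINT y|time T. norm (g (fst (x, y)) * g (snd (x, y))))"
      using g by (simp add: abs_mult)
  qed (use g in auto)
  have I: "integrable (time T \<Otimes>\<^sub>M time T) (case_prod ?i)"
  proof (rule Bochner_Integration.integrable_bound[OF gg])
    have "(\<lambda>z. indicator {z. fst z < t} z * indicator {z. snd z < fst z} z :: real) \<in> borel_measurable (borel \<Otimes>\<^sub>M borel :: (real \<times> real) measure)"
      by measurable
    from measurable_time2[OF this]
    have "(\<lambda>z. (indicator {z. fst z < t} z * indicator {z. snd z < fst z} z) * (g (fst z) * g (snd z))) \<in> borel_measurable (time T \<Otimes>\<^sub>M time T)"
      by measurable
    then show "(case_prod ?i) \<in> borel_measurable (time T \<Otimes>\<^sub>M time T)"
      by (rule measurable_cong[THEN iffD1, rotated]) (auto simp: indicator_def)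
  qed (auto simp: indicator_def)
  have A: "primitive T (\<lambda>s. primitive T g s * g s) t = (LINT r|time T. LINT s|time T. ?i r s)"
    unfolding primitive_def
  proof (rule Bochner_Integration.integral_cong[OF refl])
    fix r
    have "indicator {..<t} r * ((LINT s|time T. indicator {..<r} s * g s) * g r) =
        (LINT s|time T. (indicator {..<t} r * g r) * (indicator {..<r} s * g s))" by simp
    also have "\<dots> = (LINT s|time T. ?i r s)" by (rule Bochner_Integration.integral_cong) auto
    finally show "indicator {..<t} r * ((LINT s|time T. indicator {..<r} s * g s) * g r) = (LINT s|time T. ?i r s)" .
  qed
  have B: "(LINT r|time T. LINT s|time T. ?i r s) = (LINT r|time T. LINT s|time T. ?i s r)"
    by (rule time2.Fubini_integral[OF I, symmetric])
  have I': "integrable (time T \<Otimes>\<^sub>M time T) (\<lambda>(r, s). ?i s r)"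
    using time2.integrable_product_swap[OF I] by simp
  have "2 * (LINT r|time T. LINT s|time T. ?i r s) = (LINT r|time T. LINT s|time T. ?i r s) + (LINT r|time T. LINT s|time T. ?i s r)"
    using B by simp
  also have "\<dots> = (LINT r|time T. (LINT s|time T. ?i r s) + (LINT s|time T. ?i s r))"
    by (rule Bochner_Integration.integral_add[symmetric]) (rule time2.integrable_fst[OF I], rule time2.integrable_fst[OF I'])
  also have "\<dots> = (LINT r|time T. (indicator {..<t} r * g r) * primitive T g t)"
  proof (rule integral_cong_AE)
    show "AE r in time T. (LINT s|time T. ?i r s) + (LINT s|time T. ?i s r) = (indicator {..<t} r * g r) * primitive T g t"
      using time2.AE_integrable_fst[OF I] time2.AE_integrable_fst[OF I']
    proof eventually_elim
      case (elim r)
      have "(LINT s|time T. ?i r s) + (LINT s|time T. ?i s r) = (LINT s|time T. ?i r s + ?i s r)"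
        using elim by simp
      also have "\<dots> = (LINT s|time T. (indicator {..<t} r * g r) * (indicator {..<t} s * g s))"
      proof (rule integral_cong_AE)
        show "AE s in time T. ?i r s + ?i s r = (indicator {..<t} r * g r) * (indicator {..<t} s * g s)"
          using AE_time_neq[of r] by eventually_elim (auto simp: indicator_def)
        show "(\<lambda>s. ?i r s + ?i s r) \<in> borel_measurable (time T)" using elim by auto
        have "(\<lambda>s. indicator {..<t} s :: real) \<in> borel_measurable (time T)" by (rule measurable_time) simp
        then show "(\<lambda>s. (indicator {..<t} r * g r) * (indicator {..<t} s * g s)) \<in> borel_measurable (time T)" by measurable
      qed
      finally show ?case by (simp add: primitive_def)
    qed
    show "(\<lambda>r. (LINT s|time T. ?i r s) + (LINT s|time T. ?i s r)) \<in> borel_measurable (time T)"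
      using time2.integrable_fst[OF I] time2.integrable_fst[OF I'] by auto
    have "(\<lambda>s. indicator {..<t} s :: real) \<in> borel_measurable (time T)" by (rule measurable_time) simp
    then show "(\<lambda>r. (indicator {..<t} r * g r) * primitive T g t) \<in> borel_measurable (time T)" by measurable
  qed
  also have "\<dots> = (primitive T g t)\<^sup>2" by (simp add: primitive_def power2_eq_square)
  finally show ?thesis using A by (simp add: primitive_def mult.left_commute)
qed

text \<open>The chain rule for absolutely continuous functions: pass to the primitive and square it by Fubini's theorem,
  with \<open>primitive_square\<close>.\<close>

lemma weak_deriv_square:
  assumes T: "T > 0" and f: "integrable (time T) f" and g: "integrable (time T) g" and w: "weak_deriv T f g"
  shows "weak_deriv T (\<lambda>t. (f t)\<^sup>2) (\<lambda>t. 2 * (f t * g t))"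
proof -
  obtain c where c: "AE t in time T. f t = c + primitive T g t" by (rule weak_deriv_imp_primitive[OF assms])
  define F where "F t = c + primitive T g t" for t
  have pg: "integrable (time T) (\<lambda>t. primitive T g t * g t)"
    by (rule integrable_time_mult[OF g primitive_borel[OF g]]) (use primitive_bound[OF g] in blast)
  have I: "integrable (time T) (\<lambda>t. 2 * (F t * g t))"
    unfolding F_def using pg g by (auto simp: distrib_right)
  have "(F t)\<^sup>2 = c\<^sup>2 + primitive T (\<lambda>t. 2 * (F t * g t)) t" for t
  proof -
    have ii: "integrable (time T) (\<lambda>s. indicator {..<t} s * h s)" if "integrable (time T) h" for h :: "real \<Rightarrow> real"
      by (rule integrable_time_mult[OF that]) (auto intro!: exI[of _ 1] simp: indicator_def)
    have "primitive T (\<lambda>t. 2 * (F t * g t)) t = (LINT s|time T. 2 * c * (indicator {..<t} s * g s) + indicator {..<t} s * (2 * (primitive T g s * g s)))"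
      unfolding primitive_def[of T "\<lambda>t. 2 * (F t * g t)"]
      by (rule Bochner_Integration.integral_cong) (auto simp: F_def algebra_simps)
    also have "\<dots> = 2 * c * primitive T g t + (primitive T g t)\<^sup>2"
    proof (subst Bochner_Integration.integral_add)
      show "integrable (time T) (\<lambda>s. 2 * c * (indicator {..<t} s * g s))" using ii[OF g] by simp
      show "integrable (time T) (\<lambda>s. indicator {..<t} s * (2 * (primitive T g s * g s)))"
        by (rule ii[OF integrable_mult_right[OF pg]])
      have "(LINT s|time T. indicator {..<t} s * (2 * (primitive T g s * g s))) = (primitive T g t)\<^sup>2"
        unfolding primitive_square[OF g] by (simp only: primitive_def[of T "\<lambda>s. 2 * (primitive T g s * g s)"])
      then show "(LINT s|time T. 2 * c * (indicator {..<t} s * g s)) + (LINT s|time T. indicator {..<t} s * (2 * (primitive T g s * g s)))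
          = 2 * c * primitive T g t + (primitive T g t)\<^sup>2"
        by (simp add: primitive_def[of T g t])
    qed
    finally show ?thesis by (simp add: F_def power2_eq_square algebra_simps)
  qed
  then have wF: "weak_deriv T (\<lambda>t. (F t)\<^sup>2) (\<lambda>t. 2 * (F t * g t))"
    using weak_deriv_primitive[OF T I, of "c\<^sup>2"] by simp
  have eq: "(LINT t|time T. a t * (f t)\<^sup>2) = (LINT t|time T. a t * (F t)\<^sup>2)"
    "(LINT t|time T. a t * (2 * (f t * g t))) = (LINT t|time T. a t * (2 * (F t * g t)))"
    if "a \<in> borel_measurable borel" for a
  proof -
    have [measurable]: "a \<in> borel_measurable (time T)" by (rule measurable_time[OF that])
    have [measurable]: "F \<in> borel_measurable (time T)"
      unfolding F_def using measurable_time[OF primitive_borel[OF g]] by measurable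
    have [measurable]: "f \<in> borel_measurable (time T)" "g \<in> borel_measurable (time T)" using f g by auto
    show "(LINT t|time T. a t * (f t)\<^sup>2) = (LINT t|time T. a t * (F t)\<^sup>2)"
      by (rule integral_cong_AE) (measurable, use c in eventually_elim, simp add: F_def)
    show "(LINT t|time T. a t * (2 * (f t * g t))) = (LINT t|time T. a t * (2 * (F t * g t)))"
      by (rule integral_cong_AE) (measurable, use c in eventually_elim, simp add: F_def)
  qed
  show ?thesis
    unfolding weak_deriv_def
  proof (intro allI impI)
    fix \<theta> assume \<theta>: "time_test T \<theta>"
    show "(LINT t|time T. deriv \<theta> t * (f t)\<^sup>2) + (LINT t|time T. \<theta> t * (2 * (f t * g t))) = 0"
      unfolding eq(1)[OF time_test_props(3)[OF \<theta>]] eq(2)[OF time_test_props(2)[OF \<theta>]]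
      using wF \<theta> unfolding weak_deriv_def by blast
  qed
qed

section \<open>The balance of the filtered energy\<close>

text \<open>Young's inequality for convolutions in \<open>L\<^sup>1\<close>.\<close>

lemma kern_L1:
  assumes [measurable]: "a \<in> borel_measurable borel" "b \<in> borel_measurable borel"
    and a: "\<And>x. \<bar>a x\<bar> \<le> A" and b: "\<And>x. \<bar>b x\<bar> \<le> B" "periodic b"
  shows "(LINT \<xi>|torus. \<bar>kern a b \<xi>\<bar>) \<le> (LINT x|torus. \<bar>a x\<bar>) * (LINT x|torus. \<bar>b x\<bar>)"
proof -
  have A0: "0 \<le> A" using a[of 0] by linarith
  have ia: "integrable torus (\<lambda>\<eta>. \<bar>a \<eta>\<bar>)" by (intro integrable_abs integrable_torus_bounded[OF _ a]) simp
  have I: "integrable (torus \<Otimes>\<^sub>M torus) (\<lambda>(\<eta>, \<xi>). \<bar>a \<eta>\<bar> * \<bar>b (\<eta> - \<xi>)\<bar>)"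
  proof (rule torus2.integrable_mult_bounded[OF ia torus.finite_measure_axioms, where g="\<lambda>(\<eta>, \<xi>). \<bar>b (\<eta> - \<xi>)\<bar>" and B=B, simplified])
    show "(\<lambda>(\<eta>, \<xi>). \<bar>b (\<eta> - \<xi>)\<bar>) \<in> borel_measurable (torus \<Otimes>\<^sub>M torus)"
      by (rule measurable_torus2) measurable
  qed (use b in auto)
  have "(LINT \<xi>|torus. \<bar>kern a b \<xi>\<bar>) \<le> (LINT \<xi>|torus. (LINT \<eta>|torus. \<bar>a \<eta>\<bar> * \<bar>b (\<eta> - \<xi>)\<bar>))"
  proof (rule integral_mono)
    show "integrable torus (\<lambda>\<xi>. \<bar>kern a b \<xi>\<bar>)"
      by (intro integrable_abs integrable_torus_bounded[OF _ kern_bound[OF _ _ a b(1)]] kern_borel) measurable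
    show "integrable torus (\<lambda>\<xi>. LINT \<eta>|torus. \<bar>a \<eta>\<bar> * \<bar>b (\<eta> - \<xi>)\<bar>)"
      by (rule torus2.integrable_snd[OF I])
    show "\<bar>kern a b \<xi>\<bar> \<le> (LINT \<eta>|torus. \<bar>a \<eta>\<bar> * \<bar>b (\<eta> - \<xi>)\<bar>)" for \<xi>
      unfolding kern_def abs_mult[symmetric] by (rule integral_abs_bound)
  qed
  also have "\<dots> = (LINT \<eta>|torus. (LINT \<xi>|torus. \<bar>a \<eta>\<bar> * \<bar>b (\<eta> - \<xi>)\<bar>))" by (rule torus2.Fubini_integral[OF I])
  also have "\<dots> = (LINT \<eta>|torus. \<bar>a \<eta>\<bar> * (LINT x|torus. \<bar>b x\<bar>))"
  proof (rule Bochner_Integration.integral_cong[OF refl])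
    fix \<eta>
    have "(LINT \<xi>|torus. \<bar>b (\<eta> - \<xi>)\<bar>) = (LINT x|torus. \<bar>b x\<bar>)"
      by (rule integral_torus_reflect[where f="\<lambda>x. \<bar>b x\<bar>"]) (measurable, rule periodic_comp[OF b(2)])
    then show "(LINT \<xi>|torus. \<bar>a \<eta>\<bar> * \<bar>b (\<eta> - \<xi>)\<bar>) = \<bar>a \<eta>\<bar> * (LINT x|torus. \<bar>b x\<bar>)" by simp
  qed
  finally show ?thesis by simp
qed

lemma grad_kern_support:
  assumes \<phi>: "mollifier \<kappa> \<delta> \<phi>" and nz: "grad_kern \<phi> i \<xi> \<noteq> 0"
  shows "norm (cent \<xi>) \<le> 2 * \<delta>"
proof -
  have "\<exists>\<eta>. partial i \<phi> \<eta> * \<phi> (\<eta> - \<xi>) \<noteq> 0"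
  proof (rule ccontr)
    assume "\<not> (\<exists>\<eta>. partial i \<phi> \<eta> * \<phi> (\<eta> - \<xi>) \<noteq> 0)"
    then have "grad_kern \<phi> i \<xi> = (LINT \<eta>|torus. 0)"
      unfolding grad_kern_def kern_def by (intro Bochner_Integration.integral_cong) auto
    then show False using nz by simp
  qed
  then obtain \<eta> where \<eta>: "partial i \<phi> \<eta> \<noteq> 0" "\<phi> (\<eta> - \<xi>) \<noteq> 0" by auto
  have "\<phi> \<eta> \<noteq> 0" using partial_eq_0_if_min[OF mollifierD(1)[OF \<phi>] mollifierD(4)[OF \<phi>]] \<eta>(1) by blast
  then show ?thesis
    using norm_cent_diff[of \<eta> "\<eta> - \<xi>"] mollifierD(6)[OF \<phi>, of \<eta>] mollifierD(6)[OF \<phi> \<eta>(2)] by simp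
qed

lemma grad_kern_L1:
  assumes \<phi>: "mollifier \<kappa> \<delta> \<phi>" and "0 < \<delta>"
  shows "\<delta> * (LINT \<xi>|torus. \<bar>grad_kern \<phi> i \<xi>\<bar>) \<le> \<kappa>"
proof -
  obtain B where B: "\<And>x. \<bar>\<phi> x\<bar> \<le> B" using mollifier_bounded[OF \<phi>] by blast
  obtain A where A: "\<And>x. \<bar>partial i \<phi> x\<bar> \<le> A" using partial_mollifier(4)[OF \<phi>] by blast
  have "(LINT x|torus. \<bar>\<phi> x\<bar>) = 1" using mollifierD(4,5)[OF \<phi>] by simp
  then have "(LINT \<xi>|torus. \<bar>grad_kern \<phi> i \<xi>\<bar>) \<le> (LINT x|torus. \<bar>partial i \<phi> x\<bar>)"
    using kern_L1[OF partial_mollifier(3)[OF \<phi>] mollifierD(8)[OF \<phi>] A B mollifierD(2)[OF \<phi>]]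
    by (simp add: grad_kern_def)
  then have "\<delta> * (LINT \<xi>|torus. \<bar>grad_kern \<phi> i \<xi>\<bar>) \<le> \<delta> * (LINT x|torus. \<bar>partial i \<phi> x\<bar>)"
    using assms(2) by (intro mult_left_mono) auto
  then show ?thesis using mollifierD(7)[OF \<phi>, of i] by linarith
qed

lemma to_borel_prod:
  assumes "(\<lambda>x. x) \<in> M \<rightarrow>\<^sub>M borel" "(\<lambda>x. x) \<in> N \<rightarrow>\<^sub>M borel"
  shows "(\<lambda>x. x) \<in> M \<Otimes>\<^sub>M N \<rightarrow>\<^sub>M (borel :: ('a::second_countable_topology \<times> 'b::second_countable_topology) measure)"
  using pair_to_borel[OF assms] by (simp add: borel_prod)

lemma measurable_time_torus:
  fixes f :: "real \<times> (real ^ 3) \<Rightarrow> 'c"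
  shows "f \<in> borel \<rightarrow>\<^sub>M N \<Longrightarrow> f \<in> time T \<Otimes>\<^sub>M torus \<rightarrow>\<^sub>M N"
  using measurable_compose[OF to_borel_prod[OF time_to_borel torus_to_borel]] .

lemma
  fixes F :: "'a::second_countable_topology \<times> (real ^ 3) \<Rightarrow> real"
  assumes F: "F \<in> borel_measurable borel"
  shows borel_measurable_LINT_torus: "(\<lambda>a. LINT x|torus. F (a, x)) \<in> borel_measurable borel"
proof -
  have "F \<in> borel_measurable (borel \<Otimes>\<^sub>M torus)"
    by (rule measurable_compose[OF to_borel_prod[OF _ torus_to_borel] F]) simp
  then have "(\<lambda>(a, x). F (a, x)) \<in> borel_measurable (borel \<Otimes>\<^sub>M torus)" by simp
  then show ?thesis by (rule torus.borel_measurable_lebesgue_integral)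
qed

lemma borel_measurable_nn_torus:
  fixes F :: "'a::second_countable_topology \<times> (real ^ 3) \<Rightarrow> ennreal"
  assumes F: "F \<in> borel_measurable borel"
  shows "(\<lambda>a. \<integral>\<^sup>+x. F (a, x) \<partial>torus) \<in> borel_measurable borel"
proof -
  have "F \<in> borel_measurable (borel \<Otimes>\<^sub>M torus)"
    by (rule measurable_compose[OF to_borel_prod[OF _ torus_to_borel] F]) simp
  then have "(\<lambda>(a, x). F (a, x)) \<in> borel_measurable (borel \<Otimes>\<^sub>M torus)" by simp
  then show ?thesis by (rule torus.borel_measurable_nn_integral)
qed

lemma borel_compose:
  assumes "f \<in> borel_measurable borel" "continuous_on UNIV g" shows "(\<lambda>w. f (g w)) \<in> borel_measurable borel"
  by (rule measurable_compose[OF borel_measurable_continuous_onI[OF assms(2)] assms(1)])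

lemma borel_fst_snd:
  fixes f :: "real \<Rightarrow> real ^ 3 \<Rightarrow> 'b::topological_space"
  assumes "(\<lambda>z. f (fst z) (snd z)) \<in> borel_measurable borel" shows "f t \<in> borel_measurable borel"
  using borel_compose[OF assms, of "\<lambda>x. (t, x)"] by (simp add: continuous_intros)

lemma borel_conv_time:
  fixes f :: "real \<Rightarrow> real ^ 3 \<Rightarrow> real"
  assumes f: "(\<lambda>z. f (fst z) (snd z)) \<in> borel_measurable borel" and \<Phi>: "\<Phi> \<in> borel_measurable borel"
  shows "(\<lambda>z. conv (f (fst z)) \<Phi> (snd z)) \<in> borel_measurable borel"
proof -
  have "(\<lambda>w :: (real \<times> (real ^ 3)) \<times> (real ^ 3). f (fst (fst w)) (snd w) * \<Phi> (snd (fst w) - snd w)) \<in> borel_measurable borel"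
  proof (rule borel_measurable_times)
    show "(\<lambda>w :: (real \<times> (real ^ 3)) \<times> (real ^ 3). f (fst (fst w)) (snd w)) \<in> borel_measurable borel"
      using borel_compose[OF f, of "\<lambda>w. (fst (fst w), snd w)"] by (simp add: continuous_intros)
    show "(\<lambda>w :: (real \<times> (real ^ 3)) \<times> (real ^ 3). \<Phi> (snd (fst w) - snd w)) \<in> borel_measurable borel"
      by (rule borel_compose[OF \<Phi>]) (intro continuous_intros)
  qed
  from borel_measurable_LINT_torus[OF this] show ?thesis by (simp add: conv_def)
qed

lemma borel_conv_time1:
  fixes f :: "real \<Rightarrow> real ^ 3 \<Rightarrow> real"
  assumes "(\<lambda>z. f (fst z) (snd z)) \<in> borel_measurable borel" "\<Phi> \<in> borel_measurable borel"
  shows "(\<lambda>t. conv (f t) \<Phi> y) \<in> borel_measurable borel"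
  using borel_compose[OF borel_conv_time[OF assms], of "\<lambda>t. (t, y)"] by (simp add: continuous_intros)

text \<open>A weak solution that is Borel measurable on the whole of space-time, with bounds at every time, not only at almost
  every time. The equations are tested with products \<open>\<theta>(t) \<Phi>(x)\<close>, in the coordinate direction \<open>j\<close>: the
  energy balance is built from such products, with translates of one mollifier as \<open>\<Phi>\<close>.\<close>

locale regular_solution =
  fixes \<alpha> T K :: real and u v :: "real \<Rightarrow> real ^ 3 \<Rightarrow> real ^ 3" and p :: "real \<Rightarrow> real ^ 3 \<Rightarrow> real"
  assumes T: "T > 0"
    and um: "(\<lambda>z. u (fst z) (snd z)) \<in> borel_measurable borel"
    and vm: "(\<lambda>z. v (fst z) (snd z)) \<in> borel_measurable borel"
    and pm: "(\<lambda>z. p (fst z) (snd z)) \<in> borel_measurable borel"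
    and u: "L2_field (u t)" and v: "L2_field (v t)" and p: "integrable torus (p t)"
    and uK: "(LINT x|torus. (norm (u t x))\<^sup>2) \<le> K" and vK: "(LINT x|torus. (norm (v t x))\<^sup>2) \<le> K"
    and pK: "(LINT x|torus. \<bar>p t x\<bar>) \<le> K"
    and H: "helmholtz \<alpha> (\<lambda>x. v t x $ i) (\<lambda>x. u t x $ i)"
    and momentum: "time_test T \<theta> \<Longrightarrow> smooth \<Phi> \<Longrightarrow> periodic \<Phi> \<Longrightarrow>
      (LINT t|time T. deriv \<theta> t * (LINT x|torus. v t x $ j * \<Phi> x))
      + (LINT t|time T. \<theta> t * (LINT x|torus. (\<Sum>i\<in>UNIV. v t x $ j * u t x $ i * partial i \<Phi> x)))
      + (LINT t|time T. \<theta> t * (LINT x|torus. p t x * partial j \<Phi> x)) = 0"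
    and continuity: "time_test T \<theta> \<Longrightarrow> smooth \<Phi> \<Longrightarrow> periodic \<Phi> \<Longrightarrow>
      (LINT t|time T. \<theta> t * (LINT x|torus. (\<Sum>i\<in>UNIV. u t x $ i * partial i \<Phi> x))) = 0"
begin

lemma K0: "0 \<le> K"
  using order_trans[OF _ uK[of 0]] by (simp add: integral_nonneg_AE)

lemma components_borel:
  "(\<lambda>z. u (fst z) (snd z) $ i) \<in> borel_measurable borel" "(\<lambda>z. v (fst z) (snd z) $ i) \<in> borel_measurable borel"
  using um vm by measurable

lemma L1_product_bound:
  assumes "L2_field a" "L2_field b" "(LINT x|torus. (norm (a x))\<^sup>2) \<le> K" "(LINT x|torus. (norm (b x))\<^sup>2) \<le> K"
  shows "(LINT x|torus. \<bar>a x $ i * b x $ j\<bar>) \<le> 2 * K"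
proof -
  have "(LINT x|torus. \<bar>a x $ i * b x $ j\<bar>) \<le> (LINT x|torus. (norm (a x))\<^sup>2 + (norm (b x))\<^sup>2)"
  proof (rule integral_mono)
    show "integrable torus (\<lambda>x. \<bar>a x $ i * b x $ j\<bar>)" by (intro integrable_abs L2_field_mult assms)
    show "integrable torus (\<lambda>x. (norm (a x))\<^sup>2 + (norm (b x))\<^sup>2)" using L2_fieldD(7) assms by auto
    fix x
    have "\<bar>a x $ i * b x $ j\<bar> \<le> norm (a x) * norm (b x)"
      unfolding abs_mult by (intro mult_mono component_le_norm_cart) auto
    also have "\<dots> \<le> 2 * (norm (a x) * norm (b x))" by simp
    also have "\<dots> \<le> (norm (a x))\<^sup>2 + (norm (b x))\<^sup>2"
      using zero_le_power2[of "norm (a x) - norm (b x)"] by (simp add: power2_eq_square algebra_simps)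
    finally show "\<bar>a x $ i * b x $ j\<bar> \<le> (norm (a x))\<^sup>2 + (norm (b x))\<^sup>2" .
  qed
  also have "\<dots> = (LINT x|torus. (norm (a x))\<^sup>2) + (LINT x|torus. (norm (b x))\<^sup>2)"
    using L2_fieldD(7) assms by simp
  finally show ?thesis using assms by linarith
qed

lemma L1_bound:
  assumes "L2_field a" "(LINT x|torus. (norm (a x))\<^sup>2) \<le> K"
  shows "(LINT x|torus. \<bar>a x $ i\<bar>) \<le> 1 + K"
proof -
  have "(LINT x|torus. \<bar>a x $ i\<bar>) \<le> (LINT x|torus. 1 + (norm (a x))\<^sup>2)"
  proof (rule integral_mono)
    show "integrable torus (\<lambda>x. \<bar>a x $ i\<bar>)" by (intro integrable_abs L2_fieldD assms)
    show "integrable torus (\<lambda>x. 1 + (norm (a x))\<^sup>2)" using L2_fieldD(7) assms by auto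
    fix x
    have "\<bar>a x $ i\<bar> \<le> norm (a x)" by (rule component_le_norm_cart)
    also have "\<dots> \<le> 2 * norm (a x)" by simp
    also have "\<dots> \<le> 1 + (norm (a x))\<^sup>2"
      using zero_le_power2[of "norm (a x) - 1"] norm_ge_zero[of "a x"] by (simp add: power2_eq_square algebra_simps)
    finally show "\<bar>a x $ i\<bar> \<le> 1 + (norm (a x))\<^sup>2" .
  qed
  also have "\<dots> = 1 + (LINT x|torus. (norm (a x))\<^sup>2)" using L2_fieldD(7)[OF assms(1)] by simp
  finally show ?thesis using assms by linarith
qed

lemma integrable_time_bounded:
  fixes f :: "real \<Rightarrow> real"
  assumes "f \<in> borel_measurable borel" "\<And>t. \<bar>f t\<bar> \<le> M" shows "integrable (time T) f"
  by (rule time.integrable_const_bound[where B=M]) (use assms in \<open>auto intro: measurable_time\<close>)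

text \<open>For one translate of the kernel the divergence vanishes at almost every time. The exceptional
  null set depends on the translate; a countable dense set of translates and continuity give all of them at once.\<close>

lemma AE_divfree:
  assumes \<phi>: "smooth \<phi>" "periodic \<phi>"
  shows "AE t in time T. divfree \<phi> (\<lambda>i x. u t x $ i)"
proof -
  have s: "smooth (partial i \<phi>)" "periodic (partial i \<phi>)" for i using smooth_partial partial_periodic \<phi> by auto
  have "\<exists>b. \<forall>x. \<bar>partial i \<phi> x\<bar> \<le> b" for i using smooth_periodic_bounded[OF s, of i] by metis
  then have "\<exists>B. \<forall>i x. \<bar>partial i \<phi> x\<bar> \<le> B i" by metis
  then obtain B where B: "\<And>i x. \<bar>partial i \<phi> x\<bar> \<le> B i" by blast
  define d where "d y t = (\<Sum>i\<in>UNIV. conv (\<lambda>x. u t x $ i) (partial i \<phi>) y)" for y t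
  have z: "AE t in time T. d y t = 0" for y
  proof -
    have I: "integrable (time T) (d y)"
      unfolding d_def[abs_def]
    proof (intro Bochner_Integration.integrable_sum integrable_time_bounded)
      show "(\<lambda>t. conv (\<lambda>x. u t x $ i) (partial i \<phi>) y) \<in> borel_measurable borel" for i
        by (rule borel_conv_time1[OF components_borel(1) smooth_borel[OF s(1)]])
      show "\<bar>conv (\<lambda>x. u t x $ i) (partial i \<phi>) y\<bar> \<le> B i * (1 + K)" for i t
      proof -
        have "0 \<le> B i" using B[of i 0] by linarith
        then show ?thesis
          using conv_bound[OF L2_fieldD(6)[OF u] smooth_borel[OF s(1)] B, of t i i y] L1_bound[OF u uK, of t i]
          by (meson mult_left_mono order_trans)
      qed
    qed
    have "(LINT t|time T. \<theta> t * d y t) = 0" if \<theta>: "time_test T \<theta>" for \<theta>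
    proof -
      have "(LINT x|torus. (\<Sum>i\<in>UNIV. u t x $ i * partial i (\<lambda>x. \<phi> (y - x)) x)) = - d y t" for t
        unfolding partial_reflect[OF \<phi>(1)] d_def conv_def
        using integrable_conv[OF L2_fieldD(6)[OF u] smooth_borel[OF s(1)] B] by (simp add: sum_negf)
      then show ?thesis
        using continuity[OF \<theta> smooth_reflect[OF \<phi>(1)] periodic_reflect[OF \<phi>(2)], of y] by simp
    qed
    from integral_zero_of_time_test[OF I this] show ?thesis
      by (intro AE_zero_if_interval_integrals_zero[OF I])
  qed
  obtain D :: "(real ^ 3) set" where D: "countable D" "\<And>X. open X \<Longrightarrow> X \<noteq> {} \<Longrightarrow> \<exists>y\<in>D. y \<in> X"
    using countable_dense_exists[where 'a="real ^ 3"] by metis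
  have "AE t in time T. \<forall>y\<in>D. d y t = 0" using z D(1) by (subst AE_ball_countable) auto
  then show ?thesis
  proof eventually_elim
    case (elim t)
    have c: "continuous_on UNIV (\<lambda>y. d y t)"
      unfolding d_def
      by (intro continuous_on_sum conv_continuous[OF L2_fieldD(6)[OF u] smooth_continuous[OF s(1)] B])
    have "open {y. d y t \<noteq> 0}" using c by (intro open_Collect_neq) auto
    then have "{y. d y t \<noteq> 0} = {}" using D(2)[of "{y. d y t \<noteq> 0}"] elim by auto
    then show ?case by (auto simp: divfree_def d_def)
  qed
qed

context
  fixes \<phi> \<kappa> \<delta> assumes \<phi>: "mollifier \<kappa> \<delta> \<phi>"
begin

definition "filtered j t y = conv (\<lambda>x. v t x $ j) \<phi> y"
definition "momentum_flux j t y = flux \<phi> (u t) (v t) (p t) j y"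

lemma uv_borel: "(\<lambda>z. u (fst z) (snd z) $ i * v (fst z) (snd z) $ j) \<in> borel_measurable borel"
  using components_borel by measurable

lemma filtered_borel: "(\<lambda>z. filtered j (fst z) (snd z)) \<in> borel_measurable borel"
  unfolding filtered_def by (rule borel_conv_time[OF components_borel(2) mollifierD(8)[OF \<phi>]])

lemma momentum_flux_borel: "(\<lambda>z. momentum_flux j (fst z) (snd z)) \<in> borel_measurable borel"
  unfolding momentum_flux_def flux_def
  by (intro borel_measurable_add borel_measurable_sum borel_conv_time[OF uv_borel partial_mollifier(3)[OF \<phi>]]
      borel_conv_time[OF pm partial_mollifier(3)[OF \<phi>]])

lemma filtered_bounded: "\<exists>M. \<forall>j t y. \<bar>filtered j t y\<bar> \<le> M"
proof -
  obtain B where B: "\<And>x. \<bar>\<phi> x\<bar> \<le> B" using mollifier_bounded[OF \<phi>] by blast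
  have B0: "0 \<le> B" using B[of 0] by linarith
  have "\<bar>filtered j t y\<bar> \<le> B * (1 + K)" for j t y
    unfolding filtered_def
    by (rule order_trans[OF conv_bound[OF L2_fieldD(6)[OF v] mollifierD(8)[OF \<phi>] B] mult_left_mono[OF L1_bound[OF v vK] B0]])
  then show ?thesis by blast
qed

lemma flux_parts_bounded:
  "\<exists>M. \<forall>i j t y. \<bar>conv (\<lambda>x. u t x $ i * v t x $ j) (partial i \<phi>) y\<bar> \<le> M"
  "\<exists>M. \<forall>j t y. \<bar>conv (p t) (partial j \<phi>) y\<bar> \<le> M"
proof -
  have "\<exists>B. \<forall>i x. \<bar>partial i \<phi> x\<bar> \<le> B i" using partial_mollifier(4)[OF \<phi>] by metis
  then obtain B where B: "\<And>i x. \<bar>partial i \<phi> x\<bar> \<le> B i" by blast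
  have B0: "0 \<le> B i" for i using B[of i 0] by linarith
  have le: "B i * c \<le> (\<Sum>i\<in>UNIV. B i) * c" if "0 \<le> c" for i c
    by (intro mult_right_mono that member_le_sum B0) auto
  have "\<bar>conv (\<lambda>x. u t x $ i * v t x $ j) (partial i \<phi>) y\<bar> \<le> (\<Sum>i\<in>UNIV. B i) * (2 * K)" for i j t y
    by (rule order_trans[OF conv_bound[OF L2_field_mult(1)[OF u v] partial_mollifier(3)[OF \<phi>] B]
          order_trans[OF mult_left_mono[OF L1_product_bound[OF u v uK vK] B0] le]]) (use K0 in simp)
  then show "\<exists>M. \<forall>i j t y. \<bar>conv (\<lambda>x. u t x $ i * v t x $ j) (partial i \<phi>) y\<bar> \<le> M" by blast
  have "\<bar>conv (p t) (partial j \<phi>) y\<bar> \<le> (\<Sum>i\<in>UNIV. B i) * K" for j t y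
    by (rule order_trans[OF conv_bound[OF p partial_mollifier(3)[OF \<phi>] B]
          order_trans[OF mult_left_mono[OF pK B0] le]]) (rule K0)
  then show "\<exists>M. \<forall>j t y. \<bar>conv (p t) (partial j \<phi>) y\<bar> \<le> M" by blast
qed

lemma momentum_flux_bounded: "\<exists>M. \<forall>j t y. \<bar>momentum_flux j t y\<bar> \<le> M"
proof -
  obtain M1 where M1: "\<And>i j t y. \<bar>conv (\<lambda>x. u t x $ i * v t x $ j) (partial i \<phi>) y\<bar> \<le> M1"
    using flux_parts_bounded(1) by blast
  obtain M2 where M2: "\<And>j t y. \<bar>conv (p t) (partial j \<phi>) y\<bar> \<le> M2" using flux_parts_bounded(2) by blast
  have "\<bar>momentum_flux j t y\<bar> \<le> (\<Sum>i\<in>(UNIV :: 3 set). M1) + M2" for j t y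
    unfolding momentum_flux_def flux_def
    by (rule order_trans[OF abs_triangle_ineq add_mono[OF order_trans[OF sum_abs sum_mono[OF M1]] M2]])
  then show ?thesis by blast
qed

text \<open>Test the momentum equation with \<open>\<theta>(t) \<phi>(y - x)\<close> in direction \<open>j\<close>, for a fixed point \<open>y\<close>.\<close>

lemma weak_deriv_filtered: "weak_deriv T (\<lambda>t. filtered j t y) (\<lambda>t. - momentum_flux j t y)"
  unfolding weak_deriv_def
proof (intro allI impI)
  fix \<theta> assume \<theta>: "time_test T \<theta>"
  note s = mollifierD(1,2)[OF \<phi>]
  have "\<exists>B. \<forall>i x. \<bar>partial i \<phi> x\<bar> \<le> B i" using partial_mollifier(4)[OF \<phi>] by metis
  then obtain B where B: "\<And>i x. \<bar>partial i \<phi> x\<bar> \<le> B i" by blast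
  let ?A = "\<lambda>t. \<Sum>i\<in>UNIV. conv (\<lambda>x. u t x $ i * v t x $ j) (partial i \<phi>) y" and ?P = "\<lambda>t. conv (p t) (partial j \<phi>) y"
  have 1: "(LINT x|torus. (\<Sum>i\<in>UNIV. v t x $ j * u t x $ i * partial i (\<lambda>x. \<phi> (y - x)) x)) = - ?A t" for t
    unfolding partial_reflect[OF s(1)] conv_def
    using integrable_conv[OF L2_field_mult(1)[OF u v] partial_mollifier(3)[OF \<phi>] B] by (simp add: sum_negf mult_ac)
  have 2: "(LINT x|torus. p t x * partial j (\<lambda>x. \<phi> (y - x)) x) = - ?P t" for t
    unfolding partial_reflect[OF s(1)] conv_def by simp
  have IA: "integrable (time T) ?A"
  proof -
    obtain M where M: "\<And>i j t y. \<bar>conv (\<lambda>x. u t x $ i * v t x $ j) (partial i \<phi>) y\<bar> \<le> M"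
      using flux_parts_bounded(1) by blast
    show ?thesis
      by (intro Bochner_Integration.integrable_sum integrable_time_bounded[OF borel_conv_time1[OF uv_borel partial_mollifier(3)[OF \<phi>]] M])
  qed
  have IP: "integrable (time T) ?P"
  proof -
    obtain M where M: "\<And>j t y. \<bar>conv (p t) (partial j \<phi>) y\<bar> \<le> M" using flux_parts_bounded(2) by blast
    show ?thesis by (rule integrable_time_bounded[OF borel_conv_time1[OF pm partial_mollifier(3)[OF \<phi>]] M])
  qed
  have I: "integrable (time T) (\<lambda>t. \<theta> t * ?A t)" "integrable (time T) (\<lambda>t. \<theta> t * ?P t)"
    by (intro integrable_time_mult IA IP time_test_props[OF \<theta>])+
  have "(LINT t|time T. deriv \<theta> t * filtered j t y) - (LINT t|time T. \<theta> t * ?A t) - (LINT t|time T. \<theta> t * ?P t) = 0"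
    using momentum[OF \<theta> smooth_reflect[OF s(1)] periodic_reflect[OF s(2)], of j y]
    unfolding 1 2 by (simp add: filtered_def conv_def)
  moreover have "(LINT t|time T. \<theta> t * - momentum_flux j t y) = - (LINT t|time T. \<theta> t * ?A t) - (LINT t|time T. \<theta> t * ?P t)"
    using I unfolding momentum_flux_def flux_def by (simp add: right_diff_distrib)
  ultimately show "(LINT t|time T. deriv \<theta> t * filtered j t y) + (LINT t|time T. \<theta> t * - momentum_flux j t y) = 0" by simp
qed

definition "filtered_energy t = (\<Sum>j\<in>UNIV. LINT y|torus. (filtered j t y)\<^sup>2)"
definition "energy_flux t = (\<Sum>j\<in>UNIV. LINT y|torus. filtered j t y * momentum_flux j t y)"

lemma time_section_borel:
  fixes F :: "real \<Rightarrow> real ^ 3 \<Rightarrow> real"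
  assumes "(\<lambda>z. F (fst z) (snd z)) \<in> borel_measurable borel"
  shows "(\<lambda>t. F t y) \<in> borel_measurable borel"
  using borel_compose[OF assms, of "\<lambda>t. (t, y)"] by (simp add: continuous_intros)

lemma time_torus_Fubini:
  fixes F :: "real \<Rightarrow> real ^ 3 \<Rightarrow> real"
  assumes F: "(\<lambda>z. F (fst z) (snd z)) \<in> borel_measurable borel" "\<And>t y. \<bar>F t y\<bar> \<le> M"
    and a: "integrable (time T) a"
  shows "(LINT t|time T. a t * (LINT y|torus. F t y)) = (LINT y|torus. (LINT t|time T. a t * F t y))"
    and "integrable torus (\<lambda>y. LINT t|time T. a t * F t y)"
    and "integrable (time T) (\<lambda>t. a t * (LINT y|torus. F t y))"
proof -
  interpret P: pair_sigma_finite "time T" torus ..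
  have I: "integrable (time T \<Otimes>\<^sub>M torus) (case_prod (\<lambda>t y. a t * F t y))"
    using P.integrable_mult_bounded[OF a torus.finite_measure_axioms measurable_time_torus[OF F(1)], of M] F(2) by simp
  show "(LINT t|time T. a t * (LINT y|torus. F t y)) = (LINT y|torus. (LINT t|time T. a t * F t y))"
    using P.Fubini_integral[OF I] by simp
  show "integrable torus (\<lambda>y. LINT t|time T. a t * F t y)" by (rule P.integrable_snd[OF I])
  show "integrable (time T) (\<lambda>t. a t * (LINT y|torus. F t y))" using P.integrable_fst[OF I] by simp
qed

lemma filtered_square: "(\<lambda>z. (filtered j (fst z) (snd z))\<^sup>2) \<in> borel_measurable borel" "\<exists>M. \<forall>t y. \<bar>(filtered j t y)\<^sup>2\<bar> \<le> M"
  and filtered_flux: "(\<lambda>z. filtered j (fst z) (snd z) * momentum_flux j (fst z) (snd z)) \<in> borel_measurable borel" "\<exists>M. \<forall>t y. \<bar>filtered j t y * momentum_flux j t y\<bar> \<le> M"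
proof -
  obtain M1 where M1: "\<And>j t y. \<bar>filtered j t y\<bar> \<le> M1" using filtered_bounded by blast
  obtain M2 where M2: "\<And>j t y. \<bar>momentum_flux j t y\<bar> \<le> M2" using momentum_flux_bounded by blast
  have 0: "0 \<le> M1" using M1[of 0 0 0] by linarith
  show "(\<lambda>z. (filtered j (fst z) (snd z))\<^sup>2) \<in> borel_measurable borel" using filtered_borel by measurable
  show "(\<lambda>z. filtered j (fst z) (snd z) * momentum_flux j (fst z) (snd z)) \<in> borel_measurable borel" using filtered_borel momentum_flux_borel by measurable
  have "\<bar>(filtered j t y)\<^sup>2\<bar> \<le> M1\<^sup>2" for t y using power_mono[OF M1 abs_ge_zero, of j t y 2] by simp
  then show "\<exists>M. \<forall>t y. \<bar>(filtered j t y)\<^sup>2\<bar> \<le> M" by blast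
  have "\<bar>filtered j t y * momentum_flux j t y\<bar> \<le> M1 * M2" for t y unfolding abs_mult by (intro mult_mono M1 M2 0) auto
  then show "\<exists>M. \<forall>t y. \<bar>filtered j t y * momentum_flux j t y\<bar> \<le> M" by blast
qed

lemma filtered_energy_integrable: "integrable (time T) filtered_energy"
  and energy_flux_integrable: "integrable (time T) energy_flux"
proof -
  have c: "integrable (time T) (\<lambda>t. 1 :: real)" by simp
  have 1: "integrable (time T) (\<lambda>t. LINT y|torus. (filtered j t y)\<^sup>2)" for j
  proof -
    obtain M where M: "\<And>t y. \<bar>(filtered j t y)\<^sup>2\<bar> \<le> M" using filtered_square(2) by blast
    show ?thesis using time_torus_Fubini(3)[OF filtered_square(1) M c] by simp
  qed
  have 2: "integrable (time T) (\<lambda>t. LINT y|torus. filtered j t y * momentum_flux j t y)" for j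
  proof -
    obtain M where M: "\<And>t y. \<bar>filtered j t y * momentum_flux j t y\<bar> \<le> M" using filtered_flux(2) by blast
    show ?thesis using time_torus_Fubini(3)[OF filtered_flux(1) M c] by simp
  qed
  show "integrable (time T) filtered_energy" unfolding filtered_energy_def[abs_def] by (intro Bochner_Integration.integrable_sum 1)
  show "integrable (time T) energy_flux" unfolding energy_flux_def[abs_def] by (intro Bochner_Integration.integrable_sum 2)
qed

text \<open>The chain rule \<open>weak_deriv_square\<close> is used at each fixed \<open>y\<close>, where only time remains, and the result is
  integrated over \<open>y\<close>.\<close>

lemma weak_deriv_filtered_energy: "weak_deriv T filtered_energy (\<lambda>t. - 2 * energy_flux t)"
  unfolding weak_deriv_def
proof (intro allI impI)
  fix \<theta> assume \<theta>: "time_test T \<theta>"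
  have c: "integrable (time T) (\<lambda>t. 1 :: real)" by simp
  have i: "integrable (time T) (deriv \<theta>)" "integrable (time T) \<theta>"
    using integrable_time_mult[OF c time_test_props(3,5)[OF \<theta>]] integrable_time_mult[OF c time_test_props(2,4)[OF \<theta>]] by simp_all
  have *: "(LINT t|time T. deriv \<theta> t * (LINT y|torus. (filtered j t y)\<^sup>2)) = 2 * (LINT t|time T. \<theta> t * (LINT y|torus. filtered j t y * momentum_flux j t y))"
    and I: "integrable (time T) (\<lambda>t. deriv \<theta> t * (LINT y|torus. (filtered j t y)\<^sup>2))"
      "integrable (time T) (\<lambda>t. \<theta> t * (LINT y|torus. filtered j t y * momentum_flux j t y))" for j
  proof -
    obtain M1 where M1: "\<And>t y. \<bar>(filtered j t y)\<^sup>2\<bar> \<le> M1" using filtered_square(2) by blast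
    obtain M2 where M2: "\<And>t y. \<bar>filtered j t y * momentum_flux j t y\<bar> \<le> M2" using filtered_flux(2) by blast
    note F1 = time_torus_Fubini[OF filtered_square(1) M1 i(1)] and F2 = time_torus_Fubini[OF filtered_flux(1) M2 i(2)]
    show "integrable (time T) (\<lambda>t. deriv \<theta> t * (LINT y|torus. (filtered j t y)\<^sup>2))" by (rule F1)
    show "integrable (time T) (\<lambda>t. \<theta> t * (LINT y|torus. filtered j t y * momentum_flux j t y))" by (rule F2)
    have "(LINT t|time T. deriv \<theta> t * (filtered j t y)\<^sup>2) = 2 * (LINT t|time T. \<theta> t * (filtered j t y * momentum_flux j t y))" for y
    proof -
      obtain M where M: "\<And>j t y. \<bar>filtered j t y\<bar> \<le> M" using filtered_bounded by blast
      obtain M' where M': "\<And>j t y. \<bar>momentum_flux j t y\<bar> \<le> M'" using momentum_flux_bounded by blast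
      have "integrable (time T) (\<lambda>t. filtered j t y)" by (rule integrable_time_bounded[OF time_section_borel[OF filtered_borel] M])
      moreover have "integrable (time T) (\<lambda>t. - momentum_flux j t y)"
        using integrable_time_bounded[OF time_section_borel[OF momentum_flux_borel] M'] by simp
      ultimately have "weak_deriv T (\<lambda>t. (filtered j t y)\<^sup>2) (\<lambda>t. 2 * (filtered j t y * - momentum_flux j t y))"
        by (rule weak_deriv_square[OF T _ _ weak_deriv_filtered])
      then have "(LINT t|time T. deriv \<theta> t * (filtered j t y)\<^sup>2) + (LINT t|time T. \<theta> t * (2 * (filtered j t y * - momentum_flux j t y))) = 0"
        using \<theta> unfolding weak_deriv_def by blast
      moreover have "(LINT t|time T. \<theta> t * (2 * (filtered j t y * - momentum_flux j t y))) = (LINT t|time T. - 2 * (\<theta> t * (filtered j t y * momentum_flux j t y)))"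
        by (rule Bochner_Integration.integral_cong) auto
      ultimately show ?thesis by simp
    qed
    then show "(LINT t|time T. deriv \<theta> t * (LINT y|torus. (filtered j t y)\<^sup>2)) = 2 * (LINT t|time T. \<theta> t * (LINT y|torus. filtered j t y * momentum_flux j t y))"
      unfolding F1(1) F2(1) by simp
  qed
  have "(LINT t|time T. deriv \<theta> t * filtered_energy t) = (\<Sum>j\<in>UNIV. LINT t|time T. deriv \<theta> t * (LINT y|torus. (filtered j t y)\<^sup>2))"
    unfolding filtered_energy_def sum_distrib_left using I(1) by simp
  also have "\<dots> = 2 * (\<Sum>j\<in>UNIV. LINT t|time T. \<theta> t * (LINT y|torus. filtered j t y * momentum_flux j t y))"
    unfolding * by (simp add: sum_distrib_left)
  also have "\<dots> = 2 * (LINT t|time T. \<theta> t * energy_flux t)"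
    unfolding energy_flux_def sum_distrib_left using I(2) by (simp add: sum_distrib_left)
  finally have "(LINT t|time T. deriv \<theta> t * filtered_energy t) = 2 * (LINT t|time T. \<theta> t * energy_flux t)" .
  moreover have "(LINT t|time T. \<theta> t * (- 2 * energy_flux t)) = (LINT t|time T. - 2 * (\<theta> t * energy_flux t))"
    by (rule Bochner_Integration.integral_cong) auto
  ultimately show "(LINT t|time T. deriv \<theta> t * filtered_energy t) + (LINT t|time T. \<theta> t * (- 2 * energy_flux t)) = 0" by simp
qed

lemma filtered_energy_difference: "AE t in time T. AE s in time T. \<bar>filtered_energy t - filtered_energy s\<bar> \<le> 4 * (LINT t|time T. \<bar>energy_flux t\<bar>)"
proof -
  have I: "integrable (time T) (\<lambda>t. - 2 * energy_flux t)" using energy_flux_integrable by simp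
  obtain c where c: "AE t in time T. filtered_energy t = c + primitive T (\<lambda>t. - 2 * energy_flux t) t"
    by (rule weak_deriv_imp_primitive[OF T filtered_energy_integrable I weak_deriv_filtered_energy])
  have b: "\<bar>primitive T (\<lambda>t. - 2 * energy_flux t) t\<bar> \<le> 2 * (LINT t|time T. \<bar>energy_flux t\<bar>)" for t
    using primitive_bound[OF I, of t] by (simp add: abs_mult)
  have bb: "\<bar>(c + x) - (c + y)\<bar> \<le> 4 * m" if "\<bar>x\<bar> \<le> 2 * m" "\<bar>y\<bar> \<le> 2 * m" for x y m :: real using that by linarith
  show ?thesis
    using c
  proof eventually_elim
    case (elim t)
    show ?case using c by eventually_elim (unfold elim, use bb[OF b b] in simp)
  qed
qed

lemma energy_flux_bound:
  assumes "divfree \<phi> (\<lambda>i x. u t x $ i)"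
  shows "ennreal \<bar>energy_flux t\<bar> \<le> (\<Sum>i\<in>UNIV. \<integral>\<^sup>+\<xi>. ennreal \<bar>grad_kern \<phi> i \<xi>\<bar> *
      (\<integral>\<^sup>+x. ennreal (norm (increment \<xi> (u t) x) * (norm (increment \<xi> (v t) x))\<^sup>2) \<partial>torus) \<partial>torus)"
  unfolding energy_flux_def filtered_def momentum_flux_def
proof (rule flux_integral_bound[OF \<phi> u v assms _ _ p])
  show "divfree \<phi> (\<lambda>i x. v t x $ i)"
    by (rule divfree_helmholtz[OF H L2_fieldD(6)[OF u] mollifierD(1,2)[OF \<phi>] assms])
  show "p t \<in> borel_measurable borel" by (rule borel_fst_snd[OF pm])
qed

end

end

section \<open>Vanishing of the flux\<close>

lemma increment_measurable:
  fixes f :: "real \<Rightarrow> real ^ 3 \<Rightarrow> real ^ 3"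
  assumes "(\<lambda>z. f (fst z) (snd z)) \<in> borel_measurable borel"
  shows "(\<lambda>z :: (real \<times> (real ^ 3)) \<times> (real ^ 3). increment (snd (fst z)) (f (fst (fst z))) (snd z)) \<in> borel_measurable borel"
  unfolding increment_def
proof (rule borel_measurable_diff)
  show "(\<lambda>z :: (real \<times> (real ^ 3)) \<times> (real ^ 3). f (fst (fst z)) (snd z + snd (fst z))) \<in> borel_measurable borel"
    using borel_compose[OF assms, of "\<lambda>z. (fst (fst z), snd z + snd (fst z))"] by (simp add: continuous_intros)
  show "(\<lambda>z :: (real \<times> (real ^ 3)) \<times> (real ^ 3). f (fst (fst z)) (snd z)) \<in> borel_measurable borel"
    using borel_compose[OF assms, of "\<lambda>z. (fst (fst z), snd z)"] by (simp add: continuous_intros)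
qed

text \<open>Valued in the extended reals, so that Tonelli's theorem exchanges the integrals over \<open>t\<close> and \<open>\<xi>\<close>
  before anything is known to be finite.\<close>

definition increment_integral :: "(real ^ 3 \<Rightarrow> real ^ 3) \<Rightarrow> (real ^ 3 \<Rightarrow> real ^ 3) \<Rightarrow> real ^ 3 \<Rightarrow> ennreal" where
  "increment_integral f g \<xi> = (\<integral>\<^sup>+x. ennreal (norm (increment \<xi> f x) * (norm (increment \<xi> g x))\<^sup>2) \<partial>torus)"

lemma increment_integral_cent:
  assumes "periodic f" "periodic g" shows "increment_integral f g (cent \<xi>) = increment_integral f g \<xi>"
proof -
  have c: "h (x + cent \<xi>) = h (x + \<xi>)" if "periodic h" for h :: "real ^ 3 \<Rightarrow> real ^ 3" and x
    using periodicD[OF that cent_lattice[of \<xi>], of "x + cent \<xi>"] by (simp add: algebra_simps)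
  show ?thesis by (simp add: increment_integral_def increment_def c[OF assms(1)] c[OF assms(2)])
qed

lemma increment_integral_zero: "increment_integral f g 0 = 0" by (simp add: increment_integral_def increment_def)

context regular_solution
begin

lemma increment_integral_borel: "(\<lambda>z. increment_integral (u (fst z)) (v (fst z)) (snd z)) \<in> borel_measurable borel"
proof -
  note [measurable] = increment_measurable[OF um] increment_measurable[OF vm]
  have "(\<lambda>z :: (real \<times> (real ^ 3)) \<times> (real ^ 3). ennreal (norm (increment (snd (fst z)) (u (fst (fst z))) (snd z)) *
      (norm (increment (snd (fst z)) (v (fst (fst z))) (snd z)))\<^sup>2)) \<in> borel_measurable borel"
    by measurable
  from borel_measurable_nn_torus[OF this] show ?thesis by (simp add: increment_integral_def)
qed

text \<open>The gradient kernel has mass at most \<open>\<kappa> / \<delta>\<close> and lives on \<open>\<bar>\<xi>\<bar> \<le> 2 \<delta>\<close>, where the increments contribute at most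
  \<open>2 \<delta> e\<close>: the powers of \<open>\<delta>\<close> cancel. There are three components.\<close>

lemma flux_time_bound:
  assumes \<phi>: "mollifier \<kappa> \<delta> \<phi>" and \<delta>: "0 < \<delta>" "2 * \<delta> < \<rho>" and e: "0 \<le> e"
    and D: "\<And>\<xi>. \<xi> \<noteq> 0 \<Longrightarrow> norm \<xi> < \<rho> \<Longrightarrow> (\<integral>\<^sup>+t. increment_integral (u t) (v t) \<xi> \<partial>time T) \<le> ennreal (norm \<xi> * e)"
  shows "(LINT t|time T. \<bar>energy_flux \<phi> t\<bar>) \<le> 6 * \<kappa> * e"
proof -
  note K = grad_kern_props[OF \<phi>]
  interpret P: pair_sigma_finite "time T" torus ..
  have \<kappa>: "0 \<le> \<kappa>"
    using order_trans[OF _ mollifierD(7)[OF \<phi>, of 0]] \<delta> by (simp add: integral_nonneg_AE)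
  have [measurable]: "(\<lambda>z. increment_integral (u (fst z)) (v (fst z)) (snd z)) \<in> borel_measurable (time T \<Otimes>\<^sub>M torus)"
    by (rule measurable_time_torus[OF increment_integral_borel])
  have Kt [measurable]: "grad_kern \<phi> i \<in> borel_measurable torus" for i by (rule measurable_torus[OF K(1)])
  have m: "(\<lambda>z. ennreal \<bar>grad_kern \<phi> i (snd z)\<bar> * increment_integral (u (fst z)) (v (fst z)) (snd z)) \<in> borel_measurable (time T \<Otimes>\<^sub>M torus)" for i
    by measurable
  have ci: "(\<lambda>t. \<integral>\<^sup>+\<xi>. ennreal \<bar>grad_kern \<phi> i \<xi>\<bar> * increment_integral (u t) (v t) \<xi> \<partial>torus) \<in> borel_measurable (time T)" for i
    using torus.borel_measurable_nn_integral[of "\<lambda>t \<xi>. ennreal \<bar>grad_kern \<phi> i \<xi>\<bar> * increment_integral (u t) (v t) \<xi>" "time T"] m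
    by (simp add: split_def)
  have ct: "(\<lambda>t. increment_integral (u t) (v t) \<xi>) \<in> borel_measurable (time T)" for \<xi>
    using measurable_time[OF borel_compose[OF increment_integral_borel, of "\<lambda>t. (t, \<xi>)"]] by (simp add: continuous_intros)
  have each: "(\<integral>\<^sup>+t. \<integral>\<^sup>+\<xi>. ennreal \<bar>grad_kern \<phi> i \<xi>\<bar> * increment_integral (u t) (v t) \<xi> \<partial>torus \<partial>time T) \<le> ennreal (2 * \<kappa> * e)" for i
  proof -
    obtain B where B: "\<And>\<xi>. \<bar>grad_kern \<phi> i \<xi>\<bar> \<le> B" using K(3) by blast
    have "(\<integral>\<^sup>+t. \<integral>\<^sup>+\<xi>. ennreal \<bar>grad_kern \<phi> i \<xi>\<bar> * increment_integral (u t) (v t) \<xi> \<partial>torus \<partial>time T)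
        = (\<integral>\<^sup>+\<xi>. \<integral>\<^sup>+t. ennreal \<bar>grad_kern \<phi> i \<xi>\<bar> * increment_integral (u t) (v t) \<xi> \<partial>time T \<partial>torus)"
      using P.Fubini'[of "\<lambda>t \<xi>. ennreal \<bar>grad_kern \<phi> i \<xi>\<bar> * increment_integral (u t) (v t) \<xi>"] m[of i] by (simp add: split_def)
    also have "\<dots> = (\<integral>\<^sup>+\<xi>. ennreal \<bar>grad_kern \<phi> i \<xi>\<bar> * (\<integral>\<^sup>+t. increment_integral (u t) (v t) \<xi> \<partial>time T) \<partial>torus)"
      by (intro nn_integral_cong nn_integral_cmult ct)
    also have "\<dots> \<le> (\<integral>\<^sup>+\<xi>. ennreal (\<bar>grad_kern \<phi> i \<xi>\<bar> * (2 * \<delta> * e)) \<partial>torus)"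
    proof (rule nn_integral_mono)
      fix \<xi>
      show "ennreal \<bar>grad_kern \<phi> i \<xi>\<bar> * (\<integral>\<^sup>+t. increment_integral (u t) (v t) \<xi> \<partial>time T) \<le> ennreal (\<bar>grad_kern \<phi> i \<xi>\<bar> * (2 * \<delta> * e))"
      proof (cases "grad_kern \<phi> i \<xi> = 0")
        case False
        then have n: "norm (cent \<xi>) \<le> 2 * \<delta>" by (rule grad_kern_support[OF \<phi>])
        have "(\<integral>\<^sup>+t. increment_integral (u t) (v t) \<xi> \<partial>time T) = (\<integral>\<^sup>+t. increment_integral (u t) (v t) (cent \<xi>) \<partial>time T)"
          using increment_integral_cent[OF L2_fieldD(1)[OF u] L2_fieldD(1)[OF v]] by simp
        also have "\<dots> \<le> ennreal (2 * \<delta> * e)"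
        proof (cases "cent \<xi> = 0")
          case True then show ?thesis by (simp add: increment_integral_zero)
        next
          case nz: False
          have "(\<integral>\<^sup>+t. increment_integral (u t) (v t) (cent \<xi>) \<partial>time T) \<le> ennreal (norm (cent \<xi>) * e)"
            by (rule D[OF nz]) (use n \<delta> in linarith)
          also have "\<dots> \<le> ennreal (2 * \<delta> * e)" by (intro ennreal_leI mult_right_mono n e)
          finally show ?thesis .
        qed
        finally have "(\<integral>\<^sup>+t. increment_integral (u t) (v t) \<xi> \<partial>time T) \<le> ennreal (2 * \<delta> * e)" .
        then have "ennreal \<bar>grad_kern \<phi> i \<xi>\<bar> * (\<integral>\<^sup>+t. increment_integral (u t) (v t) \<xi> \<partial>time T) \<le> ennreal \<bar>grad_kern \<phi> i \<xi>\<bar> * ennreal (2 * \<delta> * e)"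
          by (rule mult_left_mono) simp
        then show ?thesis by (simp add: ennreal_mult')
      qed simp
    qed
    also have "\<dots> = ennreal (LINT \<xi>|torus. \<bar>grad_kern \<phi> i \<xi>\<bar> * (2 * \<delta> * e))"
      using \<delta> e by (intro nn_integral_eq_integral integrable_mult_left integrable_abs integrable_torus_bounded[OF K(1) B]) auto
    also have "\<dots> \<le> ennreal (2 * \<kappa> * e)"
    proof (rule ennreal_leI)
      have "(LINT \<xi>|torus. \<bar>grad_kern \<phi> i \<xi>\<bar> * (2 * \<delta> * e)) = 2 * e * (\<delta> * (LINT \<xi>|torus. \<bar>grad_kern \<phi> i \<xi>\<bar>))" by simp
      also have "\<dots> \<le> 2 * e * \<kappa>" using e grad_kern_L1[OF \<phi> \<delta>(1), of i] by (intro mult_left_mono) auto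
      finally show "(LINT \<xi>|torus. \<bar>grad_kern \<phi> i \<xi>\<bar> * (2 * \<delta> * e)) \<le> 2 * \<kappa> * e" by (simp add: mult_ac)
    qed
    finally show ?thesis .
  qed
  have "ennreal (LINT t|time T. \<bar>energy_flux \<phi> t\<bar>) = (\<integral>\<^sup>+t. ennreal \<bar>energy_flux \<phi> t\<bar> \<partial>time T)"
    using energy_flux_integrable[OF \<phi>] by (intro nn_integral_eq_integral[symmetric]) auto
  also have "\<dots> \<le> (\<integral>\<^sup>+t. (\<Sum>i\<in>UNIV. \<integral>\<^sup>+\<xi>. ennreal \<bar>grad_kern \<phi> i \<xi>\<bar> * increment_integral (u t) (v t) \<xi> \<partial>torus) \<partial>time T)"
    using AE_divfree[OF mollifierD(1,2)[OF \<phi>]] energy_flux_bound[OF \<phi>]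
    by (intro nn_integral_mono_AE) (auto simp: increment_integral_def elim!: eventually_mono)
  also have "\<dots> = (\<Sum>i\<in>UNIV. \<integral>\<^sup>+t. \<integral>\<^sup>+\<xi>. ennreal \<bar>grad_kern \<phi> i \<xi>\<bar> * increment_integral (u t) (v t) \<xi> \<partial>torus \<partial>time T)"
    by (rule nn_integral_sum) (rule ci)
  also have "\<dots> \<le> (\<Sum>i\<in>(UNIV :: 3 set). ennreal (2 * \<kappa> * e))" by (intro sum_mono each)
  also have "\<dots> = ennreal (\<Sum>i\<in>(UNIV :: 3 set). 2 * \<kappa> * e)" using \<kappa> e by (intro sum_ennreal) auto
  finally have "(LINT t|time T. \<bar>energy_flux \<phi> t\<bar>) \<le> (\<Sum>i\<in>(UNIV :: 3 set). 2 * \<kappa> * e)"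
    using \<kappa> e by (subst (asm) ennreal_le_iff) (auto intro!: sum_nonneg)
  then show ?thesis by simp
qed

text \<open>The flux tends to zero in \<open>L\<^sup>1(0, T)\<close>, while the filtered energies converge at every time. Only countably
  many scales are used, so the exceptional times of all scales still form a null set.\<close>

lemma energy_conservation:
  assumes C: "integrable (time T) C" and \<sigma>: "((\<lambda>\<xi> :: real ^ 3. \<sigma> (norm \<xi>)) \<longlongrightarrow> 0) (at 0)"
    and bound: "\<And>\<xi>. AE t in time T. increment_integral (u t) (v t) \<xi> \<le> ennreal (C t * norm \<xi> * \<sigma> (norm \<xi>))"
  shows "AE t in time T. AE s in time T. (LINT x|torus. (norm (v t x))\<^sup>2) = (LINT x|torus. (norm (v s x))\<^sup>2)"
proof -
  obtain \<kappa> \<phi> where \<phi>: "\<And>n. mollifier \<kappa> (scale_seq n) (\<phi> n)" using mollifier_sequence by blast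
  have pos: "scale_seq n > 0" for n by (simp add: scale_seq_def)
  have \<kappa>: "0 \<le> \<kappa>"
    using order_trans[OF _ mollifierD(7)[OF \<phi>, of 0 0]] pos[of 0] by (simp add: integral_nonneg_AE)
  define N where "N = (LINT t|time T. \<bar>C t\<bar>)"
  have N0: "0 \<le> N" unfolding N_def by (intro integral_nonneg_AE) auto
  have lim: "(\<lambda>n. LINT t|time T. \<bar>energy_flux (\<phi> n) t\<bar>) \<longlonglongrightarrow> 0"
  proof (rule LIMSEQ_I)
    fix r :: real assume r: "r > 0"
    define e where "e = r / (6 * \<kappa> * N + 1)"
    have e: "e > 0" "6 * \<kappa> * (N * e) < r"
    proof -
      have p: "0 < 6 * \<kappa> * N + 1" using \<kappa> N0 by (intro add_nonneg_pos mult_nonneg_nonneg) auto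
      then show "e > 0" using r by (simp add: e_def)
      then have "6 * \<kappa> * (N * e) < (6 * \<kappa> * N + 1) * e" by (simp add: algebra_simps)
      also have "\<dots> = r" using p by (simp add: e_def)
      finally show "6 * \<kappa> * (N * e) < r" .
    qed
    obtain \<rho> where \<rho>: "\<rho> > 0" "\<And>\<xi> :: real ^ 3. \<xi> \<noteq> 0 \<Longrightarrow> norm \<xi> < \<rho> \<Longrightarrow> \<bar>\<sigma> (norm \<xi>)\<bar> < e"
      using LIM_D[OF \<sigma> e(1)] by auto
    have D: "(\<integral>\<^sup>+t. increment_integral (u t) (v t) \<xi> \<partial>time T) \<le> ennreal (norm \<xi> * (N * e))" if \<xi>: "\<xi> \<noteq> 0" "norm \<xi> < \<rho>" for \<xi>
    proof -
      have "(\<integral>\<^sup>+t. increment_integral (u t) (v t) \<xi> \<partial>time T) \<le> (\<integral>\<^sup>+t. ennreal (\<bar>C t\<bar> * (norm \<xi> * e)) \<partial>time T)"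
      proof (rule nn_integral_mono_AE, use bound[of \<xi>] in eventually_elim)
        fix t assume t: "increment_integral (u t) (v t) \<xi> \<le> ennreal (C t * norm \<xi> * \<sigma> (norm \<xi>))"
        have "C t * norm \<xi> * \<sigma> (norm \<xi>) \<le> \<bar>C t * norm \<xi> * \<sigma> (norm \<xi>)\<bar>" by (rule abs_ge_self)
        also have "\<dots> = \<bar>C t\<bar> * (norm \<xi> * \<bar>\<sigma> (norm \<xi>)\<bar>)" by (simp add: abs_mult)
        also have "\<dots> \<le> \<bar>C t\<bar> * (norm \<xi> * e)"
          using \<rho>(2)[OF \<xi>] by (intro mult_left_mono) auto
        finally show "increment_integral (u t) (v t) \<xi> \<le> ennreal (\<bar>C t\<bar> * (norm \<xi> * e))" using order_trans[OF t ennreal_leI] by blast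
      qed
      also have "\<dots> = ennreal (LINT t|time T. \<bar>C t\<bar> * (norm \<xi> * e))"
        using C e by (intro nn_integral_eq_integral) auto
      also have "(LINT t|time T. \<bar>C t\<bar> * (norm \<xi> * e)) = norm \<xi> * (N * e)" by (simp add: N_def mult_ac)
      finally show ?thesis .
    qed
    have "0 < \<rho> / 2" using \<rho> by simp
    from order_tendstoD(2)[OF scale_seq_tendsto this] obtain n0 where n0: "\<And>n. n \<ge> n0 \<Longrightarrow> scale_seq n < \<rho> / 2"
      by (auto simp: eventually_sequentially)
    have "norm ((LINT t|time T. \<bar>energy_flux (\<phi> n) t\<bar>) - 0) < r" if "n \<ge> n0" for n
    proof -
      have "(LINT t|time T. \<bar>energy_flux (\<phi> n) t\<bar>) \<le> 6 * \<kappa> * (N * e)"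
        by (rule flux_time_bound[OF \<phi> pos _ _ D]) (use n0[OF that] N0 e in auto)
      moreover have "0 \<le> (LINT t|time T. \<bar>energy_flux (\<phi> n) t\<bar>)" by (intro integral_nonneg_AE) auto
      ultimately show ?thesis using e(2) by simp
    qed
    then show "\<exists>no. \<forall>n\<ge>no. norm ((LINT t|time T. \<bar>energy_flux (\<phi> n) t\<bar>) - 0) < r" by blast
  qed
  have El: "(\<lambda>n. filtered_energy (\<phi> n) t) \<longlonglongrightarrow> (LINT x|torus. (norm (v t x))\<^sup>2)" for t
  proof -
    have "(\<lambda>n. filtered_energy (\<phi> n) t) \<longlonglongrightarrow> (\<Sum>j\<in>UNIV. LINT x|torus. (v t x $ j)\<^sup>2)"
      unfolding filtered_energy_def[OF \<phi>] filtered_def[OF \<phi>]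
      by (intro tendsto_sum energy_mollify_tendsto[OF L2_fieldD(4)[OF v] L2_fieldD(3)[OF v] L2_fieldD(5)[OF v] \<phi> scale_seq_tendsto])
    also have "(\<Sum>j\<in>UNIV. LINT x|torus. (v t x $ j)\<^sup>2) = (LINT x|torus. (norm (v t x))\<^sup>2)"
      unfolding norm_vec_sq using L2_fieldD(5)[OF v] by simp
    finally show ?thesis .
  qed
  have "AE t in time T. \<forall>n. AE s in time T. \<bar>filtered_energy (\<phi> n) t - filtered_energy (\<phi> n) s\<bar> \<le> 4 * (LINT t|time T. \<bar>energy_flux (\<phi> n) t\<bar>)"
    unfolding AE_all_countable using filtered_energy_difference[OF \<phi>] by blast
  then show ?thesis
  proof eventually_elim
    case (elim t)
    then have "AE s in time T. \<forall>n. \<bar>filtered_energy (\<phi> n) t - filtered_energy (\<phi> n) s\<bar> \<le> 4 * (LINT t|time T. \<bar>energy_flux (\<phi> n) t\<bar>)"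
      by (simp add: AE_all_countable)
    then show ?case
    proof eventually_elim
      case (elim s)
      have "(\<lambda>n. filtered_energy (\<phi> n) t - filtered_energy (\<phi> n) s) \<longlonglongrightarrow> 0"
      proof (rule Lim_null_comparison)
        show "(\<lambda>n. 4 * (LINT t|time T. \<bar>energy_flux (\<phi> n) t\<bar>)) \<longlonglongrightarrow> 0" using tendsto_mult_left[OF lim, of 4] by simp
      qed (use elim in auto)
      moreover have "(\<lambda>n. filtered_energy (\<phi> n) t - filtered_energy (\<phi> n) s) \<longlonglongrightarrow> (LINT x|torus. (norm (v t x))\<^sup>2) - (LINT x|torus. (norm (v s x))\<^sup>2)"
        by (intro tendsto_diff El)
      ultimately show ?case using LIMSEQ_unique by fastforce
    qed
  qed
qed

end

section \<open>From weak solutions to solutions controlled at every time\<close>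

lemma powr_2: "(norm x) powr 2 = (norm x)\<^sup>2"
  by (cases "norm x = 0") (auto simp: powr_numeral)

lemma Lp_norm_2: "Lp_norm 2 f = sqrt (LINT x|torus. (norm (f x))\<^sup>2)"
  unfolding Lp_norm_def powr_2 by (simp add: powr_half_sqrt integral_nonneg_AE)

lemma in_Lp_2: "in_Lp 2 f \<longleftrightarrow> f \<in> borel_measurable torus \<and> integrable torus (\<lambda>x. (norm (f x))\<^sup>2)"
  unfolding in_Lp_def powr_2 ..

lemma Lp_norm_2_le: "Lp_norm 2 f \<le> K \<Longrightarrow> (LINT x|torus. (norm (f x))\<^sup>2) \<le> K\<^sup>2"
  unfolding Lp_norm_2 by (rule sqrt_le_D)

lemma L2_field_iff: "L2_field w \<longleftrightarrow> periodic w \<and> in_Lp 2 w"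
  unfolding L2_field_def in_Lp_2 using periodic_borel_iff by blast

lemma inverse_helmholtz_component:
  "inverse_helmholtz \<alpha> f g \<Longrightarrow> helmholtz \<alpha> (\<lambda>x. f x $ i) (\<lambda>x. g x $ i)"
  unfolding inverse_helmholtz_def helmholtz_def by blast

lemma inverse_helmholtz_L2:
  assumes f: "L2_field f" and g: "L2_field g" and H: "inverse_helmholtz \<alpha> f g"
  shows "(LINT x|torus. (norm (g x))\<^sup>2) \<le> (LINT x|torus. (norm (f x))\<^sup>2)"
proof -
  have "(LINT x|torus. (g x $ i)\<^sup>2) \<le> (LINT x|torus. (f x $ i)\<^sup>2)" for i
    by (rule helmholtz_L2[OF _ _ _ _ _ _ inverse_helmholtz_component[OF H]]) (intro L2_fieldD f g)+
  then have "(\<Sum>i\<in>UNIV. LINT x|torus. (g x $ i)\<^sup>2) \<le> (\<Sum>i\<in>UNIV. LINT x|torus. (f x $ i)\<^sup>2)"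
    by (rule sum_mono)
  then show ?thesis unfolding norm_vec_sq using L2_fieldD(5)[OF f] L2_fieldD(5)[OF g] by simp
qed

lemma smooth_product:
  fixes \<theta> :: "real \<Rightarrow> real" and \<Phi> :: "real ^ 3 \<Rightarrow> real"
  assumes "smooth \<theta>" "smooth \<Phi>"
  shows "smooth (\<lambda>(t, x). \<theta> t * \<Phi> x)"
proof -
  have "smooth (\<lambda>z :: real \<times> (real ^ 3). \<theta> (fst z))"
    using smooth_comp_affine[OF bounded_linear_fst assms(1), of 0] by simp
  moreover have "smooth (\<lambda>z :: real \<times> (real ^ 3). \<Phi> (snd z))"
    using smooth_comp_affine[OF bounded_linear_snd assms(2), of 0] by simp
  ultimately have "smooth (\<lambda>z :: real \<times> (real ^ 3). \<theta> (fst z) * \<Phi> (snd z))" by (rule smooth_mult)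
  then show ?thesis by (simp add: split_def)
qed

lemma test_function_product:
  fixes b :: "'b::euclidean_space"
  assumes \<theta>: "time_test T \<theta>" and \<Phi>: "smooth (\<Phi> :: real ^ 3 \<Rightarrow> real)" "periodic \<Phi>"
  shows "test_function T (\<lambda>t x. (\<theta> t * \<Phi> x) *\<^sub>R b)"
  unfolding test_function_def
proof (intro conjI allI)
  show "smooth (\<lambda>(t, x). (\<theta> t * \<Phi> x) *\<^sub>R b)"
    using smooth_linear_comp[OF bounded_linear_scaleR_left smooth_product[OF time_test_props(1)[OF \<theta>] \<Phi>(1)], of b]
    by (simp add: split_def)
  show "periodic (\<lambda>x. (\<theta> t * \<Phi> x) *\<^sub>R b)" for t by (rule periodic_comp[OF \<Phi>(2)])
  obtain a c where "0 < a" "c < T" "\<forall>t. t \<notin> {a..c} \<longrightarrow> \<theta> t = 0" using \<theta> by (auto simp: time_test_def)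
  then show "\<exists>a c. 0 < a \<and> c < T \<and> (\<forall>t x. t \<notin> {a..c} \<longrightarrow> (\<theta> t * \<Phi> x) *\<^sub>R b = 0)" by fastforce
qed

lemma measurable_LINT_time:
  fixes F :: "real \<times> (real ^ 3) \<Rightarrow> real"
  assumes "F \<in> borel_measurable (time T \<Otimes>\<^sub>M torus)"
  shows "(\<lambda>t. LINT x|torus. F (t, x)) \<in> borel_measurable (time T)"
  using torus.borel_measurable_lebesgue_integral[of "\<lambda>t x. F (t, x)" "time T"] assms by simp

text \<open>A weak solution may behave badly on a null set of times. Setting it to zero there, and outside the time interval,
  changes none of the integrals and leaves fields that are controlled at every time.\<close>

definition regularize :: "real set \<Rightarrow> (real \<Rightarrow> real ^ 3 \<Rightarrow> 'b::euclidean_space) \<Rightarrow> real \<Rightarrow> real ^ 3 \<Rightarrow> 'b" where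
  "regularize A w t x = (if t \<in> A then w t (wrap x) else 0)"

lemma regularize_borel:
  assumes T: "T > 0" and A: "A \<in> sets borel" "A \<subseteq> {0<..<T}" and w: "torus_field T w"
  shows "(\<lambda>z. regularize A w (fst z) (snd z)) \<in> borel_measurable borel"
proof -
  (* Nothing is known about w outside the time interval; \<tau> retracts the line to the interval. *)
  define \<tau> where "\<tau> t = (if t \<in> {0<..<T} then t else T / 2)" for t
  have "\<tau> \<in> borel \<rightarrow>\<^sub>M time T"
    unfolding time_def by (rule measurable_restrict_space2) (use T in \<open>auto simp: \<tau>_def[abs_def]\<close>)
  then have "(\<lambda>z. (\<tau> (fst z), wrap (snd z))) \<in> borel \<Otimes>\<^sub>M borel \<rightarrow>\<^sub>M time T \<Otimes>\<^sub>M torus"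
    by (intro measurable_Pair measurable_compose[OF measurable_fst] measurable_compose[OF measurable_snd] wrap_to_torus)
  moreover have "(\<lambda>(t, x). w t x) \<in> borel_measurable (time T \<Otimes>\<^sub>M torus)" using w by (simp add: torus_field_def)
  ultimately have "(\<lambda>z. w (\<tau> (fst z)) (wrap (snd z))) \<in> borel_measurable (borel \<Otimes>\<^sub>M borel)"
    using measurable_compose by fastforce
  moreover have "(\<lambda>z :: real \<times> (real ^ 3). indicator A (fst z) :: real) \<in> borel_measurable (borel \<Otimes>\<^sub>M borel)"
    using A(1) by measurable
  ultimately have "(\<lambda>z. (indicator A (fst z) :: real) *\<^sub>R w (\<tau> (fst z)) (wrap (snd z))) \<in> borel_measurable (borel \<Otimes>\<^sub>M borel)"
    by (rule borel_measurable_scaleR[rotated])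
  moreover have "(\<lambda>z. (indicator A (fst z) :: real) *\<^sub>R w (\<tau> (fst z)) (wrap (snd z))) = (\<lambda>z. regularize A w (fst z) (snd z))"
    using A(2) by (auto simp: regularize_def \<tau>_def indicator_def fun_eq_iff)
  ultimately show ?thesis by (simp add: borel_prod)
qed

lemma regularize_in: "t \<in> A \<Longrightarrow> periodic (w t) \<Longrightarrow> regularize A w t = w t"
  by (auto simp: regularize_def fun_eq_iff periodic_wrap)

lemma regularize_out: "t \<notin> A \<Longrightarrow> regularize A w t = (\<lambda>x. 0)"
  by (auto simp: regularize_def)

lemma L2_field_zero: "L2_field (\<lambda>x. 0)" by (auto simp: L2_field_def periodic_def)

definition good_time :: "real \<Rightarrow> real \<Rightarrow> (real ^ 3 \<Rightarrow> real ^ 3) \<Rightarrow> (real ^ 3 \<Rightarrow> real ^ 3) \<Rightarrow> (real ^ 3 \<Rightarrow> real) \<Rightarrow> bool" where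
  "good_time \<alpha> K u v p \<longleftrightarrow> in_Lp 2 v \<and> Lp_norm 2 v \<le> K \<and> in_Lp 2 p \<and> Lp_norm 2 p \<le> K \<and> inverse_helmholtz \<alpha> v u"

text \<open>The exceptional times of the bounds and of the Helmholtz equation are collected in one Borel null set,
  whose complement in \<open>(0, T)\<close> is \<open>A\<close>.\<close>

lemma regular_solution_of_weak_solution:
  assumes T: "T > 0" and sol: "leray_alpha_weak_solution \<alpha> T u v p"
  obtains A K where "A \<subseteq> {0<..<T}" "AE t in time T. t \<in> A"
    "\<And>t. t \<in> A \<Longrightarrow> periodic (u t) \<and> periodic (v t)"
    "regular_solution \<alpha> T K (regularize A u) (regularize A v) (regularize A p)"
proof -
  have tf: "torus_field T u" "torus_field T v" "torus_field T p"
    using sol by (auto simp: leray_alpha_weak_solution_def Linf_L2_def)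
  have per: "periodic (u t)" "periodic (v t)" "periodic (p t)" if "t \<in> {0<..<T}" for t
    using tf that by (auto simp: torus_field_def)
  obtain K1 K2 where K1: "AE t in time T. in_Lp 2 (v t) \<and> Lp_norm 2 (v t) \<le> K1"
    and K2: "AE t in time T. in_Lp 2 (p t) \<and> Lp_norm 2 (p t) \<le> K2"
    using sol by (auto simp: leray_alpha_weak_solution_def Linf_L2_def)
  define K3 where "K3 = max K1 K2"
  have "AE t in time T. inverse_helmholtz \<alpha> (v t) (u t)" using sol by (simp add: leray_alpha_weak_solution_def)
  with K1 K2 have "AE t in time T. good_time \<alpha> K3 (u t) (v t) (p t)"
    by eventually_elim (auto simp: good_time_def K3_def)
  then obtain N where N: "{t \<in> space (time T). \<not> good_time \<alpha> K3 (u t) (v t) (p t)} \<subseteq> N" "emeasure (time T) N = 0" "N \<in> sets (time T)"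
    by (rule AE_E)
  define A where "A = {0<..<T} - N"
  have A: "A \<subseteq> {0<..<T}" by (auto simp: A_def)
  have "N \<in> sets borel" using N(3) unfolding time_def by (auto simp: sets_restrict_space)
  then have Ab: "A \<in> sets borel" by (simp add: A_def)
  have AE: "AE t in time T. t \<in> A"
    by (rule AE_I[OF _ N(2,3)]) (auto simp: A_def space_time)
  have good: "good_time \<alpha> K3 (u t) (v t) (p t)" if "t \<in> A" for t
    using N(1) that by (auto simp: A_def space_time)
  let ?u = "regularize A u" and ?v = "regularize A v" and ?p = "regularize A p"
  have in': "?u t = u t" "?v t = v t" "?p t = p t" if "t \<in> A" for t
    using that A per by (auto intro!: regularize_in)
  have out: "?u t = (\<lambda>x. 0)" "?v t = (\<lambda>x. 0)" "?p t = (\<lambda>x. 0)" if "t \<notin> A" for t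
    by (rule regularize_out[OF that])+
  (* The summand 1 is for the pressure, whose L^1 norm is bounded through \<bar>p\<bar> \<le> 1 + p^2. *)
  define K where "K = 1 + K3\<^sup>2"
  have L2: "L2_field (u t)" "L2_field (v t)" if "t \<in> A" for t
    using good[OF that] per that A by (auto simp: L2_field_iff good_time_def inverse_helmholtz_def)
  have vK: "(LINT x|torus. (norm (v t x))\<^sup>2) \<le> K" if "t \<in> A" for t
    using Lp_norm_2_le[of "v t" K3] good[OF that] by (simp add: good_time_def K_def)
  have uK: "(LINT x|torus. (norm (u t x))\<^sup>2) \<le> K" if "t \<in> A" for t
    using inverse_helmholtz_L2[OF L2(2,1)[OF that]] good[OF that] vK[OF that] by (fastforce simp: good_time_def)
  have pI: "integrable torus (p t)" "(LINT x|torus. \<bar>p t x\<bar>) \<le> K" if "t \<in> A" for t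
  proof -
    have p2: "p t \<in> borel_measurable torus" "integrable torus (\<lambda>x. (p t x)\<^sup>2)" "(LINT x|torus. (p t x)\<^sup>2) \<le> K3\<^sup>2"
      using good[OF that] Lp_norm_2_le[of "p t" K3] by (auto simp: good_time_def in_Lp_2)
    show i: "integrable torus (p t)" by (rule torus.square_integrable_imp_integrable[OF p2(1,2)])
    have "(LINT x|torus. \<bar>p t x\<bar>) \<le> (LINT x|torus. 1 + (p t x)\<^sup>2)"
    proof (rule integral_mono)
      fix x
      have "\<bar>p t x\<bar> \<le> 2 * \<bar>p t x\<bar>" by simp
      also have "\<dots> \<le> 1 + (p t x)\<^sup>2"
        using zero_le_power2[of "\<bar>p t x\<bar> - 1"] by (simp add: power2_eq_square algebra_simps)
      finally show "\<bar>p t x\<bar> \<le> 1 + (p t x)\<^sup>2" .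
    qed (use i p2 in auto)
    also have "\<dots> \<le> K" using p2 by (simp add: K_def)
    finally show "(LINT x|torus. \<bar>p t x\<bar>) \<le> K" .
  qed
  have K0: "0 \<le> K" by (simp add: K_def)
  have um: "(\<lambda>z. u (fst z) (snd z)) \<in> borel_measurable (time T \<Otimes>\<^sub>M torus)"
    and vm: "(\<lambda>z. v (fst z) (snd z)) \<in> borel_measurable (time T \<Otimes>\<^sub>M torus)"
    and pm: "(\<lambda>z. p (fst z) (snd z)) \<in> borel_measurable (time T \<Otimes>\<^sub>M torus)"
    using tf by (auto simp: torus_field_def split_def)
  have b: "(\<lambda>z. ?u (fst z) (snd z)) \<in> borel_measurable borel" "(\<lambda>z. ?v (fst z) (snd z)) \<in> borel_measurable borel"
    "(\<lambda>z. ?p (fst z) (snd z)) \<in> borel_measurable borel"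
    by (rule regularize_borel[OF T Ab A tf(1)] regularize_borel[OF T Ab A tf(2)] regularize_borel[OF T Ab A tf(3)])+
  note b' = measurable_time_torus[OF b(1)] measurable_time_torus[OF b(2)] measurable_time_torus[OF b(3)]
  have "regular_solution \<alpha> T K ?u ?v ?p"
  proof
    show "T > 0" by fact
    show "L2_field (?u t)" "L2_field (?v t)" for t
      using L2[of t] in'[of t] out[of t] L2_field_zero by (cases "t \<in> A"; simp)+
    show "integrable torus (?p t)" for t using pI[of t] in'[of t] out[of t] by (cases "t \<in> A") auto
    show "(LINT x|torus. (norm (?u t x))\<^sup>2) \<le> K" "(LINT x|torus. (norm (?v t x))\<^sup>2) \<le> K" "(LINT x|torus. \<bar>?p t x\<bar>) \<le> K" for t
      using vK[of t] uK[of t] pI[of t] in'[of t] out[of t] K0 by (cases "t \<in> A"; simp)+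
    show "helmholtz \<alpha> (\<lambda>x. ?v t x $ i) (\<lambda>x. ?u t x $ i)" for t i
      using inverse_helmholtz_component[of \<alpha> "v t" "u t" i] good[of t] in'[of t] out[of t]
      by (cases "t \<in> A") (auto simp: good_time_def helmholtz_def)
  next
    fix \<theta> \<Phi> assume \<theta>: "time_test T \<theta>" and \<Phi>: "smooth \<Phi>" "periodic (\<Phi> :: real ^ 3 \<Rightarrow> real)"
    have \<theta>m [measurable]: "\<theta> \<in> borel_measurable (time T)" "deriv \<theta> \<in> borel_measurable (time T)"
      by (auto intro: measurable_time time_test_props[OF \<theta>])
    have pt: "partial i \<Phi> \<in> borel_measurable torus" "\<Phi> \<in> borel_measurable torus" for i
      by (auto intro!: measurable_torus smooth_borel smooth_partial \<Phi>)
    note [measurable] = measurable_compose[OF measurable_snd pt(1)] measurable_compose[OF measurable_snd pt(2)]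
    have replace: "(LINT t|time T. a t * (LINT x|torus. F t x)) = (LINT t|time T. a t * (LINT x|torus. F' t x))"
      if "\<And>t. t \<in> A \<Longrightarrow> F t = F' t" "a \<in> borel_measurable (time T)"
        "(\<lambda>z. F (fst z) (snd z)) \<in> borel_measurable (time T \<Otimes>\<^sub>M torus)" "(\<lambda>z. F' (fst z) (snd z)) \<in> borel_measurable (time T \<Otimes>\<^sub>M torus)"
      for a and F F' :: "real \<Rightarrow> real ^ 3 \<Rightarrow> real"
    proof (rule integral_cong_AE)
      show "(\<lambda>t. a t * (LINT x|torus. F t x)) \<in> borel_measurable (time T)" "(\<lambda>t. a t * (LINT x|torus. F' t x)) \<in> borel_measurable (time T)"
        using measurable_LINT_time[OF that(3)] measurable_LINT_time[OF that(4)] that(2) by simp_all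
      show "AE t in time T. a t * (LINT x|torus. F t x) = a t * (LINT x|torus. F' t x)"
        using AE by eventually_elim (simp add: that(1))
    qed
    note [measurable] = um vm pm b'
    show "(LINT t|time T. \<theta> t * (LINT x|torus. (\<Sum>i\<in>UNIV. ?u t x $ i * partial i \<Phi> x))) = 0"
    proof -
      have "test_function T (\<lambda>t x. (\<theta> t * \<Phi> x) *\<^sub>R (1 :: real))" by (rule test_function_product[OF \<theta> \<Phi>])
      then have "(LINT t|time T. LINT x|torus. (\<Sum>i\<in>UNIV. u t x $ i * partial i (\<lambda>x. \<theta> t * \<Phi> x) x)) = 0"
        using sol unfolding leray_alpha_weak_solution_def by auto
      moreover have "(LINT x|torus. (\<Sum>i\<in>UNIV. u t x $ i * partial i (\<lambda>x. \<theta> t * \<Phi> x) x)) = \<theta> t * (LINT x|torus. (\<Sum>i\<in>UNIV. u t x $ i * partial i \<Phi> x))" for t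
        unfolding partial_cmult[OF \<Phi>(1)] by (simp flip: integral_mult_right_zero add: sum_distrib_left mult_ac)
      ultimately have "(LINT t|time T. \<theta> t * (LINT x|torus. (\<Sum>i\<in>UNIV. u t x $ i * partial i \<Phi> x))) = 0" by simp
      then show ?thesis
        by (subst replace[where F'="\<lambda>t x. \<Sum>i\<in>UNIV. u t x $ i * partial i \<Phi> x"]) (simp_all add: in')
    qed
    fix j
    define \<psi> where "\<psi> t x = (\<theta> t * \<Phi> x) *\<^sub>R (axis j 1 :: real ^ 3)" for t x
    have c: "\<psi> t x $ i = (if i = j then \<theta> t * \<Phi> x else 0)" for t x i by (simp add: \<psi>_def axis_def)
    have p0: "partial i (\<lambda>y. 0) x = 0" for i x using partial_eqI[OF has_derivative_const] by metis
    have pc: "partial i (\<lambda>y. \<psi> t y $ k) x = (if k = j then \<theta> t * partial i \<Phi> x else 0)" for i t k x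
      unfolding c using partial_cmult[OF \<Phi>(1)] p0 by auto
    have dc: "deriv (\<lambda>s. \<psi> s x $ k) t = (if k = j then deriv \<theta> t * \<Phi> x else 0)" for x k t
    proof -
      have "((\<lambda>s. \<theta> s * \<Phi> x) has_real_derivative deriv \<theta> t * \<Phi> x) (at t)"
        using smooth_real_has_derivative[OF time_test_props(1)[OF \<theta>]] by (auto intro!: derivative_eq_intros)
      then show ?thesis unfolding c by (auto intro: DERIV_imp_deriv)
    qed
    have "test_function T \<psi>" unfolding \<psi>_def[abs_def] by (rule test_function_product[OF \<theta> \<Phi>])
    then have eq: "(LINT t|time T. LINT x|torus. (\<Sum>i\<in>UNIV. v t x $ i * deriv (\<lambda>s. \<psi> s x $ i) t))
      + (LINT t|time T. LINT x|torus. (\<Sum>i\<in>UNIV. \<Sum>j\<in>UNIV. v t x $ j * u t x $ i * partial i (\<lambda>y. \<psi> t y $ j) x))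
      + (LINT t|time T. LINT x|torus. p t x * (\<Sum>i\<in>UNIV. partial i (\<lambda>y. \<psi> t y $ i) x)) = 0"
      using sol unfolding leray_alpha_weak_solution_def by blast
    have 1: "(LINT x|torus. (\<Sum>i\<in>UNIV. v t x $ i * deriv (\<lambda>s. \<psi> s x $ i) t)) = deriv \<theta> t * (LINT x|torus. v t x $ j * \<Phi> x)" for t
      unfolding dc by (simp flip: integral_mult_right_zero add: if_distrib mult_ac cong: if_cong)
    have 2: "(LINT x|torus. (\<Sum>i\<in>UNIV. \<Sum>j\<in>UNIV. v t x $ j * u t x $ i * partial i (\<lambda>y. \<psi> t y $ j) x))
        = \<theta> t * (LINT x|torus. (\<Sum>i\<in>UNIV. v t x $ j * u t x $ i * partial i \<Phi> x))" for t
      unfolding pc by (simp flip: integral_mult_right_zero add: if_distrib sum_distrib_left mult_ac cong: if_cong)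
    have 3: "(LINT x|torus. p t x * (\<Sum>i\<in>UNIV. partial i (\<lambda>y. \<psi> t y $ i) x)) = \<theta> t * (LINT x|torus. p t x * partial j \<Phi> x)" for t
      unfolding pc by (simp flip: integral_mult_right_zero add: mult_ac)
    have r1: "(LINT t|time T. deriv \<theta> t * (LINT x|torus. ?v t x $ j * \<Phi> x)) = (LINT t|time T. deriv \<theta> t * (LINT x|torus. v t x $ j * \<Phi> x))"
      by (rule replace) (simp_all add: in')
    have r2: "(LINT t|time T. \<theta> t * (LINT x|torus. (\<Sum>i\<in>UNIV. ?v t x $ j * ?u t x $ i * partial i \<Phi> x)))
        = (LINT t|time T. \<theta> t * (LINT x|torus. (\<Sum>i\<in>UNIV. v t x $ j * u t x $ i * partial i \<Phi> x)))"
      by (rule replace) (simp_all add: in')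
    have r3: "(LINT t|time T. \<theta> t * (LINT x|torus. ?p t x * partial j \<Phi> x)) = (LINT t|time T. \<theta> t * (LINT x|torus. p t x * partial j \<Phi> x))"
      by (rule replace) (simp_all add: in')
    show "(LINT t|time T. deriv \<theta> t * (LINT x|torus. ?v t x $ j * \<Phi> x))
      + (LINT t|time T. \<theta> t * (LINT x|torus. (\<Sum>i\<in>UNIV. ?v t x $ j * ?u t x $ i * partial i \<Phi> x)))
      + (LINT t|time T. \<theta> t * (LINT x|torus. ?p t x * partial j \<Phi> x)) = 0"
      using eq unfolding 1 2 3 r1 r2 r3 .
  qed (rule b)+
  then show ?thesis using that[OF A AE] per A by blast
qed

lemma increment_integral_le_of_increment_bound:
  assumes "increment_bound f g c \<sigma> \<xi>"
  shows "increment_integral f g \<xi> \<le> ennreal (c * norm \<xi> * \<sigma> (norm \<xi>))"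
proof -
  have "increment_integral f g \<xi> = ennreal (LINT x|torus. norm (increment \<xi> f x) * (norm (increment \<xi> g x))\<^sup>2)"
    unfolding increment_integral_def using assms by (intro nn_integral_eq_integral) (auto simp: increment_bound_def)
  then show ?thesis using assms by (simp add: increment_bound_def ennreal_leI)
qed

theorem leray_alpha_energy_conservation:
  assumes T: "T > 0" and sol: "leray_alpha_weak_solution \<alpha> T u v p"
    and C: "integrable (time T) C" and \<sigma>: "((\<lambda>\<xi> :: real ^ 3. \<sigma> (norm \<xi>)) \<longlongrightarrow> 0) (at 0)"
    and bound: "\<And>\<xi>. AE t in time T. increment_bound (u t) (v t) (C t) \<sigma> \<xi>"
  shows "AE t\<^sub>1 in time T. AE t\<^sub>2 in time T. Lp_norm 2 (v t\<^sub>1) = Lp_norm 2 (v t\<^sub>2)"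
proof -
  obtain A K where A: "A \<subseteq> {0<..<T}" "AE t in time T. t \<in> A"
    "\<And>t. t \<in> A \<Longrightarrow> periodic (u t) \<and> periodic (v t)"
    and reg: "regular_solution \<alpha> T K (regularize A u) (regularize A v) (regularize A p)"
    using regular_solution_of_weak_solution[OF T sol] by blast
  have eq: "regularize A u t = u t" "regularize A v t = v t" if "t \<in> A" for t
    using A(3)[OF that] that by (auto intro!: regularize_in)
  have "AE t in time T. increment_integral (regularize A u t) (regularize A v t) \<xi> \<le> ennreal (C t * norm \<xi> * \<sigma> (norm \<xi>))" for \<xi>
    using bound[of \<xi>] A(2) by eventually_elim (simp add: eq increment_integral_le_of_increment_bound)
  from regular_solution.energy_conservation[OF reg C \<sigma> this] A(2)
  show ?thesis
  proof eventually_elim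
    case (elim t)
    show ?case using elim(1) A(2)
      by eventually_elim (use elim(2) in \<open>simp add: eq Lp_norm_2\<close>)
  qed
qed

section \<open>Increments of Besov fields\<close>

definition L3_field :: "(real ^ 3 \<Rightarrow> real ^ 3) \<Rightarrow> bool" where
  "L3_field w \<longleftrightarrow> periodic w \<and> w \<in> borel_measurable borel \<and> integrable torus (\<lambda>x. norm (w x) ^ 3)"

definition L3_cubed :: "(real ^ 3 \<Rightarrow> real ^ 3) \<Rightarrow> real" where
  "L3_cubed w = (LINT x|torus. norm (w x) ^ 3)"

lemma L3_cubed_nonneg: "0 \<le> L3_cubed w" unfolding L3_cubed_def by (intro integral_nonneg_AE) auto

lemma cube_add_le: "0 \<le> a \<Longrightarrow> 0 \<le> b \<Longrightarrow> (a + b) ^ 3 \<le> 4 * (a ^ 3 + b ^ 3)" for a b :: real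
proof -
  assume ab: "0 \<le> a" "0 \<le> b"
  have "0 \<le> 3 * ((a + b) * (a - b)\<^sup>2)" using ab by simp
  then show ?thesis by (simp add: power2_eq_square power3_eq_cube algebra_simps)
qed

text \<open>The inequality of \<open>cube_add_le\<close> with a constant close to one in front of the first cube, which in
  \<open>lower_difference_order\<close> belongs to a difference of the same order and must not grow much. It is
  sharp for \<open>a = 5 b\<close>.\<close>

lemma cube_add_le_weighted: "0 \<le> a \<Longrightarrow> 0 \<le> b \<Longrightarrow> (a + b) ^ 3 \<le> 36 / 25 * a ^ 3 + 36 * b ^ 3" for a b :: real
proof -
  assume ab: "0 \<le> a" "0 \<le> b"
  have "36 / 25 * a ^ 3 + 36 * b ^ 3 - (a + b) ^ 3 = (a - 5 * b)\<^sup>2 * (11 * a + 35 * b) / 25"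
    by (simp add: power2_eq_square power3_eq_cube algebra_simps)
  also have "0 \<le> \<dots>" using ab by simp
  finally show ?thesis by simp
qed

lemma L3_fieldD:
  assumes "L3_field w"
  shows "periodic w" "w \<in> borel_measurable borel" "integrable torus (\<lambda>x. norm (w x) ^ 3)"
    "periodic (\<lambda>x. w x $ i)" "(\<lambda>x. w x $ i) \<in> borel_measurable borel"
    "integrable torus (\<lambda>x. \<bar>w x $ i\<bar> ^ 3)" "integrable torus (\<lambda>x. w x $ i)"
    "(LINT x|torus. \<bar>w x $ i\<bar> ^ 3) \<le> L3_cubed w"
proof -
  show p: "periodic w" and m [measurable]: "w \<in> borel_measurable borel" and n: "integrable torus (\<lambda>x. norm (w x) ^ 3)"
    using assms by (auto simp: L3_field_def)
  show "periodic (\<lambda>x. w x $ i)" by (rule periodic_comp[OF p])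
  show im [measurable]: "(\<lambda>x. w x $ i) \<in> borel_measurable borel" by measurable
  have le: "\<bar>w x $ i\<bar> ^ 3 \<le> norm (w x) ^ 3" for x by (intro power_mono component_le_norm_cart) auto
  show i3: "integrable torus (\<lambda>x. \<bar>w x $ i\<bar> ^ 3)"
    by (rule Bochner_Integration.integrable_bound[OF n]) (auto intro: measurable_torus simp: le)
  show "(LINT x|torus. \<bar>w x $ i\<bar> ^ 3) \<le> L3_cubed w"
    unfolding L3_cubed_def by (rule integral_mono[OF i3 n le])
  have one: "a \<le> 1 + a ^ 3" if "0 \<le> a" for a :: real
  proof (cases "a \<le> 1")
    case True then show ?thesis using that by (simp add: add_increasing2)
  next
    case False
    then have "a ^ 1 \<le> a ^ 3" by (intro power_increasing) auto
    then show ?thesis by simp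
  qed
  show "integrable torus (\<lambda>x. w x $ i)"
  proof (rule Bochner_Integration.integrable_bound)
    show "integrable torus (\<lambda>x. 1 + \<bar>w x $ i\<bar> ^ 3)" using i3 by simp
    show "AE x in torus. norm (w x $ i) \<le> norm (1 + \<bar>w x $ i\<bar> ^ 3)"
      using one[of "\<bar>w _ $ i\<bar>"] by (intro always_eventually allI) simp
  qed (rule measurable_torus[OF im])
qed

lemma L3_field_combine:
  assumes f: "L3_field f" and g: "L3_field g"
  shows "L3_field (\<lambda>x. f x + g x)" "L3_cubed (\<lambda>x. f x + g x) \<le> 4 * (L3_cubed f + L3_cubed g)"
    "L3_cubed (\<lambda>x. f x + g x) \<le> 36 / 25 * L3_cubed f + 36 * L3_cubed g"
proof -
  note [measurable] = L3_fieldD(2)[OF f] L3_fieldD(2)[OF g]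
  note I = L3_fieldD(3)[OF f] L3_fieldD(3)[OF g]
  have le: "norm (f x + g x) ^ 3 \<le> (norm (f x) + norm (g x)) ^ 3" for x
    by (intro power_mono norm_triangle_ineq) auto
  have le4: "norm (f x + g x) ^ 3 \<le> 4 * (norm (f x) ^ 3 + norm (g x) ^ 3)" for x
    by (rule order_trans[OF le cube_add_le]) auto
  have le36: "norm (f x + g x) ^ 3 \<le> 36 / 25 * norm (f x) ^ 3 + 36 * norm (g x) ^ 3" for x
    using order_trans[OF le cube_add_le_weighted] by simp
  have i: "integrable torus (\<lambda>x. norm (f x + g x) ^ 3)"
  proof (rule Bochner_Integration.integrable_bound)
    show "integrable torus (\<lambda>x. 4 * (norm (f x) ^ 3 + norm (g x) ^ 3))" using I by auto
    show "(\<lambda>x. norm (f x + g x) ^ 3) \<in> borel_measurable torus" by (rule measurable_torus) measurable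
    show "AE x in torus. norm (norm (f x + g x) ^ 3) \<le> norm (4 * (norm (f x) ^ 3 + norm (g x) ^ 3))"
      using le4 by (intro always_eventually) simp
  qed
  then show "L3_field (\<lambda>x. f x + g x)"
    using periodic_comp2[OF L3_fieldD(1)[OF f] L3_fieldD(1)[OF g], of "(+)"] by (simp add: L3_field_def)
  have "L3_cubed (\<lambda>x. f x + g x) \<le> (LINT x|torus. 4 * (norm (f x) ^ 3 + norm (g x) ^ 3))"
    unfolding L3_cubed_def using I by (intro integral_mono[OF i _ le4]) auto
  then show "L3_cubed (\<lambda>x. f x + g x) \<le> 4 * (L3_cubed f + L3_cubed g)" using I by (simp add: L3_cubed_def)
  have "L3_cubed (\<lambda>x. f x + g x) \<le> (LINT x|torus. 36 / 25 * norm (f x) ^ 3 + 36 * norm (g x) ^ 3)"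
    unfolding L3_cubed_def using I by (intro integral_mono[OF i _ le36]) auto
  also have "\<dots> = 36 / 25 * L3_cubed f + 36 * L3_cubed g" using I unfolding L3_cubed_def by (subst Bochner_Integration.integral_add) auto
  finally show "L3_cubed (\<lambda>x. f x + g x) \<le> 36 / 25 * L3_cubed f + 36 * L3_cubed g" .
qed

lemma L3_field_scale:
  assumes f: "L3_field f"
  shows "L3_field (\<lambda>x. c *\<^sub>R f x)" "L3_cubed (\<lambda>x. c *\<^sub>R f x) = \<bar>c\<bar> ^ 3 * L3_cubed f"
proof -
  note [measurable] = L3_fieldD(2)[OF f]
  show "L3_field (\<lambda>x. c *\<^sub>R f x)"
    using L3_fieldD(1,3)[OF f] by (simp add: L3_field_def power_mult_distrib periodic_def)
  show "L3_cubed (\<lambda>x. c *\<^sub>R f x) = \<bar>c\<bar> ^ 3 * L3_cubed f"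
    by (simp add: L3_cubed_def power_mult_distrib)
qed

lemma L3_field_shift:
  assumes f: "L3_field f"
  shows "L3_field (\<lambda>x. f (x + h))" "L3_cubed (\<lambda>x. f (x + h)) = L3_cubed f"
proof -
  note [measurable] = L3_fieldD(2)[OF f]
  have p: "periodic (\<lambda>x. norm (f x) ^ 3)" by (rule periodic_comp[OF L3_fieldD(1)[OF f]])
  show "L3_field (\<lambda>x. f (x + h))"
    unfolding L3_field_def
    using periodic_shift[OF L3_fieldD(1)[OF f], of h] integrable_torus_shift[OF _ p, of h] L3_fieldD(3)[OF f]
    by (simp add: add.commute[of h])
  show "L3_cubed (\<lambda>x. f (x + h)) = L3_cubed f"
    using integral_torus_shift[OF _ p, of h] by (simp add: L3_cubed_def add.commute[of h])
qed

lemma L3_field_increment: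
  assumes f: "L3_field f"
  shows "L3_field (increment h f)" "L3_cubed (increment h f) \<le> 8 * L3_cubed f"
proof -
  have eq: "increment h f = (\<lambda>x. f (x + h) + (-1) *\<^sub>R f x)" by (auto simp: increment_def)
  show "L3_field (increment h f)" unfolding eq
    by (rule L3_field_combine(1)[OF L3_field_shift(1)[OF f] L3_field_scale(1)[OF f]])
  show "L3_cubed (increment h f) \<le> 8 * L3_cubed f" unfolding eq
    using L3_field_combine(2)[OF L3_field_shift(1)[OF f, of h] L3_field_scale(1)[OF f, of "-1"]]
      L3_field_shift(2)[OF f, of h] L3_field_scale(2)[OF f, of "-1"] by simp
qed

lemma L3_field_increments:
  assumes f: "L3_field f"
  shows "L3_field ((increment h ^^ k) f)" "L3_cubed ((increment h ^^ k) f) \<le> 8 ^ k * L3_cubed f"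
proof -
  have "L3_field ((increment h ^^ k) f) \<and> L3_cubed ((increment h ^^ k) f) \<le> 8 ^ k * L3_cubed f"
  proof (induction k)
    case (Suc k)
    then show ?case using L3_field_increment[of "(increment h ^^ k) f" h] by auto
  qed (use f in simp)
  then show "L3_field ((increment h ^^ k) f)" "L3_cubed ((increment h ^^ k) f) \<le> 8 ^ k * L3_cubed f" by auto
qed

lemma increments_add: "(increment h ^^ k) (\<lambda>x. f x + g x) = (\<lambda>x. (increment h ^^ k) f x + (increment h ^^ k) g x)"
  for f g :: "real ^ 3 \<Rightarrow> real ^ 3"
  by (induction k) (auto simp: increment_def)

lemma increments_scale: "(increment h ^^ k) (\<lambda>x. c *\<^sub>R f x) = (\<lambda>x. c *\<^sub>R (increment h ^^ k) f x)"
  for f :: "real ^ 3 \<Rightarrow> real ^ 3"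
  by (induction k) (auto simp: increment_def algebra_simps)

lemma increment_double: "increment (2 *\<^sub>R h) f = (\<lambda>x. 2 *\<^sub>R increment h f x + increment h (increment h f) x)"
  for f :: "real ^ 3 \<Rightarrow> real ^ 3"
  by (auto simp: increment_def scaleR_2 algebra_simps)

text \<open>From \<open>\<Delta>\<^sub>2\<^sub>h = 2 \<Delta>\<^sub>h + \<Delta>\<^sub>h\<^sup>2\<close>: the differences \<open>\<Delta>\<^sub>2\<^sub>h\<^sup>k\<close> and \<open>2\<^sup>k \<Delta>\<^sub>h\<^sup>k\<close> agree up to
  differences of order \<open>k + 1\<close>.\<close>

lemma increments_double:
  obtains c where "0 \<le> c"
    "\<And>f h. L3_field f \<Longrightarrow> L3_cubed (\<lambda>x. 2 ^ k *\<^sub>R (increment h ^^ k) f x - (increment (2 *\<^sub>R h) ^^ k) f x)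
       \<le> c * L3_cubed ((increment h ^^ Suc k) f)"
proof -
  let ?R = "\<lambda>k h f x. 2 ^ k *\<^sub>R (increment h ^^ k) f x - (increment (2 *\<^sub>R h) ^^ k) f x"
  have RL: "L3_field (?R k h f)" if "L3_field f" for k h f
    using L3_field_combine(1)[OF L3_field_scale(1)[OF L3_field_increments(1)[OF that], of "2 ^ k"]
        L3_field_scale(1)[OF L3_field_increments(1)[OF that], of "-1"]] by simp
  have "\<exists>c\<ge>0. \<forall>f h. L3_field f \<longrightarrow> L3_cubed (?R k h f) \<le> c * L3_cubed ((increment h ^^ Suc k) f)"
  proof (induction k)
    case 0
    show ?case by (intro exI[of _ 0]) (simp add: L3_cubed_def)
  next
    case (Suc k)
    then obtain c where c: "0 \<le> c" "\<And>f h. L3_field f \<Longrightarrow> L3_cubed (?R k h f) \<le> c * L3_cubed ((increment h ^^ Suc k) f)" by blast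
    have "L3_cubed (?R (Suc k) h f) \<le> (160 * c + 16 * 8 ^ k) * L3_cubed ((increment h ^^ Suc (Suc k)) f)"
      if f: "L3_field f" for f h
    proof -
      let ?D = "increment h f" let ?DD = "increment h (increment h f)"
      let ?O = "L3_cubed ((increment h ^^ Suc (Suc k)) f)"
      have L: "L3_field ?D" "L3_field ?DD" using L3_field_increment(1) f by blast+
      have sh: "(increment h ^^ k) ?DD = (increment h ^^ Suc (Suc k)) f"
        "(increment h ^^ Suc k) ?D = (increment h ^^ Suc (Suc k)) f"
        "(increment h ^^ Suc k) ?DD = increment h ((increment h ^^ Suc (Suc k)) f)"
        by (simp_all add: funpow_swap1)
      have eq: "?R (Suc k) h f x = 2 *\<^sub>R ?R k h ?D x + ((- (2 ^ k)) *\<^sub>R (increment h ^^ k) ?DD x + ?R k h ?DD x)" for x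
      proof -
        have "(increment (2 *\<^sub>R h) ^^ Suc k) f = (\<lambda>x. 2 *\<^sub>R (increment (2 *\<^sub>R h) ^^ k) ?D x + (increment (2 *\<^sub>R h) ^^ k) ?DD x)"
          unfolding funpow_Suc_right o_def increment_double[of h f] increments_add increments_scale ..
        moreover have "(increment h ^^ Suc k) f = (increment h ^^ k) ?D" unfolding funpow_Suc_right o_def ..
        ultimately show ?thesis by (simp add: algebra_simps)
      qed
      have A: "L3_cubed (\<lambda>x. 2 *\<^sub>R ?R k h ?D x) \<le> 8 * (c * ?O)"
        unfolding L3_field_scale(2)[OF RL[OF L(1)]] using c(2)[OF L(1), of h] unfolding sh by simp
      have B: "L3_cubed (\<lambda>x. (- (2 ^ k)) *\<^sub>R (increment h ^^ k) ?DD x) = 8 ^ k * ?O"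
        by (subst L3_field_scale(2)[OF L3_field_increments(1)[OF L(2)]])
          (simp add: funpow_swap1 power3_eq_cube flip: power_mult_distrib)
      have C: "L3_cubed (?R k h ?DD) \<le> c * (8 * ?O)"
        by (rule order_trans[OF c(2)[OF L(2), of h]], unfold sh)
          (intro mult_left_mono L3_field_increment(2) L3_field_increments(1) f c(1))
      have "L3_cubed (?R (Suc k) h f) \<le> 4 * (L3_cubed (\<lambda>x. 2 *\<^sub>R ?R k h ?D x)
          + 4 * (L3_cubed (\<lambda>x. (- (2 ^ k)) *\<^sub>R (increment h ^^ k) ?DD x) + L3_cubed (?R k h ?DD)))"
        unfolding eq
        by (rule order_trans[OF L3_field_combine(2)[OF L3_field_scale(1)[OF RL[OF L(1)]]
              L3_field_combine(1)[OF L3_field_scale(1)[OF L3_field_increments(1)[OF L(2)]] RL[OF L(2)]]]])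
          (intro mult_left_mono add_left_mono L3_field_combine(2) L3_field_scale(1) L3_field_increments(1) RL L, simp)
      also have "\<dots> \<le> 4 * (8 * (c * ?O) + 4 * (8 ^ k * ?O + c * (8 * ?O)))"
        using A B C by simp
      also have "\<dots> \<le> (160 * c + 16 * 8 ^ k) * ?O"
        using mult_nonneg_nonneg[OF c(1) L3_cubed_nonneg[of "(increment h ^^ Suc (Suc k)) f"]] by (simp add: algebra_simps)
      finally show ?thesis .
    qed
    then show ?case using c(1) by (intro exI[of _ "160 * c + 16 * 8 ^ k"]) auto
  qed
  then show ?thesis using that by blast
qed

text \<open>By \<open>increments_double\<close>, a difference of order \<open>k\<close> with step \<open>h\<close> is \<open>2\<^sup>-\<^sup>k\<close> times the one with step
  \<open>2 h\<close>, up to differences of order \<open>k + 1\<close>. In terms of cubes, doubling the step costs a factor \<open>4\<close> on the right-hand side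
  and gains \<open>8\<^sup>k \<ge> 8\<close> on the left; since \<open>4 \<cdot> 36 / 25 + 2 \<le> 8\<close>, the bound \<open>M \<bar>h\<bar>\<^sup>2\<close> passes from step \<open>2 h\<close> to
  step \<open>h\<close> and so from steps of length at least one, where it is trivial, to all steps.\<close>

lemma lower_difference_order:
  assumes k: "1 \<le> k"
  obtains c where "0 \<le> c"
    "\<And>f A h. L3_field f \<Longrightarrow> 0 \<le> A \<Longrightarrow> (\<And>h. L3_cubed ((increment h ^^ Suc k) f) \<le> A * (norm h)\<^sup>2)
       \<Longrightarrow> L3_cubed ((increment h ^^ k) f) \<le> (8 ^ k * L3_cubed f + c * A) * (norm h)\<^sup>2"
proof -
  obtain c where c: "0 \<le> c" "\<And>f h. L3_field f \<Longrightarrow>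
      L3_cubed (\<lambda>x. 2 ^ k *\<^sub>R (increment h ^^ k) f x - (increment (2 *\<^sub>R h) ^^ k) f x) \<le> c * L3_cubed ((increment h ^^ Suc k) f)"
    using increments_double[of k] by blast
  have "L3_cubed ((increment h ^^ k) f) \<le> (8 ^ k * L3_cubed f + (18 * c) * A) * (norm h)\<^sup>2"
    if f: "L3_field f" and A: "0 \<le> A" and bd: "\<And>h. L3_cubed ((increment h ^^ Suc k) f) \<le> A * (norm h)\<^sup>2" for f A h
  proof -
    define M where "M = 8 ^ k * L3_cubed f + (18 * c) * A"
    have M: "8 ^ k * L3_cubed f \<le> M" "18 * c * A \<le> M" "0 \<le> M"
      using c(1) A L3_cubed_nonneg[of f] by (auto simp: M_def)
    have rec: "8 ^ k * L3_cubed ((increment h ^^ k) f) \<le> 36 / 25 * L3_cubed ((increment (2 *\<^sub>R h) ^^ k) f) + 36 * (c * (A * (norm h)\<^sup>2))" for h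
    proof -
      let ?R = "\<lambda>x. 2 ^ k *\<^sub>R (increment h ^^ k) f x - (increment (2 *\<^sub>R h) ^^ k) f x"
      have RL: "L3_field ?R"
        using L3_field_combine(1)[OF L3_field_scale(1)[OF L3_field_increments(1)[OF f], of "2 ^ k"]
          L3_field_scale(1)[OF L3_field_increments(1)[OF f], of "-1"]] by simp
      have "8 ^ k * L3_cubed ((increment h ^^ k) f) = L3_cubed (\<lambda>x. 2 ^ k *\<^sub>R (increment h ^^ k) f x)"
        by (subst L3_field_scale(2)[OF L3_field_increments(1)[OF f]])
          (simp add: power3_eq_cube flip: power_mult_distrib)
      also have "\<dots> = L3_cubed (\<lambda>x. (increment (2 *\<^sub>R h) ^^ k) f x + ?R x)" by simp
      also have "\<dots> \<le> 36 / 25 * L3_cubed ((increment (2 *\<^sub>R h) ^^ k) f) + 36 * L3_cubed ?R"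
        by (rule L3_field_combine(3)[OF L3_field_increments(1)[OF f] RL])
      also have "L3_cubed ?R \<le> c * (A * (norm h)\<^sup>2)"
        by (rule order_trans[OF c(2)[OF f] mult_left_mono[OF bd c(1)]])
      finally show ?thesis by simp
    qed
    have dyadic: "L3_cubed ((increment h ^^ k) f) \<le> M * (norm h)\<^sup>2" if "1 \<le> 2 ^ n * norm h" for n h
      using that
    proof (induction n arbitrary: h)
      case 0
      have "L3_cubed ((increment h ^^ k) f) \<le> 8 ^ k * L3_cubed f" by (rule L3_field_increments(2)[OF f])
      also have "\<dots> \<le> M * 1" using M by simp
      also have "\<dots> \<le> M * (norm h)\<^sup>2" using 0 M by (intro mult_left_mono) auto
      finally show ?case .
    next
      case (Suc n)
      let ?q = "(norm h)\<^sup>2"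
      have "L3_cubed ((increment (2 *\<^sub>R h) ^^ k) f) \<le> M * (norm (2 *\<^sub>R h))\<^sup>2"
        by (rule Suc.IH) (use Suc.prems in simp)
      then have D: "L3_cubed ((increment (2 *\<^sub>R h) ^^ k) f) \<le> 4 * (M * ?q)" by (simp add: power_mult_distrib)
      have q: "18 * c * A * ?q \<le> M * ?q" "0 \<le> M * ?q" using M by (auto intro: mult_right_mono)
      (* The next step uses 4 * 36/25 + 2 \<le> 8. *)
      have "8 ^ k * L3_cubed ((increment h ^^ k) f) \<le> 36 / 25 * (4 * (M * ?q)) + 2 * (18 * c * A * ?q)"
        using rec[of h] D by (simp add: mult_ac)
      also have "\<dots> \<le> 8 * (M * ?q)" using q by simp
      also have "\<dots> \<le> 8 ^ k * (M * ?q)"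
        using q k power_increasing[of 1 k "8 :: real"] by (intro mult_right_mono) auto
      finally show ?case by simp
    qed
    have "L3_cubed ((increment h ^^ k) f) \<le> M * (norm h)\<^sup>2"
    proof (cases "h = 0")
      case True
      obtain k' where "k = Suc k'" using k by (cases k) auto
      then have "(increment h ^^ k) f = (\<lambda>x. 0)" using True by (auto simp: increment_def)
      then show ?thesis using True by (simp add: L3_cubed_def)
    next
      case False
      then obtain n where "1 / norm h < 2 ^ n" using real_arch_pow[of 2] by auto
      then have "1 \<le> 2 ^ n * norm h" using False by (simp add: divide_less_eq)
      then show ?thesis by (rule dyadic)
    qed
    then show ?thesis by (simp add: M_def)
  qed
  then show ?thesis using that[of "18 * c"] c(1) by simp
qed

lemma first_difference_bound:
  assumes "1 \<le> m"
  obtains c where "0 \<le> c"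
    "\<And>f A h. L3_field f \<Longrightarrow> 0 \<le> A \<Longrightarrow> (\<And>h. L3_cubed ((increment h ^^ m) f) \<le> A * (norm h)\<^sup>2)
       \<Longrightarrow> L3_cubed (increment h f) \<le> c * (L3_cubed f + A) * (norm h)\<^sup>2"
proof -
  have "\<exists>c\<ge>0. \<forall>f A h. L3_field f \<longrightarrow> 0 \<le> A \<longrightarrow> (\<forall>h. L3_cubed ((increment h ^^ m) f) \<le> A * (norm h)\<^sup>2)
       \<longrightarrow> L3_cubed (increment h f) \<le> c * (L3_cubed f + A) * (norm h)\<^sup>2"
    using assms
  proof (induction m rule: dec_induct)
    case base
    show ?case
    proof (intro exI[of _ 1] conjI allI impI)
      fix f A h assume "\<forall>h. L3_cubed ((increment h ^^ 1) f) \<le> A * (norm h)\<^sup>2"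
      then have "L3_cubed (increment h f) \<le> A * (norm h)\<^sup>2" by simp
      also have "\<dots> \<le> 1 * (L3_cubed f + A) * (norm h)\<^sup>2"
        using L3_cubed_nonneg[of f] by (intro mult_right_mono) auto
      finally show "L3_cubed (increment h f) \<le> 1 * (L3_cubed f + A) * (norm h)\<^sup>2" .
    qed simp
  next
    case (step k)
    obtain c where c: "0 \<le> c" "\<And>f A h. L3_field f \<Longrightarrow> 0 \<le> A \<Longrightarrow> (\<And>h. L3_cubed ((increment h ^^ k) f) \<le> A * (norm h)\<^sup>2)
       \<Longrightarrow> L3_cubed (increment h f) \<le> c * (L3_cubed f + A) * (norm h)\<^sup>2"
      using step.IH by blast
    obtain c' where c': "0 \<le> c'" "\<And>f A h. L3_field f \<Longrightarrow> 0 \<le> A \<Longrightarrow> (\<And>h. L3_cubed ((increment h ^^ Suc k) f) \<le> A * (norm h)\<^sup>2)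
       \<Longrightarrow> L3_cubed ((increment h ^^ k) f) \<le> (8 ^ k * L3_cubed f + c' * A) * (norm h)\<^sup>2"
      using lower_difference_order[OF step.hyps(1)] by blast
    show ?case
    proof (intro exI[of _ "c * (1 + 8 ^ k + c')"] conjI allI impI)
      show "0 \<le> c * (1 + 8 ^ k + c')" using c(1) c'(1) by simp
      fix f A h assume f: "L3_field f" and A: "0 \<le> A" and bd: "\<forall>h. L3_cubed ((increment h ^^ Suc k) f) \<le> A * (norm h)\<^sup>2"
      have "L3_cubed (increment h f) \<le> c * (L3_cubed f + (8 ^ k * L3_cubed f + c' * A)) * (norm h)\<^sup>2"
        by (rule c(2)[OF f _ c'(2)[OF f A]]) (use c'(1) A bd L3_cubed_nonneg[of f] in auto)
      also have "\<dots> \<le> c * (1 + 8 ^ k + c') * (L3_cubed f + A) * (norm h)\<^sup>2"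
      proof (intro mult_right_mono)
        have "L3_cubed f + (8 ^ k * L3_cubed f + c' * A) \<le> (1 + 8 ^ k + c') * (L3_cubed f + A)"
          using c'(1) A L3_cubed_nonneg[of f] by (simp add: algebra_simps)
        then show "c * (L3_cubed f + (8 ^ k * L3_cubed f + c' * A)) \<le> c * (1 + 8 ^ k + c') * (L3_cubed f + A)"
          using c(1) by (simp add: mult.assoc mult_left_mono)
      qed simp
      finally show "L3_cubed (increment h f) \<le> c * (1 + 8 ^ k + c') * (L3_cubed f + A) * (norm h)\<^sup>2" .
    qed
  qed
  then show ?thesis using that by blast
qed

lemma powr_3: "(norm x) powr 3 = (norm x) ^ 3"
  by (cases "norm x = 0") (auto simp: powr_numeral)

lemma in_Lp_3: "periodic f \<Longrightarrow> in_Lp 3 f \<longleftrightarrow> L3_field f"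
  unfolding in_Lp_def L3_field_def powr_3 using periodic_borel_iff by blast

lemma Lp_norm_3: "Lp_norm 3 f ^ 3 = L3_cubed f"
proof -
  have "Lp_norm 3 f ^ 3 = (L3_cubed f powr (1 / 3)) powr 3"
    unfolding Lp_norm_def powr_3 L3_cubed_def by (cases "(LINT x|torus. norm (f x) ^ 3) = 0") (simp_all add: powr_numeral)
  also have "\<dots> = L3_cubed f" using L3_cubed_nonneg[of f] by (simp add: powr_powr)
  finally show ?thesis .
qed

text \<open>For \<open>\<bar>h\<bar> \<ge> 1\<close> the \<open>L\<^sup>3\<close> norm suffices; for \<open>\<bar>h\<bar> < 1\<close> the Besov quotient and \<open>s > 1\<close> bound the cubed norm of the
  difference of order \<open>\<lfloor>s\<rfloor> + 1\<close> by \<open>\<bar>h\<bar>\<^sup>3 \<le> \<bar>h\<bar>\<^sup>2\<close>. The power \<open>2\<close> is the one that survives the passage to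
  first differences and still beats \<open>\<bar>h\<bar>\<close>.\<close>

lemma besov_increment_bound:
  assumes s: "s > 1"
  obtains c where "0 \<le> c" "\<And>f h. in_besov s f \<Longrightarrow> L3_cubed (increment h f) \<le> c * besov_norm s f ^ 3 * (norm h)\<^sup>2"
proof -
  define m where "m = nat \<lfloor>s\<rfloor> + 1"
  have "1 \<le> m" by (simp add: m_def)
  then obtain c where c: "0 \<le> c"
    "\<And>f A h. L3_field f \<Longrightarrow> 0 \<le> A \<Longrightarrow> (\<And>h. L3_cubed ((increment h ^^ m) f) \<le> A * (norm h)\<^sup>2)
       \<Longrightarrow> L3_cubed (increment h f) \<le> c * (L3_cubed f + A) * (norm h)\<^sup>2"
    using first_difference_bound by blast
  have "L3_cubed (increment h f) \<le> c * (2 + 8 ^ m) * besov_norm s f ^ 3 * (norm h)\<^sup>2" if f: "in_besov s f" for f h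
  proof -
    have L: "L3_field f" using f in_Lp_3 by (auto simp: in_besov_def)
    have bdd: "bdd_above (besov_quotient s f ` (- {0}))" using f by (simp add: in_besov_def)
    define S where "S = (SUP h\<in>- {0}. besov_quotient s f h)"
    have q: "besov_quotient s f h \<le> S" if "h \<noteq> 0" for h
      unfolding S_def by (rule cSUP_upper[OF _ bdd]) (use that in simp)
    have Ln: "0 \<le> Lp_norm 3 w" for w :: "real ^ 3 \<Rightarrow> real ^ 3" by (simp add: Lp_norm_def)
    have S0: "0 \<le> S"
      using q[of 1] Ln by (simp add: besov_quotient_def) (meson mult_nonneg_nonneg order_trans powr_ge_zero)
    have bn: "besov_norm s f = Lp_norm 3 f + S" by (simp add: besov_norm_def S_def)
    have B: "L3_cubed f \<le> besov_norm s f ^ 3" "S ^ 3 \<le> besov_norm s f ^ 3"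
      unfolding bn Lp_norm_3[symmetric] using Ln[of f] S0 by (auto intro!: power_mono)
    have bd: "L3_cubed ((increment h ^^ m) f) \<le> (S ^ 3 + 8 ^ m * L3_cubed f) * (norm h)\<^sup>2" for h
    proof (cases "h = 0")
      case True
      then have "(increment h ^^ m) f = (\<lambda>x. 0)" by (auto simp: increment_def m_def)
      then show ?thesis using True by (simp add: L3_cubed_def)
    next
      case h: False
      show ?thesis
      proof (cases "1 \<le> norm h")
        case True
        have "L3_cubed ((increment h ^^ m) f) \<le> 8 ^ m * L3_cubed f" by (rule L3_field_increments(2)[OF L])
        also have "\<dots> \<le> (S ^ 3 + 8 ^ m * L3_cubed f) * 1" using S0 by simp
        also have "\<dots> \<le> (S ^ 3 + 8 ^ m * L3_cubed f) * (norm h)\<^sup>2"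
          using True S0 L3_cubed_nonneg[of f] by (intro mult_left_mono) auto
        finally show ?thesis .
      next
        case False
        have "Lp_norm 3 ((increment h ^^ m) f) \<le> S * norm h powr s"
          using q[OF h] h by (simp add: besov_quotient_def m_def powr_minus divide_simps mult.commute)
        also have "\<dots> \<le> S * norm h"
          using False h s S0 powr_mono'[of 1 s "norm h"] by (intro mult_left_mono) auto
        finally have "Lp_norm 3 ((increment h ^^ m) f) ^ 3 \<le> (S * norm h) ^ 3" by (rule power_mono[OF _ Ln])
        also have "\<dots> = S ^ 3 * norm h ^ 3" by (rule power_mult_distrib)
        also have "\<dots> \<le> (S ^ 3 + 8 ^ m * L3_cubed f) * (norm h)\<^sup>2"
          using False S0 L3_cubed_nonneg[of f] by (intro mult_mono power_decreasing) auto
        finally show ?thesis by (simp add: Lp_norm_3)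
      qed
    qed
    have "L3_cubed (increment h f) \<le> c * (L3_cubed f + (S ^ 3 + 8 ^ m * L3_cubed f)) * (norm h)\<^sup>2"
      by (rule c(2)[OF L _ bd]) (use S0 L3_cubed_nonneg[of f] in auto)
    also have "\<dots> \<le> c * ((2 + 8 ^ m) * besov_norm s f ^ 3) * (norm h)\<^sup>2"
    proof (intro mult_right_mono mult_left_mono c(1))
      have "8 ^ m * L3_cubed f \<le> 8 ^ m * besov_norm s f ^ 3" using B by simp
      then show "L3_cubed f + (S ^ 3 + 8 ^ m * L3_cubed f) \<le> (2 + 8 ^ m) * besov_norm s f ^ 3"
        using B unfolding distrib_right by linarith
    qed simp
    finally show ?thesis by (simp add: mult.assoc)
  qed
  then show ?thesis using that[of "c * (2 + 8 ^ m)"] c(1) by simp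
qed

section \<open>Increments of the filtered velocity\<close>

lemma helmholtz_increment:
  assumes [measurable]: "f \<in> borel_measurable borel" "g \<in> borel_measurable borel"
    and f: "periodic f" "integrable torus f" and g: "periodic g" "integrable torus g" and H: "helmholtz \<alpha> f g"
  shows "helmholtz \<alpha> (\<lambda>x. f (x + \<xi>) - f x) (\<lambda>x. g (x + \<xi>) - g x)"
  unfolding helmholtz_def
proof (intro allI impI)
  fix \<phi> :: "real ^ 3 \<Rightarrow> real" assume "smooth \<phi> \<and> periodic \<phi>"
  then have \<phi>: "smooth \<phi>" "periodic \<phi>" by auto
  define \<psi> where "\<psi> x = \<phi> x - \<alpha>\<^sup>2 * laplacian \<phi> x" for x
  define \<phi>' where "\<phi>' x = \<phi> (- \<xi> + x)" for x
  have lap: "laplacian \<phi>' x = laplacian \<phi> (- \<xi> + x)" for x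
    using laplacian_reflect[OF smooth_reflect[OF \<phi>(1), of "- \<xi>"], of 0 x] laplacian_reflect[OF \<phi>(1), of "- \<xi>" "- x"]
    by (simp add: \<phi>'_def[abs_def])
  have \<phi>': "smooth \<phi>'" "periodic \<phi>'" unfolding \<phi>'_def[abs_def] by (intro smooth_shift periodic_shift' \<phi>)+
  have \<phi>m [measurable]: "\<phi> \<in> borel_measurable borel" by (rule smooth_borel[OF \<phi>(1)])
  have s\<psi>: "smooth \<psi>" unfolding \<psi>_def[abs_def] by (intro smooth_diff smooth_cmult smooth_laplacian \<phi>)
  have p\<psi>: "periodic \<psi>" unfolding \<psi>_def[abs_def]
    by (rule periodic_comp2[where G="\<lambda>a b. a - \<alpha>\<^sup>2 * b", OF \<phi>(2) laplacian_periodic[OF \<phi>]])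
  have \<psi>m [measurable]: "\<psi> \<in> borel_measurable borel" by (rule smooth_borel[OF s\<psi>])
  obtain B where B: "\<And>x. \<bar>\<phi> x\<bar> \<le> B" using smooth_periodic_bounded[OF \<phi>] by blast
  obtain B' where B': "\<And>x. \<bar>\<psi> x\<bar> \<le> B'" using smooth_periodic_bounded[OF s\<psi> p\<psi>] by blast
  have fs: "integrable torus (\<lambda>x. f (x + \<xi>))" "integrable torus (\<lambda>x. g (x + \<xi>))"
    using integrable_torus_shift[OF _ f(1), of \<xi>] integrable_torus_shift[OF _ g(1), of \<xi>] f g by (simp_all add: add.commute[of \<xi>])
  have I: "integrable torus (\<lambda>x. f (x + \<xi>) * \<phi> x)" "integrable torus (\<lambda>x. f x * \<phi> x)"
    "integrable torus (\<lambda>x. g (x + \<xi>) * \<psi> x)" "integrable torus (\<lambda>x. g x * \<psi> x)"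
    using integrable_mult_bounded_torus[OF fs(1) \<phi>m B] integrable_mult_bounded_torus[OF f(2) \<phi>m B]
      integrable_mult_bounded_torus[OF fs(2) \<psi>m B'] integrable_mult_bounded_torus[OF g(2) \<psi>m B'] by auto
  have "(LINT x|torus. g (x + \<xi>) * \<psi> x) = (LINT x|torus. g x * \<psi> (- \<xi> + x))"
    using integral_torus_shift[of "\<lambda>x. g x * \<psi> (- \<xi> + x)" \<xi>] periodic_comp2[OF g(1) periodic_shift'[OF p\<psi>, of "- \<xi>"], of "(*)"]
    by (simp add: add.commute[of \<xi>])
  also have "\<dots> = (LINT x|torus. g x * (\<phi>' x - \<alpha>\<^sup>2 * laplacian \<phi>' x))" by (simp add: \<psi>_def \<phi>'_def lap)
  also have "\<dots> = (LINT x|torus. f x * \<phi>' x)" using H \<phi>' by (simp add: helmholtz_def)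
  also have "\<dots> = (LINT x|torus. f (x + \<xi>) * \<phi> x)"
    unfolding \<phi>'_def
    using integral_torus_shift[of "\<lambda>x. f x * \<phi> (- \<xi> + x)" \<xi>] periodic_comp2[OF f(1) periodic_shift'[OF \<phi>(2), of "- \<xi>"], of "(*)"]
    by (simp add: add.commute[of \<xi>])
  finally have 1: "(LINT x|torus. g (x + \<xi>) * \<psi> x) = (LINT x|torus. f (x + \<xi>) * \<phi> x)" .
  have 2: "(LINT x|torus. g x * \<psi> x) = (LINT x|torus. f x * \<phi> x)" using H \<phi> by (simp add: helmholtz_def \<psi>_def)
  show "(LINT x|torus. (g (x + \<xi>) - g x) * (\<phi> x - \<alpha>\<^sup>2 * laplacian \<phi> x)) = (LINT x|torus. (f (x + \<xi>) - f x) * \<phi> x)"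
    unfolding \<psi>_def[symmetric] left_diff_distrib using I 1 2 by simp
qed

text \<open>The increment of \<open>g\<close> solves the Helmholtz equation for the increment of \<open>f\<close>, so each of its components has a smaller
  \<open>L\<^sup>3\<close> norm; combine this with \<open>a b\<^sup>2 \<le> a\<^sup>3 + b\<^sup>3\<close>.\<close>

lemma increment_bound_of_L3_cubed:
  assumes f: "L3_field f" and g: "L2_field g" and H: "inverse_helmholtz \<alpha> f g"
    and c: "L3_cubed (increment \<xi> f) \<le> c * (norm \<xi>)\<^sup>2"
  shows "increment_bound g f (6 * c) (\<lambda>r. r) \<xi>"
proof -
  define F where "F = increment \<xi> f"
  define G where "G = increment \<xi> g"
  have F: "L3_field F" unfolding F_def by (rule L3_field_increment[OF f])
  note gm [measurable] = L2_fieldD(2)[OF g]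
  have Gm [measurable]: "G \<in> borel_measurable borel" unfolding G_def increment_def[abs_def] by measurable
  note Fm [measurable] = L3_fieldD(2)[OF F]
  have Fc: "F x $ i = f (x + \<xi>) $ i - f x $ i" and Gc: "G x $ i = g (x + \<xi>) $ i - g x $ i" for x i
    by (simp_all add: F_def G_def increment_def)
  have Gi: "integrable torus (\<lambda>x. G x $ i)" "periodic (\<lambda>x. G x $ i)" for i
  proof -
    have "integrable torus (\<lambda>x. g (x + \<xi>) $ i)"
      using integrable_torus_shift[OF L2_fieldD(4,3)[OF g], of \<xi> i] L2_fieldD(6)[OF g] by (simp add: add.commute[of \<xi>])
    then show "integrable torus (\<lambda>x. G x $ i)" unfolding Gc using L2_fieldD(6)[OF g] by simp
    show "periodic (\<lambda>x. G x $ i)" unfolding Gc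
      by (rule periodic_comp2[OF periodic_shift[OF L2_fieldD(3)[OF g]] L2_fieldD(3)[OF g]])
  qed
  have Hc: "helmholtz \<alpha> (\<lambda>x. F x $ i) (\<lambda>x. G x $ i)" for i
    unfolding Fc Gc
    by (rule helmholtz_increment[OF L3_fieldD(5)[OF f] L2_fieldD(4)[OF g] L3_fieldD(4,7)[OF f] L2_fieldD(3,6)[OF g] inverse_helmholtz_component[OF H]])
  have Gim: "(\<lambda>x. G x $ i) \<in> borel_measurable borel" for i by measurable
  note contr = helmholtz_L3[OF L3_fieldD(5)[OF F] Gim L3_fieldD(4,7)[OF F] Gi(2,1) Hc L3_fieldD(6)[OF F]]
  have G3: "integrable torus (\<lambda>x. \<bar>G x $ i\<bar> ^ 3)" "(LINT x|torus. \<bar>G x $ i\<bar> ^ 3) \<le> L3_cubed F" for i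
    using contr[of i] L3_fieldD(8)[OF F, of i] by auto
  have young: "a * b\<^sup>2 \<le> a ^ 3 + b ^ 3" if "0 \<le> a" "0 \<le> b" for a b :: real
  proof (cases "a \<le> b")
    case True
    have "a * b\<^sup>2 \<le> b * b\<^sup>2" using True that by (intro mult_right_mono) auto
    also have "\<dots> = b ^ 3" by (simp add: power2_eq_square power3_eq_cube)
    also have "\<dots> \<le> a ^ 3 + b ^ 3" using that by simp
    finally show ?thesis .
  next
    case False
    have "a * b\<^sup>2 \<le> a * a\<^sup>2" using False that by (intro mult_left_mono power_mono) auto
    also have "\<dots> = a ^ 3" by (simp add: power2_eq_square power3_eq_cube)
    also have "\<dots> \<le> a ^ 3 + b ^ 3" using that by simp
    finally show ?thesis .
  qed
  have le: "norm (G x) * (norm (F x))\<^sup>2 \<le> (\<Sum>i\<in>UNIV. \<bar>G x $ i\<bar> ^ 3) + 3 * norm (F x) ^ 3" for x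
  proof -
    have "norm (G x) * (norm (F x))\<^sup>2 \<le> (\<Sum>i\<in>UNIV. \<bar>G x $ i\<bar>) * (norm (F x))\<^sup>2"
      by (intro mult_right_mono norm_le_l1_cart) auto
    also have "\<dots> \<le> (\<Sum>i\<in>UNIV. \<bar>G x $ i\<bar> ^ 3 + norm (F x) ^ 3)"
      unfolding sum_distrib_right by (intro sum_mono young) auto
    finally show ?thesis by (simp add: sum.distrib)
  qed
  have ib: "integrable torus (\<lambda>x. (\<Sum>i\<in>UNIV. \<bar>G x $ i\<bar> ^ 3) + 3 * norm (F x) ^ 3)"
    using G3(1) L3_fieldD(3)[OF F] by auto
  have i: "integrable torus (\<lambda>x. norm (G x) * (norm (F x))\<^sup>2)"
  proof (rule Bochner_Integration.integrable_bound[OF ib])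
    show "(\<lambda>x. norm (G x) * (norm (F x))\<^sup>2) \<in> borel_measurable torus" by (rule measurable_torus) measurable
    show "AE x in torus. norm (norm (G x) * (norm (F x))\<^sup>2) \<le> norm ((\<Sum>i\<in>UNIV. \<bar>G x $ i\<bar> ^ 3) + 3 * norm (F x) ^ 3)"
      by (intro always_eventually allI) (auto intro: order_trans[OF le abs_ge_self])
  qed
  have "(LINT x|torus. norm (G x) * (norm (F x))\<^sup>2) \<le> (LINT x|torus. (\<Sum>i\<in>UNIV. \<bar>G x $ i\<bar> ^ 3) + 3 * norm (F x) ^ 3)"
    by (rule integral_mono[OF i ib le])
  also have "\<dots> = (\<Sum>i\<in>UNIV. LINT x|torus. \<bar>G x $ i\<bar> ^ 3) + 3 * L3_cubed F"
    using G3(1) L3_fieldD(3)[OF F] by (simp add: L3_cubed_def)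
  also have "\<dots> \<le> (\<Sum>i\<in>(UNIV :: 3 set). L3_cubed F) + 3 * L3_cubed F" by (intro add_right_mono sum_mono G3)
  also have "\<dots> = 6 * L3_cubed F" by simp
  also have "\<dots> \<le> 6 * c * norm \<xi> * norm \<xi>" using c unfolding F_def by (simp add: power2_eq_square)
  finally show ?thesis using i by (simp add: increment_bound_def F_def G_def)
qed

theorem besov_increment_bound_exists:
  assumes sol: "leray_alpha_weak_solution \<alpha> T u v p" and s: "s > 1" and v: "L3_besov T s v"
  shows "\<exists>C \<sigma>. integrable (time T) C \<and> Linf_loc \<sigma> \<and> ((\<lambda>\<xi> :: real ^ 3. \<sigma> (norm \<xi>)) \<longlongrightarrow> 0) (at 0) \<and>
    (AE t in time T. \<forall>\<xi>. increment_bound (u t) (v t) (C t) \<sigma> \<xi>)"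
proof -
  obtain c where c: "0 \<le> c" "\<And>f h. in_besov s f \<Longrightarrow> L3_cubed (increment h f) \<le> c * besov_norm s f ^ 3 * (norm h)\<^sup>2"
    using besov_increment_bound[OF s] by blast
  show ?thesis
  proof (intro exI conjI)
    show "integrable (time T) (\<lambda>t. 6 * (c * besov_norm s (v t) ^ 3))" using v by (simp add: L3_besov_def)
    show "Linf_loc (\<lambda>r. r)"
      unfolding Linf_loc_def
    proof (intro conjI allI impI)
      show "(\<lambda>r. r) \<in> borel_measurable lebesgue" by (rule measurable_completion) simp
      fix K :: "real set" assume "compact K"
      then obtain M where "\<And>r. r \<in> K \<Longrightarrow> \<bar>r\<bar> \<le> M" using compact_imp_bounded bounded_iff by (metis real_norm_def)
      then show "\<exists>M. AE r in lebesgue. r \<in> K \<longrightarrow> \<bar>r\<bar> \<le> M" by (intro exI[of _ M]) auto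
    qed
    show "((\<lambda>\<xi> :: real ^ 3. norm \<xi>) \<longlongrightarrow> 0) (at 0)" by (rule tendsto_norm_zero[OF tendsto_ident_at])
    have "AE t in time T. in_besov s (v t)" using v by (simp add: L3_besov_def)
    moreover have "AE t in time T. inverse_helmholtz \<alpha> (v t) (u t)" using sol by (simp add: leray_alpha_weak_solution_def)
    moreover have "AE t in time T. periodic (u t)"
      using sol by (intro AE_I2) (simp add: leray_alpha_weak_solution_def torus_field_def space_time)
    ultimately show "AE t in time T. \<forall>\<xi>. increment_bound (u t) (v t) (6 * (c * besov_norm s (v t) ^ 3)) (\<lambda>r. r) \<xi>"
    proof eventually_elim
      case (elim t)
      have "L3_field (v t)" using elim(1) in_Lp_3 by (auto simp: in_besov_def)
      moreover have "L2_field (u t)" using elim(2,3) by (simp add: L2_field_iff inverse_helmholtz_def)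
      ultimately show ?case
        using increment_bound_of_L3_cubed[OF _ _ elim(2) c(2)[OF elim(1)]] by blast
    qed
  qed
qed

section \<open>Conservation of energy\<close>

theorem theorem2p7:
  fixes \<alpha> T :: real
    and u v :: "real \<Rightarrow> real ^ 3 \<Rightarrow> real ^ 3"
    and p :: "real \<Rightarrow> real ^ 3 \<Rightarrow> real"
  assumes "\<alpha> > 0" and "T > 0"
    and "leray_alpha_weak_solution \<alpha> T u v p"
  shows "(\<forall>C \<sigma>\<^sub>1.
            integrable (time T) C \<and> Linf_loc \<sigma>\<^sub>1 \<and> ((\<lambda>\<xi> :: real ^ 3. \<sigma>\<^sub>1 (norm \<xi>)) \<longlongrightarrow> 0) (at 0) \<and>
            (\<forall>\<xi>. AE t in time T. increment_bound (u t) (v t) (C t) \<sigma>\<^sub>1 \<xi>)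
            \<longrightarrow> (AE t\<^sub>1 in time T. AE t\<^sub>2 in time T. Lp_norm 2 (v t\<^sub>1) = Lp_norm 2 (v t\<^sub>2)))
       \<and> (\<forall>s > 1. L3_besov T s v \<longrightarrow>
            (\<exists>C \<sigma>\<^sub>1.
              integrable (time T) C \<and> Linf_loc \<sigma>\<^sub>1 \<and> ((\<lambda>\<xi> :: real ^ 3. \<sigma>\<^sub>1 (norm \<xi>)) \<longlongrightarrow> 0) (at 0) \<and>
              (AE t in time T. \<forall>\<xi>. increment_bound (u t) (v t) (C t) \<sigma>\<^sub>1 \<xi>)))"
proof (intro conjI allI impI, elim conjE)
  fix C \<sigma>\<^sub>1
  assume "integrable (time T) C" "((\<lambda>\<xi> :: real ^ 3. \<sigma>\<^sub>1 (norm \<xi>)) \<longlongrightarrow> 0) (at 0)"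
    "\<forall>\<xi>. AE t in time T. increment_bound (u t) (v t) (C t) \<sigma>\<^sub>1 \<xi>"
  then show "AE t\<^sub>1 in time T. AE t\<^sub>2 in time T. Lp_norm 2 (v t\<^sub>1) = Lp_norm 2 (v t\<^sub>2)"
    using leray_alpha_energy_conservation[OF assms(2,3)] by blast
next
  fix s :: real assume "s > 1" "L3_besov T s v"
  then show "\<exists>C \<sigma>\<^sub>1. integrable (time T) C \<and> Linf_loc \<sigma>\<^sub>1 \<and>
      ((\<lambda>\<xi> :: real ^ 3. \<sigma>\<^sub>1 (norm \<xi>)) \<longlongrightarrow> 0) (at 0) \<and>
      (AE t in time T. \<forall>\<xi>. increment_bound (u t) (v t) (C t) \<sigma>\<^sub>1 \<xi>)"
    by (rule besov_increment_bound_exists[OF assms(3)])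
qed

end
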